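(* There is a dense subset $\mathcal{D} \subset \mathbb{T} \times C(\mathbb{T},\mathbb{R})$ such that for each $(\alpha,f) \in \mathcal{D}$, the density of states measure $dk_{\alpha,f}$ is singular and $\Sigma_{\alpha,f}$ contains a non-degenerate interval. In particular, for all $(\alpha, f) \in \mathcal{D}$, $\alpha$ is irrational.
   Context: $\mathbb{T} = \mathbb{R}/\mathbb{Z}$, $C(\mathbb{T},\mathbb{R})$ carries the sup norm, and $\mathbb{T}\times C(\mathbb{T},\mathbb{R})$ the product topology. For $\alpha \in \mathbb{T}$ (rational or irrational), $f \in C(\mathbb{T},\mathbb{R})$ and $\omega \in \mathbb{T}$, $H_\omega = H_{\alpha,f,\omega}$ is the operator on $\ell^2(\mathbb{Z})$ given by $[H_\omega\psi](n) = \psi(n+1)+\psi(n-1)+f(\omega+n\alpha)\psi(n)$. Set $\Sigma_{\alpha,f} = \bigcup_{\omega\in\mathbb{T}} \sigma(H_{\alpha,f,\omega})$. The density of states measure $dk_{\alpha,f}$ is the probability measure on $\mathbb{R}$ determined by $\int g\, dk_{\alpha,f} = \int_{\mathbb{T}} \langle\delta_0, g(H_{\alpha,f,\omega})\delta_0\rangle\, d\omega$ for bounded Borel $g$. "Singular" means singular with respect to Lebesgue measure on $\mathbb{R}$. *)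

theory Defs
  imports "HOL-Probability.Probability"
begin

section \<open>The circle group\<close>

quotient_type circle = real / "\<lambda>x y. x - y \<in> \<int>"
  morphisms rep_circle to_circle
proof (rule equivpI)
  show "reflp (\<lambda>x y::real. x - y \<in> \<int>)"
    by (simp add: reflp_def)
  show "symp (\<lambda>x y::real. x - y \<in> \<int>)"
    using Ints_minus by (fastforce intro: sympI)
  show "transp (\<lambda>x y::real. x - y \<in> \<int>)"
  proof (rule transpI)
    fix x y z :: real
    assume "x - y \<in> \<int>" "y - z \<in> \<int>"
    then have "(x - y) + (y - z) \<in> \<int>" by (rule Ints_add)
    then show "x - z \<in> \<int>" by simp
  qed
qed

instantiation circle :: ab_group_add
begin

lift_definition zero_circle :: circle is 0 .

lift_definition plus_circle :: "circle \<Rightarrow> circle \<Rightarrow> circle" is "(+)"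
  by (metis Ints_add add_diff_add)

lift_definition uminus_circle :: "circle \<Rightarrow> circle" is uminus
  by (metis Ints_minus minus_diff_minus)

lift_definition minus_circle :: "circle \<Rightarrow> circle \<Rightarrow> circle" is "(-)"
proof -
  fix a b c d :: real
  assume "a - b \<in> \<int>" "c - d \<in> \<int>"
  then have "(a - b) - (c - d) \<in> \<int>" by (rule Ints_diff)
  then show "(a - c) - (b - d) \<in> \<int>" by (simp add: algebra_simps)
qed

instance
  by standard (transfer; simp)+

end

text \<open>The action of the integers: \<open>zmult n x\<close> is the \<open>n\<close>-fold multiple of \<open>x\<close>.\<close>

lift_definition zmult :: "int \<Rightarrow> circle \<Rightarrow> circle" is "\<lambda>n x. of_int n * x"
  by (metis Ints_mult Ints_of_int right_diff_distrib)

instantiation circle :: topological_space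
begin

definition open_circle :: "circle set \<Rightarrow> bool" where
  "open_circle U \<longleftrightarrow> open (to_circle -` U)"

instance
  by standard (auto simp: open_circle_def vimage_Union intro: open_Int open_UN)

end

definition haar_circle :: "circle measure" where
  "haar_circle = distr (restrict_space lborel {0..<1::real}) borel to_circle"

definition irrational_circle :: "circle \<Rightarrow> bool" where
  "irrational_circle \<alpha> \<longleftrightarrow> (\<forall>x. to_circle x = \<alpha> \<longrightarrow> x \<notin> \<rat>)"

text \<open>
  The circle is compact, so the type \<open>circle \<Rightarrow>\<^sub>C real\<close> of bounded continuous functions,
  whose distance is the sup distance, consists of all continuous functions.
\<close>

lemma continuous_to_circle: "continuous_on UNIV to_circle"
  by (simp add: continuous_on_open_vimage open_circle_def)

lemma range_to_circle: "to_circle ` {0..1} = UNIV"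
proof -
  have "c \<in> to_circle ` {0..1}" for c
  proof -
    define x where "x = rep_circle c"
    have "to_circle (frac x) = to_circle x"
      by (simp add: circle.abs_eq_iff frac_def)
    also have "\<dots> = c"
      using Quotient_abs_rep[OF Quotient_circle] by (simp add: x_def)
    finally show ?thesis
      using frac_ge_0[of x] frac_lt_1[of x] by (intro image_eqI[of _ _ "frac x"]) auto
  qed
  then show ?thesis by auto
qed

lemma compact_UNIV_circle: "compact (UNIV :: circle set)"
  by (metis range_to_circle compact_Icc compact_continuous_image continuous_on_subset
      continuous_to_circle top_greatest)

lemma bcontfun_circle: "(bcontfun :: (circle \<Rightarrow> real) set) = {f. continuous_on UNIV f}"
  by (auto simp: bcontfun_def intro: compact_imp_bounded compact_continuous_image compact_UNIV_circle)


section \<open>The Hilbert space of square-summable two-sided sequences\<close>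

typedef ell2 = "{\<psi> :: int \<Rightarrow> complex. (\<lambda>n. (cmod (\<psi> n))\<^sup>2) summable_on UNIV}"
  morphisms ell2_coord Abs_ell2
  by (rule exI[of _ "\<lambda>_. 0"]) simp

setup_lifting type_definition_ell2

lemma square_summable_add:
  fixes f g :: "int \<Rightarrow> complex"
  assumes "(\<lambda>n. (cmod (f n))\<^sup>2) summable_on UNIV" "(\<lambda>n. (cmod (g n))\<^sup>2) summable_on UNIV"
  shows "(\<lambda>n. (cmod (f n + g n))\<^sup>2) summable_on UNIV"
proof (rule summable_on_comparison_test)
  show "(\<lambda>n. 2 * (cmod (f n))\<^sup>2 + 2 * (cmod (g n))\<^sup>2) summable_on UNIV"
    by (intro summable_on_add summable_on_cmult_right assms)
  fix n
  have "(cmod (f n + g n))\<^sup>2 \<le> (cmod (f n) + cmod (g n))\<^sup>2"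
    by (intro power_mono norm_triangle_ineq) simp
  also have "\<dots> \<le> 2 * (cmod (f n))\<^sup>2 + 2 * (cmod (g n))\<^sup>2"
    using sum_squares_ge_zero[of "cmod (f n) - cmod (g n)" 0]
    by (simp add: power2_eq_square algebra_simps)
  finally show "(cmod (f n + g n))\<^sup>2 \<le> 2 * (cmod (f n))\<^sup>2 + 2 * (cmod (g n))\<^sup>2" .
qed auto

lemma square_summable_bounded_mult:
  fixes f g :: "int \<Rightarrow> complex"
  assumes "(\<lambda>n. (cmod (f n))\<^sup>2) summable_on UNIV" "\<And>n. cmod (g n) \<le> K"
  shows "(\<lambda>n. (cmod (g n * f n))\<^sup>2) summable_on UNIV"
proof (rule summable_on_comparison_test)
  show "(\<lambda>n. K\<^sup>2 * (cmod (f n))\<^sup>2) summable_on UNIV"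
    by (intro summable_on_cmult_right assms)
  show "(cmod (g n * f n))\<^sup>2 \<le> K\<^sup>2 * (cmod (f n))\<^sup>2" for n
    unfolding norm_mult power_mult_distrib
    by (intro mult_right_mono power_mono assms) auto
qed auto

lemma square_summable_shift:
  fixes f :: "int \<Rightarrow> complex"
  assumes "(\<lambda>n. (cmod (f n))\<^sup>2) summable_on UNIV"
  shows "(\<lambda>n. (cmod (f (n + k)))\<^sup>2) summable_on UNIV"
proof -
  have "bij_betw (\<lambda>n::int. n + k) UNIV UNIV"
    by (rule bij_betw_byWitness[of _ "\<lambda>n. n - k"]) auto
  from summable_on_reindex_bij_betw[OF this, of "\<lambda>n. (cmod (f n))\<^sup>2"] assms
  show ?thesis by simp
qed

lemma summable_inner_complex:
  fixes f g :: "int \<Rightarrow> complex"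
  assumes "(\<lambda>n. (cmod (f n))\<^sup>2) summable_on UNIV" "(\<lambda>n. (cmod (g n))\<^sup>2) summable_on UNIV"
  shows "(\<lambda>n. inner (f n) (g n)) summable_on UNIV"
proof -
  have "(\<lambda>n. norm (inner (f n) (g n))) summable_on UNIV"
  proof (rule summable_on_comparison_test)
    show "(\<lambda>n. (cmod (f n))\<^sup>2 + (cmod (g n))\<^sup>2) summable_on UNIV"
      by (intro summable_on_add assms)
    fix n
    have "\<bar>inner (f n) (g n)\<bar> \<le> cmod (f n) * cmod (g n)"
      by (rule Cauchy_Schwarz_ineq2)
    also have "\<dots> \<le> (cmod (f n))\<^sup>2 + (cmod (g n))\<^sup>2"
    proof -
      have "0 \<le> cmod (f n) * cmod (g n)" by simp
      moreover have "0 \<le> (cmod (f n) - cmod (g n))\<^sup>2" by simp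
      ultimately show ?thesis unfolding power2_diff by linarith
    qed
    finally show "norm (inner (f n) (g n)) \<le> (cmod (f n))\<^sup>2 + (cmod (g n))\<^sup>2" by simp
  qed auto
  then show ?thesis by (rule abs_summable_summable)
qed

instantiation ell2 :: real_vector
begin

lift_definition zero_ell2 :: ell2 is "\<lambda>_. 0" by simp

lift_definition plus_ell2 :: "ell2 \<Rightarrow> ell2 \<Rightarrow> ell2" is "\<lambda>\<phi> \<psi> n. \<phi> n + \<psi> n"
  by (rule square_summable_add)

lift_definition uminus_ell2 :: "ell2 \<Rightarrow> ell2" is "\<lambda>\<psi> n. - \<psi> n" by simp

lift_definition minus_ell2 :: "ell2 \<Rightarrow> ell2 \<Rightarrow> ell2" is "\<lambda>\<phi> \<psi> n. \<phi> n - \<psi> n"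
  using square_summable_add[where g = "\<lambda>n. - g n" for g] by simp

lift_definition scaleR_ell2 :: "real \<Rightarrow> ell2 \<Rightarrow> ell2" is "\<lambda>r \<psi> n. of_real r * \<psi> n"
  by (rule square_summable_bounded_mult) auto

instance
  by standard (transfer; simp add: algebra_simps)+

end

text \<open>
  The real part of the complex inner product makes \<^typ>\<open>ell2\<close> an instance of
  \<^class>\<open>real_inner\<close>; its norm is the usual Hilbert space norm.
\<close>

instantiation ell2 :: real_inner
begin

lift_definition inner_ell2 :: "ell2 \<Rightarrow> ell2 \<Rightarrow> real" is
  "\<lambda>\<phi> \<psi>. \<Sum>\<^sub>\<infinity>n. inner (\<phi> n) (\<psi> n)" .

lift_definition norm_ell2 :: "ell2 \<Rightarrow> real" is
  "\<lambda>\<psi>. sqrt (\<Sum>\<^sub>\<infinity>n. (cmod (\<psi> n))\<^sup>2)" .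

definition "dist_ell2 (\<phi>::ell2) \<psi> = norm (\<phi> - \<psi>)"
definition "sgn_ell2 (\<psi>::ell2) = inverse (norm \<psi>) *\<^sub>R \<psi>"
definition "uniformity_ell2 = (INF e\<in>{0<..}. principal {(\<phi>::ell2, \<psi>). dist \<phi> \<psi> < e})"
definition "open_ell2 (U::ell2 set) \<longleftrightarrow>
  (\<forall>\<phi>\<in>U. \<forall>\<^sub>F (\<phi>', \<psi>) in uniformity. \<phi>' = \<phi> \<longrightarrow> \<psi> \<in> U)"

instance
proof
  fix x y z :: ell2 and r :: real and U :: "ell2 set"
  show "dist x y = norm (x - y)" by (rule dist_ell2_def)
  show "sgn x = x /\<^sub>R norm x" by (rule sgn_ell2_def)
  show "uniformity = (INF e\<in>{0<..}. principal {(x::ell2, y). dist x y < e})"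
    by (rule uniformity_ell2_def)
  show "open U = (\<forall>x\<in>U. \<forall>\<^sub>F (x', y) in uniformity. x' = x \<longrightarrow> y \<in> U)"
    by (rule open_ell2_def)
  show "inner x y = inner y x"
    by transfer (simp add: inner_commute)
  show "inner (x + y) z = inner x z + inner y z"
    by transfer (simp add: inner_add_left infsum_add summable_inner_complex)
  show "inner (r *\<^sub>R x) y = r * inner x y"
  proof transfer
    fix r :: real and x y :: "int \<Rightarrow> complex"
    have "inner (of_real r * x n) (y n) = r * inner (x n) (y n)" for n
      by (simp flip: scaleR_conv_of_real)
    then show "(\<Sum>\<^sub>\<infinity>n. inner (of_real r * x n) (y n)) = r * (\<Sum>\<^sub>\<infinity>n. inner (x n) (y n))"
      by (simp add: infsum_cmult_right')
  qed
  show "0 \<le> inner x x"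
    by transfer (simp add: infsum_nonneg)
  show "inner x x = 0 \<longleftrightarrow> x = 0"
  proof transfer
    fix x :: "int \<Rightarrow> complex"
    assume sm: "(\<lambda>n. (cmod (x n))\<^sup>2) summable_on UNIV"
    show "((\<Sum>\<^sub>\<infinity>n. inner (x n) (x n)) = 0) = (x = (\<lambda>_. 0))"
    proof
      assume "(\<Sum>\<^sub>\<infinity>n. inner (x n) (x n)) = 0"
      then have "(cmod (x n))\<^sup>2 = 0" for n
        by (intro nonneg_infsum_le_0D[OF _ sm]) (auto simp: power2_norm_eq_inner)
      then show "x = (\<lambda>_. 0)" by auto
    qed simp
  qed
  show "norm x = sqrt (inner x x)"
    by transfer (simp add: power2_norm_eq_inner)
qed

end

lift_definition scaleC :: "complex \<Rightarrow> ell2 \<Rightarrow> ell2" is "\<lambda>c \<psi> n. c * \<psi> n"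
  by (rule square_summable_bounded_mult) auto

text \<open>The inner product is linear in its second argument.\<close>

definition cinner :: "ell2 \<Rightarrow> ell2 \<Rightarrow> complex" where
  "cinner \<phi> \<psi> = (\<Sum>\<^sub>\<infinity>n. cnj (ell2_coord \<phi> n) * ell2_coord \<psi> n)"

lift_definition delta :: "int \<Rightarrow> ell2" is "\<lambda>k n. if n = k then 1 else 0"
proof -
  fix k :: int
  have "(\<lambda>n. (cmod (if n = k then 1 else 0))\<^sup>2) summable_on {k}" by simp
  then show "(\<lambda>n. (cmod (if n = k then 1 else 0))\<^sup>2) summable_on UNIV"
    by (subst summable_on_cong_neutral[where T = "{k}" and
          g = "\<lambda>n. (cmod (if n = k then 1 else 0))\<^sup>2"]) auto
qed


section \<open>Bounded operators, spectrum, and the Borel functional calculus\<close>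

text \<open>\<^const>\<open>bounded_linear\<close> only expresses linearity over the reals.\<close>

definition bounded_operator :: "(ell2 \<Rightarrow> ell2) \<Rightarrow> bool" where
  "bounded_operator A \<longleftrightarrow> bounded_linear A \<and> (\<forall>c \<psi>. A (scaleC c \<psi>) = scaleC c (A \<psi>))"

definition spectrum :: "(ell2 \<Rightarrow> ell2) \<Rightarrow> complex set" where
  "spectrum A = {z. \<not> (\<exists>R. bounded_operator R \<and>
     (\<forall>\<psi>. A (R \<psi>) - scaleC z (R \<psi>) = \<psi>) \<and> (\<forall>\<psi>. R (A \<psi> - scaleC z \<psi>) = \<psi>))}"

definition orthogonal_projection :: "(ell2 \<Rightarrow> ell2) \<Rightarrow> bool" where
  "orthogonal_projection P \<longleftrightarrow> bounded_operator P \<and> (\<forall>\<psi>. P (P \<psi>) = P \<psi>) \<and>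
     (\<forall>\<phi> \<psi>. cinner \<phi> (P \<psi>) = cinner (P \<phi>) \<psi>)"

text \<open>
  Strong countable additivity forces the value on the empty set to be zero, and hence, the values
  being projections, multiplicativity on intersections.
\<close>

definition projection_valued_measure :: "(real set \<Rightarrow> ell2 \<Rightarrow> ell2) \<Rightarrow> bool" where
  "projection_valued_measure E \<longleftrightarrow>
     (\<forall>B\<in>sets borel. orthogonal_projection (E B)) \<and>
     (\<forall>\<psi>. E UNIV \<psi> = \<psi>) \<and>
     (\<forall>B::nat \<Rightarrow> real set. range B \<subseteq> sets borel \<longrightarrow> disjoint_family B \<longrightarrow>
        (\<forall>\<psi>. (\<lambda>i. E (B i) \<psi>) sums E (\<Union>i. B i) \<psi>))"

text \<open>The scalar measure \<open>B \<mapsto> \<langle>\<psi>, E B \<psi>\<rangle>\<close>.\<close>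

definition scalar_measure :: "(real set \<Rightarrow> ell2 \<Rightarrow> ell2) \<Rightarrow> ell2 \<Rightarrow> real measure" where
  "scalar_measure E \<psi> = measure_of UNIV (sets borel) (\<lambda>B. ennreal (Re (cinner \<psi> (E B \<psi>))))"

text \<open>
  \<open>A = \<integral> x dE(x)\<close> for a projection-valued measure \<open>E\<close> of bounded support.
  Over the complex numbers, a bounded operator is determined by its quadratic form.
\<close>

definition spectral_resolution :: "(ell2 \<Rightarrow> ell2) \<Rightarrow> (real set \<Rightarrow> ell2 \<Rightarrow> ell2) \<Rightarrow> bool" where
  "spectral_resolution A E \<longleftrightarrow> projection_valued_measure E \<and>
     (\<exists>r. \<forall>\<psi>. E {-r..r} \<psi> = \<psi>) \<and>
     (\<forall>\<psi>. cinner \<psi> (A \<psi>) = complex_of_real (\<integral>x. x \<partial>scalar_measure E \<psi>))"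

text \<open>\<open>g(A) = \<integral> g(x) dE(x)\<close> for bounded Borel \<open>g\<close> and bounded self-adjoint \<open>A\<close>.\<close>

definition borel_calculus :: "(ell2 \<Rightarrow> ell2) \<Rightarrow> (real \<Rightarrow> complex) \<Rightarrow> (ell2 \<Rightarrow> ell2)" where
  "borel_calculus A g = (THE G. bounded_operator G \<and>
     (\<exists>E. spectral_resolution A E \<and> (\<forall>\<psi>. cinner \<psi> (G \<psi>) = (\<integral>x. g x \<partial>scalar_measure E \<psi>))))"


section \<open>The operators, their spectra and the density of states measure\<close>

definition schroedinger :: "circle \<Rightarrow> (circle \<Rightarrow>\<^sub>C real) \<Rightarrow> circle \<Rightarrow> ell2 \<Rightarrow> ell2" where
  "schroedinger \<alpha> f \<omega> \<psi> = Abs_ell2 (\<lambda>n. ell2_coord \<psi> (n + 1) + ell2_coord \<psi> (n - 1)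
     + complex_of_real (f (\<omega> + zmult n \<alpha>)) * ell2_coord \<psi> n)"

lemma ell2_coord_schroedinger:
  "ell2_coord (schroedinger \<alpha> f \<omega> \<psi>) n = ell2_coord \<psi> (n + 1) + ell2_coord \<psi> (n - 1)
     + complex_of_real (f (\<omega> + zmult n \<alpha>)) * ell2_coord \<psi> n"
proof -
  have sm: "(\<lambda>n. (cmod (ell2_coord \<psi> n))\<^sup>2) summable_on UNIV"
    using ell2_coord[of \<psi>] by simp
  have "\<bar>f x\<bar> \<le> norm f" for x
    using norm_bounded[of f x] by simp
  then have "(\<lambda>n. (cmod (complex_of_real (f (\<omega> + zmult n \<alpha>)) * ell2_coord \<psi> n))\<^sup>2) summable_on UNIV"
    by (intro square_summable_bounded_mult[OF sm, of _ "norm f"]) auto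
  then have "(\<lambda>n. (cmod (ell2_coord \<psi> (n + 1) + ell2_coord \<psi> (n - 1)
      + complex_of_real (f (\<omega> + zmult n \<alpha>)) * ell2_coord \<psi> n))\<^sup>2) summable_on UNIV"
    using square_summable_shift[OF sm, of 1] square_summable_shift[OF sm, of "-1"]
    by (intro square_summable_add) auto
  then show ?thesis
    by (simp add: schroedinger_def Abs_ell2_inverse)
qed

definition total_spectrum :: "circle \<Rightarrow> (circle \<Rightarrow>\<^sub>C real) \<Rightarrow> complex set" where
  "total_spectrum \<alpha> f = (\<Union>\<omega>. spectrum (schroedinger \<alpha> f \<omega>))"

definition dos_measure :: "circle \<Rightarrow> (circle \<Rightarrow>\<^sub>C real) \<Rightarrow> real measure" where
  "dos_measure \<alpha> f = (THE \<mu>. prob_space \<mu> \<and> sets \<mu> = sets borel \<and>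
     (\<forall>g::real \<Rightarrow> complex. g \<in> borel_measurable borel \<longrightarrow> bounded (range g) \<longrightarrow>
        (\<integral>x. g x \<partial>\<mu>) =
        (\<integral>\<omega>. cinner (delta 0) (borel_calculus (schroedinger \<alpha> f \<omega>) g (delta 0)) \<partial>haar_circle)))"

definition lebesgue_singular :: "real measure \<Rightarrow> bool" where
  "lebesgue_singular \<mu> \<longleftrightarrow> (\<exists>N. N \<in> null_sets lborel \<and> - N \<in> null_sets \<mu>)"

end

theory Submission
  imports Defs "HOL-Real_Asymp.Real_Asymp"
begin

text \<open>
  The density of states measure is the average over the phase of the spectral measures of \<open>\<delta>\<^sub>0\<close>,
  so it does not see what happens on a small set of phases, whereas a single phase suffices to put
  an energy into the spectrum. The construction exploits this difference. For most phases the
  operator has a spectrum of tiny measure; on a thin set of phases the same operator appears with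
  constants added, and these constants sweep the spectrum across a whole interval.

  One step, \<open>rational_step\<close>, starts from a frequency \<open>p/q\<close> and a function whose operators have
  approximate eigenvectors for every energy of a given interval. It passes to the frequency
  \<open>p/q + 1/Q\<close>, a fraction with denominator \<open>Q\<close>, where \<open>Q\<close> is a large multiple of \<open>q\<^sup>2\<close>. Along an
  orbit the function looks like one \<open>q\<close>-periodic sequence for a time proportional to \<open>Q\<close>. In this
  stretch the sequence is replaced by finitely many nearby periodic words, each repeated a number
  of times proportional to \<open>Q\<close>, such that every energy is hyperbolic for one of the words
  (\<open>barrier_word\<close>, \<open>barrier_family\<close>). Inside a hyperbolic stretch solutions are exponentially
  small, so every spectral value of the resulting \<open>Q\<close>-periodic operator has an approximate
  eigenvector that lives on one period. Such vectors for different energies are almost orthogonal,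
  hence the spectrum is covered by a number of intervals linear in \<open>Q\<close>, each exponentially short
  (\<open>thin_spectrum\<close>). The new function is constant on most of each arc of length \<open>1/Q\<close>, with values
  taken from the periodic sequence, so that for most phases the potential is a translate of that
  sequence. On a thin layer of each arc a sine wave is added, whose amplitude exceeds the
  precision of the covering; there the potential is a translate of the sequence plus a constant,
  and every energy of the interval becomes a spectral value for some phase.

  Both achievements are stable. The spectral measures depend weakly continuously on frequency and
  function (\<open>dos_weakly_continuous\<close>), so that giving most of the mass to an open set of small
  measure is an open condition; and approximate eigenvectors may be taken with finite support, so
  that an approximate covering persists as well (\<open>covers_persists\<close>). Iterating the step inside
  nested balls therefore produces a limit, arbitrarily close to the initial pair, whose density of
  states measure gives mass at least \<open>1 - 2\<^sup>-\<^sup>n\<close> to an open set of measure below \<open>2\<^sup>-\<^sup>n\<close> for every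
  \<open>n\<close>; by Borel and Cantelli it is carried by a null set. The balls also avoid the fractions of
  small denominator, so the limit frequency is irrational. Its orbits are then dense, and the
  energies of the interval, being covered to every precision by operators of various phases,
  belong to the spectrum for one and the same phase.

  The analysis of the operators uses polynomials as far as possible. A self-adjoint operator \<open>A\<close>
  with a vector \<open>\<psi>\<close> defines the functional \<open>p \<mapsto> \<langle>\<psi>, p(A) \<psi>\<rangle>\<close>, which is positive on products of
  powers of the two affine functions vanishing at the ends of an interval and positive inside;
  Hausdorff's theorem makes it a measure. Projections are strong limits of polynomials of \<open>A\<close>,
  first for half-lines and then, by a Dynkin argument, for Borel sets. Conversely every spectral
  resolution has these moments, so the spectral measures and with them the functional calculus are
  determined by \<open>A\<close>.
\<close>

section \<open>The Hilbert space of two-sided sequences\<close>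

lemma summable_coord: "(\<lambda>n. (cmod (ell2_coord \<psi> n))\<^sup>2) summable_on UNIV"
  using ell2_coord[of \<psi>] by simp

lemma ell2_eqI: "(\<And>n. ell2_coord \<phi> n = ell2_coord \<psi> n) \<Longrightarrow> \<phi> = \<psi>"
  by (metis ell2_coord_inject ext)

lemma coord_add [simp]: "ell2_coord (\<phi> + \<psi>) n = ell2_coord \<phi> n + ell2_coord \<psi> n"
  by transfer simp

lemma coord_diff [simp]: "ell2_coord (\<phi> - \<psi>) n = ell2_coord \<phi> n - ell2_coord \<psi> n"
  by transfer simp

lemma coord_zero [simp]: "ell2_coord 0 n = 0"
  by transfer simp

lemma coord_uminus [simp]: "ell2_coord (- \<psi>) n = - ell2_coord \<psi> n"
  by transfer simp

lemma coord_scaleR [simp]: "ell2_coord (r *\<^sub>R \<psi>) n = of_real r * ell2_coord \<psi> n"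
  by transfer simp

lemma coord_scaleC [simp]: "ell2_coord (scaleC c \<psi>) n = c * ell2_coord \<psi> n"
  by transfer simp

lemma coord_delta [simp]: "ell2_coord (delta k) n = (if n = k then 1 else 0)"
  by transfer simp

lemma coord_sum [simp]: "ell2_coord (\<Sum>i\<in>I. f i) n = (\<Sum>i\<in>I. ell2_coord (f i) n)"
  by (induction I rule: infinite_finite_induct) auto

lemma norm_ell2_sq: "(norm \<psi>)\<^sup>2 = (\<Sum>\<^sub>\<infinity>n. (cmod (ell2_coord \<psi> n))\<^sup>2)"
  by transfer (simp add: infsum_nonneg)

lemma inner_ell2_eq: "inner \<phi> \<psi> = (\<Sum>\<^sub>\<infinity>n. inner (ell2_coord \<phi> n) (ell2_coord \<psi> n))"
  by transfer simp

lemma sum_coord_le_norm: "finite F \<Longrightarrow> (\<Sum>n\<in>F. (cmod (ell2_coord \<psi> n))\<^sup>2) \<le> (norm \<psi>)\<^sup>2"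
  unfolding norm_ell2_sq by (rule finite_sum_le_infsum[OF summable_coord]) auto

lemma coord_le_norm: "cmod (ell2_coord \<psi> n) \<le> norm \<psi>"
proof -
  have "(cmod (ell2_coord \<psi> n))\<^sup>2 \<le> (norm \<psi>)\<^sup>2"
    using sum_coord_le_norm[of "{n}" \<psi>] by simp
  then show ?thesis by (rule power2_le_imp_le) simp
qed

lemma norm_le_iff_finite:
  assumes "0 \<le> c"
  shows "norm \<psi> \<le> c \<longleftrightarrow> (\<forall>F. finite F \<longrightarrow> (\<Sum>n\<in>F. (cmod (ell2_coord \<psi> n))\<^sup>2) \<le> c\<^sup>2)"
proof
  assume "norm \<psi> \<le> c"
  then have "(norm \<psi>)\<^sup>2 \<le> c\<^sup>2" by (intro power_mono) auto
  then show "\<forall>F. finite F \<longrightarrow> (\<Sum>n\<in>F. (cmod (ell2_coord \<psi> n))\<^sup>2) \<le> c\<^sup>2"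
    using sum_coord_le_norm order_trans by blast
next
  assume *: "\<forall>F. finite F \<longrightarrow> (\<Sum>n\<in>F. (cmod (ell2_coord \<psi> n))\<^sup>2) \<le> c\<^sup>2"
  have "(norm \<psi>)\<^sup>2 \<le> c\<^sup>2"
    unfolding norm_ell2_sq by (rule infsum_le_finite_sums[OF summable_coord]) (use * in auto)
  then show "norm \<psi> \<le> c" using assms by (rule power2_le_imp_le)
qed

lemma square_summableI:
  fixes f :: "int \<Rightarrow> complex"
  assumes "\<And>F. finite F \<Longrightarrow> (\<Sum>n\<in>F. (cmod (f n))\<^sup>2) \<le> c"
  shows "(\<lambda>n. (cmod (f n))\<^sup>2) summable_on UNIV"
  by (rule nonneg_bounded_partial_sums_imp_summable_on) (use assms in \<open>auto intro!: eventually_finite_subsets_at_top_weakI\<close>)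

text \<open>Norm bounds of a Cauchy sequence pass to its coordinatewise limit through the finite partial
  sums of the squares.\<close>

instance ell2 :: complete_space
proof
  fix X :: "nat \<Rightarrow> ell2"
  assume C: "Cauchy X"
  have "Cauchy (\<lambda>i. ell2_coord (X i) n)" for n
  proof (rule metric_CauchyI)
    fix e :: real assume "0 < e"
    then obtain M where M: "\<And>i j. i \<ge> M \<Longrightarrow> j \<ge> M \<Longrightarrow> dist (X i) (X j) < e"
      using metric_CauchyD[OF C] by blast
    show "\<exists>M. \<forall>m\<ge>M. \<forall>k\<ge>M. dist (ell2_coord (X m) n) (ell2_coord (X k) n) < e"
    proof (intro exI allI impI)
      fix i j assume "i \<ge> M" "j \<ge> M"
      then have "norm (X i - X j) < e" using M by (simp add: dist_norm)
      then show "dist (ell2_coord (X i) n) (ell2_coord (X j) n) < e"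
        using coord_le_norm[of "X i - X j" n] by (simp add: dist_norm)
    qed
  qed
  then have "\<forall>n. \<exists>l. (\<lambda>i. ell2_coord (X i) n) \<longlonglongrightarrow> l"
    using Cauchy_convergent_iff convergent_def by blast
  then obtain l where l: "\<And>n. (\<lambda>i. ell2_coord (X i) n) \<longlonglongrightarrow> l n" by metis
  have fin: "(\<Sum>n\<in>F. (cmod (l n - ell2_coord (X j) n))\<^sup>2) \<le> e\<^sup>2"
    if "finite F" "e > 0" "\<And>i. i \<ge> j \<Longrightarrow> norm (X i - X j) \<le> e" for F e j
  proof (rule LIMSEQ_le_const2)
    show "(\<lambda>i. \<Sum>n\<in>F. (cmod (ell2_coord (X i) n - ell2_coord (X j) n))\<^sup>2)
        \<longlonglongrightarrow> (\<Sum>n\<in>F. (cmod (l n - ell2_coord (X j) n))\<^sup>2)"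
      by (intro tendsto_intros l)
    have "(\<Sum>n\<in>F. (cmod (ell2_coord (X i) n - ell2_coord (X j) n))\<^sup>2) \<le> e\<^sup>2" if "i \<ge> j" for i
    proof -
      have "(\<Sum>n\<in>F. (cmod (ell2_coord (X i - X j) n))\<^sup>2) \<le> (norm (X i - X j))\<^sup>2"
        by (rule sum_coord_le_norm) fact
      also have "\<dots> \<le> e\<^sup>2" using \<open>\<And>i. i \<ge> j \<Longrightarrow> norm (X i - X j) \<le> e\<close>[OF that] by (intro power_mono) auto
      finally show ?thesis by simp
    qed
    then show "\<exists>N. \<forall>i\<ge>N. (\<Sum>n\<in>F. (cmod (ell2_coord (X i) n - ell2_coord (X j) n))\<^sup>2) \<le> e\<^sup>2"
      by blast
  qed
  obtain M0 where M0: "\<And>i. i \<ge> M0 \<Longrightarrow> norm (X i - X M0) \<le> 1"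
    using metric_CauchyD[OF C, of 1] by (auto simp: dist_norm intro!: less_imp_le)
  have "(\<lambda>n. (cmod (l n - ell2_coord (X M0) n))\<^sup>2) summable_on UNIV"
    by (rule square_summableI[where c = "1\<^sup>2"], rule fin) (use M0 in auto)
  then have sl: "(\<lambda>n. (cmod (l n))\<^sup>2) summable_on UNIV"
    using square_summable_add[OF _ summable_coord[of "X M0"]] by fastforce
  define L where "L = Abs_ell2 l"
  have cL: "ell2_coord L n = l n" for n
    using sl by (simp add: L_def Abs_ell2_inverse)
  have "X \<longlonglongrightarrow> L"
  proof (rule LIMSEQ_I)
    fix r :: real assume "0 < r"
    then obtain M where M: "\<And>i j. i \<ge> M \<Longrightarrow> j \<ge> M \<Longrightarrow> dist (X i) (X j) < r/2"
      using metric_CauchyD[OF C, of "r/2"] by auto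
    have "norm (X j - L) < r" if "j \<ge> M" for j
    proof -
      have "norm (L - X j) \<le> r/2"
        using \<open>0 < r\<close> M[THEN less_imp_le] that
        by (subst norm_le_iff_finite) (auto simp: cL dist_norm intro!: fin)
      then show ?thesis using \<open>0 < r\<close> by (simp add: norm_minus_commute)
    qed
    then show "\<exists>no. \<forall>n\<ge>no. norm (X n - L) < r" by blast
  qed
  then show "convergent X" by (rule convergentI)
qed

lemma scaleC_simps [simp]:
  "scaleC c (\<phi> + \<psi>) = scaleC c \<phi> + scaleC c \<psi>"
  "scaleC c (\<phi> - \<psi>) = scaleC c \<phi> - scaleC c \<psi>"
  "scaleC c (r *\<^sub>R \<phi>) = r *\<^sub>R scaleC c \<phi>"
  "scaleC c (scaleC d \<phi>) = scaleC (c * d) \<phi>"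
  "scaleC 1 \<phi> = \<phi>" "scaleC c 0 = 0" "scaleC 0 \<phi> = 0" "scaleC (-1) \<phi> = - \<phi>"
  by (rule ell2_eqI, simp add: algebra_simps)+

lemma scaleC_of_real: "scaleC (of_real r) \<psi> = r *\<^sub>R \<psi>"
  by (rule ell2_eqI) simp

lemma norm_scaleC [simp]: "norm (scaleC c \<psi>) = cmod c * norm \<psi>"
proof -
  have "(norm (scaleC c \<psi>))\<^sup>2 = (cmod c * norm \<psi>)\<^sup>2"
    unfolding norm_ell2_sq power_mult_distrib
    by (simp add: norm_mult power_mult_distrib infsum_cmult_right')
  then show ?thesis by (simp add: power2_eq_iff_nonneg)
qed

lemma inner_scaleC_left: "inner (scaleC c \<phi>) \<psi> = inner \<phi> (scaleC (cnj c) \<psi>)"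
  unfolding inner_ell2_eq coord_scaleC by (simp add: inner_complex_def algebra_simps)

lemma summable_cinner: "(\<lambda>n. cnj (ell2_coord \<phi> n) * ell2_coord \<psi> n) summable_on UNIV"
proof -
  have "(\<lambda>n. norm (cnj (ell2_coord \<phi> n) * ell2_coord \<psi> n)) summable_on UNIV"
  proof (rule summable_on_comparison_test)
    show "(\<lambda>n. (cmod (ell2_coord \<phi> n))\<^sup>2 + (cmod (ell2_coord \<psi> n))\<^sup>2) summable_on UNIV"
      by (intro summable_on_add summable_coord)
    fix n
    have "0 \<le> (cmod (ell2_coord \<phi> n) - cmod (ell2_coord \<psi> n))\<^sup>2" by simp
    moreover have "0 \<le> cmod (ell2_coord \<phi> n) * cmod (ell2_coord \<psi> n)" by simp
    ultimately show "norm (cnj (ell2_coord \<phi> n) * ell2_coord \<psi> n)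
        \<le> (cmod (ell2_coord \<phi> n))\<^sup>2 + (cmod (ell2_coord \<psi> n))\<^sup>2"
      unfolding power2_diff norm_mult complex_mod_cnj by linarith
  qed auto
  then show ?thesis by (rule abs_summable_summable)
qed

text \<open>The complex inner product is recovered from its real part, so that all estimates can be done
  in the real inner product space.\<close>

lemma cinner_eq: "cinner \<phi> \<psi> = Complex (inner \<phi> \<psi>) (inner (scaleC \<i> \<phi>) \<psi>)"
proof (rule complex_eqI)
  show "Re (cinner \<phi> \<psi>) = Re (Complex (inner \<phi> \<psi>) (inner (scaleC \<i> \<phi>) \<psi>))"
    unfolding cinner_def inner_ell2_eq
    using infsum_Re[OF summable_cinner[of \<phi> \<psi>]] by (simp add: inner_complex_def)
  show "Im (cinner \<phi> \<psi>) = Im (Complex (inner \<phi> \<psi>) (inner (scaleC \<i> \<phi>) \<psi>))"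
    unfolding cinner_def inner_ell2_eq
    using infsum_Im[OF summable_cinner[of \<phi> \<psi>]] by (simp add: inner_complex_def)
qed

lemma Re_cinner [simp]: "Re (cinner \<phi> \<psi>) = inner \<phi> \<psi>"
  by (simp add: cinner_eq)

lemma norm_delta [simp]: "norm (delta k) = 1"
proof -
  have "(norm (delta k))\<^sup>2 = (\<Sum>\<^sub>\<infinity>n. if n = k then 1 else 0)"
    unfolding norm_ell2_sq by (intro infsum_cong) simp
  also have "\<dots> = (\<Sum>\<^sub>\<infinity>n\<in>{k}. 1)" by (rule infsum_cong_neutral) auto
  finally have "(norm (delta k))\<^sup>2 = 1" by simp
  then show ?thesis by (simp add: power2_eq_1_iff)
    (metis norm_ge_zero not_one_le_zero neg_0_le_iff_le)
qed


section \<open>Bounded self-adjoint operators and their polynomials\<close>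

definition selfadj :: "(ell2 \<Rightarrow> ell2) \<Rightarrow> bool" where
  "selfadj A \<longleftrightarrow> bounded_operator A \<and> (\<forall>\<phi> \<psi>. inner (A \<phi>) \<psi> = inner \<phi> (A \<psi>))"

lemma selfadjD:
  assumes "selfadj A"
  shows "bounded_linear A" "linear A" "A (scaleC c \<psi>) = scaleC c (A \<psi>)" "inner (A \<phi>) \<psi> = inner \<phi> (A \<psi>)"
    "A (\<phi> + \<psi>) = A \<phi> + A \<psi>" "A (\<phi> - \<psi>) = A \<phi> - A \<psi>" "A (r *\<^sub>R \<phi>) = r *\<^sub>R A \<phi>" "A 0 = 0"
proof -
  show bl: "bounded_linear A" and "A (scaleC c \<psi>) = scaleC c (A \<psi>)" "inner (A \<phi>) \<psi> = inner \<phi> (A \<psi>)"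
    using assms by (auto simp: selfadj_def bounded_operator_def)
  show l: "linear A" using bl by (rule bounded_linear.linear)
  show "A (\<phi> + \<psi>) = A \<phi> + A \<psi>" "A (\<phi> - \<psi>) = A \<phi> - A \<psi>" "A (r *\<^sub>R \<phi>) = r *\<^sub>R A \<phi>" "A 0 = 0"
    using l by (auto simp: linear_add linear_diff linear_scale linear_0)
qed

lemma selfadjI:
  assumes "linear A" "\<And>c \<psi>. A (scaleC c \<psi>) = scaleC c (A \<psi>)" "\<And>\<psi>. norm (A \<psi>) \<le> K * norm \<psi>"
    "\<And>\<phi> \<psi>. inner (A \<phi>) \<psi> = inner \<phi> (A \<psi>)"
  shows "selfadj A"
proof -
  have "bounded_linear A"
    by (rule bounded_linear_intro[where K = K])
      (use assms in \<open>auto simp: linear_add linear_scale mult.commute\<close>)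
  then show ?thesis using assms by (auto simp: selfadj_def bounded_operator_def)
qed

lemma selfadj_id: "selfadj (\<lambda>\<psi>. \<psi>)"
  by (rule selfadjI[where K = 1]) (auto intro: linearI)

lemma bounded_operator_add:
  "bounded_operator A \<Longrightarrow> bounded_operator B \<Longrightarrow> bounded_operator (\<lambda>\<psi>. A \<psi> + B \<psi>)"
  by (auto simp: bounded_operator_def bounded_linear_add)

lemma bounded_operator_scaleC:
  assumes "bounded_operator A"
  shows "bounded_operator (\<lambda>\<psi>. scaleC c (A \<psi>))"
proof -
  have bl: "bounded_linear A" using assms by (simp add: bounded_operator_def)
  then obtain K where K: "\<And>x. norm (A x) \<le> norm x * K" using bounded_linear.bounded by blast
  have "bounded_linear (\<lambda>\<psi>. scaleC c (A \<psi>))"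
    by (rule bounded_linear_intro[where K = "cmod c * K"])
      (use K in \<open>auto simp: linear_add linear_scale bounded_linear.linear[OF bl] mult.assoc
         mult.left_commute[of _ "cmod c"] intro!: mult_left_mono\<close>)
  then show ?thesis using assms by (simp add: bounded_operator_def mult.commute)
qed

lemma selfadj_add: "selfadj A \<Longrightarrow> selfadj B \<Longrightarrow> selfadj (\<lambda>\<psi>. A \<psi> + B \<psi>)"
  by (auto simp: selfadj_def bounded_operator_add inner_add_left inner_add_right)

lemma selfadj_scaleR:
  assumes "selfadj A" shows "selfadj (\<lambda>\<psi>. r *\<^sub>R A \<psi>)"
  using bounded_operator_scaleC[of A "of_real r"] assms by (simp add: selfadj_def scaleC_of_real)

lemma selfadj_diff:
  assumes "selfadj A" "selfadj B" shows "selfadj (\<lambda>\<psi>. A \<psi> - B \<psi>)"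
  using selfadj_add[OF assms(1) selfadj_scaleR[OF assms(2), of "-1"]] by simp

lemma selfadj_sum: "(\<And>i. i \<in> I \<Longrightarrow> selfadj (A i)) \<Longrightarrow> selfadj (\<lambda>\<psi>. \<Sum>i\<in>I. A i \<psi>)"
proof (induction I rule: infinite_finite_induct)
  case (insert x F) then show ?case by (simp add: selfadj_add)
qed (use selfadj_scaleR[OF selfadj_id, of 0] in auto)

lemma selfadj_commuting_compose:
  assumes "selfadj A" "selfadj B" "\<And>\<psi>. A (B \<psi>) = B (A \<psi>)"
  shows "selfadj (\<lambda>\<psi>. A (B \<psi>))"
  using assms bounded_linear_compose[OF selfadjD(1)[OF assms(1)] selfadjD(1)[OF assms(2)]]
  by (auto simp: selfadj_def bounded_operator_def)

lemma selfadj_cinner: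
  assumes "selfadj A"
  shows "cinner \<phi> (A \<psi>) = cinner (A \<phi>) \<psi>" "cinner \<psi> (A \<psi>) = complex_of_real (inner \<psi> (A \<psi>))"
proof -
  show 1: "cinner \<phi> (A \<psi>) = cinner (A \<phi>) \<psi>" for \<phi>
    using selfadjD(3,4)[OF assms] by (metis cinner_eq)
  have "inner (scaleC \<i> \<psi>) (A \<psi>) = - inner (scaleC \<i> (A \<psi>)) \<psi>"
    by (simp add: inner_scaleC_left inner_commute[of \<psi>])
      (metis add_eq_0_iff2 add.inverse_inverse inner_commute inner_scaleC_left complex_cnj_i inner_minus_right mult_minus1
        scaleC_simps(4,8))
  moreover have "inner (scaleC \<i> \<psi>) (A \<psi>) = inner (scaleC \<i> (A \<psi>)) \<psi>"
    using selfadjD(3,4)[OF assms] by metis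
  ultimately have "inner (scaleC \<i> \<psi>) (A \<psi>) = 0" by linarith
  then show "cinner \<psi> (A \<psi>) = complex_of_real (inner \<psi> (A \<psi>))"
    by (simp add: cinner_eq complex_eq_iff)
qed

lemma selfadj_polarization:
  assumes "selfadj A"
  shows "4 * inner \<phi> (A \<psi>) = inner (\<phi> + \<psi>) (A (\<phi> + \<psi>)) - inner (\<phi> - \<psi>) (A (\<phi> - \<psi>))"
  using selfadjD(4)[OF assms, of \<psi> \<phi>]
  by (simp add: selfadjD(5,6)[OF assms] inner_add_left inner_add_right inner_diff_left inner_diff_right inner_commute)

text \<open>By polarization \<open>inner \<phi> (A \<psi>)\<close> is a difference of two values of the form; the parallelogram
  law bounds it for vectors of equal length, and \<open>\<phi>\<close> is chosen as \<open>A \<psi>\<close> rescaled to the length of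
  \<open>\<psi>\<close>.\<close>

lemma selfadj_form_bound:
  assumes A: "selfadj A" and b: "\<And>\<psi>. \<bar>inner \<psi> (A \<psi>)\<bar> \<le> c * (norm \<psi>)\<^sup>2"
  shows "norm (A \<psi>) \<le> c * norm \<psi>"
proof (cases "A \<psi> = 0 \<or> \<psi> = 0")
  case True
  have "0 \<le> c" if "\<psi> \<noteq> 0"
  proof -
    have "0 \<le> c * (norm \<psi>)\<^sup>2" using b[of \<psi>] by linarith
    then show ?thesis using that by (simp add: zero_le_mult_iff)
  qed
  then show ?thesis using True selfadjD(8)[OF A] by (cases "\<psi> = 0") auto
next
  case False
  define s where "s = norm \<psi> / norm (A \<psi>)"
  define \<phi> where "\<phi> = s *\<^sub>R A \<psi>"
  have n: "norm \<phi> = norm \<psi>" using False by (simp add: \<phi>_def s_def)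
  have "4 * inner \<phi> (A \<psi>) \<le> c * (norm (\<phi> + \<psi>))\<^sup>2 + c * (norm (\<phi> - \<psi>))\<^sup>2"
    unfolding selfadj_polarization[OF A] using b[of "\<phi> + \<psi>"] b[of "\<phi> - \<psi>"] by linarith
  also have "\<dots> = c * ((norm (\<phi> + \<psi>))\<^sup>2 + (norm (\<phi> - \<psi>))\<^sup>2)" by (simp add: distrib_left)
  also have "(norm (\<phi> + \<psi>))\<^sup>2 + (norm (\<phi> - \<psi>))\<^sup>2 = 4 * (norm \<psi>)\<^sup>2"
    using n by (simp add: power2_norm_eq_inner inner_add_left inner_add_right inner_diff_left inner_diff_right inner_commute)
      (simp add: norm_eq_sqrt_inner)
  finally have "inner \<phi> (A \<psi>) \<le> c * (norm \<psi>)\<^sup>2" by simp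
  moreover have "inner \<phi> (A \<psi>) = norm \<psi> * norm (A \<psi>)"
    using False by (simp add: \<phi>_def s_def power2_norm_eq_inner[symmetric] power2_eq_square)
  ultimately have "norm \<psi> * norm (A \<psi>) \<le> norm \<psi> * (c * norm \<psi>)"
    by (simp add: power2_eq_square mult_ac)
  then show ?thesis using False by simp
qed

lemma selfadj_eqI:
  assumes "selfadj A" "selfadj B" "\<And>\<psi>. inner \<psi> (A \<psi>) = inner \<psi> (B \<psi>)"
  shows "A \<psi> = B \<psi>"
  using selfadj_form_bound[OF selfadj_diff[OF assms(1,2)], of 0 \<psi>] assms(3)
  by (simp add: inner_diff_right)

text \<open>Self-adjointness passes to strong limits; this is how all projections and functions of an
  operator are obtained below.\<close>

lemma selfadj_limit:
  assumes G: "\<And>n. selfadj (G n)" and b: "\<And>n \<psi>. norm (G n \<psi>) \<le> C * norm \<psi>"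
    and lim: "\<And>\<psi>. (\<lambda>n. G n \<psi>) \<longlonglongrightarrow> H \<psi>"
  shows "selfadj H"
proof (rule selfadjI[where K = C])
  note D = selfadjD[OF G]
  show "linear H"
  proof (rule linearI)
    fix x y r
    have "(\<lambda>n. G n x + G n y) \<longlonglongrightarrow> H x + H y" by (intro tendsto_intros lim)
    then show "H (x + y) = H x + H y" using lim[of "x + y"] LIMSEQ_unique by (auto simp: D)
    have "(\<lambda>n. r *\<^sub>R G n x) \<longlonglongrightarrow> r *\<^sub>R H x" by (intro tendsto_intros lim)
    then show "H (r *\<^sub>R x) = r *\<^sub>R H x" using lim[of "r *\<^sub>R x"] LIMSEQ_unique by (auto simp: D)
  qed
  fix c \<phi> \<psi>
  have "bounded_operator (\<lambda>\<psi>. scaleC c \<psi>)"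
    using bounded_operator_scaleC selfadj_id by (simp add: selfadj_def)
  then have "bounded_linear (scaleC c)" by (simp add: bounded_operator_def)
  from bounded_linear.tendsto[OF this lim[of \<psi>]]
  have "(\<lambda>n. scaleC c (G n \<psi>)) \<longlonglongrightarrow> scaleC c (H \<psi>)" .
  then show "H (scaleC c \<psi>) = scaleC c (H \<psi>)"
    using lim[of "scaleC c \<psi>"] LIMSEQ_unique by (auto simp: D)
  show "norm (H \<psi>) \<le> C * norm \<psi>"
    by (rule LIMSEQ_le_const2[OF tendsto_norm[OF lim]]) (use b in auto)
  have "(\<lambda>n. inner (G n \<phi>) \<psi>) \<longlonglongrightarrow> inner (H \<phi>) \<psi>" "(\<lambda>n. inner \<phi> (G n \<psi>)) \<longlonglongrightarrow> inner \<phi> (H \<psi>)"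
    by (intro tendsto_intros lim)+
  then show "inner (H \<phi>) \<psi> = inner \<phi> (H \<psi>)"
    using LIMSEQ_unique by (auto simp: D)
qed

definition poly_op :: "(ell2 \<Rightarrow> ell2) \<Rightarrow> real poly \<Rightarrow> ell2 \<Rightarrow> ell2" where
  "poly_op A p = fold_coeffs (\<lambda>a F \<psi>. a *\<^sub>R \<psi> + A (F \<psi>)) p (\<lambda>_. 0)"

lemma poly_op_0 [simp]: "poly_op A 0 \<psi> = 0"
  by (simp add: poly_op_def)

lemma poly_op_pCons:
  assumes "selfadj A"
  shows "poly_op A (pCons a p) \<psi> = a *\<^sub>R \<psi> + A (poly_op A p \<psi>)"
  using selfadjD(8)[OF assms] by (cases "p = 0 \<and> a = 0") (auto simp: poly_op_def)

lemma poly_op_add: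
  assumes "selfadj A"
  shows "poly_op A (p + q) \<psi> = poly_op A p \<psi> + poly_op A q \<psi>"
  by (induction p q rule: poly_induct2)
    (auto simp: poly_op_pCons[OF assms] selfadjD[OF assms] algebra_simps)

lemma poly_op_smult:
  assumes "selfadj A"
  shows "poly_op A (smult c p) \<psi> = c *\<^sub>R poly_op A p \<psi>"
  by (induction p) (auto simp: poly_op_pCons[OF assms] selfadjD[OF assms] algebra_simps)

lemma poly_op_diff:
  assumes "selfadj A"
  shows "poly_op A (p - q) \<psi> = poly_op A p \<psi> - poly_op A q \<psi>"
  using poly_op_add[OF assms, of p "smult (-1) q" \<psi>] poly_op_smult[OF assms, of "-1" q \<psi>] by simp

lemma selfadj_poly_op:
  assumes "selfadj A"
  shows "selfadj (poly_op A p) \<and> (\<forall>\<psi>. poly_op A p (A \<psi>) = A (poly_op A p \<psi>))"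
proof (induction p)
  case 0
  have "poly_op A 0 = (\<lambda>\<psi>. 0 *\<^sub>R \<psi>)" by auto
  then show ?case using selfadj_scaleR[OF selfadj_id, of 0] selfadjD(8)[OF assms] by simp
next
  case (pCons a p)
  then have "selfadj (\<lambda>\<psi>. A (poly_op A p \<psi>))"
    using selfadj_commuting_compose[OF assms, of "poly_op A p"] by auto
  then have "selfadj (\<lambda>\<psi>. a *\<^sub>R \<psi> + A (poly_op A p \<psi>))"
    by (intro selfadj_add selfadj_scaleR[OF selfadj_id])
  moreover have "poly_op A (pCons a p) = (\<lambda>\<psi>. a *\<^sub>R \<psi> + A (poly_op A p \<psi>))"
    using poly_op_pCons[OF assms] by auto
  ultimately show ?case using pCons by (simp add: selfadjD[OF assms])
qed

lemma poly_op_mult: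
  assumes "selfadj A"
  shows "poly_op A (p * q) \<psi> = poly_op A p (poly_op A q \<psi>)"
  by (induction p) (auto simp: poly_op_pCons[OF assms] poly_op_add[OF assms] poly_op_smult[OF assms])

lemma poly_op_affine [simp]: "selfadj A \<Longrightarrow> poly_op A [:a:] \<psi> = a *\<^sub>R \<psi>"
  "selfadj A \<Longrightarrow> poly_op A 1 \<psi> = \<psi>"
  "selfadj A \<Longrightarrow> poly_op A [:a, b:] \<psi> = a *\<^sub>R \<psi> + b *\<^sub>R A \<psi>"
  by (auto simp: poly_op_pCons selfadjD one_pCons)

text \<open>With equal polynomials this turns norms of vectors \<open>p(A) \<psi>\<close> into moments.\<close>

lemma inner_poly_op_mult:
  assumes "selfadj A"
  shows "inner (poly_op A p \<psi>) (poly_op A q \<psi>) = inner \<psi> (poly_op A (p * q) \<psi>)"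
  using selfadjD(4)[of "poly_op A p" \<psi> "poly_op A q \<psi>"] selfadj_poly_op[OF assms, of p]
  by (simp add: poly_op_mult[OF assms])

section \<open>The moment problem on a compact interval\<close>

lemma linear_functional_sum:
  fixes L :: "real poly \<Rightarrow> real"
  assumes "\<And>p q. L (p + q) = L p + L q" "\<And>c p. L (smult c p) = c * L p"
  shows "L (\<Sum>i\<in>I. p i) = (\<Sum>i\<in>I. L (p i))"
proof (induction I rule: infinite_finite_induct)
  case (insert x F) then show ?case using assms by simp
qed (use assms(2)[of 0 0] in auto)

lemma borel_measurable_poly [measurable]: "poly p \<in> borel_measurable (borel :: real measure)"
  by (intro borel_measurable_continuous_onI continuous_intros)

text \<open>The ratio is the probability that a sample of size \<open>m\<close> drawn without replacement hits only a
  marked subset of size \<open>k\<close>; replacing the draws one at a time gives the error bound.\<close>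

lemma choose_ratio_approx:
  assumes "k \<le> n" "m < n"
  shows "\<bar>real (k choose m) / real (n choose m) - (real k / real n) ^ m\<bar> \<le> (real m)\<^sup>2 / (real n - real m)"
  using assms(2)
proof (induction m)
  case 0 then show ?case by simp
next
  case (Suc m)
  define r where "r = real (k choose m) / real (n choose m)"
  define x where "x = real k / real n"
  have x01: "0 \<le> x" "x \<le> 1" using assms Suc.prems by (auto simp: x_def divide_le_eq)
  have r01: "0 \<le> r" "r \<le> 1"
    using Suc.prems binomial_right_mono[OF assms(1), of m] by (auto simp: r_def divide_le_eq)
  have step: "real (j choose Suc m) * (real m + 1) = real (j choose m) * (real j - real m)" for j
  proof (cases "m \<le> j")
    case True
    have "(Suc m) * (j choose Suc m) = (j - m) * (j choose m)"
    proof (cases "m = j")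
      case False
      then have "(j choose Suc m) * (Suc m choose m) = (j choose m) * ((j - m) choose (Suc m - m))"
        using True by (intro choose_mult) auto
      then show ?thesis by (simp add: Suc_diff_le mult.commute)
    qed simp
    then have "real ((Suc m) * (j choose Suc m)) = real ((j - m) * (j choose m))" by simp
    then show ?thesis using True by (simp add: of_nat_diff algebra_simps)
  qed (simp add: binomial_eq_0)
  have n0: "real (n choose m) > 0" "real (n choose Suc m) > 0" "real n - real m > 0" using Suc.prems by auto
  have "real (k choose Suc m) / real (n choose Suc m)
      = (real (k choose Suc m) * (real m + 1)) / (real (n choose Suc m) * (real m + 1))" by simp
  also have "\<dots> = r * ((real k - real m) / (real n - real m))"
    unfolding step r_def by simp
  finally have rs: "real (k choose Suc m) / real (n choose Suc m) = r * ((real k - real m) / (real n - real m))" .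
  have "x - (real k - real m) / (real n - real m) = real m * (real n - real k) / (real n * (real n - real m))"
    using n0 Suc.prems unfolding x_def by (simp add: field_simps)
  also have "\<dots> = (real m / (real n - real m)) * ((real n - real k) / real n)" by simp
  finally have d: "\<bar>x - (real k - real m) / (real n - real m)\<bar> = (real m / (real n - real m)) * ((real n - real k) / real n)"
    using n0 assms by simp
  have "(real n - real k) / real n \<le> 1" using assms Suc.prems by (simp add: divide_le_eq)
  then have d': "\<bar>x - (real k - real m) / (real n - real m)\<bar> \<le> real m / (real n - real m)"
    unfolding d using n0 by (intro mult_left_le) auto
  have "\<bar>r * ((real k - real m) / (real n - real m)) - x ^ Suc m\<bar>
      = \<bar>r * ((real k - real m) / (real n - real m) - x) + (r - x ^ m) * x\<bar>"
    by (simp add: algebra_simps)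
  also have "\<dots> \<le> r * \<bar>x - (real k - real m) / (real n - real m)\<bar> + \<bar>r - x ^ m\<bar> * x"
    using r01 x01 by (intro order_trans[OF abs_triangle_ineq]) (simp add: abs_mult abs_minus_commute)
  also have "\<dots> \<le> real m / (real n - real m) + (real m)\<^sup>2 / (real n - real m)"
    using Suc r01 x01 d' by (intro add_mono order_trans[OF mult_left_le_one_le] order_trans[OF mult_left_le]) (auto simp: r_def x_def)
  also have "\<dots> = (real m + (real m)\<^sup>2) / (real n - real m)" by (simp add: add_divide_distrib)
  also have "\<dots> \<le> (real (Suc m))\<^sup>2 / (real n - real (Suc m))"
    using Suc.prems by (intro frac_le) (auto simp: power2_eq_square algebra_simps)
  finally show ?case unfolding rs x_def .
qed

text \<open>Factorial moments of binomial weights: as \<open>(n choose k) (k choose m)\<close> equals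
  \<open>(n choose m) (n - m choose k - m)\<close>, a binomial expansion of \<open>(t + u)^(n - m)\<close> remains.\<close>

lemma binomial_partition_moment:
  fixes t u :: "real poly"
  assumes "t + u = 1" "m \<le> n"
  shows "(\<Sum>k\<le>n. smult (real (n choose k) * real (k choose m)) (t ^ k * u ^ (n - k))) = smult (real (n choose m)) (t ^ m)"
proof -
  have "(\<Sum>k\<le>n. smult (real (n choose k) * real (k choose m)) (t ^ k * u ^ (n - k)))
     = (\<Sum>k=m..n. smult (real (n choose k) * real (k choose m)) (t ^ k * u ^ (n - k)))"
    by (rule sum.mono_neutral_right) auto
  also have "\<dots> = (\<Sum>j\<le>n-m. smult (real (n choose (j+m)) * real ((j+m) choose m)) (t ^ (j+m) * u ^ (n - (j+m))))"
    by (rule sum.reindex_bij_witness[where i = "\<lambda>j. j + m" and j = "\<lambda>k. k - m"]) (use assms(2) in auto)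
  also have "\<dots> = (\<Sum>j\<le>n-m. smult (real (n choose m)) (t^m) * (of_nat ((n-m) choose j) * t ^ j * u ^ ((n - m) - j)))"
  proof (rule sum.cong)
    fix j assume "j \<in> {..n-m}"
    then have "j + m \<le> n" using assms(2) by auto
    then have "(n choose (j+m)) * ((j+m) choose m) = (n choose m) * ((n-m) choose j)"
      using choose_mult[of m "j+m" n] by simp
    then have "real (n choose (j+m)) * real ((j+m) choose m) = real (n choose m) * real ((n-m) choose j)"
      by (metis of_nat_mult)
    then show "smult (real (n choose (j+m)) * real ((j+m) choose m)) (t ^ (j+m) * u ^ (n - (j+m)))
      = smult (real (n choose m)) (t^m) * (of_nat ((n-m) choose j) * t ^ j * u ^ ((n - m) - j))"
      by (simp add: power_add of_nat_poly mult_ac diff_diff_eq add.commute)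
  qed simp
  also have "\<dots> = smult (real (n choose m)) (t^m) * (t + u) ^ (n - m)"
    by (simp add: binomial_ring sum_distrib_left)
  finally show ?thesis using assms(1) by simp
qed

text \<open>The measures with mass \<open>(n choose k) L (t^k (1 - t)^(n - k))\<close> at \<open>k / n\<close>, where \<open>k \<le> n\<close>,
  have total mass one and almost the right moments: the factorial moments are exact, and
  \<open>(k / n)^m\<close> differs from the ratio of binomial coefficients by \<open>O(1 / n)\<close>. A weak limit of a
  subsequence has the moments \<open>L\<close>.\<close>

theorem hausdorff_moment_problem:
  fixes L :: "real poly \<Rightarrow> real"
  assumes add: "\<And>p q. L (p + q) = L p + L q" and sm: "\<And>c p. L (smult c p) = c * L p"
    and one: "L 1 = 1" and pos: "\<And>i j. 0 \<le> L ([:0, 1:] ^ i * [:1, -1:] ^ j)"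
  shows "\<exists>M. real_distribution M \<and> (AE x in M. x \<in> {0..1}) \<and> (\<forall>p. (\<integral>x. poly p x \<partial>M) = L p)"
proof -
  define t u :: "real poly" where "t = [:0, 1:]" and "u = [:1, -1:]"
  have tu: "t + u = 1" by (simp add: t_def u_def one_pCons)
  note Ls = linear_functional_sum[OF add sm]
  define w where "w n k = real (n choose k) * L (t ^ k * u ^ (n - k))" for n k
  have w0: "0 \<le> w n k" for n k using pos by (simp add: w_def t_def u_def)
  have wm: "(\<Sum>k\<le>n. w n k * (real (k choose m) / real (n choose m))) = L (t ^ m)" if "m \<le> n" for n m
  proof -
    have "(\<Sum>k\<le>n. w n k * real (k choose m)) = L (smult (real (n choose m)) (t ^ m))"
      unfolding binomial_partition_moment[OF tu that, symmetric] Ls w_def sm by (simp add: mult_ac)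
    then have "(\<Sum>k\<le>n. w n k * real (k choose m)) = real (n choose m) * L (t ^ m)" by (simp add: sm)
    then show ?thesis using that by (simp add: sum_divide_distrib[symmetric])
  qed
  have w1: "(\<Sum>k\<le>n. w n k) = 1" for n using wm[of 0 n] one by simp
  define D where "D n = distr (point_measure {..n} (w n)) borel (\<lambda>k. real k / real n)" for n
  have iD: "(\<integral>x. g x \<partial>D n) = (\<Sum>k\<le>n. w n k * g (real k / real n))"
    if "g \<in> borel_measurable borel" for g :: "real \<Rightarrow> real" and n
    unfolding D_def using that w0
    by (subst integral_distr) (auto simp: lebesgue_integral_point_measure_finite)
  have psP: "prob_space (point_measure {..n} (w n))" for n
    by (rule prob_spaceI) (simp add: emeasure_point_measure_finite space_point_measure w0 sum_ennreal w1)
  have rdD: "real_distribution (D n)" for n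
    unfolding D_def by (intro real_distribution.intro prob_space.prob_space_distr psP)
      (auto simp: real_distribution_axioms_def)
  have mD: "measure (D n) {-1<..1} = 1" for n
  proof -
    interpret prob_space "D n" using rdD real_distribution_def by blast
    have sD: "sets (D n) = sets borel" by (simp add: D_def)
    have "measure (D n) {-1<..1} = (\<integral>x. indicator {-1<..1} x \<partial>D n)"
      by (simp add: sD sets_eq_imp_space_eq[OF sD])
    also have "\<dots> = (\<Sum>k\<le>n. w n k * indicator {-1<..1} (real k / real n))"
      by (rule iD) measurable
    also have "\<dots> = (\<Sum>k\<le>n. w n k)"
    proof (rule sum.cong)
      fix k assume "k \<in> {..n}"
      then have "real k / real n \<in> {-1<..1}"
        by (auto simp: divide_le_eq intro: less_le_trans[of _ 0])
      then show "w n k * indicator {-1<..1} (real k / real n) = w n k" by simp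
    qed simp
    finally show ?thesis by (simp add: w1)
  qed
  have "tight D"
    unfolding tight_def
    by (intro conjI allI impI rdD exI[of _ "-1"] exI[of _ 1]) (use mD in auto)
  from tight_imp_convergent_subsubsequence[OF this strict_mono_id]
  obtain r M where rM: "strict_mono r" "real_distribution M" "weak_conv_m (D \<circ> id \<circ> r) M" by blast
  interpret M: real_distribution M by fact
  have conv: "(\<lambda>n. \<integral>x. g x \<partial>D (r n)) \<longlonglongrightarrow> (\<integral>x. g x \<partial>M)"
    if "\<And>x. isCont g x" "\<And>x. \<bar>g x\<bar> \<le> 1" for g :: "real \<Rightarrow> real"
    using weak_conv_imp_integral_bdd_continuous_conv[of "D \<circ> id \<circ> r" M g 1] rM rdD that by auto
  \<comment> \<open>Powers of the truncation to the unit interval are bounded continuous test functions.\<close>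
  define cl where "cl x = max 0 (min 1 x)" for x :: real
  have ccl: "isCont cl x" for x unfolding cl_def by (intro continuous_intros)
  have mcl[measurable]: "cl \<in> borel_measurable borel" unfolding cl_def by measurable
  have clk: "cl (real k / real n) = real k / real n" if "k \<le> n" for k n
    using that by (auto simp: cl_def divide_le_eq)
  have cl01: "0 \<le> cl x" "cl x \<le> 1" for x by (auto simp: cl_def)
  have mom: "(\<integral>x. cl x ^ m \<partial>M) = L (t ^ m)" for m
  proof (rule LIMSEQ_unique)
    show "(\<lambda>n. \<integral>x. cl x ^ m \<partial>D (r n)) \<longlonglongrightarrow> (\<integral>x. cl x ^ m \<partial>M)"
      by (rule conv) (use cl01 in \<open>auto intro!: continuous_intros ccl power_le_one\<close>)
    have "(\<lambda>n. \<integral>x. cl x ^ m \<partial>D n) \<longlonglongrightarrow> L (t ^ m)"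
    proof (rule LIMSEQ_I)
      fix e :: real assume "0 < e"
      have "((\<lambda>n. (real m)\<^sup>2 / (real n - real m)) \<longlongrightarrow> 0) sequentially"
        by real_asymp
      then have "eventually (\<lambda>n. (real m)\<^sup>2 / (real n - real m) < e) sequentially"
        using \<open>0 < e\<close> by (auto dest!: order_tendstoD(2))
      then have "eventually (\<lambda>n. norm ((\<integral>x. cl x ^ m \<partial>D n) - L (t ^ m)) < e) sequentially"
        using eventually_gt_at_top[of m]
      proof eventually_elim
        case (elim n)
        have "(\<integral>x. cl x ^ m \<partial>D n) - L (t ^ m)
          = (\<Sum>k\<le>n. w n k * ((real k / real n) ^ m - real (k choose m) / real (n choose m)))"
        proof -
          have "(\<integral>x. cl x ^ m \<partial>D n) = (\<Sum>k\<le>n. w n k * (real k / real n) ^ m)"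
            by (subst iD) (auto simp: clk)
          moreover have "L (t ^ m) = (\<Sum>k\<le>n. w n k * (real (k choose m) / real (n choose m)))"
            using wm elim by simp
          ultimately show ?thesis by (simp add: sum_subtractf right_diff_distrib)
        qed
        also have "norm \<dots> \<le> (\<Sum>k\<le>n. w n k * ((real m)\<^sup>2 / (real n - real m)))"
        proof (rule order_trans[OF norm_sum sum_mono])
          fix k assume "k \<in> {..n}"
          then show "norm (w n k * ((real k / real n) ^ m - real (k choose m) / real (n choose m)))
             \<le> w n k * ((real m)\<^sup>2 / (real n - real m))"
            using choose_ratio_approx[of k n m] elim w0[of n k]
            by (auto simp: abs_mult abs_minus_commute simp del: times_divide_eq_right intro!: mult_left_mono)
        qed
        also have "\<dots> = (real m)\<^sup>2 / (real n - real m)"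
          unfolding sum_distrib_right[symmetric] w1 by simp
        finally show ?case using elim by linarith
      qed
      then show "\<exists>no. \<forall>n\<ge>no. norm ((\<integral>x. cl x ^ m \<partial>D n) - L (t ^ m)) < e"
        by (simp add: eventually_sequentially)
    qed
    from LIMSEQ_subseq_LIMSEQ[OF this rM(1)]
    show "(\<lambda>n. \<integral>x. cl x ^ m \<partial>D (r n)) \<longlonglongrightarrow> L (t ^ m)" by (simp add: o_def)
  qed
  have AE: "AE x in M. x \<in> {0..1}"
  proof -
    define g where "g x = min 1 \<bar>x - cl x\<bar>" for x
    have [measurable]: "g \<in> borel_measurable borel" unfolding g_def by measurable
    have g_nonneg: "0 \<le> g x" for x by (simp add: g_def)
    have "(\<lambda>n. \<integral>x. g x \<partial>D (r n)) \<longlonglongrightarrow> (\<integral>x. g x \<partial>M)"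
      by (rule conv) (auto simp: g_def intro!: continuous_intros ccl)
    moreover have "(\<integral>x. g x \<partial>D n) = 0" for n
      by (subst iD) (auto simp: g_def clk)
    ultimately have "(\<lambda>n. 0) \<longlonglongrightarrow> (\<integral>x. g x \<partial>M)" by simp
    from LIMSEQ_unique[OF this tendsto_const] have g0: "(\<integral>x. g x \<partial>M) = 0" .
    have "integrable M g"
      by (rule M.integrable_const_bound[where B = 1]) (auto simp: g_def)
    then have "AE x in M. g x = 0"
      using g0 integral_nonneg_eq_0_iff_AE[of M g] g_nonneg by simp
    then show ?thesis by eventually_elim (auto simp: g_def cl_def min_def max_def split: if_splits)
  qed
  have "(\<integral>x. poly p x \<partial>M) = L p" for p
  proof -
    have pp: "L p = (\<Sum>i\<le>degree p. coeff p i * L (t ^ i))"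
    proof -
      have "p = (\<Sum>i\<le>degree p. smult (coeff p i) (t ^ i))"
        by (subst poly_as_sum_of_monoms[symmetric]) (simp add: monom_altdef t_def)
      then have "L p = L (\<Sum>i\<le>degree p. smult (coeff p i) (t ^ i))" by simp
      then show ?thesis by (simp add: Ls sm)
    qed
    have "(\<integral>x. poly p x \<partial>M) = (\<integral>x. (\<Sum>i\<le>degree p. coeff p i * cl x ^ i) \<partial>M)"
    proof (rule integral_cong_AE)
      show "AE x in M. poly p x = (\<Sum>i\<le>degree p. coeff p i * cl x ^ i)"
        using AE
      proof eventually_elim
        case (elim x)
        then have "cl x = x" by (auto simp: cl_def)
        then show ?case by (simp add: poly_altdef)
      qed
    qed measurable
    also have "\<dots> = (\<Sum>i\<le>degree p. coeff p i * (\<integral>x. cl x ^ i \<partial>M))"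
    proof (subst Bochner_Integration.integral_sum)
      fix i show "integrable M (\<lambda>x. coeff p i * cl x ^ i)"
        by (intro integrable_mult_right M.integrable_const_bound[where B = 1])
          (use cl01 in \<open>auto intro!: power_le_one\<close>)
    qed simp
    finally show ?thesis by (simp add: pp mom)
  qed
  then show ?thesis using AE M.real_distribution_axioms by blast
qed

lemma continuous_poly_approx:
  fixes b :: "real \<Rightarrow> real"
  assumes "continuous_on {-r..r} b" "0 < e"
  shows "\<exists>p. \<forall>y\<in>{-r..r}. \<bar>b y - poly p y\<bar> < e"
proof -
  obtain g where g: "real_polynomial_function g" "\<And>x. x \<in> {-r..r} \<Longrightarrow> \<bar>b x - g x\<bar> < e"
    using Stone_Weierstrass_real_polynomial_function[OF compact_Icc assms] by blast
  obtain a n where "g = (\<lambda>x. \<Sum>i\<le>n. a i * x^i)"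
    using g(1) real_polynomial_function_iff_sum by blast
  then have "g = poly (\<Sum>i\<le>n. monom (a i) i)" by (auto simp: poly_sum poly_monom)
  then show ?thesis using g(2) by metis
qed

text \<open>Polynomials that replace the indicator of a half-line. The uniform bound is for dominated
  convergence, which turns polynomial integrals into masses of half-lines.\<close>

definition halfline_polys :: "real \<Rightarrow> real \<Rightarrow> (nat \<Rightarrow> real poly) \<Rightarrow> bool" where
  "halfline_polys r x p \<longleftrightarrow> (\<forall>n. \<forall>y\<in>{-r..r}. \<bar>poly (p n) y\<bar> \<le> 2) \<and>
     (\<forall>y\<in>{-r..r}. (\<lambda>n. poly (p n) y) \<longlonglongrightarrow> indicator {x<..} y)"

lemma borel_halflines:
  "sets (borel :: real measure) = sigma_sets UNIV (range (\<lambda>a. {a<..}))"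
  "Int_stable (range (\<lambda>a::real. {a<..}))"
proof -
  show "sets (borel :: real measure) = sigma_sets UNIV (range (\<lambda>a. {a<..}))"
    unfolding borel_Ioi by (rule sets_measure_of) auto
  have "{a<..} \<inter> {b<..} = {max a b<..}" for a b :: real by auto
  then show "Int_stable (range (\<lambda>a::real. {a<..}))" by (auto simp: Int_stable_def)
qed

lemma halfline_polys_exist: "\<exists>p. halfline_polys r x p"
proof -
  define h where "h n y = min 1 (max 0 (real n * (y - x)))" for n y
  have "\<exists>p. \<forall>y\<in>{-r..r}. \<bar>h n y - poly p y\<bar> < 1 / (real n + 1)" for n
    by (rule continuous_poly_approx) (auto simp: h_def intro!: continuous_intros)
  then obtain p where p: "\<And>n y. y \<in> {-r..r} \<Longrightarrow> \<bar>h n y - poly (p n) y\<bar> < 1 / (real n + 1)" by metis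
  have "\<bar>poly (p n) y\<bar> \<le> 2" if "y \<in> {-r..r}" for n y
  proof -
    have "\<bar>h n y\<bar> \<le> 1" by (auto simp: h_def)
    moreover have "1 / (real n + 1) \<le> 1" by simp
    ultimately show ?thesis using p[OF that, of n] by linarith
  qed
  moreover have "(\<lambda>n. poly (p n) y) \<longlonglongrightarrow> indicator {x<..} y" if "y \<in> {-r..r}" for y
  proof -
    have h: "(\<lambda>n. h n y) \<longlonglongrightarrow> indicator {x<..} y"
    proof (cases "x < y")
      case True
      have "filterlim (\<lambda>n. real n * (y - x)) at_top sequentially"
        using True by (intro filterlim_at_top_mult_tendsto_pos[OF tendsto_const _ filterlim_real_sequentially]) auto
      then have "eventually (\<lambda>n. 1 \<le> real n * (y - x)) sequentially"
        by (auto simp: filterlim_at_top)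
      then have "eventually (\<lambda>n. h n y = 1) sequentially"
        by eventually_elim (auto simp: h_def)
      then show ?thesis using True by (simp add: tendsto_eventually)
    next
      case False
      then have "h n y = 0" for n
        by (auto simp: h_def max_def mult_le_0_iff zero_le_mult_iff)
      then show ?thesis using False by simp
    qed
    have "(\<lambda>n. 1 / (real n + 1)) \<longlonglongrightarrow> 0" by real_asymp
    then have "(\<lambda>n. h n y - poly (p n) y) \<longlonglongrightarrow> 0"
      by (rule Lim_null_comparison[rotated]) (use p[OF that] in \<open>auto intro!: always_eventually less_imp_le\<close>)
    from tendsto_diff[OF h this] show ?thesis by simp
  qed
  ultimately show ?thesis unfolding halfline_polys_def by blast
qed

lemma halfline_polys_integral:
  fixes M :: "real measure"
  assumes "finite_measure M" "sets M = sets borel" "AE x in M. x \<in> {-r..r}" "halfline_polys r x p"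
  shows "(\<lambda>n. \<integral>y. poly (p n) y \<partial>M) \<longlonglongrightarrow> measure M {x<..}"
    "(\<lambda>n. \<integral>y. (poly (p n) y)\<^sup>2 \<partial>M) \<longlonglongrightarrow> measure M {x<..}"
    "(\<lambda>n. \<integral>y. (poly (p n) y - indicator {x<..} y)\<^sup>2 \<partial>M) \<longlonglongrightarrow> 0"
proof -
  interpret finite_measure M by fact
  note [measurable_cong] = assms(2)
  have lim: "AE y in M. (\<lambda>n. poly (p n) y) \<longlonglongrightarrow> indicator {x<..} y"
    using assms(3) by eventually_elim (use assms(4) in \<open>auto simp: halfline_polys_def\<close>)
  have bd: "AE y in M. \<bar>poly (p n) y\<bar> \<le> 2" for n
    using assms(3) by eventually_elim (use assms(4) in \<open>auto simp: halfline_polys_def\<close>)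
  have "(\<lambda>n. \<integral>y. poly (p n) y \<partial>M) \<longlonglongrightarrow> (\<integral>y. indicator {x<..} y \<partial>M)"
    by (rule integral_dominated_convergence[where w = "\<lambda>_. 2"]) (use bd lim in auto)
  then show "(\<lambda>n. \<integral>y. poly (p n) y \<partial>M) \<longlonglongrightarrow> measure M {x<..}"
    by (simp add: sets_eq_imp_space_eq[OF assms(2)])
  have "(\<lambda>n. \<integral>y. (poly (p n) y)\<^sup>2 \<partial>M) \<longlonglongrightarrow> (\<integral>y. indicator {x<..} y \<partial>M)"
  proof (rule integral_dominated_convergence[where w = "\<lambda>_. 4"])
    show "AE y in M. (\<lambda>n. (poly (p n) y)\<^sup>2) \<longlonglongrightarrow> indicator {x<..} y"
      using lim
    proof eventually_elim
      case (elim y)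
      from tendsto_power[OF this, of 2] show ?case by (cases "x < y") simp_all
    qed
    show "AE y in M. norm ((poly (p n) y)\<^sup>2) \<le> 4" for n
      using bd[of n] by eventually_elim (use power_mono[of "\<bar>_\<bar>" 2 2] in fastforce)
  qed auto
  then show "(\<lambda>n. \<integral>y. (poly (p n) y)\<^sup>2 \<partial>M) \<longlonglongrightarrow> measure M {x<..}"
    by (simp add: sets_eq_imp_space_eq[OF assms(2)])
  have "(\<lambda>n. \<integral>y. (poly (p n) y - indicator {x<..} y)\<^sup>2 \<partial>M) \<longlonglongrightarrow> (\<integral>y. 0 \<partial>M)"
  proof (rule integral_dominated_convergence[where w = "\<lambda>_. 9"])
    show "AE y in M. (\<lambda>n. (poly (p n) y - indicator {x<..} y)\<^sup>2) \<longlonglongrightarrow> 0"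
      using lim
    proof eventually_elim
      case (elim y)
      from tendsto_power[OF tendsto_diff[OF this tendsto_const[of "indicator {x<..} y"]], of 2]
      show ?case by simp
    qed
    show "AE y in M. norm ((poly (p n) y - indicator {x<..} y)\<^sup>2) \<le> 9" for n
      using bd[of n]
    proof eventually_elim
      case (elim y)
      then have "\<bar>poly (p n) y - indicator {x<..} y\<bar> \<le> 3" by (auto simp: indicator_def)
      from power_mono[OF this, of 2] show ?case by simp
    qed
  qed auto
  then show "(\<lambda>n. \<integral>y. (poly (p n) y - indicator {x<..} y)\<^sup>2 \<partial>M) \<longlonglongrightarrow> 0" by simp
qed

text \<open>The moments determine the masses of the half-lines, and these generate the Borel sets.\<close>

lemma measure_eqI_poly_integrals:
  fixes M N :: "real measure"
  assumes M: "finite_measure M" "sets M = sets borel" "AE x in M. x \<in> {-r..r}"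
    and N: "finite_measure N" "sets N = sets borel" "AE x in N. x \<in> {-r..r}"
    and eq: "\<And>p. (\<integral>x. poly p x \<partial>M) = (\<integral>x. poly p x \<partial>N)"
  shows "M = N"
proof (rule measure_eqI_lessThan)
  interpret M: finite_measure M by fact
  interpret N: finite_measure N by fact
  fix x
  obtain p where p: "halfline_polys r x p" using halfline_polys_exist by blast
  have "measure M {x<..} = measure N {x<..}"
    using LIMSEQ_unique[OF halfline_polys_integral(1)[OF M p]] halfline_polys_integral(1)[OF N p] eq by simp
  then show "emeasure M {x<..} = emeasure N {x<..}"
    by (simp add: M.emeasure_eq_measure N.emeasure_eq_measure)
  show "emeasure M {x<..} < \<infinity>" by (simp add: M.emeasure_eq_measure)
qed (use assms in auto)

section \<open>The spectral theorem for bounded self-adjoint operators\<close>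

lemma pcompose_power: "pcompose (p ^ n) q = pcompose p q ^ n" for p q :: "real poly"
  by (induction n) (auto simp: pcompose_mult pcompose_1)

locale bounded_selfadj =
  fixes A :: "ell2 \<Rightarrow> ell2" and r :: real
  assumes sa: "selfadj A" and bound: "\<And>\<psi>. norm (A \<psi>) \<le> r * norm \<psi>" and r_pos: "0 < r"
begin

text \<open>The two factors are \<open>t = (1 + x/r) / 2\<close> and \<open>u = (1 - x/r) / 2\<close>. After removing squares, one
  of \<open>1\<close>, \<open>t\<close>, \<open>u\<close> and \<open>t u\<close> remains in the middle. The bound on \<open>A\<close> makes the forms of \<open>t\<close> and
  \<open>u\<close> nonnegative, and also that of \<open>t u = (r\<^sup>2 - x\<^sup>2) / (4 r\<^sup>2)\<close>.\<close>

lemma affine_positive: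
  "0 \<le> inner \<psi> (poly_op A ([:1/2, 1/(2*r):] ^ i * [:1/2, -1/(2*r):] ^ j) \<psi>)"
proof -
  define t u :: "real poly" where "t = [:1/2, 1/(2*r):]" and "u = [:1/2, -1/(2*r):]"
  have form: "\<bar>inner \<phi> (A \<phi>)\<bar> \<le> r * (norm \<phi>)\<^sup>2" for \<phi>
  proof -
    have "\<bar>inner \<phi> (A \<phi>)\<bar> \<le> norm \<phi> * norm (A \<phi>)" by (rule Cauchy_Schwarz_ineq2)
    also have "\<dots> \<le> norm \<phi> * (r * norm \<phi>)" by (intro mult_left_mono bound) auto
    finally show ?thesis by (simp add: power2_eq_square mult_ac)
  qed
  have t0: "0 \<le> inner \<phi> (poly_op A t \<phi>)" for \<phi>
    using form[of \<phi>] r_pos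
    by (simp add: t_def sa inner_add_right power2_norm_eq_inner field_simps)
  have u0: "0 \<le> inner \<phi> (poly_op A u \<phi>)" for \<phi>
    using form[of \<phi>] r_pos
    by (simp add: u_def sa inner_add_right inner_diff_right power2_norm_eq_inner field_simps)
  have tu0: "0 \<le> inner \<phi> (poly_op A (t * u) \<phi>)" for \<phi>
  proof -
    have "t * u = smult (1/(4*r\<^sup>2)) ([:r\<^sup>2:] - [:0, 1:] * [:0, 1:])"
      using r_pos by (simp add: t_def u_def power2_eq_square)
    then have "inner \<phi> (poly_op A (t * u) \<phi>) = 1/(4*r\<^sup>2) * (r\<^sup>2 * (norm \<phi>)\<^sup>2 - inner \<phi> (A (A \<phi>)))"
      by (simp only: poly_op_smult[OF sa] poly_op_diff[OF sa] poly_op_mult[OF sa])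
        (simp add: sa inner_diff_right power2_norm_eq_inner)
    also have "\<dots> \<ge> 0"
    proof -
      have "inner \<phi> (A (A \<phi>)) = (norm (A \<phi>))\<^sup>2"
        using selfadjD(4)[OF sa, of \<phi> "A \<phi>"] by (simp add: power2_norm_eq_inner)
      also have "\<dots> \<le> (r * norm \<phi>)\<^sup>2" by (intro power_mono bound) auto
      finally show ?thesis by (simp add: power_mult_distrib)
    qed
    finally show ?thesis .
  qed
  define s where "s = t ^ (i div 2) * u ^ (j div 2)"
  define w where "w = t ^ (i mod 2) * u ^ (j mod 2)"
  have "t ^ i * u ^ j = s * w * s"
  proof -
    have "t ^ i = t ^ (i div 2 + i div 2 + i mod 2)" "u ^ j = u ^ (j div 2 + j div 2 + j mod 2)"
      by (simp_all add: mult_2[symmetric])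
    then show ?thesis by (simp add: s_def w_def power_add mult_ac)
  qed
  then have "inner \<psi> (poly_op A (t ^ i * u ^ j) \<psi>) = inner (poly_op A s \<psi>) (poly_op A w (poly_op A s \<psi>))"
    using selfadjD(4)[of "poly_op A s"] selfadj_poly_op[OF sa, of s] by (simp add: poly_op_mult[OF sa])
  also have "\<dots> \<ge> 0"
  proof -
    have "i mod 2 = 0 \<or> i mod 2 = 1" "j mod 2 = 0 \<or> j mod 2 = 1" by auto
    then have "w = 1 \<or> w = t \<or> w = u \<or> w = t * u" by (auto simp: w_def)
    then show ?thesis using t0 u0 tu0 by (auto simp: sa)
  qed
  finally show ?thesis unfolding t_def u_def .
qed

text \<open>The affine map \<open>x \<mapsto> (1 + x/r) / 2\<close> carries \<open>{-r..r}\<close> to the unit interval. The moment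
  problem is solved there for a unit vector; a constant density restores the length of \<open>\<psi>\<close>.\<close>

lemma moment_measure_exists:
  "\<exists>M. finite_measure M \<and> sets M = sets borel \<and> (AE x in M. x \<in> {-r..r}) \<and>
     (\<forall>p. (\<integral>x. poly p x \<partial>M) = inner \<psi> (poly_op A p \<psi>))"
proof -
  \<comment> \<open>For \<open>\<psi> = 0\<close> any unit vector serves, as the density vanishes.\<close>
  define \<phi> where "\<phi> = (if \<psi> = 0 then delta 0 else (1 / norm \<psi>) *\<^sub>R \<psi>)"
  have n\<phi>: "norm \<phi> = 1" by (simp add: \<phi>_def)
  have \<psi>\<phi>: "\<psi> = norm \<psi> *\<^sub>R \<phi>" by (simp add: \<phi>_def)
  define L where "L p = inner \<phi> (poly_op A (pcompose p [:1/2, 1/(2*r):]) \<phi>)" for p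
  have "\<exists>M. real_distribution M \<and> (AE x in M. x \<in> {0..1}) \<and> (\<forall>p. (\<integral>x. poly p x \<partial>M) = L p)"
  proof (rule hausdorff_moment_problem)
    show "L (p + q) = L p + L q" for p q
      by (simp add: L_def pcompose_add poly_op_add[OF sa] inner_add_right)
    show "L (smult c p) = c * L p" for c p
      by (simp add: L_def pcompose_smult poly_op_smult[OF sa])
    show "L 1 = 1" using n\<phi> by (simp add: L_def sa pcompose_1 power2_norm_eq_inner[symmetric])
    fix i j
    have "pcompose ([:0, 1:] ^ i * [:1, -1:] ^ j) [:1/2, 1/(2*r):] = [:1/2, 1/(2*r):] ^ i * [:1/2, -1/(2*r):] ^ j"
    proof -
      have "pcompose [:0, 1:] [:1/2, 1/(2*r):] = [:1/2, 1/(2*r):]"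
        "pcompose [:1, -1:] [:1/2, 1/(2*r):] = [:1/2, -1/(2*r):]" by (simp_all add: pcompose_pCons)
      then show ?thesis by (simp only: pcompose_mult pcompose_power)
    qed
    then show "0 \<le> L ([:0, 1:] ^ i * [:1, -1:] ^ j)"
      unfolding L_def using affine_positive by simp
  qed
  then obtain M where M: "real_distribution M" "AE x in M. x \<in> {0..1}" "\<And>p. (\<integral>x. poly p x \<partial>M) = L p" by blast
  interpret M: real_distribution M by fact
  define N where "N = density (distr M borel (\<lambda>x. 2 * r * x - r)) (\<lambda>_. ennreal ((norm \<psi>)\<^sup>2))"
  have sN: "sets N = sets borel" by (simp add: N_def)
  interpret D: prob_space "distr M borel (\<lambda>x. 2 * r * x - r)" by (rule M.prob_space_distr) simp
  have "emeasure N (space N) = ennreal ((norm \<psi>)\<^sup>2) * emeasure (distr M borel (\<lambda>x. 2 * r * x - r)) UNIV"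
    unfolding N_def by (subst emeasure_density) (auto simp: nn_integral_cmult)
  then have "finite_measure N"
    by (intro finite_measureI) (use D.emeasure_space_1 in \<open>simp add: ennreal_mult_eq_top_iff\<close>)
  moreover have "AE x in N. x \<in> {-r..r}"
  proof -
    have "AE x in M. 2 * r * x - r \<in> {-r..r}"
      using M(2) by eventually_elim (use r_pos in \<open>auto simp: mult_le_cancel_left1\<close>)
    then have "AE x in distr M borel (\<lambda>x. 2 * r * x - r). x \<in> {-r..r}"
      by (subst AE_distr_iff) auto
    then show ?thesis unfolding N_def by (subst AE_density) auto
  qed
  moreover have "(\<integral>x. poly p x \<partial>N) = inner \<psi> (poly_op A p \<psi>)" for p
  proof -
    have c: "pcompose (pcompose p [:-r, 2*r:]) [:1/2, 1/(2*r):] = p"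
    proof -
      have "pcompose [:-r, 2*r:] [:1/2, 1/(2*r):] = [:0, 1:]" using r_pos by (simp add: pcompose_pCons)
      then show ?thesis by (simp add: pcompose_assoc[symmetric] pcompose_idR)
    qed
    have "(\<integral>x. poly p x \<partial>N) = (\<integral>x. (norm \<psi>)\<^sup>2 * poly p x \<partial>distr M borel (\<lambda>x. 2 * r * x - r))"
      unfolding N_def by (subst integral_density) auto
    also have "\<dots> = (norm \<psi>)\<^sup>2 * (\<integral>x. poly (pcompose p [:-r, 2*r:]) x \<partial>M)"
    proof -
      have "poly (pcompose p [:-r, 2*r:]) = (\<lambda>x. poly p (2 * r * x - r))"
        by (auto simp: poly_pcompose algebra_simps)
      then show ?thesis by (subst integral_distr) auto
    qed
    also have "\<dots> = (norm \<psi>)\<^sup>2 * inner \<phi> (poly_op A p \<phi>)"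
      by (simp add: M(3) L_def c)
    also have "\<dots> = inner (norm \<psi> *\<^sub>R \<phi>) (poly_op A p (norm \<psi> *\<^sub>R \<phi>))"
      using selfadj_poly_op[OF sa, of p] by (simp add: selfadjD power2_eq_square)
    finally show ?thesis using \<psi>\<phi> by simp
  qed
  ultimately show ?thesis using sN by blast
qed

definition mu :: "ell2 \<Rightarrow> real measure" where
  "mu \<psi> = (SOME M. finite_measure M \<and> sets M = sets borel \<and> (AE x in M. x \<in> {-r..r}) \<and>
     (\<forall>p. (\<integral>x. poly p x \<partial>M) = inner \<psi> (poly_op A p \<psi>)))"

lemma mu: "finite_measure (mu \<psi>)" "sets (mu \<psi>) = sets borel" "AE x in mu \<psi>. x \<in> {-r..r}"
  "(\<integral>x. poly p x \<partial>mu \<psi>) = inner \<psi> (poly_op A p \<psi>)"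
  using someI_ex[OF moment_measure_exists[of \<psi>]] unfolding mu_def by auto

lemma space_mu: "space (mu \<psi>) = UNIV"
  using sets_eq_imp_space_eq[OF mu(2)] by simp

lemma norm_poly_op: "(norm (poly_op A p \<psi>))\<^sup>2 = (\<integral>x. (poly p x)\<^sup>2 \<partial>mu \<psi>)"
proof -
  have "(norm (poly_op A p \<psi>))\<^sup>2 = inner \<psi> (poly_op A (p * p) \<psi>)"
    by (simp only: power2_norm_eq_inner inner_poly_op_mult[OF sa])
  also have "\<dots> = (\<integral>x. poly (p * p) x \<partial>mu \<psi>)" by (rule mu(4)[symmetric])
  finally show ?thesis by (simp only: poly_mult power2_eq_square)
qed

lemma mu_total: "measure (mu \<psi>) UNIV = (norm \<psi>)\<^sup>2"
  using norm_poly_op[of 1 \<psi>] by (simp add: sa space_mu)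

lemma mu_le: "measure (mu \<psi>) B \<le> (norm \<psi>)\<^sup>2"
  using finite_measure.bounded_measure[OF mu(1)] by (simp add: mu_total[symmetric] space_mu)

text \<open>The projection belonging to a set is described through the measures alone. As the form and
  the square of the norm agree, the forms of \<open>P\<close> and \<open>P\<^sup>2\<close> agree, so \<open>P\<close> is idempotent.\<close>

definition has_proj :: "real set \<Rightarrow> (ell2 \<Rightarrow> ell2) \<Rightarrow> bool" where
  "has_proj B P \<longleftrightarrow> selfadj P \<and> (\<forall>\<psi>. inner \<psi> (P \<psi>) = measure (mu \<psi>) B \<and> (norm (P \<psi>))\<^sup>2 = measure (mu \<psi>) B)"

lemma has_projD:
  assumes "has_proj B P"
  shows "selfadj P" "inner \<psi> (P \<psi>) = measure (mu \<psi>) B" "(norm (P \<psi>))\<^sup>2 = measure (mu \<psi>) B"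
    "P (P \<psi>) = P \<psi>" "norm (P \<psi>) \<le> norm \<psi>"
proof -
  show s: "selfadj P" and 2: "inner \<psi> (P \<psi>) = measure (mu \<psi>) B" "(norm (P \<psi>))\<^sup>2 = measure (mu \<psi>) B" for \<psi>
    using assms by (auto simp: has_proj_def)
  show "P (P \<psi>) = P \<psi>"
    by (rule selfadj_eqI[of "\<lambda>\<psi>. P (P \<psi>)"])
      (use s 2 in \<open>auto intro: selfadj_commuting_compose simp: selfadjD(4)[OF s, symmetric] power2_norm_eq_inner\<close>)
  show "norm (P \<psi>) \<le> norm \<psi>"
    by (rule power2_le_imp_le[OF order_trans[OF eq_refl[OF 2(2)] mu_le] norm_ge_zero])
qed

lemma has_proj_empty: "has_proj {} (\<lambda>\<psi>. 0)"
  using selfadj_scaleR[OF selfadj_id, of 0] by (simp add: has_proj_def)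

text \<open>Nonnegativity of the form at \<open>\<psi> - R \<psi>\<close> gives \<open>2 R\<^sup>2 \<le> R + R\<^sup>3\<close> in the sense of forms, and
  \<open>R\<^sup>3 \<le> R\<^sup>2\<close>.\<close>

lemma selfadj_between_0_1:
  assumes R: "selfadj R" and b: "\<And>\<phi>. 0 \<le> inner \<phi> (R \<phi>)" "\<And>\<phi>. inner \<phi> (R \<phi>) \<le> (norm \<phi>)\<^sup>2"
  shows "(norm (R \<psi>))\<^sup>2 \<le> inner \<psi> (R \<psi>)"
proof -
  have "0 \<le> inner (\<psi> - R \<psi>) (R (\<psi> - R \<psi>))" by (rule b)
  also have "\<dots> = inner \<psi> (R \<psi>) - 2 * (norm (R \<psi>))\<^sup>2 + inner (R \<psi>) (R (R \<psi>))"
    using selfadjD(4)[OF R, of \<psi> "R \<psi>"]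
    by (simp add: selfadjD(6)[OF R] inner_diff_left inner_diff_right power2_norm_eq_inner)
  finally show ?thesis using b(2)[of "R \<psi>"] by linarith
qed

lemma has_proj_diff_le:
  assumes "has_proj B P" "has_proj C Q" "C \<subseteq> B" "B \<in> sets borel"
  shows "(norm (P \<psi> - Q \<psi>))\<^sup>2 \<le> measure (mu \<psi>) B - measure (mu \<psi>) C"
proof -
  have f: "inner \<phi> (P \<phi> - Q \<phi>) = measure (mu \<phi>) B - measure (mu \<phi>) C" for \<phi>
    using has_projD(2)[OF assms(1)] has_projD(2)[OF assms(2)] by (simp add: inner_diff_right)
  have "measure (mu \<phi>) C \<le> measure (mu \<phi>) B" for \<phi>
    using finite_measure.finite_measure_mono[OF mu(1) assms(3)] assms(4) by (simp add: mu(2))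
  moreover have "measure (mu \<phi>) B - measure (mu \<phi>) C \<le> (norm \<phi>)\<^sup>2" for \<phi>
    using mu_le[of \<phi> B] measure_nonneg[of "mu \<phi>" C] by linarith
  ultimately show ?thesis
    using selfadj_between_0_1[of "\<lambda>\<phi>. P \<phi> - Q \<phi>" \<psi>] f
      selfadj_diff[OF has_projD(1)[OF assms(1)] has_projD(1)[OF assms(2)]] by auto
qed

text \<open>The total mass of the measure of \<open>P \<psi>\<close> is already attained on \<open>B\<close>, which leaves no mass for
  the disjoint set \<open>C\<close>. So the ranges of the projections are orthogonal and Pythagoras applies.\<close>

lemma has_proj_disjoint_Un:
  assumes B: "has_proj B P" "B \<in> sets borel" and C: "has_proj C Q" "C \<in> sets borel" and d: "B \<inter> C = {}"
  shows "has_proj (B \<union> C) (\<lambda>\<psi>. P \<psi> + Q \<psi>)"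
proof -
  note P = has_projD[OF B(1)] and Q = has_projD[OF C(1)]
  have un: "measure (mu \<psi>) (B \<union> C) = measure (mu \<psi>) B + measure (mu \<psi>) C" for \<psi>
    using finite_measure.finite_measure_Union[OF mu(1) _ _ d] B(2) C(2) by (simp add: mu(2))
  have QP: "Q (P \<psi>) = 0" for \<psi>
  proof -
    have "measure (mu (P \<psi>)) B = (norm (P \<psi>))\<^sup>2" using P(3,4) by metis
    then have "measure (mu (P \<psi>)) C \<le> 0"
      using un[of "P \<psi>"] mu_le[of "P \<psi>" "B \<union> C"] by linarith
    then have "(norm (Q (P \<psi>)))\<^sup>2 \<le> 0" using Q(3) by simp
    then show ?thesis by simp
  qed
  have "inner (P \<psi>) (Q \<psi>) = 0" for \<psi>
    using selfadjD(4)[OF Q(1), of "P \<psi>" \<psi>] QP by simp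
  then have "(norm (P \<psi> + Q \<psi>))\<^sup>2 = measure (mu \<psi>) (B \<union> C)" for \<psi>
    using P(3)[of \<psi>] Q(3)[of \<psi>] un
    by (simp add: power2_norm_eq_inner inner_add_left inner_add_right inner_commute)
  then show ?thesis
    unfolding has_proj_def using P Q un by (auto intro: selfadj_add simp: inner_add_right)
qed

lemma has_proj_limit:
  assumes P: "\<And>n::nat. selfadj (P n)" "\<And>n \<psi>. norm (P n \<psi>) \<le> c * norm \<psi>" "\<And>\<psi>. Cauchy (\<lambda>n. P n \<psi>)"
    and lim: "\<And>\<psi>. (\<lambda>n. inner \<psi> (P n \<psi>)) \<longlonglongrightarrow> measure (mu \<psi>) B"
      "\<And>\<psi>. (\<lambda>n. (norm (P n \<psi>))\<^sup>2) \<longlonglongrightarrow> measure (mu \<psi>) B"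
  shows "\<exists>Q. has_proj B Q"
proof -
  have "\<forall>\<psi>. \<exists>l. (\<lambda>n. P n \<psi>) \<longlonglongrightarrow> l" using P(3) Cauchy_convergent_iff convergent_def by blast
  then obtain Q where Q: "\<And>\<psi>. (\<lambda>n. P n \<psi>) \<longlonglongrightarrow> Q \<psi>" by metis
  have "selfadj Q" by (rule selfadj_limit[OF P(1,2) Q])
  moreover have "inner \<psi> (Q \<psi>) = measure (mu \<psi>) B" for \<psi>
    by (rule LIMSEQ_unique[OF _ lim(1)]) (intro tendsto_intros Q)
  moreover have "(norm (Q \<psi>))\<^sup>2 = measure (mu \<psi>) B" for \<psi>
    by (rule LIMSEQ_unique[OF _ lim(2)]) (intro tendsto_intros Q)
  ultimately show ?thesis unfolding has_proj_def by blast
qed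

text \<open>On polynomials the map \<open>p \<mapsto> p(A) \<psi>\<close> is an isometry from \<open>L\<^sup>2\<close> of the measure of \<open>\<psi>\<close>. The
  polynomials replacing the indicator converge in \<open>L\<^sup>2\<close>, hence their operators converge strongly.\<close>

lemma has_proj_halfline: "\<exists>P. has_proj {x<..} P"
proof -
  obtain p where p: "halfline_polys r x p" using halfline_polys_exist by blast
  note lim = halfline_polys_integral[OF mu(1,2,3) p]
  show ?thesis
  proof (rule has_proj_limit[where P = "\<lambda>n. poly_op A (p n)" and c = 2])
    show "selfadj (poly_op A (p n))" for n using selfadj_poly_op[OF sa] by blast
    show "(\<lambda>n. inner \<psi> (poly_op A (p n) \<psi>)) \<longlonglongrightarrow> measure (mu \<psi>) {x<..}" for \<psi>
      using lim(1) by (simp add: mu(4))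
    show "(\<lambda>n. (norm (poly_op A (p n) \<psi>))\<^sup>2) \<longlonglongrightarrow> measure (mu \<psi>) {x<..}" for \<psi>
      using lim(2) by (simp add: norm_poly_op)
  next
    fix n \<psi>
    interpret finite_measure "mu \<psi>" by (rule mu)
    note [measurable_cong] = mu(2)
    have "(norm (poly_op A (p n) \<psi>))\<^sup>2 \<le> (\<integral>x. 4 \<partial>mu \<psi>)"
      unfolding norm_poly_op
    proof (rule integral_mono_AE)
      show AE: "AE x in mu \<psi>. (poly (p n) x)\<^sup>2 \<le> 4"
        using mu(3)
      proof eventually_elim
        case (elim x)
        then have "\<bar>poly (p n) x\<bar> \<le> 2" using p by (auto simp: halfline_polys_def)
        from power_mono[OF this, of 2] show ?case by simp
      qed
      then show "integrable (mu \<psi>) (\<lambda>x. (poly (p n) x)\<^sup>2)"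
        by (intro integrable_const_bound[where B = 4]) auto
    qed auto
    then have "(norm (poly_op A (p n) \<psi>))\<^sup>2 \<le> (2 * norm \<psi>)\<^sup>2"
      by (simp add: space_mu mu_total power_mult_distrib)
    then show "norm (poly_op A (p n) \<psi>) \<le> 2 * norm \<psi>" by (rule power2_le_imp_le) simp
  next
    fix \<psi>
    interpret finite_measure "mu \<psi>" by (rule mu)
    note [measurable_cong] = mu(2)
    define d where "d n = (\<integral>y. (poly (p n) y - indicator {x<..} y)\<^sup>2 \<partial>mu \<psi>)" for n
    have int: "integrable (mu \<psi>) (\<lambda>y. (poly (p n) y - indicator {x<..} y)\<^sup>2)" for n
    proof (rule integrable_const_bound[where B = 9])
      show "AE y in mu \<psi>. norm ((poly (p n) y - indicator {x<..} y)\<^sup>2) \<le> 9"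
        using mu(3)
      proof eventually_elim
        case (elim y)
        then have "\<bar>poly (p n) y\<bar> \<le> 2" using p by (auto simp: halfline_polys_def)
        then have "\<bar>poly (p n) y - indicator {x<..} y\<bar> \<le> 3" by (auto simp: indicator_def)
        from power_mono[OF this, of 2] show ?case by simp
      qed
    qed auto
    have dn: "(norm (poly_op A (p n) \<psi> - poly_op A (p m) \<psi>))\<^sup>2 \<le> 2 * d n + 2 * d m" for n m
    proof -
      have "(norm (poly_op A (p n) \<psi> - poly_op A (p m) \<psi>))\<^sup>2 = (\<integral>y. (poly (p n) y - poly (p m) y)\<^sup>2 \<partial>mu \<psi>)"
        using norm_poly_op[of "p n - p m" \<psi>] by (simp add: poly_op_diff[OF sa])
      also have "\<dots> \<le> (\<integral>y. 2 * (poly (p n) y - indicator {x<..} y)\<^sup>2 + 2 * (poly (p m) y - indicator {x<..} y)\<^sup>2 \<partial>mu \<psi>)"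
      proof (rule integral_mono')
        show "(poly (p n) y - poly (p m) y)\<^sup>2 \<le> 2 * (poly (p n) y - indicator {x<..} y)\<^sup>2 + 2 * (poly (p m) y - indicator {x<..} y)\<^sup>2" for y
        proof -
          have "(a - b)\<^sup>2 \<le> 2 * (a - c)\<^sup>2 + 2 * (b - c)\<^sup>2" for a b c :: real
            using sum_squares_ge_zero[of "a + b - 2 * c" 0] by (simp add: power2_eq_square algebra_simps)
          then show ?thesis .
        qed
      qed (use int in auto)
      also have "\<dots> = 2 * d n + 2 * d m" using int by (simp add: d_def)
      finally show ?thesis .
    qed
    show "Cauchy (\<lambda>n. poly_op A (p n) \<psi>)"
    proof (rule metric_CauchyI)
      fix e :: real assume e: "0 < e"
      have "d \<longlonglongrightarrow> 0" using lim(3)[of \<psi>] unfolding d_def .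
      then have "eventually (\<lambda>n. d n < e\<^sup>2 / 4) sequentially"
        using e by (auto dest!: order_tendstoD(2)[where a = "e\<^sup>2 / 4"])
      then obtain N where N: "\<And>n. n \<ge> N \<Longrightarrow> d n < e\<^sup>2 / 4" by (auto simp: eventually_sequentially)
      have "dist (poly_op A (p n) \<psi>) (poly_op A (p m) \<psi>) < e" if "n \<ge> N" "m \<ge> N" for n m
      proof -
        have "(norm (poly_op A (p n) \<psi> - poly_op A (p m) \<psi>))\<^sup>2 < e\<^sup>2"
          using dn[of n m] N[OF that(1)] N[OF that(2)] by linarith
        then show ?thesis unfolding dist_norm using e by (simp add: power2_less_imp_less)
      qed
      then show "\<exists>M. \<forall>m\<ge>M. \<forall>n\<ge>M. dist (poly_op A (p m) \<psi>) (poly_op A (p n) \<psi>) < e" by blast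
    qed
  qed
qed

text \<open>The sets that own a projection form a Dynkin system containing the half-lines: complements
  are immediate, and for disjoint unions the partial sums are projections that increase with the
  masses.\<close>

lemma has_proj_borel:
  assumes "B \<in> sets borel"
  shows "\<exists>P. has_proj B P"
proof -
  define G where "G = range (\<lambda>a::real. {a<..})"
  note ss = borel_halflines(1)[folded G_def] and Is = borel_halflines(2)[folded G_def]
  have "G \<subseteq> Pow UNIV" "B \<in> sigma_sets UNIV G" using assms by (simp_all add: ss)
  with Is show ?thesis
  proof (induction rule: sigma_sets_induct_disjoint)
    case (basic B)
    then show ?case using has_proj_halfline by (auto simp: G_def)
  next
    case empty
    show ?case using has_proj_empty by blast
  next
    case (compl B)
    then obtain P where P: "has_proj B P" by blast
    note D = has_projD[OF P]
    have c: "measure (mu \<psi>) (UNIV - B) = (norm \<psi>)\<^sup>2 - measure (mu \<psi>) B" for \<psi>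
      using finite_measure.finite_measure_compl[OF mu(1), of B \<psi>] compl by (simp add: mu(2) ss space_mu mu_total)
    have "has_proj (UNIV - B) (\<lambda>\<psi>. \<psi> - P \<psi>)"
      unfolding has_proj_def
    proof (intro conjI allI)
      show "selfadj (\<lambda>\<psi>. \<psi> - P \<psi>)" by (intro selfadj_diff selfadj_id D)
      show "inner \<psi> (\<psi> - P \<psi>) = measure (mu \<psi>) (UNIV - B)" for \<psi>
        by (simp add: c inner_diff_right D(2) power2_norm_eq_inner)
      show "(norm (\<psi> - P \<psi>))\<^sup>2 = measure (mu \<psi>) (UNIV - B)" for \<psi>
        using D(2,3)[of \<psi>] by (simp add: c inner_diff_right inner_diff_left power2_norm_eq_inner inner_commute)
    qed
    then show ?case by blast
  next
    case (union B)
    have Bs: "B i \<in> sets borel" for i using union by (auto simp: ss)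
    define C where "C n = (\<Union>i<n. B i)" for n :: nat
    have Cs: "C n \<in> sets borel" for n unfolding C_def using Bs by auto
    have "\<exists>P. has_proj (C n) P" for n
    proof (induction n)
      case 0
      show ?case unfolding C_def using has_proj_empty by auto
    next
      case (Suc n)
      then obtain P Q where PQ: "has_proj (C n) P" "has_proj (B n) Q" using union by blast
      have "C n \<inter> B n = {}" unfolding C_def using disjoint_family_onD[OF union(1), of _ n] by fastforce
      from has_proj_disjoint_Un[OF PQ(1) Cs PQ(2) Bs this]
      have "has_proj (C n \<union> B n) (\<lambda>\<psi>. P \<psi> + Q \<psi>)" .
      moreover have "C (Suc n) = C n \<union> B n" by (auto simp: C_def less_Suc_eq)
      ultimately show ?case by auto
    qed
    then obtain P where P: "\<And>n. has_proj (C n) (P n)" by metis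
    have mono: "C m \<subseteq> C n" if "m \<le> n" for m n unfolding C_def using that by (intro UN_mono) auto
    have UC: "(\<Union>n. C n) = (\<Union>i. B i)" by (auto simp: C_def)
    have lim: "(\<lambda>n. measure (mu \<psi>) (C n)) \<longlonglongrightarrow> measure (mu \<psi>) (\<Union>i. B i)" for \<psi>
      using finite_measure.finite_Lim_measure_incseq[OF mu(1), of C \<psi>] Cs mono
      by (auto simp: mu(2) UC incseq_def)
    show ?case
    proof (rule has_proj_limit[where P = P and c = 1])
      show "selfadj (P n)" for n using has_projD[OF P] by blast
      show "norm (P n \<psi>) \<le> 1 * norm \<psi>" for n \<psi> using has_projD(5)[OF P] by simp
      show "(\<lambda>n. inner \<psi> (P n \<psi>)) \<longlonglongrightarrow> measure (mu \<psi>) (\<Union>i. B i)" for \<psi>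
        using lim by (simp add: has_projD[OF P])
      show "(\<lambda>n. (norm (P n \<psi>))\<^sup>2) \<longlonglongrightarrow> measure (mu \<psi>) (\<Union>i. B i)" for \<psi>
        using lim by (simp add: has_projD[OF P])
      fix \<psi>
      have le: "(norm (P n \<psi> - P m \<psi>))\<^sup>2 \<le> \<bar>measure (mu \<psi>) (C n) - measure (mu \<psi>) (C m)\<bar>" for n m
      proof (cases "m \<le> n")
        case True
        then show ?thesis using has_proj_diff_le[OF P P mono Cs, of m n \<psi>] by linarith
      next
        case False
        then show ?thesis using has_proj_diff_le[OF P P mono Cs, of n m \<psi>] by (simp add: norm_minus_commute)
      qed
      show "Cauchy (\<lambda>n. P n \<psi>)"
      proof (rule metric_CauchyI)
        fix e :: real assume e: "0 < e"
        have "Cauchy (\<lambda>n. measure (mu \<psi>) (C n))" using lim LIMSEQ_imp_Cauchy by blast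
        then obtain N where N: "\<And>n m. n \<ge> N \<Longrightarrow> m \<ge> N \<Longrightarrow> dist (measure (mu \<psi>) (C n)) (measure (mu \<psi>) (C m)) < e\<^sup>2"
          using metric_CauchyD[of _ "e\<^sup>2"] e by (metis zero_less_power)
        have "dist (P n \<psi>) (P m \<psi>) < e" if "n \<ge> N" "m \<ge> N" for n m
        proof -
          have "(norm (P n \<psi> - P m \<psi>))\<^sup>2 < e\<^sup>2"
            using le[of n m] N[OF that] by (simp add: dist_real_def)
          then show ?thesis unfolding dist_norm using e by (simp add: power2_less_imp_less)
        qed
        then show "\<exists>M. \<forall>m\<ge>M. \<forall>n\<ge>M. dist (P m \<psi>) (P n \<psi>) < e" by blast
      qed
    qed
  qed
qed

text \<open>The scalar measures of the family of projections are the moment measures. Partial sums over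
  disjoint sets are projections of finite unions, and the square of the norm of the remainder is
  the mass of the rest.\<close>

theorem spectral_resolution_exists: "\<exists>E. spectral_resolution A E"
proof -
  define E where "E B = (SOME P. has_proj B P)" for B
  have E: "has_proj B (E B)" if "B \<in> sets borel" for B
    unfolding E_def using has_proj_borel[OF that] by (rule someI_ex)
  note ED = has_projD[OF E]
  have E_eqI: "E B \<psi> = \<psi>" if "B \<in> sets borel" "\<And>\<psi>. measure (mu \<psi>) B = (norm \<psi>)\<^sup>2" for B \<psi>
  proof (rule selfadj_eqI[OF ED(1)[OF that(1)] selfadj_id])
    show "inner \<phi> (E B \<phi>) = inner \<phi> \<phi>" for \<phi>
      unfolding ED(2)[OF that(1)] that(2) by (rule power2_norm_eq_inner)
  qed
  have sm: "scalar_measure E \<psi> = mu \<psi>" for \<psi>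
  proof -
    have "scalar_measure E \<psi> = measure_of UNIV (sets borel) (emeasure (mu \<psi>))"
      unfolding scalar_measure_def
    proof (rule measure_of_eq)
      fix B assume "B \<in> sigma_sets UNIV (sets (borel :: real measure))"
      then have "B \<in> sets borel" using sets.sigma_sets_eq[of "borel :: real measure"] by simp
      then show "ennreal (Re (cinner \<psi> (E B \<psi>))) = emeasure (mu \<psi>) B"
        using ED(2) finite_measure.emeasure_eq_measure[OF mu(1)] by simp
    qed auto
    also have "\<dots> = mu \<psi>" using measure_of_of_measure[of "mu \<psi>"] by (simp add: mu(2) space_mu)
    finally show ?thesis .
  qed
  have UN: "E UNIV \<psi> = \<psi>" for \<psi>
    by (rule E_eqI) (auto simp: mu_total)
  have "projection_valued_measure E"
    unfolding projection_valued_measure_def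
  proof (intro conjI ballI allI impI)
    fix B :: "real set" assume "B \<in> sets borel"
    then show "orthogonal_projection (E B)"
      using ED selfadj_cinner(1)[OF ED(1)] by (auto simp: orthogonal_projection_def selfadj_def)
  next
    fix B :: "nat \<Rightarrow> real set" and \<psi> assume "range B \<subseteq> sets borel" and d: "disjoint_family B"
    then have Bs: "B i \<in> sets borel" for i by auto
    define C where "C n = (\<Union>i<n. B i)" for n :: nat
    have Cs: "C n \<in> sets borel" for n unfolding C_def using Bs by auto
    have sum: "has_proj (C n) (\<lambda>\<psi>. \<Sum>i<n. E (B i) \<psi>)" for n
    proof (induction n)
      case 0
      show ?case using has_proj_empty by (simp add: C_def)
    next
      case (Suc n)
      have "C n \<inter> B n = {}" unfolding C_def using disjoint_family_onD[OF d, of _ n] by fastforce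
      from has_proj_disjoint_Un[OF Suc Cs E[OF Bs] Bs this]
      have "has_proj (C n \<union> B n) (\<lambda>\<psi>. (\<Sum>i<n. E (B i) \<psi>) + E (B n) \<psi>)" .
      moreover have "C (Suc n) = C n \<union> B n" by (auto simp: C_def less_Suc_eq)
      ultimately show ?case by simp
    qed
    have UC: "(\<Union>n. C n) = (\<Union>i. B i)" by (auto simp: C_def)
    have lim: "(\<lambda>n. measure (mu \<psi>) (C n)) \<longlonglongrightarrow> measure (mu \<psi>) (\<Union>i. B i)"
    proof -
      have "incseq C" unfolding incseq_def C_def by (intro allI impI UN_mono) auto
      then show ?thesis
        using finite_measure.finite_Lim_measure_incseq[OF mu(1), of C \<psi>] Cs by (auto simp: mu(2) UC)
    qed
    have U: "(\<Union>i. B i) \<in> sets borel" using Bs by auto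
    have le: "(norm (E (\<Union>i. B i) \<psi> - (\<Sum>i<n. E (B i) \<psi>)))\<^sup>2 \<le> measure (mu \<psi>) (\<Union>i. B i) - measure (mu \<psi>) (C n)" for n
      by (rule has_proj_diff_le[OF E[OF U] sum _ U]) (auto simp: C_def)
    have "(\<lambda>n. (norm (E (\<Union>i. B i) \<psi> - (\<Sum>i<n. E (B i) \<psi>)))\<^sup>2) \<longlonglongrightarrow> 0"
    proof (rule Lim_null_comparison[of _ "\<lambda>n. measure (mu \<psi>) (\<Union>i. B i) - measure (mu \<psi>) (C n)"])
      show "(\<lambda>n. measure (mu \<psi>) (\<Union>i. B i) - measure (mu \<psi>) (C n)) \<longlonglongrightarrow> 0"
        using tendsto_diff[OF tendsto_const lim, of "measure (mu \<psi>) (\<Union>i. B i)"] by simp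
    qed (use le in auto)
    then have "(\<lambda>n. norm (E (\<Union>i. B i) \<psi> - (\<Sum>i<n. E (B i) \<psi>))) \<longlonglongrightarrow> 0"
      using tendsto_real_sqrt[of _ 0] by fastforce
    then have "(\<lambda>n. E (\<Union>i. B i) \<psi> - (\<Sum>i<n. E (B i) \<psi>)) \<longlonglongrightarrow> 0" by (rule tendsto_norm_zero_cancel)
    from tendsto_diff[OF tendsto_const this, of "E (\<Union>i. B i) \<psi>"]
    show "(\<lambda>i. E (B i) \<psi>) sums E (\<Union>i. B i) \<psi>" by (simp add: sums_def)
  qed (rule UN)
  moreover have "E {-r..r} \<psi> = \<psi>" for \<psi>
  proof (rule E_eqI)
    fix \<psi>
    have "measure (mu \<psi>) {-r..r} = measure (mu \<psi>) UNIV"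
      by (rule finite_measure.finite_measure_eq_AE[OF mu(1)])
        (use mu(3)[of \<psi>] in \<open>auto simp: mu(2) elim: eventually_mono\<close>)
    then show "measure (mu \<psi>) {-r..r} = (norm \<psi>)\<^sup>2" by (simp add: mu_total)
  qed simp
  moreover have "cinner \<psi> (A \<psi>) = complex_of_real (\<integral>x. x \<partial>scalar_measure E \<psi>)" for \<psi>
    unfolding selfadj_cinner(2)[OF sa] sm using mu(4)[of \<psi> "[:0, 1:]"] by (simp add: sa)
  ultimately have "spectral_resolution A E"
    unfolding spectral_resolution_def by blast
  then show ?thesis by blast
qed

end

section \<open>Uniqueness of spectral measures and the Borel calculus\<close>

locale resolution =
  fixes A :: "ell2 \<Rightarrow> ell2" and E :: "real set \<Rightarrow> ell2 \<Rightarrow> ell2"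
  assumes sa: "selfadj A" and res: "spectral_resolution A E"
begin

lemma pvm: "projection_valued_measure E"
  using res by (simp add: spectral_resolution_def)

lemma E_proj:
  assumes "B \<in> sets borel"
  shows "selfadj (E B)" "E B (E B \<psi>) = E B \<psi>" "inner \<psi> (E B \<psi>) = (norm (E B \<psi>))\<^sup>2"
proof -
  have op: "orthogonal_projection (E B)" using pvm assms by (auto simp: projection_valued_measure_def)
  then have *: "inner \<phi> (E B \<psi>) = inner (E B \<phi>) \<psi>" for \<phi> \<psi>
    unfolding orthogonal_projection_def by (metis Re_cinner)
  show "selfadj (E B)" using op * by (simp add: orthogonal_projection_def selfadj_def)
  show i: "E B (E B \<psi>) = E B \<psi>" using op by (simp add: orthogonal_projection_def)
  show "inner \<psi> (E B \<psi>) = (norm (E B \<psi>))\<^sup>2"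
    using *[of \<psi> "E B \<psi>"] i by (simp add: power2_norm_eq_inner)
qed

lemma E_sums:
  assumes "range B \<subseteq> sets borel" "disjoint_family B"
  shows "(\<lambda>i. E (B i) \<psi>) sums E (\<Union>i. B i) \<psi>"
  using pvm assms by (auto simp: projection_valued_measure_def)

lemma E_empty: "E {} \<psi> = 0"
proof -
  have "(\<lambda>i::nat. E {} \<psi>) sums E {} \<psi>"
    using E_sums[of "\<lambda>_. {}" \<psi>] by (simp add: disjoint_family_on_def)
  then have "(\<lambda>i::nat. E {} \<psi>) \<longlonglongrightarrow> 0" by (intro summable_LIMSEQ_zero sums_summable)
  then show ?thesis by (simp add: LIMSEQ_const_iff)
qed

abbreviation nu :: "ell2 \<Rightarrow> real measure" where "nu \<equiv> scalar_measure E"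

lemma sets_nu [simp, measurable_cong]: "sets (nu \<psi>) = sets borel"
  unfolding scalar_measure_def using sets.sigma_sets_eq[of "borel :: real measure"] by (subst sets_measure_of) auto

lemma space_nu [simp]: "space (nu \<psi>) = UNIV"
  using sets_eq_imp_space_eq[OF sets_nu] by simp

lemma emeasure_nu:
  assumes "B \<in> sets borel"
  shows "emeasure (nu \<psi>) B = ennreal (inner \<psi> (E B \<psi>))"
proof -
  have "emeasure (nu \<psi>) B = ennreal (Re (cinner \<psi> (E B \<psi>)))"
  proof (rule emeasure_measure_of[OF scalar_measure_def])
    show "sets (borel :: real measure) \<subseteq> Pow UNIV" by simp
    show "B \<in> sets (nu \<psi>)" using assms by simp
    show "positive (sets (nu \<psi>)) (\<lambda>B. ennreal (Re (cinner \<psi> (E B \<psi>))))"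
      by (simp add: positive_def E_empty)
    show "countably_additive (sets (nu \<psi>)) (\<lambda>B. ennreal (Re (cinner \<psi> (E B \<psi>))))"
    proof (rule countably_additiveI)
      fix B :: "nat \<Rightarrow> real set" assume B: "range B \<subseteq> sets (nu \<psi>)" "disjoint_family B"
      have "(\<lambda>i. inner \<psi> (E (B i) \<psi>)) sums inner \<psi> (E (\<Union>i. B i) \<psi>)"
        using E_sums[of B \<psi>] B by (intro bounded_linear.sums[OF bounded_linear_inner_right]) auto
      moreover have "0 \<le> inner \<psi> (E (B i) \<psi>)" for i
        using E_proj(3)[of "B i" \<psi>] B by auto
      ultimately have "(\<Sum>i. ennreal (inner \<psi> (E (B i) \<psi>))) = ennreal (inner \<psi> (E (\<Union>i. B i) \<psi>))"
        by (intro suminf_ennreal_eq)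
      then show "(\<Sum>i. ennreal (Re (cinner \<psi> (E (B i) \<psi>)))) = ennreal (Re (cinner \<psi> (E (\<Union>i. B i) \<psi>)))"
        by simp
    qed
  qed
  then show ?thesis by simp
qed

lemma finite_nu: "finite_measure (nu \<psi>)"
  by (rule finite_measureI) (simp add: emeasure_nu)

lemma measure_nu: "B \<in> sets borel \<Longrightarrow> measure (nu \<psi>) B = inner \<psi> (E B \<psi>)"
  using E_proj(3) by (simp add: measure_def emeasure_nu)

lemma E_UNIV: "E UNIV \<psi> = \<psi>"
  using pvm by (simp add: projection_valued_measure_def)

lemma nu_total: "measure (nu \<psi>) UNIV = (norm \<psi>)\<^sup>2"
  by (simp add: measure_nu E_UNIV power2_norm_eq_inner)

lemma nu_support: obtains r where "0 < r" "\<And>\<psi>. AE x in nu \<psi>. x \<in> {-r..r}"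
proof -
  obtain r where r: "\<And>\<psi>. E {-r..r} \<psi> = \<psi>" using res by (auto simp: spectral_resolution_def)
  have "AE x in nu \<psi>. x \<in> {-r..r}" for \<psi>
  proof -
    interpret finite_measure "nu \<psi>" by (rule finite_nu)
    have "measure (nu \<psi>) (space (nu \<psi>) - {-r..r}) = measure (nu \<psi>) (space (nu \<psi>)) - measure (nu \<psi>) {-r..r}"
      by (rule finite_measure_compl) simp
    also have "\<dots> = 0" by (simp add: measure_nu r E_UNIV)
    finally have "emeasure (nu \<psi>) (space (nu \<psi>) - {-r..r}) = 0" by (simp add: emeasure_eq_measure)
    then show ?thesis by (intro AE_I[of _ _ "UNIV - {-r..r}"]) auto
  qed
  then have "AE x in nu \<psi>. x \<in> {-max r 1..max r 1}" for \<psi>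
    by (rule AE_mp) (auto intro!: AE_I2)
  then show ?thesis by (intro that[of "max r 1"]) auto
qed

lemma E_Un:
  assumes "B \<in> sets borel" "C \<in> sets borel" "B \<inter> C = {}"
  shows "E (B \<union> C) \<psi> = E B \<psi> + E C \<psi>"
proof (rule selfadj_eqI[of _ "\<lambda>\<psi>. E B \<psi> + E C \<psi>"])
  interpret finite_measure "nu \<psi>" for \<psi> by (rule finite_nu)
  show "selfadj (E (B \<union> C))" "selfadj (\<lambda>\<psi>. E B \<psi> + E C \<psi>)"
    using assms by (auto intro: E_proj selfadj_add)
  fix \<psi> show "inner \<psi> (E (B \<union> C) \<psi>) = inner \<psi> (E B \<psi> + E C \<psi>)"
    using finite_measure_Union[of B \<psi> C] assms by (simp add: measure_nu inner_add_right)
qed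

text \<open>Otherwise the measure of \<open>E C \<psi>\<close>, whose mass on \<open>C\<close> is already the square of its norm, would
  have too much mass on \<open>B \<union> C\<close>.\<close>

lemma E_orthogonal:
  assumes "B \<in> sets borel" "C \<in> sets borel" "B \<inter> C = {}"
  shows "E B (E C \<psi>) = 0"
proof -
  define \<phi> where "\<phi> = E C \<psi>"
  have "inner \<phi> (E C \<phi>) = (norm \<phi>)\<^sup>2" using E_proj(2)[OF assms(2)] by (simp add: \<phi>_def power2_norm_eq_inner)
  moreover have "inner \<phi> (E (B \<union> C) \<phi>) \<le> (norm \<phi>)\<^sup>2"
    using finite_measure.bounded_measure[OF finite_nu, of \<phi> "B \<union> C"] assms by (simp add: measure_nu nu_total[unfolded measure_nu] E_UNIV power2_norm_eq_inner)
  ultimately have "inner \<phi> (E B \<phi>) \<le> 0" by (simp add: E_Un[OF assms] inner_add_right)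
  then have "(norm (E B \<phi>))\<^sup>2 \<le> 0" using E_proj(3)[OF assms(1)] by simp
  then show ?thesis by (simp add: \<phi>_def)
qed

lemma E_finite_UN:
  assumes "finite J" "\<And>i. i \<in> J \<Longrightarrow> B i \<in> sets borel" "disjoint_family_on B J"
  shows "E (\<Union>i\<in>J. B i) \<psi> = (\<Sum>i\<in>J. E (B i) \<psi>)"
  using assms
proof (induction J rule: finite_induct)
  case empty then show ?case by (simp add: E_empty)
next
  case (insert i J)
  have "B i \<inter> (\<Union>i\<in>J. B i) = {}" using insert by (auto simp: disjoint_family_on_def)
  then have "E (B i \<union> (\<Union>i\<in>J. B i)) \<psi> = E (B i) \<psi> + E (\<Union>i\<in>J. B i) \<psi>"
    using insert by (intro E_Un) auto
  moreover have "disjoint_family_on B J" using insert(5) by (auto simp: disjoint_family_on_def)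
  ultimately show ?case using insert by simp
qed

text \<open>For \<open>g\<close> rounded down to multiples of \<open>e\<close> the operator is a finite combination of mutually
  orthogonal projections, on which a polynomial acts by acting on the coefficients.\<close>

lemma simple_operator:
  assumes [measurable]: "g \<in> borel_measurable borel" and c: "\<And>x. \<bar>g x\<bar> \<le> c" and e: "0 < e"
  shows "\<exists>S. selfadj S \<and> (\<forall>p \<psi>. inner \<psi> (poly_op S p \<psi>) = (\<integral>x. poly p (e * of_int \<lfloor>g x / e\<rfloor>) \<partial>nu \<psi>))"
proof -
  define B where "B i = {x. \<lfloor>g x / e\<rfloor> = i}" for i :: int
  have B[measurable]: "B i \<in> sets borel" for i unfolding B_def by measurable
  define I where "I = {\<lfloor>-c/e\<rfloor> .. \<lceil>c/e\<rceil>}"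
  have I: "\<lfloor>g x / e\<rfloor> \<in> I" for x
  proof -
    have "-c/e \<le> g x / e" "g x / e \<le> c / e"
      by (rule divide_right_mono; use c[of x] e in simp)+
    then show ?thesis unfolding I_def
      by (auto intro: floor_mono order_trans[OF floor_mono floor_le_ceiling])
  qed
  have finI: "finite I" by (simp add: I_def)
  have disj: "disjoint_family_on B I" by (auto simp: disjoint_family_on_def B_def)
  have "(\<Union>i\<in>I. B i) = UNIV" using I by (auto simp: B_def)
  then have tot: "(\<Sum>i\<in>I. E (B i) \<psi>) = \<psi>" for \<psi>
    using E_finite_UN[OF finI B disj, of \<psi>] by (simp add: E_UNIV)
  define S where "S \<psi> = (\<Sum>i\<in>I. (e * of_int i) *\<^sub>R E (B i) \<psi>)" for \<psi>
  have sS: "selfadj S" unfolding S_def by (intro selfadj_sum selfadj_scaleR E_proj B)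
  have orth: "E (B i) (E (B j) \<psi>) = (if i = j then E (B i) \<psi> else 0)" for i j \<psi>
  proof (cases "i = j")
    case False
    then have "B i \<inter> B j = {}" by (auto simp: B_def)
    then show ?thesis using E_orthogonal[OF B B] False by simp
  qed (simp add: E_proj(2))
  have SE: "S (\<Sum>j\<in>I. a j *\<^sub>R E (B j) \<psi>) = (\<Sum>i\<in>I. (e * of_int i * a i) *\<^sub>R E (B i) \<psi>)" for a \<psi>
    unfolding S_def
  proof (rule sum.cong)
    fix i assume i: "i \<in> I"
    note D = selfadjD[OF E_proj(1)[OF B[of i]]]
    have "E (B i) (\<Sum>j\<in>I. a j *\<^sub>R E (B j) \<psi>) = (\<Sum>j\<in>I. a j *\<^sub>R E (B i) (E (B j) \<psi>))"
      by (simp add: linear_sum[OF D(2)] D(7))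
    also have "\<dots> = (\<Sum>j\<in>I. if i = j then a i *\<^sub>R E (B i) \<psi> else 0)"
      by (intro sum.cong) (auto simp: orth)
    also have "\<dots> = a i *\<^sub>R E (B i) \<psi>" using i finI by simp
    finally show "(e * of_int i) *\<^sub>R E (B i) (\<Sum>j\<in>I. a j *\<^sub>R E (B j) \<psi>) = (e * of_int i * a i) *\<^sub>R E (B i) \<psi>" by simp
  qed simp
  have pS: "poly_op S p \<psi> = (\<Sum>i\<in>I. poly p (e * of_int i) *\<^sub>R E (B i) \<psi>)" for p \<psi>
  proof (induction p)
    case 0 then show ?case by simp
  next
    case (pCons a p)
    have "poly_op S (pCons a p) \<psi> = a *\<^sub>R (\<Sum>i\<in>I. E (B i) \<psi>) + S (\<Sum>i\<in>I. poly p (e * of_int i) *\<^sub>R E (B i) \<psi>)"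
      using pCons by (simp add: poly_op_pCons[OF sS] tot)
    also have "\<dots> = (\<Sum>i\<in>I. poly (pCons a p) (e * of_int i) *\<^sub>R E (B i) \<psi>)"
      unfolding SE by (simp add: scaleR_sum_right sum.distrib[symmetric] scaleR_add_left)
    finally show ?case .
  qed
  have "inner \<psi> (poly_op S p \<psi>) = (\<integral>x. poly p (e * of_int \<lfloor>g x / e\<rfloor>) \<partial>nu \<psi>)" for p \<psi>
  proof -
    interpret finite_measure "nu \<psi>" by (rule finite_nu)
    have "(\<integral>x. poly p (e * of_int \<lfloor>g x / e\<rfloor>) \<partial>nu \<psi>) = (\<integral>x. (\<Sum>i\<in>I. poly p (e * of_int i) * indicator (B i) x) \<partial>nu \<psi>)"
    proof (rule Bochner_Integration.integral_cong)
      fix x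
      have "(\<Sum>i\<in>I. poly p (e * of_int i) * indicator (B i) x) = (\<Sum>i\<in>I. if i = \<lfloor>g x / e\<rfloor> then poly p (e * of_int i) else 0)"
        by (intro sum.cong) (auto simp: B_def)
      then show "poly p (e * of_int \<lfloor>g x / e\<rfloor>) = (\<Sum>i\<in>I. poly p (e * of_int i) * indicator (B i) x)"
        using I[of x] finI by simp
    qed simp
    also have "\<dots> = (\<Sum>i\<in>I. poly p (e * of_int i) * measure (nu \<psi>) (B i))"
      by (subst Bochner_Integration.integral_sum) (auto intro!: integrable_mult_right integrable_real_indicator emeasure_finite[THEN less_top[THEN iffD1]] simp: less_top)
    also have "\<dots> = inner \<psi> (poly_op S p \<psi>)" by (simp add: pS inner_sum_right measure_nu B)
    finally show ?thesis by simp
  qed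
  then show ?thesis using sS by blast
qed

lemma floor_approx: "0 < e \<Longrightarrow> \<bar>y - e * of_int \<lfloor>y / e\<rfloor>\<bar> \<le> e" for y e :: real
proof -
  assume e: "0 < e"
  have "e * of_int \<lfloor>y / e\<rfloor> \<le> y" "y \<le> e * of_int \<lfloor>y / e\<rfloor> + e"
    using floor_divide_lower[OF e, of y] floor_divide_upper[OF e, of y] by (simp_all add: algebra_simps)
  then show ?thesis by linarith
qed

lemma integral_diff_le:
  assumes [measurable]: "f \<in> borel_measurable borel" "g \<in> borel_measurable borel"
    and b: "AE x in nu \<psi>. \<bar>f x\<bar> \<le> c" "AE x in nu \<psi>. \<bar>g x\<bar> \<le> c" "AE x in nu \<psi>. \<bar>f x - g x\<bar> \<le> e"
  shows "\<bar>(\<integral>x. f x \<partial>nu \<psi>) - (\<integral>x. g x \<partial>nu \<psi>)\<bar> \<le> e * (norm \<psi>)\<^sup>2"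
proof -
  interpret finite_measure "nu \<psi>" by (rule finite_nu)
  have i: "integrable (nu \<psi>) f" "integrable (nu \<psi>) g"
    using b by (auto intro!: integrable_const_bound[where B = c])
  have "\<bar>(\<integral>x. f x \<partial>nu \<psi>) - (\<integral>x. g x \<partial>nu \<psi>)\<bar> = norm (\<integral>x. f x - g x \<partial>nu \<psi>)" using i by simp
  also have "\<dots> \<le> (\<integral>x. norm (f x - g x) \<partial>nu \<psi>)" by (rule integral_norm_bound)
  also have "\<dots> \<le> (\<integral>x. e \<partial>nu \<psi>)" using i b(3) by (intro integral_mono_AE) auto
  also have "\<dots> = e * (norm \<psi>)\<^sup>2" using nu_total[of \<psi>] by simp
  finally show ?thesis .
qed

text \<open>A resolution prescribes the first moment only. Rounding \<open>x\<close> to multiples of a small number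
  \<open>e\<close> gives a simple operator whose form is within \<open>e\<close> of that of \<open>A\<close>; so the simple operators
  converge to \<open>A\<close> in norm, their polynomials converge strongly, and for simple operators all
  moments are known.\<close>

theorem moments: "(\<integral>x. poly p x \<partial>nu \<psi>) = inner \<psi> (poly_op A p \<psi>)"
proof -
  obtain r where r: "0 < r" "\<And>\<psi>. AE x in nu \<psi>. x \<in> {-r..r}" using nu_support by blast
  \<comment> \<open>A bounded representative of the identity on the support of the measures.\<close>
  define g where "g x = max (-r) (min r x)" for x
  have gm[measurable]: "g \<in> borel_measurable borel" unfolding g_def by measurable
  have gb: "\<bar>g x\<bar> \<le> r" for x using r(1) by (auto simp: g_def)
  have gx: "AE x in nu \<psi>. g x = x" for \<psi> using r(2)[of \<psi>] by eventually_elim (auto simp: g_def)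
  define e where "e n = 1 / (real n + 1)" for n
  have e: "0 < e n" "e n \<le> 1" for n by (auto simp: e_def)
  have e0: "e \<longlonglongrightarrow> 0" unfolding e_def by real_asymp
  define fl where "fl n x = e n * of_int \<lfloor>g x / e n\<rfloor>" for n x
  have flm[measurable]: "fl n \<in> borel_measurable borel" for n unfolding fl_def by measurable
  have gfl: "\<bar>g x - fl n x\<bar> \<le> e n" for n x unfolding fl_def using e by (intro floor_approx) auto
  have flb: "\<bar>fl n x\<bar> \<le> r + 1" for n x using gfl[of x n] gb[of x] e(2)[of n] by linarith
  have "\<forall>n. \<exists>S. selfadj S \<and> (\<forall>p \<psi>. inner \<psi> (poly_op S p \<psi>) = (\<integral>x. poly p (fl n x) \<partial>nu \<psi>))"
    unfolding fl_def using simple_operator[OF gm gb e(1)] by blast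
  then obtain S where S: "\<And>n. selfadj (S n)" "\<And>n p \<psi>. inner \<psi> (poly_op (S n) p \<psi>) = (\<integral>x. poly p (fl n x) \<partial>nu \<psi>)"
    by metis
  have close: "norm (A \<psi> - S n \<psi>) \<le> e n * norm \<psi>" for n \<psi>
  proof (rule selfadj_form_bound[OF selfadj_diff[OF sa S(1)]])
    fix \<psi>
    have "cinner \<psi> (A \<psi>) = complex_of_real (\<integral>x. x \<partial>nu \<psi>)" using res by (simp add: spectral_resolution_def)
    then have "inner \<psi> (A \<psi>) = (\<integral>x. x \<partial>nu \<psi>)" by (metis Re_cinner Re_complex_of_real)
    also have "\<dots> = (\<integral>x. g x \<partial>nu \<psi>)" using gx[of \<psi>] by (intro integral_cong_AE) auto
    finally have "inner \<psi> (A \<psi> - S n \<psi>) = (\<integral>x. g x \<partial>nu \<psi>) - (\<integral>x. fl n x \<partial>nu \<psi>)"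
      using S(2)[of \<psi> n "[:0, 1:]"] S(1)[of n] by (simp add: inner_diff_right)
    then show "\<bar>inner \<psi> (A \<psi> - S n \<psi>)\<bar> \<le> e n * (norm \<psi>)\<^sup>2"
      using integral_diff_le[where f = g and g = "fl n" and \<psi> = \<psi> and c = "r + 1" and e = "e n"] gb flb gfl r(1)
      by (simp add: add_increasing2 order_trans[OF gb])
  qed
  obtain K where K: "\<And>\<psi>. norm (A \<psi>) \<le> norm \<psi> * K" "0 \<le> K"
    using bounded_linear.nonneg_bounded[OF selfadjD(1)[OF sa]] by blast
  have conv: "(\<lambda>n. poly_op (S n) p \<psi>) \<longlonglongrightarrow> poly_op A p \<psi>" for p
  proof (induction p)
    case 0 then show ?case by simp
  next
    case (pCons a p)
    define y where "y n = poly_op (S n) p \<psi>" for n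
    have y: "y \<longlonglongrightarrow> poly_op A p \<psi>" using pCons.IH unfolding y_def .
    have "(\<lambda>n. A (y n)) \<longlonglongrightarrow> A (poly_op A p \<psi>)"
      by (rule bounded_linear.tendsto[OF selfadjD(1)[OF sa] y])
    moreover have "(\<lambda>n. A (y n) - S n (y n)) \<longlonglongrightarrow> 0"
    proof (rule Lim_null_comparison)
      show "\<forall>\<^sub>F n in sequentially. norm (A (y n) - S n (y n)) \<le> e n * norm (y n)"
        using close by auto
      show "(\<lambda>n. e n * norm (y n)) \<longlonglongrightarrow> 0"
        using tendsto_mult[OF e0 tendsto_norm[OF y]] by simp
    qed
    ultimately have "(\<lambda>n. A (y n) - (A (y n) - S n (y n))) \<longlonglongrightarrow> A (poly_op A p \<psi>) - 0"
      by (rule tendsto_diff)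
    then have "(\<lambda>n. a *\<^sub>R \<psi> + S n (y n)) \<longlonglongrightarrow> a *\<^sub>R \<psi> + A (poly_op A p \<psi>)"
      by (intro tendsto_intros) simp
    then show ?case by (simp add: poly_op_pCons[OF sa] poly_op_pCons[OF S(1)] y_def)
  qed
  have "(\<lambda>n. inner \<psi> (poly_op (S n) p \<psi>)) \<longlonglongrightarrow> inner \<psi> (poly_op A p \<psi>)"
    by (intro tendsto_intros conv)
  moreover have "(\<lambda>n. inner \<psi> (poly_op (S n) p \<psi>)) \<longlonglongrightarrow> (\<integral>x. poly p (g x) \<partial>nu \<psi>)"
    unfolding S(2)
  proof -
    interpret finite_measure "nu \<psi>" by (rule finite_nu)
    have "compact (poly p ` {-(r+1)..r+1})" by (intro compact_continuous_image continuous_intros) auto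
    then obtain C where C: "\<And>x. x \<in> {-(r+1)..r+1} \<Longrightarrow> norm (poly p x) \<le> C"
      using compact_imp_bounded bounded_iff by (metis (no_types) imageI)
    show "(\<lambda>n. \<integral>x. poly p (fl n x) \<partial>nu \<psi>) \<longlonglongrightarrow> (\<integral>x. poly p (g x) \<partial>nu \<psi>)"
    proof (rule integral_dominated_convergence[where w = "\<lambda>_. C"])
      show "AE x in nu \<psi>. (\<lambda>n. poly p (fl n x)) \<longlonglongrightarrow> poly p (g x)"
      proof (rule AE_I2)
        fix x
        have "(\<lambda>n. g x - fl n x) \<longlonglongrightarrow> 0"
          by (rule Lim_null_comparison[OF _ e0]) (use gfl in auto)
        from tendsto_diff[OF tendsto_const this, of "g x"] have "(\<lambda>n. fl n x) \<longlonglongrightarrow> g x" by simp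
        then show "(\<lambda>n. poly p (fl n x)) \<longlonglongrightarrow> poly p (g x)" by (intro tendsto_intros)
      qed
      show "AE x in nu \<psi>. norm (poly p (fl n x)) \<le> C" for n
      proof (rule AE_I2)
        fix x show "norm (poly p (fl n x)) \<le> C"
          using flb[of n x] by (intro C) (auto simp: abs_le_iff)
      qed
    qed auto
  qed
  ultimately have "inner \<psi> (poly_op A p \<psi>) = (\<integral>x. poly p (g x) \<partial>nu \<psi>)" by (rule LIMSEQ_unique)
  also have "\<dots> = (\<integral>x. poly p x \<partial>nu \<psi>)"
  proof (rule integral_cong_AE)
    show "AE x in nu \<psi>. poly p (g x) = poly p x" using gx[of \<psi>] by eventually_elim simp
  qed measurable
  finally show ?thesis by simp
qed

text \<open>The simple operators for \<open>g\<close> rounded to finer and finer multiples form a Cauchy sequence in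
  norm, because their forms do.\<close>

lemma real_calculus:
  assumes gm[measurable]: "g \<in> borel_measurable borel" and c: "\<And>x. \<bar>g x\<bar> \<le> c"
  shows "\<exists>G. selfadj G \<and> (\<forall>\<psi>. inner \<psi> (G \<psi>) = (\<integral>x. g x \<partial>nu \<psi>))"
proof -
  define e where "e n = 1 / (real n + 1)" for n
  have e: "0 < e n" "e n \<le> 1" for n by (auto simp: e_def)
  have e0: "e \<longlonglongrightarrow> 0" unfolding e_def by real_asymp
  define fl where "fl n x = e n * of_int \<lfloor>g x / e n\<rfloor>" for n x
  have flm[measurable]: "fl n \<in> borel_measurable borel" for n unfolding fl_def by measurable
  have gfl: "\<bar>g x - fl n x\<bar> \<le> e n" for n x unfolding fl_def using e by (intro floor_approx) auto
  have flb: "\<bar>fl n x\<bar> \<le> c + 1" for n x using gfl[of x n] c[of x] e(2)[of n] by linarith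
  have c1: "\<bar>g x\<bar> \<le> c + 1" for x using c[of x] by linarith
  have "\<forall>n. \<exists>S. selfadj S \<and> (\<forall>p \<psi>. inner \<psi> (poly_op S p \<psi>) = (\<integral>x. poly p (fl n x) \<partial>nu \<psi>))"
    unfolding fl_def using simple_operator[OF gm c e(1)] by blast
  then obtain S where S: "\<And>n. selfadj (S n)" "\<And>n p \<psi>. inner \<psi> (poly_op (S n) p \<psi>) = (\<integral>x. poly p (fl n x) \<partial>nu \<psi>)"
    by metis
  have S1: "inner \<psi> (S n \<psi>) = (\<integral>x. fl n x \<partial>nu \<psi>)" for n \<psi>
    using S(2)[of \<psi> n "[:0, 1:]"] S(1)[of n] by simp
  have lim: "\<bar>inner \<psi> (S n \<psi>) - (\<integral>x. g x \<partial>nu \<psi>)\<bar> \<le> e n * (norm \<psi>)\<^sup>2" for n \<psi>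
    unfolding S1 by (rule integral_diff_le[where c = "c + 1"]) (use flb c1 gfl in \<open>auto simp: abs_minus_commute\<close>)
  have close: "norm (S n \<psi> - S m \<psi>) \<le> (e n + e m) * norm \<psi>" for n m \<psi>
  proof (rule selfadj_form_bound[OF selfadj_diff[OF S(1) S(1)]])
    fix \<psi> show "\<bar>inner \<psi> (S n \<psi> - S m \<psi>)\<bar> \<le> (e n + e m) * (norm \<psi>)\<^sup>2"
      using lim[of \<psi> n] lim[of \<psi> m] by (simp add: inner_diff_right distrib_right)
  qed
  have bd: "norm (S n \<psi>) \<le> (c + 1) * norm \<psi>" for n \<psi>
  proof (rule selfadj_form_bound[OF S(1)])
    fix \<psi> show "\<bar>inner \<psi> (S n \<psi>)\<bar> \<le> (c + 1) * (norm \<psi>)\<^sup>2"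
      using integral_diff_le[where f = "fl n" and g = "\<lambda>_. 0" and \<psi> = \<psi> and c = "c + 1" and e = "c + 1"] flb c1[of 0] unfolding S1 by simp
  qed
  have "\<forall>\<psi>. \<exists>l. (\<lambda>n. S n \<psi>) \<longlonglongrightarrow> l"
  proof
    fix \<psi>
    have "Cauchy (\<lambda>n. S n \<psi>)"
    proof (rule metric_CauchyI)
      fix d :: real assume d: "0 < d"
      have "(\<lambda>n. e n * (2 * norm \<psi>)) \<longlonglongrightarrow> 0" using tendsto_mult_right[OF e0, of "2 * norm \<psi>"] by simp
      then have "eventually (\<lambda>n. e n * (2 * norm \<psi>) < d) sequentially" using d by (rule order_tendstoD(2))
      then obtain N where N: "\<And>n. n \<ge> N \<Longrightarrow> e n * (2 * norm \<psi>) < d" by (auto simp: eventually_sequentially)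
      have "dist (S n \<psi>) (S m \<psi>) < d" if "n \<ge> N" "m \<ge> N" for n m
        using close[of n \<psi> m] N[OF that(1)] N[OF that(2)] by (simp add: dist_norm distrib_right)
      then show "\<exists>M. \<forall>m\<ge>M. \<forall>n\<ge>M. dist (S m \<psi>) (S n \<psi>) < d" by blast
    qed
    then show "\<exists>l. (\<lambda>n. S n \<psi>) \<longlonglongrightarrow> l" using Cauchy_convergent_iff convergent_def by blast
  qed
  then obtain G where G: "\<And>\<psi>. (\<lambda>n. S n \<psi>) \<longlonglongrightarrow> G \<psi>" by metis
  have "selfadj G" by (rule selfadj_limit[OF S(1) bd G])
  moreover have "inner \<psi> (G \<psi>) = (\<integral>x. g x \<partial>nu \<psi>)" for \<psi>
  proof (rule LIMSEQ_unique)
    show "(\<lambda>n. inner \<psi> (S n \<psi>)) \<longlonglongrightarrow> inner \<psi> (G \<psi>)" by (intro tendsto_intros G)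
    have "(\<lambda>n. inner \<psi> (S n \<psi>) - (\<integral>x. g x \<partial>nu \<psi>)) \<longlonglongrightarrow> 0"
    proof (rule Lim_null_comparison)
      show "\<forall>\<^sub>F n in sequentially. norm (inner \<psi> (S n \<psi>) - (\<integral>x. g x \<partial>nu \<psi>)) \<le> e n * (norm \<psi>)\<^sup>2"
        using lim by auto
      show "(\<lambda>n. e n * (norm \<psi>)\<^sup>2) \<longlonglongrightarrow> 0" using tendsto_mult_right[OF e0, of "(norm \<psi>)\<^sup>2"] by simp
    qed
    then show "(\<lambda>n. inner \<psi> (S n \<psi>)) \<longlonglongrightarrow> (\<integral>x. g x \<partial>nu \<psi>)" by (simp add: LIM_zero_iff)
  qed
  ultimately show ?thesis by blast
qed

text \<open>A vector in the range of the projection of the ball would violate the hypothesis, as its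
  second moment about \<open>x\<close> is at most \<open>e\<^sup>2\<close>.\<close>

lemma isolated_null:
  assumes "0 < e" and no: "\<And>\<phi>. \<phi> \<noteq> 0 \<Longrightarrow> e * norm \<phi> < norm (A \<phi> - x *\<^sub>R \<phi>)"
  shows "measure (nu \<psi>) (ball x e) = 0"
proof (rule ccontr)
  assume n0: "measure (nu \<psi>) (ball x e) \<noteq> 0"
  define \<phi> where "\<phi> = E (ball x e) \<psi>"
  have "\<phi> \<noteq> 0" using n0 by (auto simp: \<phi>_def measure_nu)
  interpret finite_measure "nu \<phi>" by (rule finite_nu)
  have "measure (nu \<phi>) (ball x e) = measure (nu \<phi>) (space (nu \<phi>))"
    by (simp add: measure_nu E_UNIV \<phi>_def E_proj(2))
  then have "AE y in nu \<phi>. y \<in> ball x e"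
    using finite_measure_compl[of "ball x e"]
    by (intro AE_I[of _ _ "UNIV - ball x e"]) (auto simp: emeasure_eq_measure)
  then have AE: "AE y in nu \<phi>. (y - x)\<^sup>2 \<le> e\<^sup>2"
    by eventually_elim (auto simp: dist_real_def abs_minus_commute intro!: abs_le_square_iff[THEN iffD1])
  have "(norm (A \<phi> - x *\<^sub>R \<phi>))\<^sup>2 = inner \<phi> (poly_op A ([:-x, 1:] * [:-x, 1:]) \<phi>)"
    unfolding inner_poly_op_mult[OF sa, symmetric] using sa by (simp add: power2_norm_eq_inner)
  also have "\<dots> = (\<integral>y. poly ([:-x, 1:] * [:-x, 1:]) y \<partial>nu \<phi>)" by (rule moments[symmetric])
  also have "\<dots> = (\<integral>y. (y - x)\<^sup>2 \<partial>nu \<phi>)"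
    by (simp add: power2_eq_square algebra_simps)
  also have "\<dots> \<le> (\<integral>y. e\<^sup>2 \<partial>nu \<phi>)"
    using AE by (intro integral_mono_AE integrable_const_bound[where B = "e\<^sup>2"]) auto
  also have "\<dots> = (e * norm \<phi>)\<^sup>2" using nu_total[of \<phi>] by (simp add: power_mult_distrib)
  finally have "norm (A \<phi> - x *\<^sub>R \<phi>) \<le> e * norm \<phi>"
    using assms(1) by (intro power2_le_imp_le[of "norm (A \<phi> - x *\<^sub>R \<phi>)"]) auto
  with no[OF \<open>\<phi> \<noteq> 0\<close>] show False by simp
qed

end

lemma selfadj_bound_ex:
  assumes "selfadj A"
  obtains r where "0 < r" "\<And>\<psi>. norm (A \<psi>) \<le> r * norm \<psi>"
  using bounded_linear.pos_bounded[OF selfadjD(1)[OF assms]] by (auto simp: mult.commute)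

lemma scalar_measure_unique:
  assumes "selfadj A" "spectral_resolution A E" "spectral_resolution A F"
  shows "scalar_measure E \<psi> = scalar_measure F \<psi>"
proof -
  interpret E: resolution A E using assms by unfold_locales
  interpret F: resolution A F using assms by unfold_locales
  obtain r where r: "\<And>\<psi>. AE x in scalar_measure E \<psi>. x \<in> {-r..r}" using E.nu_support by blast
  obtain s where s: "\<And>\<psi>. AE x in scalar_measure F \<psi>. x \<in> {-s..s}" using F.nu_support by blast
  show ?thesis
  proof (rule measure_eqI_poly_integrals[where r = "max r s"])
    show "AE x in scalar_measure E \<psi>. x \<in> {- max r s..max r s}"
      using r[of \<psi>] by eventually_elim auto
    show "AE x in scalar_measure F \<psi>. x \<in> {- max r s..max r s}"
      using s[of \<psi>] by eventually_elim auto
  qed (use E.finite_nu F.finite_nu E.moments F.moments in auto)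
qed

text \<open>The choice of the resolution is immaterial by \<open>scalar_measure_unique\<close>.\<close>

definition spec_measure :: "(ell2 \<Rightarrow> ell2) \<Rightarrow> ell2 \<Rightarrow> real measure" where
  "spec_measure A = scalar_measure (SOME E. spectral_resolution A E)"

lemma spec_resolution:
  assumes "selfadj A"
  shows "resolution A (SOME E. spectral_resolution A E)"
proof -
  obtain r where r: "0 < r" "\<And>\<psi>. norm (A \<psi>) \<le> r * norm \<psi>" using selfadj_bound_ex[OF assms] by blast
  interpret bounded_selfadj A r using assms r by unfold_locales
  show ?thesis using someI_ex[OF spectral_resolution_exists] assms by unfold_locales
qed

lemma spec_measure:
  assumes A: "selfadj A"
  shows "finite_measure (spec_measure A \<psi>)" "sets (spec_measure A \<psi>) = sets borel"
    "measure (spec_measure A \<psi>) UNIV = (norm \<psi>)\<^sup>2" "space (spec_measure A \<psi>) = UNIV"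
    "(\<integral>x. poly p x \<partial>spec_measure A \<psi>) = inner \<psi> (poly_op A p \<psi>)"
proof -
  interpret R: resolution A "SOME E. spectral_resolution A E" by (rule spec_resolution[OF A])
  show "finite_measure (spec_measure A \<psi>)" "sets (spec_measure A \<psi>) = sets borel"
    "measure (spec_measure A \<psi>) UNIV = (norm \<psi>)\<^sup>2" "space (spec_measure A \<psi>) = UNIV"
    "(\<integral>x. poly p x \<partial>spec_measure A \<psi>) = inner \<psi> (poly_op A p \<psi>)"
    unfolding spec_measure_def by (auto intro: R.finite_nu R.nu_total R.moments)
qed

lemma spec_measure_support:
  assumes A: "selfadj A" and r: "0 < r" "\<And>\<psi>. norm (A \<psi>) \<le> r * norm \<psi>"
  shows "AE x in spec_measure A \<psi>. x \<in> {-r..r}"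
proof -
  interpret bounded_selfadj A r using A r by unfold_locales
  interpret R: resolution A "SOME E. spectral_resolution A E" by (rule spec_resolution[OF A])
  obtain s where s: "\<And>\<psi>. AE x in spec_measure A \<psi>. x \<in> {-s..s}" using R.nu_support unfolding spec_measure_def by blast
  have "mu \<psi> = spec_measure A \<psi>"
  proof (rule measure_eqI_poly_integrals[where r = "max r s"])
    show "AE x in mu \<psi>. x \<in> {- max r s..max r s}"
      using mu(3)[of \<psi>] by eventually_elim auto
    show "AE x in spec_measure A \<psi>. x \<in> {- max r s..max r s}"
      using s[of \<psi>] by eventually_elim auto
  qed (auto simp: mu spec_measure[OF A])
  then show ?thesis using mu(3)[of \<psi>] by metis
qed

text \<open>The form vanishes at \<open>a + b\<close>, which makes \<open>inner a (D b)\<close> antisymmetric in \<open>a\<close> and \<open>b\<close>; the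
  imaginary part, applied with \<open>\<i> b\<close> in place of \<open>b\<close>, makes it symmetric.\<close>

lemma bounded_operator_form_zero:
  assumes D: "bounded_operator D" and z: "\<And>\<psi>. cinner \<psi> (D \<psi>) = 0"
  shows "D \<psi> = 0"
proof -
  have lin: "linear D" and sc: "\<And>c \<psi>. D (scaleC c \<psi>) = scaleC c (D \<psi>)"
    using D by (auto simp: bounded_operator_def bounded_linear.linear)
  have z': "inner \<phi> (D \<phi>) = 0" for \<phi> using z[of \<phi>] by (metis Re_cinner zero_complex.sel(1))
  have s: "inner a (D b) + inner b (D a) = 0" for a b
    using z'[of "a + b"] z'[of a] z'[of b] by (simp add: linear_add[OF lin] inner_add_left inner_add_right)
  have im: "inner (scaleC \<i> a) (D a) = 0" for a
    using z[of a] by (simp add: cinner_eq complex_eq_iff)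
  have im2: "inner (scaleC \<i> a) (D b) + inner (scaleC \<i> b) (D a) = 0" for a b
    using im[of "a + b"] im[of a] im[of b] by (simp add: linear_add[OF lin] inner_add_left inner_add_right)
  have "inner a (D b) - inner b (D a) = 0" for a b
    using im2[of a "scaleC \<i> b"] inner_scaleC_left[of \<i> a "scaleC \<i> (D b)"] by (simp add: sc)
  with s[of "D \<psi>" \<psi>] have "2 * inner (D \<psi>) (D \<psi>) = 0"
    by (metis diff_eq_eq add_0 mult_2)
  then show ?thesis by simp
qed

text \<open>The real and the imaginary part of \<open>g\<close> give two self-adjoint operators that combine to one
  with the right form. A form determines its operator and \<open>A\<close> determines the measures, so the
  description singles out this operator.\<close>

theorem borel_calculus_form:
  fixes g :: "real \<Rightarrow> complex"
  assumes A: "selfadj A" and gm[measurable]: "g \<in> borel_measurable borel" and gb: "bounded (range g)"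
  shows "cinner \<psi> (borel_calculus A g \<psi>) = (\<integral>x. g x \<partial>spec_measure A \<psi>)"
proof -
  define E0 where "E0 = (SOME E. spectral_resolution A E)"
  interpret R: resolution A E0 unfolding E0_def by (rule spec_resolution[OF A])
  have sm: "spec_measure A = scalar_measure E0" by (simp add: spec_measure_def E0_def)
  obtain c where c: "\<And>x. cmod (g x) \<le> c" using gb by (auto simp: bounded_iff)
  obtain G1 where G1: "selfadj G1" "\<And>\<psi>. inner \<psi> (G1 \<psi>) = (\<integral>x. Re (g x) \<partial>scalar_measure E0 \<psi>)"
    using R.real_calculus[of "\<lambda>x. Re (g x)" c] order_trans[OF abs_Re_le_cmod c] by auto
  obtain G2 where G2: "selfadj G2" "\<And>\<psi>. inner \<psi> (G2 \<psi>) = (\<integral>x. Im (g x) \<partial>scalar_measure E0 \<psi>)"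
    using R.real_calculus[of "\<lambda>x. Im (g x)" c] order_trans[OF abs_Im_le_cmod c] by auto
  define G where "G \<psi> = G1 \<psi> + scaleC \<i> (G2 \<psi>)" for \<psi>
  have int: "integrable (scalar_measure E0 \<psi>) g" for \<psi>
    by (rule finite_measure.integrable_const_bound[OF R.finite_nu, where B = c]) (use c in auto)
  have cform: "cinner \<psi> (G \<psi>) = (\<integral>x. g x \<partial>scalar_measure E0 \<psi>)" for \<psi>
  proof -
    have i0: "inner (scaleC \<i> \<psi>) (H \<psi>) = 0" if "selfadj H" for H
      using selfadj_cinner(2)[OF that, of \<psi>] by (simp add: cinner_eq complex_eq_iff)
    have i1: "inner \<psi> (scaleC \<i> a) = - inner (scaleC \<i> \<psi>) a" for a
      using inner_scaleC_left[of "\<i>" \<psi> a] by (simp add: inner_minus_right[symmetric] del: inner_minus_right)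
         (metis add.inverse_inverse inner_minus_right mult_minus1 scaleC_simps(4,8))
    have i2: "inner (scaleC \<i> \<psi>) (scaleC \<i> a) = inner \<psi> a" for a
      by (simp add: inner_scaleC_left)
    have "cinner \<psi> (G \<psi>) = Complex (inner \<psi> (G1 \<psi>)) (inner \<psi> (G2 \<psi>))"
      by (simp add: cinner_eq G_def inner_add_right i0[OF G1(1)] i0[OF G2(1)] i1 i2)
    also have "\<dots> = (\<integral>x. g x \<partial>scalar_measure E0 \<psi>)"
      using int[of \<psi>] by (simp add: G1(2) G2(2) complex_eq_iff)
    finally show ?thesis .
  qed
  have bG: "bounded_operator G"
    unfolding G_def using G1(1) G2(1) by (intro bounded_operator_add bounded_operator_scaleC) (auto simp: selfadj_def)
  have "borel_calculus A g = G"
    unfolding borel_calculus_def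
  proof (rule the_equality)
    show "bounded_operator G \<and> (\<exists>E. spectral_resolution A E \<and> (\<forall>\<psi>. cinner \<psi> (G \<psi>) = (\<integral>x. g x \<partial>scalar_measure E \<psi>)))"
      using bG cform R.res by blast
    fix F assume F: "bounded_operator F \<and> (\<exists>E. spectral_resolution A E \<and> (\<forall>\<psi>. cinner \<psi> (F \<psi>) = (\<integral>x. g x \<partial>scalar_measure E \<psi>)))"
    then have f: "cinner \<psi> (F \<psi>) = cinner \<psi> (G \<psi>)" for \<psi>
      using cform scalar_measure_unique[OF A _ R.res] by metis
    have "bounded_operator (\<lambda>\<psi>. F \<psi> + scaleC (-1) (G \<psi>))"
      using F bG by (intro bounded_operator_add bounded_operator_scaleC) auto
    then have D: "bounded_operator (\<lambda>\<psi>. F \<psi> - G \<psi>)" by simp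
    have "F \<psi> - G \<psi> = 0" for \<psi>
      by (rule bounded_operator_form_zero[OF D]) (use f in \<open>simp add: cinner_eq complex_eq_iff inner_diff_right\<close>)
    then show "F = G" by auto
  qed
  then show ?thesis using cform by (simp add: sm)
qed


section \<open>Approximate eigenvalues\<close>

text \<open>Weyl's criterion. For self-adjoint operators this describes the spectrum, but it can be
  verified and perturbed by means of vectors.\<close>

definition approx_eigenvalue :: "(ell2 \<Rightarrow> ell2) \<Rightarrow> real \<Rightarrow> bool" where
  "approx_eigenvalue A x \<longleftrightarrow> (\<forall>e>0. \<exists>\<psi>. \<psi> \<noteq> 0 \<and> norm (A \<psi> - x *\<^sub>R \<psi>) \<le> e * norm \<psi>)"

text \<open>Every point that is no approximate eigenvalue has a ball without mass, and countably many of
  these balls cover the set.\<close>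

lemma spec_measure_null:
  assumes A: "selfadj A" and B: "B \<in> sets borel" and no: "\<And>x. x \<in> B \<Longrightarrow> \<not> approx_eigenvalue A x"
  shows "measure (spec_measure A \<psi>) B = 0"
proof -
  interpret R: resolution A "SOME E. spectral_resolution A E" by (rule spec_resolution[OF A])
  interpret finite_measure "spec_measure A \<psi>" by (rule spec_measure[OF A])
  have sB: "sets (spec_measure A \<psi>) = sets borel" by (rule spec_measure[OF A])
  define F where "F = {ball x e | x e. measure (spec_measure A \<psi>) (ball x e) = 0}"
  have "B \<subseteq> \<Union>F"
  proof
    fix x assume "x \<in> B"
    then obtain e where e: "0 < e" "\<And>\<phi>. \<phi> \<noteq> 0 \<Longrightarrow> e * norm \<phi> < norm (A \<phi> - x *\<^sub>R \<phi>)"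
      using no[of x] by (auto simp: approx_eigenvalue_def not_le)
    from R.isolated_null[OF this, of \<psi>] have "ball x e \<in> F"
      by (auto simp: F_def spec_measure_def)
    then show "x \<in> \<Union>F" using e(1) by (auto intro!: bexI[of _ "ball x e"])
  qed
  moreover obtain F' where F': "F' \<subseteq> F" "countable F'" "\<Union>F' = \<Union>F"
    using Lindelof[of F] by (auto simp: F_def)
  moreover have "\<Union>F' \<in> null_sets (spec_measure A \<psi>)"
  proof -
    have "(\<Union>S\<in>F'. S) \<in> null_sets (spec_measure A \<psi>)"
    proof (rule null_sets_UN')
      fix S assume "S \<in> F'"
      then show "S \<in> null_sets (spec_measure A \<psi>)"
        using F'(1) sB by (auto simp: F_def null_sets_def emeasure_eq_measure)
    qed (rule F')
    then show ?thesis by simp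
  qed
  ultimately have "B \<in> null_sets (spec_measure A \<psi>)"
    using B sB by (metis null_sets_subset)
  then show ?thesis by (simp add: null_sets_def measure_def)
qed

text \<open>If the measure of \<open>\<psi>\<close> gave no mass to the interval, its second moment about \<open>x\<close> would be at
  least \<open>c\<^sup>2\<close> times its total mass.\<close>

lemma approx_eigenvalue_exists:
  assumes A: "selfadj A" and c: "0 \<le> c" and \<psi>: "\<psi> \<noteq> 0" "norm (A \<psi> - x *\<^sub>R \<psi>) < c * norm \<psi>"
  shows "\<exists>y. \<bar>y - x\<bar> \<le> c \<and> approx_eigenvalue A y"
proof (rule ccontr)
  assume "\<not> ?thesis"
  then have "measure (spec_measure A \<psi>) {x-c..x+c} = 0"
    by (intro spec_measure_null[OF A]) (auto simp: abs_le_iff)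
  interpret finite_measure "spec_measure A \<psi>" by (rule spec_measure[OF A])
  have sB[measurable_cong]: "sets (spec_measure A \<psi>) = sets borel" by (rule spec_measure[OF A])
  have "{x-c..x+c} \<in> null_sets (spec_measure A \<psi>)"
    using \<open>measure (spec_measure A \<psi>) {x-c..x+c} = 0\<close> sB by (auto simp: null_sets_def emeasure_eq_measure)
  then have "AE y in spec_measure A \<psi>. y \<notin> {x-c..x+c}" by (rule AE_not_in)
  then have AE: "AE y in spec_measure A \<psi>. c\<^sup>2 \<le> (y - x)\<^sup>2"
    by eventually_elim (use c in \<open>auto intro!: abs_le_square_iff[THEN iffD1]\<close>)
  obtain r where r: "0 < r" "\<And>\<psi>. norm (A \<psi>) \<le> r * norm \<psi>" using selfadj_bound_ex[OF A] by blast
  have int: "integrable (spec_measure A \<psi>) (\<lambda>y. (y - x)\<^sup>2)"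
  proof (rule integrable_const_bound[where B = "(r + \<bar>x\<bar>)\<^sup>2"])
    show "AE y in spec_measure A \<psi>. norm ((y - x)\<^sup>2) \<le> (r + \<bar>x\<bar>)\<^sup>2"
      using spec_measure_support[OF A r, of \<psi>] by eventually_elim (auto intro!: abs_le_square_iff[THEN iffD1])
  qed measurable
  have "c\<^sup>2 * (norm \<psi>)\<^sup>2 = (\<integral>y. c\<^sup>2 \<partial>spec_measure A \<psi>)"
    using spec_measure(3,4)[OF A, of \<psi>] by simp
  also have "\<dots> \<le> (\<integral>y. (y - x)\<^sup>2 \<partial>spec_measure A \<psi>)" using AE int by (intro integral_mono_AE) auto
  also have "\<dots> = (\<integral>y. poly ([:-x, 1:] * [:-x, 1:]) y \<partial>spec_measure A \<psi>)"
    by (simp add: power2_eq_square algebra_simps)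
  also have "\<dots> = inner \<psi> (poly_op A ([:-x, 1:] * [:-x, 1:]) \<psi>)" by (rule spec_measure(5)[OF A])
  also have "\<dots> = (norm (A \<psi> - x *\<^sub>R \<psi>))\<^sup>2"
    unfolding inner_poly_op_mult[OF A, symmetric] using A by (simp add: power2_norm_eq_inner)
  also have "\<dots> < (c * norm \<psi>)\<^sup>2" using \<psi> by (intro power_strict_mono) auto
  finally show False by (simp add: power_mult_distrib)
qed

lemma approx_eigenvalue_in_spectrum:
  assumes "approx_eigenvalue A x"
  shows "complex_of_real x \<in> spectrum A"
proof (rule ccontr)
  assume "complex_of_real x \<notin> spectrum A"
  then obtain R where R: "bounded_operator R" "\<And>\<psi>. R (A \<psi> - scaleC (complex_of_real x) \<psi>) = \<psi>"
    by (auto simp: spectrum_def)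
  obtain K where K: "\<And>\<psi>. norm (R \<psi>) \<le> norm \<psi> * K" "0 < K"
    using bounded_linear.pos_bounded[of R] R(1) by (auto simp: bounded_operator_def)
  obtain \<psi> where \<psi>: "\<psi> \<noteq> 0" "norm (A \<psi> - x *\<^sub>R \<psi>) \<le> 1 / (2 * K) * norm \<psi>"
    using assms K(2) unfolding approx_eigenvalue_def by (metis divide_pos_pos mult_pos_pos zero_less_numeral zero_less_one)
  have "norm \<psi> = norm (R (A \<psi> - x *\<^sub>R \<psi>))" using R(2)[of \<psi>] by (simp add: scaleC_of_real)
  also have "\<dots> \<le> norm (A \<psi> - x *\<^sub>R \<psi>) * K" by (rule K)
  also have "\<dots> \<le> 1 / (2 * K) * norm \<psi> * K" using \<psi> K by (intro mult_right_mono) auto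
  also have "\<dots> = norm \<psi> / 2" using K(2) by simp
  finally show False using \<psi>(1) by simp
qed

section \<open>Jacobi operators with bounded potential\<close>

definition shift_op :: "int \<Rightarrow> ell2 \<Rightarrow> ell2" where
  "shift_op k \<psi> = Abs_ell2 (\<lambda>n. ell2_coord \<psi> (n + k))"

text \<open>Meant for bounded \<open>v\<close>; otherwise the products may fail to be square summable.\<close>

definition mult_op :: "(int \<Rightarrow> real) \<Rightarrow> ell2 \<Rightarrow> ell2" where
  "mult_op v \<psi> = Abs_ell2 (\<lambda>n. of_real (v n) * ell2_coord \<psi> n)"

definition jacobi :: "(int \<Rightarrow> real) \<Rightarrow> ell2 \<Rightarrow> ell2" where
  "jacobi v \<psi> = shift_op 1 \<psi> + shift_op (-1) \<psi> + mult_op v \<psi>"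

definition bounded_pot :: "real \<Rightarrow> (int \<Rightarrow> real) \<Rightarrow> bool" where
  "bounded_pot K v \<longleftrightarrow> (\<forall>n. \<bar>v n\<bar> \<le> K)"

lemma bounded_pot_nonneg: "bounded_pot K v \<Longrightarrow> 0 \<le> K"
  unfolding bounded_pot_def by (meson abs_ge_zero order_trans)

lemma coord_shift [simp]: "ell2_coord (shift_op k \<psi>) n = ell2_coord \<psi> (n + k)"
  unfolding shift_op_def using square_summable_shift[OF summable_coord] by (subst Abs_ell2_inverse) auto

lemma coord_mult:
  assumes "bounded_pot K v"
  shows "ell2_coord (mult_op v \<psi>) n = of_real (v n) * ell2_coord \<psi> n"
proof -
  have "(\<lambda>n. (cmod (complex_of_real (v n) * ell2_coord \<psi> n))\<^sup>2) summable_on UNIV"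
    by (rule square_summable_bounded_mult[OF summable_coord, where K = K]) (use assms in \<open>auto simp: bounded_pot_def\<close>)
  then show ?thesis unfolding mult_op_def by (subst Abs_ell2_inverse) auto
qed

lemma coord_jacobi:
  assumes "bounded_pot K v"
  shows "ell2_coord (jacobi v \<psi>) n = ell2_coord \<psi> (n + 1) + ell2_coord \<psi> (n - 1) + of_real (v n) * ell2_coord \<psi> n"
  by (simp add: jacobi_def coord_mult[OF assms])

lemma inner_shift: "inner (shift_op k \<phi>) \<psi> = inner \<phi> (shift_op (-k) \<psi>)"
proof -
  have b: "bij_betw (\<lambda>n::int. n + k) UNIV UNIV"
    by (rule bij_betw_byWitness[of _ "\<lambda>n. n - k"]) auto
  have "(\<Sum>\<^sub>\<infinity>n. inner (ell2_coord \<phi> (n + k)) (ell2_coord \<psi> ((n + k) - k))) = (\<Sum>\<^sub>\<infinity>n. inner (ell2_coord \<phi> n) (ell2_coord \<psi> (n - k)))"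
    by (rule infsum_reindex_bij_betw[OF b])
  then show ?thesis by (simp add: inner_ell2_eq)
qed

lemma shift_shift [simp]: "shift_op j (shift_op k \<psi>) = shift_op (j + k) \<psi>"
  by (rule ell2_eqI) (simp add: algebra_simps)

lemma shift_0 [simp]: "shift_op 0 \<psi> = \<psi>"
  by (rule ell2_eqI) simp

lemma shift_linear: "shift_op k (\<phi> + \<psi>) = shift_op k \<phi> + shift_op k \<psi>"
  "shift_op k (\<phi> - \<psi>) = shift_op k \<phi> - shift_op k \<psi>" "shift_op k (r *\<^sub>R \<phi>) = r *\<^sub>R shift_op k \<phi>"
  "shift_op k (scaleC c \<phi>) = scaleC c (shift_op k \<phi>)"
  by (rule ell2_eqI, simp)+

lemma norm_shift [simp]: "norm (shift_op k \<psi>) = norm \<psi>"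
  using inner_shift[of k \<psi> "shift_op k \<psi>"] by (simp add: norm_eq_sqrt_inner)

lemma shift_eq_0 [simp]: "shift_op k \<psi> = 0 \<longleftrightarrow> \<psi> = 0"
  using norm_shift[of k \<psi>] by (metis norm_eq_zero)

lemma norm_le_pointwise:
  assumes "\<And>n. cmod (ell2_coord \<phi> n) \<le> K * cmod (ell2_coord \<psi> n)" "0 \<le> K"
  shows "norm \<phi> \<le> K * norm \<psi>"
proof (subst norm_le_iff_finite)
  show "\<forall>F. finite F \<longrightarrow> (\<Sum>n\<in>F. (cmod (ell2_coord \<phi> n))\<^sup>2) \<le> (K * norm \<psi>)\<^sup>2"
  proof (intro allI impI)
    fix F :: "int set" assume F: "finite F"
    have "(\<Sum>n\<in>F. (cmod (ell2_coord \<phi> n))\<^sup>2) \<le> (\<Sum>n\<in>F. K\<^sup>2 * (cmod (ell2_coord \<psi> n))\<^sup>2)"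
      unfolding power_mult_distrib[symmetric] by (intro sum_mono power_mono assms) auto
    also have "\<dots> = K\<^sup>2 * (\<Sum>n\<in>F. (cmod (ell2_coord \<psi> n))\<^sup>2)" by (simp add: sum_distrib_left)
    also have "\<dots> \<le> K\<^sup>2 * (norm \<psi>)\<^sup>2" by (intro mult_left_mono sum_coord_le_norm F) auto
    finally show "(\<Sum>n\<in>F. (cmod (ell2_coord \<phi> n))\<^sup>2) \<le> (K * norm \<psi>)\<^sup>2" by (simp add: power_mult_distrib)
  qed
qed (use assms in auto)

lemma norm_mult_op:
  assumes "bounded_pot K v"
  shows "norm (mult_op v \<psi>) \<le> K * norm \<psi>"
proof (rule norm_le_pointwise)
  show "cmod (ell2_coord (mult_op v \<psi>) n) \<le> K * cmod (ell2_coord \<psi> n)" for n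
    using assms by (auto simp: coord_mult[OF assms] norm_mult bounded_pot_def intro!: mult_right_mono)
  show "0 \<le> K" by (rule bounded_pot_nonneg[OF assms])
qed

lemma norm_jacobi:
  assumes "bounded_pot K v"
  shows "norm (jacobi v \<psi>) \<le> (2 + K) * norm \<psi>"
  using norm_triangle_ineq[of "shift_op 1 \<psi> + shift_op (-1) \<psi>" "mult_op v \<psi>"] norm_mult_op[OF assms, of \<psi>]
    norm_triangle_ineq[of "shift_op 1 \<psi>" "shift_op (-1) \<psi>"]
  by (simp add: jacobi_def distrib_right)

lemma selfadj_jacobi:
  assumes "bounded_pot K v"
  shows "selfadj (jacobi v)"
proof (rule selfadjI[where K = "2 + K"])
  show "linear (jacobi v)"
    by (rule linearI; rule ell2_eqI) (simp_all add: coord_jacobi[OF assms] algebra_simps)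
  show "jacobi v (scaleC c \<psi>) = scaleC c (jacobi v \<psi>)" for c \<psi>
    by (rule ell2_eqI) (simp add: coord_jacobi[OF assms] algebra_simps)
  show "norm (jacobi v \<psi>) \<le> (2 + K) * norm \<psi>" for \<psi> by (rule norm_jacobi[OF assms])
  fix \<phi> \<psi>
  have "inner (mult_op v \<phi>) \<psi> = inner \<phi> (mult_op v \<psi>)"
    unfolding inner_ell2_eq coord_mult[OF assms]
    by (intro infsum_cong) (simp add: inner_complex_def algebra_simps)
  then show "inner (jacobi v \<phi>) \<psi> = inner \<phi> (jacobi v \<psi>)"
    using inner_shift[of 1 \<phi> \<psi>] inner_shift[of "-1" \<phi> \<psi>]
    by (simp add: jacobi_def inner_add_left inner_add_right)
qed

lemma jacobi_shift:
  assumes "bounded_pot K v"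
  shows "jacobi (\<lambda>n. v (n + k)) (shift_op k \<psi>) = shift_op k (jacobi v \<psi>)"
proof (rule ell2_eqI)
  have "bounded_pot K (\<lambda>n. v (n + k))" using assms by (simp add: bounded_pot_def)
  then show "ell2_coord (jacobi (\<lambda>n. v (n + k)) (shift_op k \<psi>)) n = ell2_coord (shift_op k (jacobi v \<psi>)) n" for n
    by (simp add: coord_jacobi[OF assms] coord_jacobi) (simp add: algebra_simps)
qed

lemma approx_eigenvalue_shift:
  assumes K: "bounded_pot K v" and a: "approx_eigenvalue (jacobi v) x"
  shows "approx_eigenvalue (jacobi (\<lambda>n. v (n + k))) x"
  unfolding approx_eigenvalue_def
proof (intro allI impI)
  fix e :: real assume "0 < e"
  then obtain \<psi> where \<psi>: "\<psi> \<noteq> 0" "norm (jacobi v \<psi> - x *\<^sub>R \<psi>) \<le> e * norm \<psi>"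
    using a by (auto simp: approx_eigenvalue_def)
  have "jacobi (\<lambda>n. v (n + k)) (shift_op k \<psi>) - x *\<^sub>R shift_op k \<psi> = shift_op k (jacobi v \<psi> - x *\<^sub>R \<psi>)"
    by (simp add: jacobi_shift[OF K] shift_linear)
  then have "norm (jacobi (\<lambda>n. v (n + k)) (shift_op k \<psi>) - x *\<^sub>R shift_op k \<psi>) \<le> e * norm (shift_op k \<psi>)"
    using \<psi> by simp
  then show "\<exists>\<psi>. \<psi> \<noteq> 0 \<and> norm (jacobi (\<lambda>n. v (n + k)) \<psi> - x *\<^sub>R \<psi>) \<le> e * norm \<psi>"
    using \<psi>(1) by (metis shift_eq_0)
qed

lemma jacobi_add_const:
  assumes "bounded_pot K v"
  shows "jacobi (\<lambda>n. v n + c) \<psi> = jacobi v \<psi> + c *\<^sub>R \<psi>"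
proof (rule ell2_eqI)
  have "bounded_pot (K + \<bar>c\<bar>) (\<lambda>n. v n + c)"
    using assms unfolding bounded_pot_def by (metis abs_triangle_ineq add_right_mono order_trans)
  then show "ell2_coord (jacobi (\<lambda>n. v n + c) \<psi>) n = ell2_coord (jacobi v \<psi> + c *\<^sub>R \<psi>) n" for n
    by (simp add: coord_jacobi[OF assms] coord_jacobi algebra_simps)
qed

lemma approx_eigenvalue_add_const:
  assumes "bounded_pot K v" "approx_eigenvalue (jacobi v) x"
  shows "approx_eigenvalue (jacobi (\<lambda>n. v n + c)) (x + c)"
  using assms(2) by (simp add: approx_eigenvalue_def jacobi_add_const[OF assms(1)] scaleR_add_left)

text \<open>A coordinate of \<open>p(A) \<psi>\<close> for a Jacobi operator \<open>A\<close> involves finitely many values of the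
  potential only, so pointwise convergence is enough.\<close>

lemma poly_op_coord_tendsto:
  assumes v: "\<And>i. bounded_pot (K i) (v i)" "bounded_pot K' v'" and lim: "\<And>m. ((\<lambda>i. v i m) \<longlongrightarrow> v' m) F"
  shows "((\<lambda>i. ell2_coord (poly_op (jacobi (v i)) p \<psi>) n) \<longlongrightarrow> ell2_coord (poly_op (jacobi v') p \<psi>) n) F"
proof (induction p arbitrary: n)
  case 0 then show ?case by simp
next
  case (pCons a p)
  show ?case
    unfolding poly_op_pCons[OF selfadj_jacobi[OF v(1)]] poly_op_pCons[OF selfadj_jacobi[OF v(2)]]
      coord_add coord_jacobi[OF v(1)] coord_jacobi[OF v(2)]
    by (intro tendsto_intros lim pCons)
qed

lemma inner_delta: "inner (delta k) \<psi> = Re (ell2_coord \<psi> k)"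
proof -
  have "inner (delta k) \<psi> = (\<Sum>\<^sub>\<infinity>n\<in>{k}. Re (ell2_coord \<psi> n))"
    unfolding inner_ell2_eq by (rule infsum_cong_neutral) (auto simp: inner_complex_def)
  then show ?thesis by simp
qed

lemma poly_integral_tendsto:
  assumes v: "\<And>i. bounded_pot (K i) (v i)" "bounded_pot K' v'" and lim: "\<And>m. ((\<lambda>i. v i m) \<longlongrightarrow> v' m) F"
  shows "((\<lambda>i. \<integral>x. poly p x \<partial>spec_measure (jacobi (v i)) (delta 0)) \<longlongrightarrow>
     (\<integral>x. poly p x \<partial>spec_measure (jacobi v') (delta 0))) F"
  unfolding spec_measure(5)[OF selfadj_jacobi[OF v(1)]] spec_measure(5)[OF selfadj_jacobi[OF v(2)]] inner_delta
  by (intro tendsto_intros poly_op_coord_tendsto[OF v lim])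

lemma spec_prob_space: "selfadj A \<Longrightarrow> prob_space (spec_measure A (delta k))"
  using spec_measure[of A "delta k"] by (intro prob_spaceI) (simp add: finite_measure.emeasure_eq_measure)

text \<open>A common bound on the potentials confines all measures to one compact interval, on which
  polynomials approximate \<open>b\<close> uniformly.\<close>

lemma spec_measure_weakly_continuous:
  fixes b :: "real \<Rightarrow> real"
  assumes v: "\<And>i. bounded_pot K (v i)" "bounded_pot K v'" and lim: "\<And>m. ((\<lambda>i. v i m) \<longlongrightarrow> v' m) F"
    and b: "continuous_on UNIV b" "\<And>x. \<bar>b x\<bar> \<le> C"
  shows "((\<lambda>i. \<integral>x. b x \<partial>spec_measure (jacobi (v i)) (delta 0)) \<longlongrightarrow> (\<integral>x. b x \<partial>spec_measure (jacobi v') (delta 0))) F"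
proof (rule tendstoI)
  fix e :: real assume e: "0 < e"
  have K0: "0 < 2 + K" using bounded_pot_nonneg[OF v(2)] by simp
  have [measurable]: "b \<in> borel_measurable borel" using b(1) by (rule borel_measurable_continuous_onI)
  obtain p where p: "\<And>y. y \<in> {-(2+K)..2+K} \<Longrightarrow> \<bar>b y - poly p y\<bar> < e / 3"
    using continuous_poly_approx[OF continuous_on_subset[OF b(1) subset_UNIV], of "e / 3" "2 + K"] e
    by (metis divide_pos_pos zero_less_numeral)
  have close: "\<bar>(\<integral>x. b x \<partial>spec_measure (jacobi w) (delta 0)) - (\<integral>x. poly p x \<partial>spec_measure (jacobi w) (delta 0))\<bar> \<le> e / 3"
    if w: "bounded_pot K w" for w
  proof -
    note sw = selfadj_jacobi[OF w]
    interpret prob_space "spec_measure (jacobi w) (delta 0)" by (rule spec_prob_space[OF sw])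
    note [measurable_cong] = spec_measure(2)[OF sw]
    have AE: "AE x in spec_measure (jacobi w) (delta 0). x \<in> {-(2+K)..2+K}"
      by (rule spec_measure_support[OF sw K0 norm_jacobi[OF w]])
    have d: "AE x in spec_measure (jacobi w) (delta 0). \<bar>b x - poly p x\<bar> \<le> e / 3"
      using AE by eventually_elim (use p in \<open>auto intro: less_imp_le\<close>)
    have ib: "integrable (spec_measure (jacobi w) (delta 0)) b"
      by (rule integrable_const_bound[where B = C]) (use b in auto)
    have ip: "integrable (spec_measure (jacobi w) (delta 0)) (poly p)"
    proof (rule integrable_const_bound[where B = "C + e / 3"])
      show "AE x in spec_measure (jacobi w) (delta 0). norm (poly p x) \<le> C + e / 3"
        using d
      proof eventually_elim
        case (elim x) then show ?case using b(2)[of x] unfolding real_norm_def by linarith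
      qed
    qed auto
    have "\<bar>(\<integral>x. b x \<partial>spec_measure (jacobi w) (delta 0)) - (\<integral>x. poly p x \<partial>spec_measure (jacobi w) (delta 0))\<bar>
      = norm (\<integral>x. b x - poly p x \<partial>spec_measure (jacobi w) (delta 0))" using ib ip by simp
    also have "\<dots> \<le> (\<integral>x. norm (b x - poly p x) \<partial>spec_measure (jacobi w) (delta 0))" by (rule integral_norm_bound)
    also have "\<dots> \<le> (\<integral>x. e / 3 \<partial>spec_measure (jacobi w) (delta 0))"
      using d ib ip by (intro integral_mono_AE) auto
    finally show ?thesis by (simp add: prob_space)
  qed
  have "\<forall>\<^sub>F i in F. dist (\<integral>x. poly p x \<partial>spec_measure (jacobi (v i)) (delta 0)) (\<integral>x. poly p x \<partial>spec_measure (jacobi v') (delta 0)) < e / 3"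
    using poly_integral_tendsto[OF v lim, of p] e by (intro tendstoD) auto
  then show "\<forall>\<^sub>F i in F. dist (\<integral>x. b x \<partial>spec_measure (jacobi (v i)) (delta 0)) (\<integral>x. b x \<partial>spec_measure (jacobi v') (delta 0)) < e"
  proof eventually_elim
    case (elim i)
    then show ?case using close[OF v(1)[of i]] close[OF v(2)] unfolding dist_real_def by linarith
  qed
qed


section \<open>The density of states measure\<close>

definition pot :: "circle \<Rightarrow> (circle \<Rightarrow>\<^sub>C real) \<Rightarrow> circle \<Rightarrow> int \<Rightarrow> real" where
  "pot \<alpha> f \<omega> n = f (\<omega> + zmult n \<alpha>)"

lemma bounded_pot_pot: "bounded_pot (norm f) (pot \<alpha> f \<omega>)"
  using norm_bounded[of f] by (simp add: bounded_pot_def pot_def)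

lemma schroedinger_jacobi: "schroedinger \<alpha> f \<omega> = jacobi (pot \<alpha> f \<omega>)"
  by (rule ext, rule ell2_eqI) (simp add: ell2_coord_schroedinger coord_jacobi[OF bounded_pot_pot] pot_def)

lemma selfadj_schroedinger: "selfadj (schroedinger \<alpha> f \<omega>)"
  unfolding schroedinger_jacobi by (rule selfadj_jacobi[OF bounded_pot_pot])

lemma to_circle_add: "to_circle x + to_circle y = to_circle (x + y)"
  by (simp add: plus_circle.abs_eq)

lemma zmult_to_circle: "zmult n (to_circle x) = to_circle (of_int n * x)"
  by (simp add: zmult.abs_eq)

lemma to_circle_eq_iff: "to_circle x = to_circle y \<longleftrightarrow> x - y \<in> \<int>"
  by (simp add: circle.abs_eq_iff)

lemma to_circle_surj: obtains x where "c = to_circle x" "x \<in> {0..<1}"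
proof -
  define x where "x = rep_circle c"
  have "to_circle (frac x) = to_circle x"
    by (simp add: to_circle_eq_iff frac_def)
  also have "\<dots> = c" using Quotient_abs_rep[OF Quotient_circle] by (simp add: x_def)
  finally show ?thesis using that[of "frac x"] frac_ge_0[of x] frac_lt_1[of x] by auto
qed

lemma continuous_on_add_circle: "continuous_on UNIV (\<lambda>\<omega>::circle. \<omega> + c)"
proof -
  have "open ((\<lambda>\<omega>. \<omega> + c) -` U)" if U: "open U" for U
  proof -
    obtain y where y: "c = to_circle y" using to_circle_surj by blast
    have "to_circle -` ((\<lambda>\<omega>. \<omega> + c) -` U) = (\<lambda>x. x + y) -` (to_circle -` U)"
      by (auto simp: y to_circle_add)
    moreover have "open ((\<lambda>x. x + y) -` (to_circle -` U))"
      by (rule open_vimage) (use U in \<open>auto simp: open_circle_def intro!: continuous_intros\<close>)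
    ultimately show ?thesis by (simp add: open_circle_def)
  qed
  then show ?thesis by (simp add: continuous_on_open_vimage)
qed

lemma continuous_on_bcontfun: "continuous_on UNIV (apply_bcontfun f)"
  using apply_bcontfun[of f] by (simp add: bcontfun_def)

lemma continuous_on_pot: "continuous_on UNIV (\<lambda>\<omega>. pot \<alpha> f \<omega> n)"
  unfolding pot_def
  by (rule continuous_on_compose2[OF continuous_on_bcontfun continuous_on_add_circle]) auto

lemma sets_haar [simp, measurable_cong]: "sets haar_circle = sets borel"
  by (simp add: haar_circle_def)

lemma space_haar [simp]: "space haar_circle = UNIV"
  by (simp add: haar_circle_def)

lemma to_circle_measurable [measurable]: "to_circle \<in> borel_measurable borel"
  by (rule borel_measurable_continuous_onI[OF continuous_to_circle])

lemma to_circle_measurable_restrict: "to_circle \<in> restrict_space lborel {0..<1} \<rightarrow>\<^sub>M borel"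
  by (rule measurable_restrict_space1) simp

lemma prob_space_haar: "prob_space haar_circle"
  unfolding haar_circle_def
  by (rule prob_space.prob_space_distr[OF _ to_circle_measurable_restrict], rule prob_spaceI)
    (simp add: space_restrict_space emeasure_restrict_space)

lemma measure_haar:
  assumes "S \<in> sets borel"
  shows "measure haar_circle S = measure lborel (to_circle -` S \<inter> {0..<1})"
proof -
  have m: "to_circle -` S \<in> sets borel" using measurable_sets[OF to_circle_measurable assms] by simp
  have "measure haar_circle S = measure (restrict_space lborel {0..<1}) (to_circle -` S \<inter> {0..<1})"
    unfolding haar_circle_def
    by (subst measure_distr[OF to_circle_measurable_restrict assms]) (simp add: space_restrict_space)
  then show ?thesis using m by (simp add: measure_restrict_space)
qed

definition phase_measure :: "circle \<Rightarrow> (circle \<Rightarrow>\<^sub>C real) \<Rightarrow> circle \<Rightarrow> real measure" where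
  "phase_measure \<alpha> f \<omega> = spec_measure (schroedinger \<alpha> f \<omega>) (delta 0)"

lemma phase_measure: "prob_space (phase_measure \<alpha> f \<omega>)" "sets (phase_measure \<alpha> f \<omega>) = sets borel"
  unfolding phase_measure_def
  by (rule spec_prob_space[OF selfadj_schroedinger], rule spec_measure(2)[OF selfadj_schroedinger])

lemma phase_integral_le:
  fixes g :: "real \<Rightarrow> real"
  assumes g: "g \<in> borel_measurable borel" "\<And>x. \<bar>g x\<bar> \<le> C"
  shows "norm (\<integral>x. g x \<partial>phase_measure \<alpha> f \<omega>) \<le> C"
proof -
  interpret prob_space "phase_measure \<alpha> f \<omega>" by (rule phase_measure)
  note [measurable_cong] = phase_measure(2)
  have "norm (\<integral>x. g x \<partial>phase_measure \<alpha> f \<omega>) \<le> (\<integral>x. norm (g x) \<partial>phase_measure \<alpha> f \<omega>)"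
    by (rule integral_norm_bound)
  also have "\<dots> \<le> (\<integral>x. C \<partial>phase_measure \<alpha> f \<omega>)"
    using g order_trans[OF abs_ge_zero g(2)[of 0]]
    by (intro integral_mono integrable_const_bound[where B = C]) auto
  finally show ?thesis by (simp add: prob_space)
qed

text \<open>Polynomial integrals depend continuously on the phase, and masses of half-lines are limits
  of polynomial integrals.\<close>

lemma phase_measure_measurable: "phase_measure \<alpha> f \<in> haar_circle \<rightarrow>\<^sub>M prob_algebra borel"
proof (rule measurable_prob_algebra_generated)
  define G where "G = range (\<lambda>a::real. {a<..})"
  show "sets (borel :: real measure) = sigma_sets UNIV G" "Int_stable G"
    unfolding G_def by (rule borel_halflines)+
  show "G \<subseteq> Pow UNIV" by simp
  show "prob_space (phase_measure \<alpha> f \<omega>)" "sets (phase_measure \<alpha> f \<omega>) = sets borel" for \<omega>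
    by (rule phase_measure)+
  fix S assume "S \<in> G"
  then obtain x where S: "S = {x<..}" by (auto simp: G_def)
  define r where "r = 2 + norm f"
  have r: "0 < r" by (simp add: r_def add_pos_nonneg)
  obtain p where p: "halfline_polys r x p" using halfline_polys_exist by blast
  have cont: "continuous_on UNIV (\<lambda>\<omega>. \<integral>y. poly (p n) y \<partial>phase_measure \<alpha> f \<omega>)" for n
    unfolding continuous_on_def phase_measure_def schroedinger_jacobi
  proof
    fix \<omega> :: circle
    show "((\<lambda>\<omega>. \<integral>y. poly (p n) y \<partial>spec_measure (jacobi (pot \<alpha> f \<omega>)) (delta 0)) \<longlongrightarrow>
       (\<integral>y. poly (p n) y \<partial>spec_measure (jacobi (pot \<alpha> f \<omega>)) (delta 0))) (at \<omega> within UNIV)"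
      by (rule poly_integral_tendsto[OF bounded_pot_pot bounded_pot_pot])
        (use continuous_on_pot in \<open>auto simp: continuous_on_def\<close>)
  qed
  have "(\<lambda>\<omega>. measure (phase_measure \<alpha> f \<omega>) {x<..}) \<in> borel_measurable borel"
  proof (rule borel_measurable_LIMSEQ_real)
    fix \<omega>
    show "(\<lambda>n. \<integral>y. poly (p n) y \<partial>phase_measure \<alpha> f \<omega>) \<longlonglongrightarrow> measure (phase_measure \<alpha> f \<omega>) {x<..}"
    proof (rule halfline_polys_integral(1)[OF _ phase_measure(2) _ p])
      show "finite_measure (phase_measure \<alpha> f \<omega>)"
        using phase_measure(1) by (simp add: prob_space_def)
      show "AE y in phase_measure \<alpha> f \<omega>. y \<in> {-r..r}"
        unfolding phase_measure_def schroedinger_jacobi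
        by (rule spec_measure_support[OF selfadj_jacobi[OF bounded_pot_pot] r])
          (unfold r_def, rule norm_jacobi[OF bounded_pot_pot])
    qed
  next
    show "(\<lambda>\<omega>. \<integral>y. poly (p n) y \<partial>phase_measure \<alpha> f \<omega>) \<in> borel_measurable borel" for n
      by (rule borel_measurable_continuous_onI[OF cont])
  qed
  moreover have "emeasure (phase_measure \<alpha> f \<omega>) S = ennreal (measure (phase_measure \<alpha> f \<omega>) {x<..})" for \<omega>
    using phase_measure(1) by (simp add: S prob_space_def finite_measure.emeasure_eq_measure)
  ultimately show "(\<lambda>\<omega>. emeasure (phase_measure \<alpha> f \<omega>) S) \<in> borel_measurable haar_circle"
    by simp
qed

lemma phase_measure_measurable_sub: "phase_measure \<alpha> f \<in> haar_circle \<rightarrow>\<^sub>M subprob_algebra borel"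
  using phase_measure_measurable by (rule measurable_prob_algebraD)

lemma integral_bind_phase:
  fixes g :: "real \<Rightarrow> real"
  assumes g: "g \<in> borel_measurable borel" "\<And>x. \<bar>g x\<bar> \<le> C"
  shows "(\<integral>x. g x \<partial>(haar_circle \<bind> phase_measure \<alpha> f)) = (\<integral>\<omega>. (\<integral>x. g x \<partial>phase_measure \<alpha> f \<omega>) \<partial>haar_circle)"
    "integrable haar_circle (\<lambda>\<omega>. \<integral>x. g x \<partial>phase_measure \<alpha> f \<omega>)"
proof -
  interpret H: prob_space haar_circle by (rule prob_space_haar)
  have le1: "emeasure (phase_measure \<alpha> f \<omega>) (space (phase_measure \<alpha> f \<omega>)) \<le> ennreal 1" for \<omega>
    using prob_space.emeasure_space_1[OF phase_measure(1)] by simp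
  show "(\<integral>x. g x \<partial>(haar_circle \<bind> phase_measure \<alpha> f)) = (\<integral>\<omega>. (\<integral>x. g x \<partial>phase_measure \<alpha> f \<omega>) \<partial>haar_circle)"
    by (rule integral_bind[where K = borel and B = C and B' = 1])
      (use g phase_measure_measurable_sub le1 H.finite_measure_axioms in auto)
  show "integrable haar_circle (\<lambda>\<omega>. \<integral>x. g x \<partial>phase_measure \<alpha> f \<omega>)"
  proof (rule H.integrable_const_bound[where B = C])
    show "(\<lambda>\<omega>. \<integral>x. g x \<partial>phase_measure \<alpha> f \<omega>) \<in> borel_measurable haar_circle"
      using measurable_compose[OF phase_measure_measurable_sub integral_measurable_subprob_algebra[OF g(1)]] .
  qed (rule AE_I2, rule phase_integral_le[OF g])
qed

text \<open>The average of the spectral measures has the defining property of the density of states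
  measure, and indicator functions show that nothing else has it.\<close>

lemma dos_measure_bind: "dos_measure \<alpha> f = haar_circle \<bind> phase_measure \<alpha> f"
proof -
  define M where "M = haar_circle \<bind> phase_measure \<alpha> f"
  have sM[measurable_cong]: "sets M = sets borel"
    unfolding M_def by (rule sets_bind[OF sets_kernel[OF phase_measure_measurable_sub]]) auto
  have pM: "prob_space M" unfolding M_def
    by (rule prob_space_bind'[OF _ phase_measure_measurable])
      (use prob_space_haar in \<open>simp add: space_prob_algebra\<close>)
  interpret M: prob_space M by fact
  have calc: "cinner (delta 0) (borel_calculus (schroedinger \<alpha> f \<omega>) g (delta 0)) = (\<integral>x. g x \<partial>phase_measure \<alpha> f \<omega>)"
    if "g \<in> borel_measurable borel" "bounded (range g)" for g \<omega>
    unfolding phase_measure_def by (rule borel_calculus_form[OF selfadj_schroedinger that])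
  have int: "(\<integral>x. g x \<partial>M) = (\<integral>\<omega>. cinner (delta 0) (borel_calculus (schroedinger \<alpha> f \<omega>) g (delta 0)) \<partial>haar_circle)"
    if g: "g \<in> borel_measurable borel" "bounded (range g)" for g :: "real \<Rightarrow> complex"
  proof -
    obtain C where C: "\<And>x. cmod (g x) \<le> C" using g(2) by (auto simp: bounded_iff)
    have Re: "\<bar>Re (g x)\<bar> \<le> C" and Im: "\<bar>Im (g x)\<bar> \<le> C" for x
      using order_trans[OF abs_Re_le_cmod C] order_trans[OF abs_Im_le_cmod C] by auto
    have m[measurable]: "g \<in> borel_measurable borel" by fact
    have gi: "integrable N g" if "prob_space N" "sets N = sets borel" for N
      using that C by (intro finite_measure.integrable_const_bound[where B = C])
        (auto simp: prob_space_def measurable_cong_sets[OF that(2) refl])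
    have split: "(\<integral>x. g x \<partial>phase_measure \<alpha> f \<omega>) = complex_of_real (\<integral>x. Re (g x) \<partial>phase_measure \<alpha> f \<omega>) + \<i> * complex_of_real (\<integral>x. Im (g x) \<partial>phase_measure \<alpha> f \<omega>)" for \<omega>
      using gi[OF phase_measure] by (simp add: complex_eq_iff)
    note iR = integral_bind_phase[of "\<lambda>x. Re (g x)" C \<alpha> f, folded M_def]
    note iI = integral_bind_phase[of "\<lambda>x. Im (g x)" C \<alpha> f, folded M_def]
    have "(\<integral>x. g x \<partial>M) = complex_of_real (\<integral>x. Re (g x) \<partial>M) + \<i> * complex_of_real (\<integral>x. Im (g x) \<partial>M)"
      using gi[OF pM sM] by (simp add: complex_eq_iff)
    also have "\<dots> = (\<integral>\<omega>. (\<integral>x. g x \<partial>phase_measure \<alpha> f \<omega>) \<partial>haar_circle)"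
      unfolding split using iR iI Re Im by simp
    finally show ?thesis using calc[OF g] by simp
  qed
  show ?thesis
    unfolding dos_measure_def M_def[symmetric]
  proof (rule the_equality)
    show "prob_space M \<and> sets M = sets borel \<and>
     (\<forall>g::real \<Rightarrow> complex. g \<in> borel_measurable borel \<longrightarrow> bounded (range g) \<longrightarrow>
        (\<integral>x. g x \<partial>M) = (\<integral>\<omega>. cinner (delta 0) (borel_calculus (schroedinger \<alpha> f \<omega>) g (delta 0)) \<partial>haar_circle))"
      using pM sM int by blast
    fix N assume N: "prob_space N \<and> sets N = sets borel \<and>
     (\<forall>g::real \<Rightarrow> complex. g \<in> borel_measurable borel \<longrightarrow> bounded (range g) \<longrightarrow>
        (\<integral>x. g x \<partial>N) = (\<integral>\<omega>. cinner (delta 0) (borel_calculus (schroedinger \<alpha> f \<omega>) g (delta 0)) \<partial>haar_circle))"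
    then interpret N: prob_space N by simp
    have sN: "sets N = sets borel" using N by simp
    have "emeasure N B = emeasure M B" if B: "B \<in> sets borel" for B
    proof -
      have g: "(indicator B :: real \<Rightarrow> complex) \<in> borel_measurable borel" "bounded (range (indicator B :: real \<Rightarrow> complex))"
        using B by (auto simp: bounded_iff indicator_def intro!: exI[of _ 1])
      have "(\<integral>x. indicator B x \<partial>N) = (\<integral>x. (indicator B x :: complex) \<partial>M)"
        using N int[OF g] g by simp
      moreover have "(indicator B :: real \<Rightarrow> complex) = (\<lambda>x. complex_of_real (indicator B x))"
        by (auto simp: indicator_def)
      ultimately have "complex_of_real (\<integral>x. indicator B x \<partial>N) = complex_of_real (\<integral>x. indicator B x \<partial>M)"
        by (simp only: integral_complex_of_real)
      then have "measure N B = measure M B"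
        using B sN sM sets_eq_imp_space_eq[OF sN] sets_eq_imp_space_eq[OF sM] by simp
      then show ?thesis by (simp add: N.emeasure_eq_measure M.emeasure_eq_measure)
    qed
    then show "N = M" using sN sM by (intro measure_eqI) auto
  qed
qed

lemma dos_measure: "prob_space (dos_measure \<alpha> f)" "sets (dos_measure \<alpha> f) = sets borel"
proof -
  show "prob_space (dos_measure \<alpha> f)" unfolding dos_measure_bind
    by (rule prob_space_bind'[OF _ phase_measure_measurable])
      (use prob_space_haar in \<open>simp add: space_prob_algebra\<close>)
  show "sets (dos_measure \<alpha> f) = sets borel"
    unfolding dos_measure_bind by (rule sets_bind[OF sets_kernel[OF phase_measure_measurable_sub]]) auto
qed

lemmas dos_integral = integral_bind_phase[folded dos_measure_bind]

lemma dos_measure_ge: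
  assumes B: "B \<in> sets borel" and G: "G \<in> sets borel" "\<And>\<omega>. \<omega> \<in> G \<Longrightarrow> measure (phase_measure \<alpha> f \<omega>) B = 1"
  shows "measure haar_circle G \<le> measure (dos_measure \<alpha> f) B"
proof -
  interpret H: prob_space haar_circle by (rule prob_space_haar)
  interpret D: prob_space "dos_measure \<alpha> f" by (rule dos_measure)
  have sp: "space (dos_measure \<alpha> f) = UNIV" "space (phase_measure \<alpha> f \<omega>) = UNIV" for \<omega>
    using sets_eq_imp_space_eq[OF dos_measure(2)] sets_eq_imp_space_eq[OF phase_measure(2)] by auto
  have ib: "(indicator B :: real \<Rightarrow> real) \<in> borel_measurable borel" "\<bar>indicator B x :: real\<bar> \<le> 1" for x
    using B by (auto simp: indicator_def)
  have m: "(\<integral>x. indicator B x \<partial>phase_measure \<alpha> f \<omega>) = measure (phase_measure \<alpha> f \<omega>) B" for \<omega>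
    using B by (simp add: phase_measure(2) sp)
  have "measure haar_circle G = (\<integral>\<omega>. indicator G \<omega> \<partial>haar_circle)" using G by simp
  also have "\<dots> \<le> (\<integral>\<omega>. measure (phase_measure \<alpha> f \<omega>) B \<partial>haar_circle)"
  proof (rule integral_mono)
    show "integrable haar_circle (indicat_real G)"
      using G(1) by (intro integrable_real_indicator) (auto simp: less_top[symmetric])
    show "integrable haar_circle (\<lambda>\<omega>. measure (phase_measure \<alpha> f \<omega>) B)"
      using dos_integral(2)[OF ib, of \<alpha> f] by (simp only: m)
  qed (use G(2) in \<open>auto simp: indicator_def\<close>)
  also have "\<dots> = (\<integral>x. indicator B x \<partial>dos_measure \<alpha> f)"
    using dos_integral(1)[OF ib, of \<alpha> f] by (simp only: m)
  also have "\<dots> = measure (dos_measure \<alpha> f) B" using B by (simp add: dos_measure(2) sp)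
  finally show ?thesis .
qed

lemma bcontfun_eval_tendsto:
  fixes f :: "nat \<Rightarrow> circle \<Rightarrow>\<^sub>C real"
  assumes f: "f \<longlonglongrightarrow> g" and x: "x \<longlonglongrightarrow> (y :: real)"
  shows "(\<lambda>n. apply_bcontfun (f n) (to_circle (x n))) \<longlonglongrightarrow> apply_bcontfun g (to_circle y)"
proof -
  have "continuous_on UNIV (\<lambda>x. apply_bcontfun g (to_circle x))"
    by (rule continuous_on_compose2[OF continuous_on_bcontfun continuous_to_circle]) auto
  then have "(\<lambda>n. apply_bcontfun g (to_circle (x n))) \<longlonglongrightarrow> apply_bcontfun g (to_circle y)"
    by (rule continuous_on_tendsto_compose[OF _ x]) auto
  moreover have "(\<lambda>n. apply_bcontfun (f n) (to_circle (x n)) - apply_bcontfun g (to_circle (x n))) \<longlonglongrightarrow> 0"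
  proof (rule Lim_null_comparison)
    have "norm (apply_bcontfun (f n) z - apply_bcontfun g z) \<le> dist (f n) g" for n z
      using dist_bounded[of "f n" z g] by (simp only: dist_norm)
    then show "\<forall>\<^sub>F n in sequentially. norm (apply_bcontfun (f n) (to_circle (x n)) - apply_bcontfun g (to_circle (x n))) \<le> dist (f n) g"
      by (intro always_eventually allI)
    show "(\<lambda>n. dist (f n) g) \<longlonglongrightarrow> 0" by (rule tendsto_dist_iff[THEN iffD1, OF f])
  qed
  ultimately show ?thesis by (rule Lim_transform)
qed

text \<open>For every phase the potentials converge pointwise, and dominated convergence applies to the
  average over the phase. The frequency is represented by a real number, so that convergence in
  the circle need not be unfolded.\<close>

lemma dos_weakly_continuous:
  fixes b :: "real \<Rightarrow> real"
  assumes a: "a \<longlonglongrightarrow> (a' :: real)" and f: "f \<longlonglongrightarrow> f'" and b: "continuous_on UNIV b" "\<And>x. \<bar>b x\<bar> \<le> C"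
  shows "(\<lambda>n. \<integral>x. b x \<partial>dos_measure (to_circle (a n)) (f n)) \<longlonglongrightarrow> (\<integral>x. b x \<partial>dos_measure (to_circle a') f')"
proof -
  interpret H: prob_space haar_circle by (rule prob_space_haar)
  have bm[measurable]: "b \<in> borel_measurable borel" using b(1) by (rule borel_measurable_continuous_onI)
  obtain K where K: "\<And>n. norm (f n) \<le> K"
    using convergent_imp_Bseq[of f] f by (auto simp: convergent_def Bseq_def)
  have K': "norm f' \<le> K"
    by (rule LIMSEQ_le_const2[OF tendsto_norm[OF f]]) (use K in auto)
  have bp: "bounded_pot K (pot \<alpha> h \<omega>)" if "norm h \<le> K" for \<alpha> h \<omega>
    using bounded_pot_pot[of h \<alpha> \<omega>] that by (auto simp: bounded_pot_def intro: order_trans)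
  have "(\<lambda>n. \<integral>\<omega>. (\<integral>x. b x \<partial>phase_measure (to_circle (a n)) (f n) \<omega>) \<partial>haar_circle)
     \<longlonglongrightarrow> (\<integral>\<omega>. (\<integral>x. b x \<partial>phase_measure (to_circle a') f' \<omega>) \<partial>haar_circle)"
  proof (rule integral_dominated_convergence[where w = "\<lambda>_. C"])
    show "(\<lambda>\<omega>. \<integral>x. b x \<partial>phase_measure (to_circle (a n)) (f n) \<omega>) \<in> borel_measurable haar_circle"
      "(\<lambda>\<omega>. \<integral>x. b x \<partial>phase_measure (to_circle a') f' \<omega>) \<in> borel_measurable haar_circle" for n
      using integral_bind_phase(2)[OF bm b(2)] by (auto dest: borel_measurable_integrable)
    show "AE \<omega> in haar_circle. norm (\<integral>x. b x \<partial>phase_measure (to_circle (a n)) (f n) \<omega>) \<le> C" for n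
      by (rule AE_I2) (rule phase_integral_le[OF bm b(2)])
    show "AE \<omega> in haar_circle. (\<lambda>n. \<integral>x. b x \<partial>phase_measure (to_circle (a n)) (f n) \<omega>) \<longlonglongrightarrow> (\<integral>x. b x \<partial>phase_measure (to_circle a') f' \<omega>)"
    proof (rule AE_I2)
      fix \<omega>
      show "(\<lambda>n. \<integral>x. b x \<partial>phase_measure (to_circle (a n)) (f n) \<omega>) \<longlonglongrightarrow> (\<integral>x. b x \<partial>phase_measure (to_circle a') f' \<omega>)"
        unfolding phase_measure_def schroedinger_jacobi
      proof (rule spec_measure_weakly_continuous[OF _ _ _ b])
        fix m
        obtain y where y: "\<omega> = to_circle y" using to_circle_surj by blast
        show "(\<lambda>n. pot (to_circle (a n)) (f n) \<omega> m) \<longlonglongrightarrow> pot (to_circle a') f' \<omega> m"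
          unfolding pot_def y zmult_to_circle to_circle_add
          by (intro bcontfun_eval_tendsto f tendsto_intros a)
      qed (use bp K K' in auto)
    qed
  qed auto
  then show ?thesis using dos_integral(1)[OF bm b(2)] by simp
qed

section \<open>Transfer matrices and spectral barriers\<close>

definition step_matrix :: "real \<Rightarrow> real^2^2" where
  "step_matrix x = vector [vector [x, -1], vector [1, 0]]"

text \<open>For a solution of the eigenvalue equation this matrix maps the pair of the values at \<open>n\<close> and
  \<open>n - 1\<close> to the pair of the values at \<open>n + j\<close> and \<open>n + j - 1\<close>.\<close>

primrec transfer :: "(int \<Rightarrow> real) \<Rightarrow> real \<Rightarrow> int \<Rightarrow> nat \<Rightarrow> real^2^2" where
  "transfer v E n 0 = mat 1"
| "transfer v E n (Suc j) = step_matrix (E - v (n + int j)) ** transfer v E n j"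

text \<open>For an \<open>l\<close>-periodic potential this is the discriminant of Floquet theory: the energies where
  it exceeds two in absolute value, called hyperbolic, are those outside the spectrum.\<close>

definition discriminant :: "(int \<Rightarrow> real) \<Rightarrow> real \<Rightarrow> int \<Rightarrow> nat \<Rightarrow> real" where
  "discriminant v E n l = transfer v E n l $ 1 $ 1 + transfer v E n l $ 2 $ 2"

definition periodic :: "nat \<Rightarrow> (int \<Rightarrow> real) \<Rightarrow> bool" where
  "periodic l v \<longleftrightarrow> (\<forall>n. v (n + int l) = v n)"

lemma matrix_mult_2: "((A :: real^2^2) ** B) $ i $ j = A $ i $ 1 * B $ 1 $ j + A $ i $ 2 * B $ 2 $ j"
  by (simp add: matrix_matrix_mult_def sum_2)

lemma step_matrix_nth [simp]:
  "step_matrix x $ 1 $ 1 = x" "step_matrix x $ 1 $ 2 = -1" "step_matrix x $ 2 $ 1 = 1" "step_matrix x $ 2 $ 2 = 0"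
  by (simp_all add: step_matrix_def)

lemma mat1_nth [simp]: "(mat 1 :: real^2^2) $ 1 $ 1 = 1" "(mat 1 :: real^2^2) $ 1 $ 2 = 0"
  "(mat 1 :: real^2^2) $ 2 $ 1 = 0" "(mat 1 :: real^2^2) $ 2 $ 2 = 1"
  by (simp_all add: mat_def)

lemma transfer_add: "transfer v E n (j + k) = transfer v E (n + int j) k ** transfer v E n j"
  by (induction k) (simp_all add: matrix_mul_assoc add.assoc)

lemma transfer_cong: "(\<And>i. i < j \<Longrightarrow> v (n + int i) = w (m + int i)) \<Longrightarrow> transfer v E n j = transfer w E m j"
  by (induction j) auto

lemma transfer_det: "transfer v E n j $ 1 $ 1 * transfer v E n j $ 2 $ 2 - transfer v E n j $ 1 $ 2 * transfer v E n j $ 2 $ 1 = 1"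
proof (induction j)
  case (Suc j) then show ?case by (simp add: matrix_mult_2 algebra_simps)
qed simp

lemma periodic_nat_mult:
  assumes "periodic l v" shows "v (n + int l * int k) = v n"
proof (induction k)
  case (Suc k)
  have "v (n + int l * int (Suc k)) = v ((n + int l * int k) + int l)" by (simp add: algebra_simps)
  then show ?case using assms Suc by (simp add: periodic_def)
qed simp

lemma periodic_mult:
  assumes "periodic l v" shows "v (n + int l * k) = v n"
proof (cases "0 \<le> k")
  case True then show ?thesis using periodic_nat_mult[OF assms, of n "nat k"] by simp
next
  case False
  then show ?thesis using periodic_nat_mult[OF assms, of "n + int l * k" "nat (-k)"] by simp
qed

lemma periodic_mult_nat: "periodic l v \<Longrightarrow> periodic (l * k) v"
  using periodic_nat_mult by (simp add: periodic_def)

lemma transfer_periodic: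
  assumes "periodic l v" shows "transfer v E (n + int l * k) j = transfer v E n j"
proof (rule transfer_cong)
  fix i show "v (n + int l * k + int i) = v (n + int i)"
    using periodic_mult[OF assms, of "n + int i" k] by (simp add: algebra_simps)
qed

text \<open>Moving the base point conjugates the transfer matrix over a period.\<close>

lemma discriminant_base:
  assumes "periodic l v" shows "discriminant v E n l = discriminant v E 0 l"
proof (cases "l = 0")
  case True then show ?thesis by (simp add: discriminant_def)
next
  case False
  define r where "r = nat (n mod int l)"
  have r: "r \<le> l" "int r = n mod int l" using False by (auto simp: r_def nat_le_iff less_imp_le)
  have "n = int r + int l * (n div int l)" using r(2) by simp
  then have "transfer v E n l = transfer v E (int r) l" using transfer_periodic[OF assms] by metis
  moreover have "transfer v E 0 l = transfer v E (int r) (l - r) ** transfer v E 0 r"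
    using transfer_add[of v E 0 r "l - r"] r by simp
  moreover have "transfer v E (int r) l = transfer v E 0 r ** transfer v E (int r) (l - r)"
    using transfer_add[of v E "int r" "l - r" r] r transfer_periodic[OF assms, of E 0 1 r] by (simp add: of_nat_diff)
  ultimately show ?thesis by (simp add: discriminant_def matrix_mult_2 algebra_simps)
qed

lemma continuous_transfer: "continuous_on UNIV (\<lambda>E. transfer v E n j $ i $ k)"
proof (induction j arbitrary: i k)
  case (Suc j)
  have "i = 1 \<or> i = 2" by (rule exhaust_2)
  then show ?case
    by (elim disjE; simp add: matrix_mult_2; intro continuous_intros Suc)
qed simp

lemma continuous_discriminant: "continuous_on UNIV (\<lambda>E. discriminant v E n l)"
  unfolding discriminant_def by (intro continuous_intros continuous_transfer)

text \<open>Changing the potential at the first and at the last site of a word multiplies its transfer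
  matrix on both sides by unipotent matrices.\<close>

lemma discriminant_perturb:
  fixes W w :: "int \<Rightarrow> real" and E s1 s2 :: real
  assumes "2 \<le> l" and w: "\<And>j. 0 < j \<Longrightarrow> j < int l - 1 \<Longrightarrow> w j = W j" "w 0 = W 0 - s1" "w (int l - 1) = W (int l - 1) - s2"
  defines "X \<equiv> transfer W E 0 l"
  shows "discriminant w E 0 l = X $ 1 $ 1 + X $ 2 $ 2 + s2 * X $ 2 $ 1 - s1 * X $ 1 $ 2 - s1 * s2 * X $ 2 $ 2"
proof -
  obtain r where "l = 2 + r" using le_Suc_ex[OF assms(1)] by blast
  then have r: "l = Suc (Suc r)" by simp
  define P where "P = transfer W E 1 r"
  have Pw: "transfer w E 1 r = P"
    unfolding P_def by (rule transfer_cong) (use w(1) r in auto)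
  have dec: "transfer u E 0 l = step_matrix (E - u (int l - 1)) ** (transfer u E 1 r ** step_matrix (E - u 0))" for u
    using transfer_add[of u E 0 1 "Suc r"] by (simp add: r matrix_mul_rid matrix_mul_assoc)
  show ?thesis
    unfolding X_def discriminant_def dec Pw P_def[symmetric] w(2,3)
    by (simp add: matrix_mult_2) (simp add: algebra_simps)
qed

text \<open>Suppose that changing the first and the last value by \<open>s\<close> or \<open>-s\<close> never produces a trace
  above two in absolute value. Then the four sign patterns bound all entries of the powers of the
  transfer matrix, so two powers are close to each other and some power is close to the identity.
  But near the identity opposite signs give a trace close to \<open>2 + s\<^sup>2\<close>.\<close>

lemma barrier_word:
  assumes per: "periodic n W" and n: "1 \<le> n" and s: "0 < s"
  shows "\<exists>l w. n dvd l \<and> 1 \<le> l \<and> periodic l w \<and> (\<forall>j. \<bar>w j - W j\<bar> \<le> s) \<and> 2 < \<bar>discriminant w E 0 l\<bar>"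
proof (rule ccontr)
  assume neg: "\<not> ?thesis"
  \<comment> \<open>The factor two separates the first from the last site of the word also for \<open>n = 1\<close>.\<close>
  define X where "X k = transfer W E 0 (2 * n * k)" for k
  have F: "\<bar>X k $ 1 $ 1 + X k $ 2 $ 2 + s2 * X k $ 2 $ 1 - s1 * X k $ 1 $ 2 - s1 * s2 * X k $ 2 $ 2\<bar> \<le> 2"
    if k: "1 \<le> k" and s12: "\<bar>s1\<bar> = s" "\<bar>s2\<bar> = s" for k s1 s2
  proof -
    define l where "l = 2 * n * k"
    have l2: "2 \<le> l" using k n by (simp add: l_def)
    define w where "w j = W j - (if int l dvd j then s1 else 0) - (if int l dvd j + 1 then s2 else 0)" for j
    have excl: "\<not> (int l dvd j \<and> int l dvd j + 1)" for j
    proof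
      assume "int l dvd j \<and> int l dvd j + 1"
      then have "int l dvd (j + 1) - j" by (intro dvd_diff) auto
      then show False using l2 by simp
    qed
    have close: "\<bar>w j - W j\<bar> \<le> s" for j using excl[of j] s12 s by (auto simp: w_def)
    have "periodic l W" using periodic_mult_nat[OF per, of "2 * k"] by (simp add: l_def mult_ac)
    then have pw: "periodic l w"
      unfolding periodic_def w_def
    proof (intro allI)
      fix j assume "\<forall>n. W (n + int l) = W n"
      moreover have "int l dvd j + int l \<longleftrightarrow> int l dvd j" "int l dvd j + int l + 1 \<longleftrightarrow> int l dvd j + 1"
        using dvd_add_left_iff[of "int l" "int l" j] dvd_add_left_iff[of "int l" "int l" "j + 1"] by (auto simp: algebra_simps)
      ultimately show "W (j + int l) - (if int l dvd j + int l then s1 else 0) - (if int l dvd j + int l + 1 then s2 else 0)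
        = W j - (if int l dvd j then s1 else 0) - (if int l dvd j + 1 then s2 else 0)" by simp
    qed
    have "discriminant w E 0 l = X k $ 1 $ 1 + X k $ 2 $ 2 + s2 * X k $ 2 $ 1 - s1 * X k $ 1 $ 2 - s1 * s2 * X k $ 2 $ 2"
      unfolding X_def l_def[symmetric]
    proof (rule discriminant_perturb[OF l2])
      fix j :: int assume j: "0 < j" "j < int l - 1"
      then have "\<not> int l dvd j" "\<not> int l dvd j + 1" using zdvd_not_zless[of j "int l"] zdvd_not_zless[of "j + 1" "int l"] by auto
      then show "w j = W j" by (simp add: w_def)
    next
      show "w 0 = W 0 - s1" using excl[of 0] by (simp add: w_def)
      show "w (int l - 1) = W (int l - 1) - s2" using excl[of "int l - 1"] by (simp add: w_def)
    qed
    moreover have "\<not> 2 < \<bar>discriminant w E 0 l\<bar>"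
      using neg close pw l2 by (metis dvd_triv_left l_def mult.assoc mult.left_commute one_le_numeral order_trans)
    ultimately show ?thesis by simp
  qed
  define C where "C = 2 + 2 / s + 2 / s\<^sup>2"
  have bd: "\<bar>X k $ i $ j\<bar> \<le> C" if k: "1 \<le> k" for k i j
  proof -
    let ?a = "X k $ 1 $ 1" and ?b = "X k $ 1 $ 2" and ?c = "X k $ 2 $ 1" and ?d = "X k $ 2 $ 2"
    have f: "\<bar>?a + ?d + s * ?c - s * ?b - s * s * ?d\<bar> \<le> 2" "\<bar>?a + ?d + s * ?c + s * ?b + s * s * ?d\<bar> \<le> 2"
      "\<bar>?a + ?d - s * ?c - s * ?b + s * s * ?d\<bar> \<le> 2" "\<bar>?a + ?d - s * ?c + s * ?b - s * s * ?d\<bar> \<le> 2"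
      using F[OF k, of s s] F[OF k, of "-s" s] F[OF k, of s "-s"] F[OF k, of "-s" "-s"] s by auto
    \<comment> \<open>Each entry is isolated by averaging the four sign patterns with suitable signs.\<close>
    have c: "\<bar>s * ?c\<bar> \<le> 2" "\<bar>s * ?b\<bar> \<le> 2" "\<bar>s * s * ?d\<bar> \<le> 2" "\<bar>?a + ?d\<bar> \<le> 2"
      using f by linarith+
    have "\<bar>?c\<bar> \<le> 2 / s" "\<bar>?b\<bar> \<le> 2 / s" "\<bar>?d\<bar> \<le> 2 / s\<^sup>2"
      using c(1,2,3) s by (simp_all add: abs_mult pos_le_divide_eq power2_eq_square mult_ac)
    moreover have "\<bar>?a\<bar> \<le> 2 + 2 / s\<^sup>2" using c(4) \<open>\<bar>?d\<bar> \<le> 2 / s\<^sup>2\<close> by linarith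
    moreover have "0 \<le> 2 / s" "0 \<le> 2 / s\<^sup>2" using s by auto
    ultimately have "\<bar>?a\<bar> \<le> C" "\<bar>?b\<bar> \<le> C" "\<bar>?c\<bar> \<le> C" "\<bar>?d\<bar> \<le> C" unfolding C_def by linarith+
    moreover have "i = 1 \<or> i = 2" "j = 1 \<or> j = 2" by (rule exhaust_2)+
    ultimately show ?thesis by auto
  qed
  have C0: "0 < C" unfolding C_def using s by (simp add: add_pos_pos)
  \<comment> \<open>An error of \<open>e\<close> in each entry lowers the trace by at most \<open>(2 + 2 s + s\<^sup>2) e = s\<^sup>2 / 2\<close>.\<close>
  define e where "e = s\<^sup>2 / (2 * (2 + 2 * s + s\<^sup>2))"
  have den: "0 < 2 + 2 * s + s\<^sup>2" using s by (simp add: add_pos_pos)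
  have e0: "0 < e" using s den by (simp add: e_def)
  have XS: "X (a + b) = X b ** X a" for a b
  proof -
    have "periodic (2 * n) W" using periodic_mult_nat[OF per, of 2] by (simp add: mult_ac)
    from transfer_periodic[OF this, of E 0 "int a" "2 * n * b"]
    show ?thesis using transfer_add[of W E 0 "2 * n * a" "2 * n * b"] by (simp add: X_def distrib_left)
  qed
  have "bounded (range (\<lambda>k. X (Suc k)))"
  proof -
    have "norm (X (Suc k)) \<le> 4 * C" for k
    proof -
      have "norm (X (Suc k)) \<le> (\<Sum>i\<in>UNIV. norm (X (Suc k) $ i))"
        unfolding norm_vec_def by (rule L2_set_le_sum) simp
      also have "\<dots> \<le> (\<Sum>i\<in>(UNIV::2 set). \<Sum>j\<in>UNIV. \<bar>X (Suc k) $ i $ j\<bar>)"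
        by (intro sum_mono norm_le_l1_cart)
      also have "\<dots> \<le> (\<Sum>i\<in>(UNIV::2 set). \<Sum>j\<in>(UNIV::2 set). C)" by (intro sum_mono bd) simp
      finally show ?thesis by simp
    qed
    then show ?thesis by (auto simp: bounded_iff)
  qed
  then obtain L r where r: "strict_mono r" "((\<lambda>k. X (Suc k)) \<circ> r) \<longlonglongrightarrow> L"
    using bounded_imp_convergent_subsequence by blast
  then have "Cauchy ((\<lambda>k. X (Suc k)) \<circ> r)" using LIMSEQ_imp_Cauchy by blast
  then obtain N where N: "\<And>i j. i \<ge> N \<Longrightarrow> j \<ge> N \<Longrightarrow> dist (((\<lambda>k. X (Suc k)) \<circ> r) i) (((\<lambda>k. X (Suc k)) \<circ> r) j) < e / (2 * C)"
    using metric_CauchyD[of _ "e / (2 * C)"] e0 C0 by (metis divide_pos_pos mult_pos_pos zero_less_numeral)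
  define a where "a = Suc (r N)"
  define b where "b = Suc (r (Suc N)) - a"
  have "r N < r (Suc N)" using r(1) by (simp add: strict_mono_def)
  then have ab: "1 \<le> a" "1 \<le> b" "a + b = Suc (r (Suc N))" by (auto simp: a_def b_def)
  have dab: "\<bar>X (a + b) $ i $ j - X a $ i $ j\<bar> \<le> e / (2 * C)" for i j
  proof -
    have "\<bar>(X (a + b) - X a) $ i $ j\<bar> \<le> norm ((X (a + b) - X a) $ i)" by (rule component_le_norm_cart)
    also have "\<dots> \<le> norm (X (a + b) - X a)" by (rule Finite_Cartesian_Product.norm_nth_le)
    also have "\<dots> < e / (2 * C)" using N[of "Suc N" N] unfolding ab(3) by (simp add: a_def dist_norm)
    finally show ?thesis by simp
  qed
  let ?Y = "X b" and ?Z = "X a"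
  have det: "?Z $ 1 $ 1 * ?Z $ 2 $ 2 - ?Z $ 1 $ 2 * ?Z $ 2 $ 1 = 1" unfolding X_def by (rule transfer_det)
  define D where "D i j = X (a + b) $ i $ j - X a $ i $ j" for i j
  have DY: "D i j = ?Y $ i $ 1 * ?Z $ 1 $ j + ?Y $ i $ 2 * ?Z $ 2 $ j - ?Z $ i $ j" for i j
    by (simp add: D_def XS matrix_mult_2)
  \<comment> \<open>\<open>Y = (X (a + b)) (X a)\<^sup>-\<^sup>1\<close>, and the inverse is the adjugate since the determinant is one.\<close>
  have Y: "?Y $ 1 $ 1 - 1 = D 1 1 * ?Z $ 2 $ 2 - D 1 2 * ?Z $ 2 $ 1"
    "?Y $ 1 $ 2 = D 1 2 * ?Z $ 1 $ 1 - D 1 1 * ?Z $ 1 $ 2"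
    "?Y $ 2 $ 1 = D 2 1 * ?Z $ 2 $ 2 - D 2 2 * ?Z $ 2 $ 1"
    "?Y $ 2 $ 2 - 1 = D 2 2 * ?Z $ 1 $ 1 - D 2 1 * ?Z $ 1 $ 2"
    unfolding DY using det by algebra+
  have bnd: "\<bar>D i j * ?Z $ i' $ j' - D k l * ?Z $ k' $ l'\<bar> \<le> e" for i j i' j' k l k' l'
  proof -
    have "\<bar>D i j * ?Z $ i' $ j'\<bar> \<le> e / (2 * C) * C" for i j i' j'
      unfolding abs_mult using dab[of i j] bd[OF ab(1), of i' j'] e0 C0 by (intro mult_mono) (auto simp: D_def)
    then have "\<bar>D i j * ?Z $ i' $ j'\<bar> \<le> e / 2" for i j i' j' using C0 by simp
    from this[of i j i' j'] this[of k l k' l'] show ?thesis by linarith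
  qed
  have y: "\<bar>?Y $ 1 $ 1 - 1\<bar> \<le> e" "\<bar>?Y $ 1 $ 2\<bar> \<le> e" "\<bar>?Y $ 2 $ 1\<bar> \<le> e" "\<bar>?Y $ 2 $ 2 - 1\<bar> \<le> e"
    unfolding Y by (rule bnd)+
  have "?Y $ 1 $ 1 + ?Y $ 2 $ 2 + (-s) * ?Y $ 2 $ 1 - s * ?Y $ 1 $ 2 - s * (-s) * ?Y $ 2 $ 2 \<le> 2"
    using F[OF ab(2), of s "-s"] s by simp
  moreover have "(-s) * ?Y $ 2 $ 1 \<ge> - (s * e)" "- s * ?Y $ 1 $ 2 \<ge> - (s * e)"
    using mult_left_mono[of "?Y $ 2 $ 1" e s] mult_left_mono[of "?Y $ 1 $ 2" e s] y s by auto
  moreover have "- s * (-s) * ?Y $ 2 $ 2 \<ge> s\<^sup>2 * (1 - e)"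
    using mult_left_mono[of "1 - e" "?Y $ 2 $ 2" "s\<^sup>2"] y by (simp add: power2_eq_square)
  moreover have "?Y $ 1 $ 1 + ?Y $ 2 $ 2 \<ge> 2 - 2 * e" using y by linarith
  ultimately have "s\<^sup>2 \<le> e * (2 + 2 * s + s\<^sup>2)" by (simp add: algebra_simps)
  also have "e * (2 + 2 * s + s\<^sup>2) = s\<^sup>2 / 2"
  proof -
    have "s\<^sup>2 / (2 * x) * x = s\<^sup>2 / 2" if "0 < x" for x using that by simp
    from this[OF den] show ?thesis unfolding e_def .
  qed
  finally show False using s by simp
qed

text \<open>Exceeding a threshold above two is an open condition on the energy, so compactness leaves
  finitely many words and one threshold.\<close>

lemma barrier_family:
  assumes per: "periodic n W" and n: "1 \<le> n" and s: "0 < s"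
  shows "\<exists>(m::nat) l w t. 2 < t \<and> (\<forall>i<m. n dvd l i \<and> 1 \<le> l i \<and> periodic (l i) (w i) \<and> (\<forall>j. \<bar>w i j - W j\<bar> \<le> s)) \<and>
     (\<forall>E\<in>{-K..K}. \<exists>i<m. t \<le> \<bar>discriminant (w i) E 0 (l i)\<bar>)"
proof -
  obtain l w where lw: "\<And>E. n dvd l E" "\<And>E. 1 \<le> l E" "\<And>E. periodic (l E) (w E)" "\<And>E j. \<bar>w E j - W j\<bar> \<le> s"
    "\<And>E. 2 < \<bar>discriminant (w E) E 0 (l E)\<bar>"
    using barrier_word[OF assms] by metis
  define t where "t E = (2 + \<bar>discriminant (w E) E 0 (l E)\<bar>) / 2" for E
  have t2: "2 < t E" and tE: "t E < \<bar>discriminant (w E) E 0 (l E)\<bar>" for E using lw(5)[of E] by (auto simp: t_def)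
  define U where "U E = {x. t E < \<bar>discriminant (w E) x 0 (l E)\<bar>}" for E
  have "open (U E)" for E
    unfolding U_def by (intro open_Collect_less continuous_intros continuous_discriminant)
  moreover have "{-K..K} \<subseteq> (\<Union>E\<in>{-K..K}. U E)" using tE by (auto simp: U_def)
  ultimately obtain D where D: "D \<subseteq> {-K..K}" "finite D" "{-K..K} \<subseteq> (\<Union>E\<in>D. U E)"
    using compactE_image[OF compact_Icc, of "{-K..K}" U "-K" K] by metis
  obtain e where e: "bij_betw e {0..<card D} D" using ex_bij_betw_nat_finite[OF D(2)] by blast
  define t0 where "t0 = Min (insert 3 (t ` D))"
  have t0: "2 < t0" "\<And>E. E \<in> D \<Longrightarrow> t0 \<le> t E" using D(2) t2 by (auto simp: t0_def)
  have "\<exists>i<card D. t0 \<le> \<bar>discriminant (w (e i)) x 0 (l (e i))\<bar>" if x: "x \<in> {-K..K}" for x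
  proof -
    obtain E where E: "E \<in> D" "x \<in> U E" using subsetD[OF D(3) x] by blast
    then obtain i where "i < card D" "e i = E" using e unfolding bij_betw_def by (metis atLeastLessThan_iff imageE)
    then show ?thesis using E t0(2)[OF E(1)] by (auto simp: U_def intro!: exI[of _ i])
  qed
  then show ?thesis using t0(1) lw
    by (intro exI[of _ "card D"] exI[of _ "\<lambda>i. l (e i)"] exI[of _ "\<lambda>i. w (e i)"] exI[of _ t0]) auto
qed

section \<open>Periodic potentials with thin spectrum\<close>

lemma transfer_bounded:
  assumes "bounded_pot K v"
  shows "\<exists>B. \<forall>n i k. \<bar>transfer v E n j $ i $ k\<bar> \<le> B"
proof (induction j)
  case 0
  have "\<bar>(mat 1 :: real^2^2) $ i $ k\<bar> \<le> 1" for i k by (simp add: mat_def)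
  then show ?case by auto
next
  case (Suc j)
  then obtain B where B: "\<And>n i k. \<bar>transfer v E n j $ i $ k\<bar> \<le> B" by blast
  have B0: "0 \<le> B" using B[of 0 1 1] by linarith
  have K0: "0 \<le> K" by (rule bounded_pot_nonneg[OF assms])
  have "\<bar>transfer v E n (Suc j) $ i $ k\<bar> \<le> (\<bar>E\<bar> + K) * B + B" for n i k
  proof -
    have "\<bar>E - v (n + int j)\<bar> \<le> \<bar>E\<bar> + K"
      using assms abs_triangle_ineq4[of E "v (n + int j)"] by (simp add: bounded_pot_def) (meson add_left_mono order_trans)
    then have 1: "\<bar>(E - v (n + int j)) * transfer v E n j $ 1 $ k\<bar> \<le> (\<bar>E\<bar> + K) * B"
      unfolding abs_mult by (intro mult_mono B) (use K0 in auto)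
    have 2: "\<bar>transfer v E n j $ 1 $ k\<bar> \<le> B" "\<bar>transfer v E n j $ 2 $ k\<bar> \<le> B" by (rule B)+
    have 3: "0 \<le> (\<bar>E\<bar> + K) * B" using B0 K0 by simp
    have "i = 1 \<or> i = 2" by (rule exhaust_2)
    then show ?thesis
    proof
      assume "i = 1" then show ?thesis using 1 2(2) by (simp add: matrix_mult_2)
    next
      assume "i = 2" then show ?thesis using 2(1) 3 by (simp add: matrix_mult_2)
    qed
  qed
  then show ?case by blast
qed

text \<open>The vectors \<open>e\<close> and \<open>e'\<close> collect, for all sites \<open>n\<close> at once, the amounts by which \<open>\<psi>\<close> fails
  to be transported by the transfer matrix over \<open>j\<close> steps.\<close>

definition transfer_error :: "(int \<Rightarrow> real) \<Rightarrow> real \<Rightarrow> nat \<Rightarrow> ell2 \<Rightarrow> ell2 \<Rightarrow> ell2 \<Rightarrow> bool" where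
  "transfer_error v E j \<psi> e e' \<longleftrightarrow>
    (\<forall>n. ell2_coord \<psi> (n + int j) = of_real (transfer v E n j $ 1 $ 1) * ell2_coord \<psi> n
        + of_real (transfer v E n j $ 1 $ 2) * ell2_coord \<psi> (n - 1) + ell2_coord e n) \<and>
    (\<forall>n. ell2_coord \<psi> (n + int j - 1) = of_real (transfer v E n j $ 2 $ 1) * ell2_coord \<psi> n
        + of_real (transfer v E n j $ 2 $ 2) * ell2_coord \<psi> (n - 1) + ell2_coord e' n)"

text \<open>Each step adds a shifted copy of the residual \<open>jacobi v \<psi> - E \<psi>\<close> and applies bounded
  multiplication operators to the previous errors, so the errors stay bounded by the residual in
  the Hilbert space norm.\<close>

lemma inhomogeneous_transfer:
  assumes v: "bounded_pot K v"
  shows "\<exists>C\<ge>0. \<forall>\<psi>. \<exists>e e'. norm e \<le> C * norm (jacobi v \<psi> - E *\<^sub>R \<psi>) \<and>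
    norm e' \<le> C * norm (jacobi v \<psi> - E *\<^sub>R \<psi>) \<and> transfer_error v E j \<psi> e e'"
proof (induction j)
  case 0
  show ?case
    by (intro exI[of _ "0::real"] conjI allI exI[of _ "0::ell2"]) (auto simp: transfer_error_def)
next
  case (Suc j)
  then obtain C where C: "0 \<le> C" and IH: "\<And>\<psi>. \<exists>e e'. norm e \<le> C * norm (jacobi v \<psi> - E *\<^sub>R \<psi>) \<and>
    norm e' \<le> C * norm (jacobi v \<psi> - E *\<^sub>R \<psi>) \<and> transfer_error v E j \<psi> e e'" by blast
  define u where "u n = E - v (n + int j)" for n
  have K0: "0 \<le> K" by (rule bounded_pot_nonneg[OF v])
  have u: "bounded_pot (\<bar>E\<bar> + K) u"
    using v unfolding bounded_pot_def u_def by (meson abs_triangle_ineq4 add_left_mono order_trans)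
  have "\<exists>e e'. norm e \<le> ((\<bar>E\<bar> + K) * C + C + 1) * norm (jacobi v \<psi> - E *\<^sub>R \<psi>) \<and>
    norm e' \<le> ((\<bar>E\<bar> + K) * C + C + 1) * norm (jacobi v \<psi> - E *\<^sub>R \<psi>) \<and>
    transfer_error v E (Suc j) \<psi> e e'" for \<psi>
  proof -
    define h where "h = jacobi v \<psi> - E *\<^sub>R \<psi>"
    obtain e e' where e: "norm e \<le> C * norm h" "norm e' \<le> C * norm h"
      "\<And>n. ell2_coord \<psi> (n + int j) = of_real (transfer v E n j $ 1 $ 1) * ell2_coord \<psi> n
        + of_real (transfer v E n j $ 1 $ 2) * ell2_coord \<psi> (n - 1) + ell2_coord e n"
      "\<And>n. ell2_coord \<psi> (n + int j - 1) = of_real (transfer v E n j $ 2 $ 1) * ell2_coord \<psi> n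
        + of_real (transfer v E n j $ 2 $ 2) * ell2_coord \<psi> (n - 1) + ell2_coord e' n"
      using IH[of \<psi>] unfolding h_def transfer_error_def by blast
    define e2 where "e2 = mult_op u e - e' + shift_op (int j) h"
    have "norm e2 \<le> norm (mult_op u e) + norm e' + norm h"
      unfolding e2_def using norm_triangle_ineq[of "mult_op u e - e'" "shift_op (int j) h"] norm_triangle_ineq4[of "mult_op u e" e'] by simp
    also have "\<dots> \<le> (\<bar>E\<bar> + K) * (C * norm h) + C * norm h + norm h"
      using norm_mult_op[OF u, of e] e(1,2) K0 mult_left_mono[OF e(1), of "\<bar>E\<bar> + K"] by simp
    finally have e2: "norm e2 \<le> ((\<bar>E\<bar> + K) * C + C + 1) * norm h" by (simp add: algebra_simps)
    have "C * norm h \<le> ((\<bar>E\<bar> + K) * C + C + 1) * norm h"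
      using C K0 by (intro mult_right_mono) (auto simp: add_increasing)
    then have e1: "norm e \<le> ((\<bar>E\<bar> + K) * C + C + 1) * norm h" using e(1) by linarith
    have hc: "ell2_coord h m = ell2_coord \<psi> (m + 1) + ell2_coord \<psi> (m - 1) + of_real (v m) * ell2_coord \<psi> m - of_real E * ell2_coord \<psi> m" for m
      by (simp add: h_def coord_jacobi[OF v])
    have "ell2_coord \<psi> (n + int (Suc j)) = of_real (transfer v E n (Suc j) $ 1 $ 1) * ell2_coord \<psi> n
        + of_real (transfer v E n (Suc j) $ 1 $ 2) * ell2_coord \<psi> (n - 1) + ell2_coord e2 n" for n
    proof -
      have "ell2_coord \<psi> (n + int (Suc j)) = of_real (u n) * ell2_coord \<psi> (n + int j) - ell2_coord \<psi> (n + int j - 1) + ell2_coord h (n + int j)"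
        by (simp add: hc u_def) (simp add: algebra_simps)
      then show ?thesis
        unfolding e(3)[of n] e(4)[of n]
        by (simp add: e2_def coord_mult[OF u] matrix_mult_2 u_def algebra_simps)
    qed
    moreover have "ell2_coord \<psi> (n + int (Suc j) - 1) = of_real (transfer v E n (Suc j) $ 2 $ 1) * ell2_coord \<psi> n
        + of_real (transfer v E n (Suc j) $ 2 $ 2) * ell2_coord \<psi> (n - 1) + ell2_coord e n" for n
      using e(3)[of n] by (simp add: matrix_mult_2)
    ultimately show ?thesis using e1 e2 unfolding h_def transfer_error_def by blast
  qed
  then show ?case using C K0 by (intro exI[of _ "(\<bar>E\<bar> + K) * C + C + 1"]) auto
qed

text \<open>For a \<open>q\<close>-periodic potential, eliminating the inner sites turns the eigenvalue equation into
  \<open>\<psi> (n + q) + \<psi> (n - q) = D \<psi> n\<close> with \<open>D\<close> the discriminant, which has no approximate solution in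
  the Hilbert space once \<open>D\<close> exceeds two in absolute value.\<close>

lemma approx_eigenvalue_discriminant:
  assumes per: "periodic q v" and v: "bounded_pot K v" and a: "approx_eigenvalue (jacobi v) E"
  shows "\<bar>discriminant v E 0 q\<bar> \<le> 2"
proof (rule ccontr)
  define D where "D = discriminant v E 0 q"
  assume "\<not> ?thesis"
  then have D2: "2 < \<bar>D\<bar>" by (simp add: D_def)
  obtain B where B: "\<And>n i k. \<bar>transfer v E n q $ i $ k\<bar> \<le> B" using transfer_bounded[OF v] by blast
  have B0: "0 \<le> B" using B[of 0 1 1] by linarith
  obtain C where C: "0 \<le> C" and CC: "\<And>\<psi>. \<exists>e e'. norm e \<le> C * norm (jacobi v \<psi> - E *\<^sub>R \<psi>) \<and>
    norm e' \<le> C * norm (jacobi v \<psi> - E *\<^sub>R \<psi>) \<and> transfer_error v E q \<psi> e e'"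
    using inhomogeneous_transfer[OF v, of E q] by blast
  define C' where "C' = C + 2 * B * C"
  have C'0: "0 \<le> C'" using B0 C by (simp add: C'_def)
  define \<eta> where "\<eta> = (\<bar>D\<bar> - 2) / (2 * (C' + 1))"
  have "0 < \<eta>" using D2 C'0 by (simp add: \<eta>_def)
  then obtain \<psi> where \<psi>: "\<psi> \<noteq> 0" "norm (jacobi v \<psi> - E *\<^sub>R \<psi>) \<le> \<eta> * norm \<psi>"
    using a by (auto simp: approx_eigenvalue_def)
  define h where "h = norm (jacobi v \<psi> - E *\<^sub>R \<psi>)"
  obtain e e' where e: "norm e \<le> C * h" "norm e' \<le> C * h"
    "\<And>n. ell2_coord \<psi> (n + int q) = of_real (transfer v E n q $ 1 $ 1) * ell2_coord \<psi> n
        + of_real (transfer v E n q $ 1 $ 2) * ell2_coord \<psi> (n - 1) + ell2_coord e n"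
    "\<And>n. ell2_coord \<psi> (n + int q - 1) = of_real (transfer v E n q $ 2 $ 1) * ell2_coord \<psi> n
        + of_real (transfer v E n q $ 2 $ 2) * ell2_coord \<psi> (n - 1) + ell2_coord e' n"
    using CC[of \<psi>] unfolding h_def transfer_error_def by blast
  define T where "T n i k = transfer v E n q $ i $ k" for n i k
  have Tper: "transfer v E (n - int q) q = transfer v E n q" for n
    using transfer_periodic[OF per, of E n "-1" q] by simp
  have b22: "bounded_pot B (\<lambda>n. T n 2 2)" and b12: "bounded_pot B (\<lambda>n. T n 1 2)"
    using B by (auto simp: bounded_pot_def T_def)
  define g where "g = e - mult_op (\<lambda>n. T n 2 2) (shift_op (- int q) e) + mult_op (\<lambda>n. T n 1 2) (shift_op (- int q) e')"
  have "D *\<^sub>R \<psi> = shift_op (int q) \<psi> + shift_op (- int q) \<psi> - g"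
  proof (rule ell2_eqI)
    fix n
    let ?a = "complex_of_real (T n 1 1)" and ?b = "complex_of_real (T n 1 2)" and ?c = "complex_of_real (T n 2 1)" and ?d = "complex_of_real (T n 2 2)"
    have dt: "?a * ?d - ?b * ?c = 1"
      using arg_cong[OF transfer_det[of v E n q], of complex_of_real] by (simp add: T_def)
    have D: "complex_of_real D = ?a + ?d"
      unfolding D_def discriminant_base[OF per, of E n, symmetric] by (simp add: discriminant_def T_def)
    have f1: "ell2_coord \<psi> (n + int q) = ?a * ell2_coord \<psi> n + ?b * ell2_coord \<psi> (n - 1) + ell2_coord e n"
      using e(3)[of n] by (simp add: T_def)
    have f2: "ell2_coord \<psi> n = ?a * ell2_coord \<psi> (n - int q) + ?b * ell2_coord \<psi> (n - int q - 1) + ell2_coord e (n - int q)"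
      using e(3)[of "n - int q"] by (simp add: T_def Tper)
    have f3: "ell2_coord \<psi> (n - 1) = ?c * ell2_coord \<psi> (n - int q) + ?d * ell2_coord \<psi> (n - int q - 1) + ell2_coord e' (n - int q)"
      using e(4)[of "n - int q"] by (simp add: T_def Tper)
    \<comment> \<open>Applying the adjugate to the two transported values recovers the value one period back.\<close>
    have f4: "?d * ell2_coord \<psi> n - ?b * ell2_coord \<psi> (n - 1) = ell2_coord \<psi> (n - int q) + ?d * ell2_coord e (n - int q) - ?b * ell2_coord e' (n - int q)"
      unfolding f2 f3 using dt by algebra
    have "(?a + ?d) * ell2_coord \<psi> n = ell2_coord \<psi> (n + int q) + ell2_coord \<psi> (n - int q) - (ell2_coord e n - ?d * ell2_coord e (n - int q) + ?b * ell2_coord e' (n - int q))"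
      using f1 f4 by algebra
    then show "ell2_coord (D *\<^sub>R \<psi>) n = ell2_coord (shift_op (int q) \<psi> + shift_op (- int q) \<psi> - g) n"
      by (simp add: D g_def coord_mult[OF b22] coord_mult[OF b12])
  qed
  then have "\<bar>D\<bar> * norm \<psi> = norm (shift_op (int q) \<psi> + shift_op (- int q) \<psi> - g)"
    by (metis norm_scaleR)
  also have "\<dots> \<le> norm (shift_op (int q) \<psi> + shift_op (- int q) \<psi>) + norm g" by (rule norm_triangle_ineq4)
  also have "\<dots> \<le> norm \<psi> + norm \<psi> + norm g"
    using norm_triangle_ineq[of "shift_op (int q) \<psi>" "shift_op (- int q) \<psi>"] by simp
  finally have "\<bar>D\<bar> * norm \<psi> \<le> norm \<psi> + norm \<psi> + norm g" .
  moreover have "norm g \<le> C' * h"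
  proof -
    have "norm g \<le> norm e + norm (mult_op (\<lambda>n. T n 2 2) (shift_op (- int q) e)) + norm (mult_op (\<lambda>n. T n 1 2) (shift_op (- int q) e'))"
      unfolding g_def using norm_triangle_ineq[of "e - mult_op (\<lambda>n. T n 2 2) (shift_op (- int q) e)" "mult_op (\<lambda>n. T n 1 2) (shift_op (- int q) e')"]
        norm_triangle_ineq4[of e "mult_op (\<lambda>n. T n 2 2) (shift_op (- int q) e)"] by linarith
    also have "\<dots> \<le> C * h + B * (C * h) + B * (C * h)"
      using norm_mult_op[OF b22, of "shift_op (- int q) e"] norm_mult_op[OF b12, of "shift_op (- int q) e'"] e(1,2)
        mult_left_mono[OF e(1) B0] mult_left_mono[OF e(2) B0] by simp
    finally show ?thesis by (simp add: C'_def algebra_simps)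
  qed
  moreover have "C' * h \<le> C' * (\<eta> * norm \<psi>)" using \<psi>(2) C'0 by (intro mult_left_mono) (auto simp: h_def)
  ultimately have "(\<bar>D\<bar> - 2) * norm \<psi> \<le> (C' * \<eta>) * norm \<psi>" by (simp add: algebra_simps)
  then have "\<bar>D\<bar> - 2 \<le> C' * \<eta>" using \<psi>(1) by simp
  also have "\<dots> \<le> (C' + 1) * \<eta>" using \<open>0 < \<eta>\<close> by simp
  also have "\<dots> = (\<bar>D\<bar> - 2) / 2"
  proof -
    have "x * (y / (2 * x)) = y / 2" if "0 < x" for x y :: real using that by simp
    from this[of "C' + 1" "\<bar>D\<bar> - 2"] C'0 show ?thesis unfolding \<eta>_def by simp
  qed
  finally show False using D2 by simp
qed

text \<open>The eigenvalues of a real matrix with determinant one and trace at most two in absolute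
  value are conjugate and on the unit circle. If both off-diagonal entries vanish, the matrix is
  the identity or its negative.\<close>

lemma unimodular_eigenvector:
  fixes a b c d :: real
  assumes det: "a * d - b * c = 1" and tr: "\<bar>a + d\<bar> \<le> 2"
  shows "\<exists>z x y :: complex. cmod z = 1 \<and> (x \<noteq> 0 \<or> y \<noteq> 0) \<and>
    of_real a * x + of_real b * y = z * x \<and> of_real c * x + of_real d * y = z * y"
proof -
  define t where "t = a + d"
  have t2: "t\<^sup>2 \<le> 4" using tr power_mono[of "\<bar>t\<bar>" 2 2] by (simp add: t_def)
  define z where "z = Complex (t / 2) (sqrt (1 - t\<^sup>2 / 4))"
  have sq: "(sqrt (1 - t\<^sup>2 / 4))\<^sup>2 = 1 - t\<^sup>2 / 4" using t2 by simp
  have n1: "cmod z = 1" using sq by (simp add: z_def cmod_def power_divide)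
  have zz: "z * z - of_real t * z + 1 = 0"
    using sq by (simp add: z_def complex_eq_iff power2_eq_square field_simps)
  have D: "complex_of_real a * of_real d - of_real b * of_real c = 1" using arg_cong[OF det, of complex_of_real] by simp
  have T: "complex_of_real t = of_real a + of_real d" by (simp add: t_def)
  show ?thesis
  proof (cases "b = 0")
    case False
    have "of_real c * of_real b + of_real d * (z - of_real a) = z * (z - of_real a)"
      using zz D T by algebra
    then show ?thesis using n1 False
      by (intro exI[of _ z] exI[of _ "of_real b"] exI[of _ "z - of_real a"]) (simp add: algebra_simps)
  next
    case b: True
    show ?thesis
    proof (cases "c = 0")
      case False
      have "of_real a * (z - of_real d) + of_real b * of_real c = z * (z - of_real d)"
        using zz D T by algebra
      then show ?thesis using n1 False
        by (intro exI[of _ z] exI[of _ "z - of_real d"] exI[of _ "of_real c"]) (simp add: algebra_simps)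
    next
      case True
      have ad: "a * d = 1" using det b True by simp
      have "(a - d)\<^sup>2 = (a + d)\<^sup>2 - 4" using ad by (simp add: power2_eq_square algebra_simps)
      then have "(a - d)\<^sup>2 \<le> 0" using t2 by (simp add: t_def)
      then have "a = d" by simp
      then have "\<bar>a\<bar> = 1" using ad by (metis abs_mult abs_one abs_mult_self_eq mult_1 real_sqrt_abs2 real_sqrt_one)
      then show ?thesis using b True \<open>a = d\<close>
        by (intro exI[of _ "of_real a"] exI[of _ 1] exI[of _ 0]) simp
    qed
  qed
qed

text \<open>An eigenvector of the transfer matrix over one period, used as initial value, gives a
  solution that is multiplied by a phase factor over each period. It lives on the half-line to
  which the transfer matrices lead from \<open>c\<close>.\<close>

lemma bloch_solution:
  assumes per: "periodic q v" and D: "\<bar>discriminant v E 0 q\<bar> \<le> 2"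
  shows "\<exists>\<phi> :: int \<Rightarrow> complex. (\<forall>n\<ge>c. \<phi> (n + 1) = of_real (E - v n) * \<phi> n - \<phi> (n - 1)) \<and>
    (\<forall>n\<ge>c-1. cmod (\<phi> (n + int q)) = cmod (\<phi> n)) \<and> (\<exists>n\<ge>c-1. \<phi> n \<noteq> 0)"
proof -
  define T where "T j = transfer v E c j" for j
  have "\<bar>T q $ 1 $ 1 + T q $ 2 $ 2\<bar> \<le> 2"
    using D discriminant_base[OF per, of E c] by (simp add: discriminant_def T_def)
  moreover have "T q $ 1 $ 1 * T q $ 2 $ 2 - T q $ 1 $ 2 * T q $ 2 $ 1 = 1" unfolding T_def by (rule transfer_det)
  ultimately obtain z x y :: complex where z: "cmod z = 1" "x \<noteq> 0 \<or> y \<noteq> 0"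
    "of_real (T q $ 1 $ 1) * x + of_real (T q $ 1 $ 2) * y = z * x"
    "of_real (T q $ 2 $ 1) * x + of_real (T q $ 2 $ 2) * y = z * y"
    using unimodular_eigenvector by metis
  define \<phi> where "\<phi> n = (if n < c then y else of_real (T (nat (n - c)) $ 1 $ 1) * x + of_real (T (nat (n - c)) $ 1 $ 2) * y)" for n
  have p1: "\<phi> (c + int j) = of_real (T j $ 1 $ 1) * x + of_real (T j $ 1 $ 2) * y" for j by (simp add: \<phi>_def)
  have p2: "\<phi> (c + int j - 1) = of_real (T j $ 2 $ 1) * x + of_real (T j $ 2 $ 2) * y" for j
  proof (cases j)
    case 0 then show ?thesis by (simp add: \<phi>_def T_def)
  next
    case (Suc i)
    then have "\<phi> (c + int j - 1) = of_real (T i $ 1 $ 1) * x + of_real (T i $ 1 $ 2) * y" using p1[of i] by simp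
    then show ?thesis by (simp add: Suc T_def matrix_mult_2)
  qed
  have Tq: "T (q + j) = T j ** T q" for j
    using transfer_add[of v E c q j] transfer_periodic[OF per, of E c 1 j] by (simp add: T_def)
  have rec: "\<phi> (n + 1) = of_real (E - v n) * \<phi> n - \<phi> (n - 1)" if "n \<ge> c" for n
  proof -
    define j where "j = nat (n - c)"
    have n: "n = c + int j" using that by (simp add: j_def)
    have "\<phi> (n + 1) = \<phi> (c + int (Suc j))" by (simp add: n algebra_simps)
    then show ?thesis unfolding n p1 p2 by (simp add: T_def matrix_mult_2 algebra_simps)
  qed
  have quasi: "cmod (\<phi> (n + int q)) = cmod (\<phi> n)" if "n \<ge> c - 1" for n
  proof -
    define j where "j = nat (n - c + 1)"
    have n: "n = c + int j - 1" using that by (simp add: j_def)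
    have "\<phi> (n + int q) = \<phi> (c + int (q + j) - 1)" by (simp add: n algebra_simps)
    also have "\<dots> = of_real (T j $ 2 $ 1) * (of_real (T q $ 1 $ 1) * x + of_real (T q $ 1 $ 2) * y)
        + of_real (T j $ 2 $ 2) * (of_real (T q $ 2 $ 1) * x + of_real (T q $ 2 $ 2) * y)"
      unfolding p2 Tq by (simp add: matrix_mult_2 algebra_simps)
    also have "\<dots> = z * \<phi> n" unfolding z(3,4) n p2 by (simp add: algebra_simps)
    finally show ?thesis using z(1) by (simp add: norm_mult)
  qed
  have "\<phi> c = x" "\<phi> (c - 1) = y" using p1[of 0] by (simp_all add: \<phi>_def T_def)
  then have "\<phi> c \<noteq> 0 \<or> \<phi> (c - 1) \<noteq> 0" using z(2) by simp
  then have "\<exists>n\<ge>c-1. \<phi> n \<noteq> 0"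
  proof
    assume "\<phi> c \<noteq> 0" then show ?thesis by (intro exI[of _ c]) simp
  next
    assume "\<phi> (c - 1) \<noteq> 0" then show ?thesis by (intro exI[of _ "c - 1"]) simp
  qed
  then show ?thesis using rec quasi by blast
qed

lemma solution_transfer:
  fixes \<phi> :: "int \<Rightarrow> complex"
  assumes "\<And>m. n \<le> m \<Longrightarrow> m < n + int j \<Longrightarrow> \<phi> (m + 1) = of_real (E - v m) * \<phi> m - \<phi> (m - 1)"
  shows "\<phi> (n + int j) = of_real (transfer v E n j $ 1 $ 1) * \<phi> n + of_real (transfer v E n j $ 1 $ 2) * \<phi> (n - 1) \<and>
    \<phi> (n + int j - 1) = of_real (transfer v E n j $ 2 $ 1) * \<phi> n + of_real (transfer v E n j $ 2 $ 2) * \<phi> (n - 1)"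
  using assms
proof (induction j)
  case (Suc j)
  have IH: "\<phi> (n + int j) = of_real (transfer v E n j $ 1 $ 1) * \<phi> n + of_real (transfer v E n j $ 1 $ 2) * \<phi> (n - 1)"
    "\<phi> (n + int j - 1) = of_real (transfer v E n j $ 2 $ 1) * \<phi> n + of_real (transfer v E n j $ 2 $ 2) * \<phi> (n - 1)"
    using Suc by auto
  have "\<phi> (n + int (Suc j)) = of_real (E - v (n + int j)) * \<phi> (n + int j) - \<phi> (n + int j - 1)"
    using Suc.prems[of "n + int j"] by (simp add: algebra_simps)
  then have "\<phi> (n + int (Suc j)) = of_real (transfer v E n (Suc j) $ 1 $ 1) * \<phi> n + of_real (transfer v E n (Suc j) $ 1 $ 2) * \<phi> (n - 1)"
    unfolding IH by (simp add: matrix_mult_2 algebra_simps)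
  moreover have "\<phi> (n + int (Suc j) - 1) = of_real (transfer v E n (Suc j) $ 2 $ 1) * \<phi> n + of_real (transfer v E n (Suc j) $ 2 $ 2) * \<phi> (n - 1)"
    using IH(1) by (simp add: matrix_mult_2)
  ultimately show ?case by simp
qed simp

text \<open>Each step away from the ends improves the bound by the factor \<open>2 / t\<close>.\<close>

lemma discrete_convexity_decay:
  fixes y :: "int \<Rightarrow> complex"
  assumes t: "2 < t" and M: "\<And>k. \<bar>k\<bar> \<le> int R \<Longrightarrow> cmod (y k) \<le> M"
    and rec: "\<And>k. \<bar>k\<bar> < int R \<Longrightarrow> t * cmod (y k) \<le> cmod (y (k + 1)) + cmod (y (k - 1))"
  shows "cmod (y 0) \<le> (2 / t) ^ R * M"
proof -
  have "i \<le> R \<Longrightarrow> \<bar>k\<bar> \<le> int (R - i) \<Longrightarrow> cmod (y k) \<le> (2 / t) ^ i * M" for i k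
  proof (induction i arbitrary: k)
    case 0 then show ?case using M by simp
  next
    case (Suc i)
    have "t * cmod (y k) \<le> cmod (y (k + 1)) + cmod (y (k - 1))" using Suc.prems by (intro rec) auto
    also have "\<dots> \<le> (2 / t) ^ i * M + (2 / t) ^ i * M"
    proof (rule add_mono)
      have "\<bar>k\<bar> \<le> int R - int i - 1" using Suc.prems by (simp add: of_nat_diff)
      then have "\<bar>k + 1\<bar> \<le> int (R - i)" "\<bar>k - 1\<bar> \<le> int (R - i)" using Suc.prems(1) by (simp_all add: of_nat_diff)
      then show "cmod (y (k + 1)) \<le> (2 / t) ^ i * M" "cmod (y (k - 1)) \<le> (2 / t) ^ i * M"
        using Suc.IH Suc.prems(1) by auto
    qed
    finally show ?case using t by (simp add: field_simps)
  qed
  from this[of R 0] show ?thesis by simp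
qed

text \<open>By the Cayley-Hamilton identity the values of a solution along a progression of step \<open>l\<close>
  satisfy \<open>y (k + 1) + y (k - 1) = D y k\<close> with \<open>D\<close> the discriminant. So in the middle of a long
  hyperbolic stretch the solution is small, whatever happens at its ends.\<close>

lemma barrier_decay:
  fixes \<phi> :: "int \<Rightarrow> complex"
  assumes per: "periodic l w" and t: "2 < t" "t \<le> \<bar>discriminant w E c l\<bar>" 
    and sol: "\<And>m. c - int (R * l) \<le> m \<Longrightarrow> m < c + int (R * l) \<Longrightarrow> \<phi> (m + 1) = of_real (E - w m) * \<phi> m - \<phi> (m - 1)"
    and M: "\<And>m. c - int (R * l) - 1 \<le> m \<Longrightarrow> m \<le> c + int (R * l) \<Longrightarrow> cmod (\<phi> m) \<le> M"
  shows "cmod (\<phi> c) \<le> (2 / t) ^ R * M" "cmod (\<phi> (c - 1)) \<le> (2 / t) ^ R * M"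
proof -
  define T where "T = transfer w E c l"
  have rel: "\<phi> (c + (k + 1) * int l) = of_real (T $ 1 $ 1) * \<phi> (c + k * int l) + of_real (T $ 1 $ 2) * \<phi> (c + k * int l - 1) \<and>
     \<phi> (c + (k + 1) * int l - 1) = of_real (T $ 2 $ 1) * \<phi> (c + k * int l) + of_real (T $ 2 $ 2) * \<phi> (c + k * int l - 1)"
    if k: "- int R \<le> k" "k < int R" for k
  proof -
    have 1: "- int R * int l \<le> k * int l" using k by (intro mult_right_mono) auto
    have 2: "(k + 1) * int l \<le> int R * int l" using k by (intro mult_right_mono) auto
    have "transfer w E (c + k * int l) l = T" using transfer_periodic[OF per, of E c k l] by (simp add: T_def mult.commute)
    moreover have "\<phi> (m + 1) = of_real (E - w m) * \<phi> m - \<phi> (m - 1)" if "c + k * int l \<le> m" "m < c + k * int l + int l" for m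
      using that 1 2 by (intro sol) (auto simp: algebra_simps)
    ultimately show ?thesis using solution_transfer[of "c + k * int l" l \<phi> E w] by (simp add: algebra_simps)
  qed
  have dt: "complex_of_real (T $ 1 $ 1) * of_real (T $ 2 $ 2) - of_real (T $ 1 $ 2) * of_real (T $ 2 $ 1) = 1"
    using arg_cong[OF transfer_det[of w E c l], of complex_of_real] by (simp add: T_def)
  define D where "D = discriminant w E c l"
  have Dt: "complex_of_real D = of_real (T $ 1 $ 1) + of_real (T $ 2 $ 2)" by (simp add: D_def discriminant_def T_def)
  have two: "of_real D * \<phi> (c + k * int l) = \<phi> (c + (k + 1) * int l) + \<phi> (c + (k - 1) * int l)"
    "of_real D * \<phi> (c + k * int l - 1) = \<phi> (c + (k + 1) * int l - 1) + \<phi> (c + (k - 1) * int l - 1)" if k: "\<bar>k\<bar> < int R" for k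
  proof -
    have r1: "\<phi> (c + (k + 1) * int l) = of_real (T $ 1 $ 1) * \<phi> (c + k * int l) + of_real (T $ 1 $ 2) * \<phi> (c + k * int l - 1)"
     "\<phi> (c + (k + 1) * int l - 1) = of_real (T $ 2 $ 1) * \<phi> (c + k * int l) + of_real (T $ 2 $ 2) * \<phi> (c + k * int l - 1)"
      using rel[of k] k by auto
    have r2: "\<phi> (c + k * int l) = of_real (T $ 1 $ 1) * \<phi> (c + (k - 1) * int l) + of_real (T $ 1 $ 2) * \<phi> (c + (k - 1) * int l - 1)"
     "\<phi> (c + k * int l - 1) = of_real (T $ 2 $ 1) * \<phi> (c + (k - 1) * int l) + of_real (T $ 2 $ 2) * \<phi> (c + (k - 1) * int l - 1)"
      using rel[of "k - 1"] k by auto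
    show "of_real D * \<phi> (c + k * int l) = \<phi> (c + (k + 1) * int l) + \<phi> (c + (k - 1) * int l)"
      unfolding Dt using r1(1) r2 dt by algebra
    show "of_real D * \<phi> (c + k * int l - 1) = \<phi> (c + (k + 1) * int l - 1) + \<phi> (c + (k - 1) * int l - 1)"
      unfolding Dt using r1(2) r2 dt by algebra
  qed
  have ineq: "t * cmod a \<le> cmod b + cmod b'" if "of_real D * a = b + b'" for a b b' :: complex
  proof -
    have "t * cmod a \<le> \<bar>D\<bar> * cmod a" using t by (intro mult_right_mono) (auto simp: D_def)
    also have "\<dots> = cmod (b + b')" using that by (metis norm_mult norm_of_real)
    also have "\<dots> \<le> cmod b + cmod b'" by (rule norm_triangle_ineq)
    finally show ?thesis .
  qed
  have rng: "c - int (R * l) \<le> c + k * int l" "c + k * int l \<le> c + int (R * l)" if "\<bar>k\<bar> \<le> int R" for k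
  proof -
    have "- int R * int l \<le> k * int l" using that by (intro mult_right_mono) auto
    then show "c - int (R * l) \<le> c + k * int l" by simp
    have "k * int l \<le> int R * int l" using that by (intro mult_right_mono) auto
    then show "c + k * int l \<le> c + int (R * l)" by simp
  qed
  have "cmod (\<phi> (c + 0 * int l)) \<le> (2 / t) ^ R * M"
  proof (rule discrete_convexity_decay[OF t(1), where y = "\<lambda>k. \<phi> (c + k * int l)"])
    show "cmod (\<phi> (c + k * int l)) \<le> M" if "\<bar>k\<bar> \<le> int R" for k using rng[OF that] by (intro M) auto
    show "t * cmod (\<phi> (c + k * int l)) \<le> cmod (\<phi> (c + (k + 1) * int l)) + cmod (\<phi> (c + (k - 1) * int l))" if "\<bar>k\<bar> < int R" for k
      by (rule ineq[OF two(1)[OF that]])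
  qed
  then show "cmod (\<phi> c) \<le> (2 / t) ^ R * M" by simp
  have "cmod (\<phi> (c + 0 * int l - 1)) \<le> (2 / t) ^ R * M"
  proof (rule discrete_convexity_decay[OF t(1), where y = "\<lambda>k. \<phi> (c + k * int l - 1)"])
    show "cmod (\<phi> (c + k * int l - 1)) \<le> M" if "\<bar>k\<bar> \<le> int R" for k using rng[OF that] by (intro M) auto
    show "t * cmod (\<phi> (c + k * int l - 1)) \<le> cmod (\<phi> (c + (k + 1) * int l - 1)) + cmod (\<phi> (c + (k - 1) * int l - 1))" if "\<bar>k\<bar> < int R" for k
      by (rule ineq[OF two(2)[OF that]])
  qed
  then show "cmod (\<phi> (c - 1)) \<le> (2 / t) ^ R * M" by simp
qed

text \<open>For infinite \<open>S\<close> this is zero, by the convention for sums.\<close>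

definition fin_vec :: "int set \<Rightarrow> (int \<Rightarrow> complex) \<Rightarrow> ell2" where
  "fin_vec S \<phi> = (\<Sum>n\<in>S. scaleC (\<phi> n) (delta n))"

lemma coord_fin_vec: "finite S \<Longrightarrow> ell2_coord (fin_vec S \<phi>) n = (if n \<in> S then \<phi> n else 0)"
  by (simp add: fin_vec_def if_distrib cong: if_cong)

text \<open>The span is taken over the reals, hence two vectors for each site.\<close>

lemma fin_vec_in_span:
  "finite S \<Longrightarrow> fin_vec S \<phi> \<in> span (delta ` S \<union> (\<lambda>n. scaleC \<i> (delta n)) ` S)"
proof -
  have eq: "scaleC (\<phi> n) (delta n) = Re (\<phi> n) *\<^sub>R delta n + Im (\<phi> n) *\<^sub>R scaleC \<i> (delta n)" for n
    by (rule ell2_eqI) (simp add: complex_eq_iff)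
  show ?thesis unfolding fin_vec_def
  proof (rule span_sum)
    fix n assume "n \<in> S"
    then show "scaleC (\<phi> n) (delta n) \<in> span (delta ` S \<union> (\<lambda>n. scaleC \<i> (delta n)) ` S)"
      unfolding eq by (intro span_add span_scale span_base) auto
  qed
qed

text \<open>Cutting a Bloch solution off at two consecutive sites where it is tiny gives an approximate
  eigenvector supported in a single period.\<close>

lemma barrier_approx_eigenvector:
  assumes per: "periodic q v" and q: "1 \<le> q" and v: "bounded_pot K v" and a: "approx_eigenvalue (jacobi v) E"
    and w: "periodic l w" "2 < t" "t \<le> \<bar>discriminant w E c l\<bar>"
      "\<And>n. c - int (R * l) \<le> n \<Longrightarrow> n < c + int (R * l) \<Longrightarrow> v n = w n"
  shows "\<exists>u\<in>span (delta ` {c..<c + int q} \<union> (\<lambda>n. scaleC \<i> (delta n)) ` {c..<c + int q}).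
    u \<noteq> 0 \<and> norm (jacobi v u - E *\<^sub>R u) \<le> 4 * (2 / t) ^ R * norm u"
proof -
  \<comment> \<open>The Bloch solution starts at the left end of the barrier.\<close>
  define c0 where "c0 = c - int (R * l)"
  obtain \<phi> :: "int \<Rightarrow> complex" where rec: "\<And>n. n \<ge> c0 \<Longrightarrow> \<phi> (n + 1) = of_real (E - v n) * \<phi> n - \<phi> (n - 1)"
    and quasi: "\<And>n. n \<ge> c0 - 1 \<Longrightarrow> cmod (\<phi> (n + int q)) = cmod (\<phi> n)" and nz: "\<exists>n\<ge>c0-1. \<phi> n \<noteq> 0"
    using bloch_solution[OF per approx_eigenvalue_discriminant[OF per v a], of c0] by blast
  define S where "S = {c..<c + int q}"
  define u where "u = fin_vec S \<phi>"
  have finS: "finite S" by (simp add: S_def)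
  have cu: "ell2_coord u n = (if n \<in> S then \<phi> n else 0)" for n unfolding u_def by (rule coord_fin_vec[OF finS])
  have quasi': "cmod (\<phi> (n + int q * int k)) = cmod (\<phi> n)" if "n \<ge> c0 - 1" for n k
  proof (induction k)
    case (Suc k)
    have "0 \<le> int q * int k" by simp
    then have "n + int q * int k \<ge> c0 - 1" using that by linarith
    from quasi[OF this] show ?case using Suc by (simp add: algebra_simps)
  qed simp
  have le: "cmod (\<phi> n) \<le> norm u" if n: "n \<ge> c0 - 1" for n
  proof -
    define n' where "n' = c + (n - c) mod int q"
    have n'S: "n' \<in> S" using q by (simp add: n'_def S_def)
    have eq: "n = n' + int q * ((n - c) div int q)" by (simp add: n'_def algebra_simps)
    have "cmod (\<phi> n) = cmod (\<phi> n')"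
    proof (cases "0 \<le> (n - c) div int q")
      case True
      have "c \<le> n'" using n'S by (simp add: S_def)
      then have "n' \<ge> c0 - 1" unfolding c0_def by linarith
      from quasi'[OF this, of "nat ((n - c) div int q)"] eq True show ?thesis by simp
    next
      case False
      have "n' = n + int q * int (nat (- ((n - c) div int q)))" using eq False by simp
      then show ?thesis using quasi'[OF n, of "nat (- ((n - c) div int q))"] by simp
    qed
    also have "\<dots> \<le> norm u" using coord_le_norm[of u n'] n'S by (simp add: cu)
    finally show ?thesis .
  qed
  have u0: "u \<noteq> 0" using nz le by (metis norm_le_zero_iff norm_zero)
  have dec: "cmod (\<phi> c) \<le> (2 / t) ^ R * norm u" "cmod (\<phi> (c - 1)) \<le> (2 / t) ^ R * norm u"
  proof -
    have sol: "\<phi> (m + 1) = of_real (E - w m) * \<phi> m - \<phi> (m - 1)" if "c - int (R * l) \<le> m" "m < c + int (R * l)" for m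
      using rec[of m] w(4)[OF that] that by (simp add: c0_def)
    have M: "cmod (\<phi> m) \<le> norm u" if "c - int (R * l) - 1 \<le> m" "m \<le> c + int (R * l)" for m
      using that by (intro le) (simp add: c0_def)
    show "cmod (\<phi> c) \<le> (2 / t) ^ R * norm u" "cmod (\<phi> (c - 1)) \<le> (2 / t) ^ R * norm u"
      by (rule barrier_decay[OF w(1,2,3) sol M]; assumption)+
  qed
  have cq: "cmod (\<phi> (c + int q)) = cmod (\<phi> c)" "cmod (\<phi> (c + int q - 1)) = cmod (\<phi> (c - 1))"
    using quasi[of c] quasi[of "c - 1"] by (auto simp: c0_def algebra_simps)
  \<comment> \<open>The cut-off leaves errors at the four sites next to the two cuts.\<close>
  have J: "jacobi v u - E *\<^sub>R u = scaleC (- \<phi> (c - 1)) (delta c) + scaleC (\<phi> c) (delta (c - 1))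
     + scaleC (- \<phi> (c + int q)) (delta (c + int q - 1)) + scaleC (\<phi> (c + int q - 1)) (delta (c + int q))" (is "_ = ?r")
  proof (rule ell2_eqI)
    fix n
    have L: "ell2_coord (jacobi v u - E *\<^sub>R u) n = ell2_coord u (n + 1) + ell2_coord u (n - 1) + of_real (v n - E) * ell2_coord u n"
      by (simp add: coord_jacobi[OF v] algebra_simps)
    consider "n < c - 1 \<or> n > c + int q" | "n = c - 1" | "n = c + int q" | "n \<in> S" by (fastforce simp: S_def)
    then show "ell2_coord (jacobi v u - E *\<^sub>R u) n = ell2_coord ?r n"
    proof cases
      case 1
      then show ?thesis unfolding L using q by (auto simp: cu S_def)
    next
      case 2
      then show ?thesis unfolding L using q by (auto simp: cu S_def)
    next
      case 3
      then show ?thesis unfolding L using q by (auto simp: cu S_def)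
    next
      case 4
      have "c \<le> n" using 4 by (simp add: S_def)
      then have "c0 \<le> n" unfolding c0_def by linarith
      then have "\<phi> (n + 1) = of_real (E - v n) * \<phi> n - \<phi> (n - 1)" by (rule rec)
      then have r: "of_real (v n - E) * \<phi> n = - \<phi> (n + 1) - \<phi> (n - 1)" by (simp add: algebra_simps)
      have un: "ell2_coord u n = \<phi> n" using 4 by (simp add: cu)
      show ?thesis unfolding L un r using 4 q by (cases "q = 1") (auto simp: cu S_def)
    qed
  qed
  have "norm (jacobi v u - E *\<^sub>R u) \<le> cmod (\<phi> (c - 1)) + cmod (\<phi> c) + cmod (\<phi> (c + int q)) + cmod (\<phi> (c + int q - 1))"
    unfolding J by (intro norm_triangle_le add_mono) auto
  also have "\<dots> \<le> 4 * (2 / t) ^ R * norm u" using dec cq by linarith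
  finally have "norm (jacobi v u - E *\<^sub>R u) \<le> 4 * (2 / t) ^ R * norm u" .
  moreover have "u \<in> span (delta ` S \<union> (\<lambda>n. scaleC \<i> (delta n)) ` S)"
    unfolding u_def by (rule fin_vec_in_span[OF finS])
  ultimately show ?thesis using u0 unfolding S_def by (intro bexI[of _ u] conjI)
qed

text \<open>Approximate eigenvectors for separated values are almost orthogonal and therefore linearly
  independent if there are at most \<open>card T + 1\<close> of them; hence a separated set has at most
  \<open>card T\<close> elements, and the intervals around a maximal separated set cover.\<close>

lemma approx_eigenvalues_cover:
  assumes A: "selfadj A" and T: "finite T" "T \<noteq> {}" and \<eta>: "0 < \<eta>"
    and Z: "\<And>x. x \<in> Z \<Longrightarrow> \<exists>u\<in>span T. u \<noteq> 0 \<and> norm (A u - x *\<^sub>R u) \<le> \<eta> * norm u"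
  shows "\<exists>F. finite F \<and> card F \<le> card T \<and> Z \<subseteq> (\<Union>x\<in>F. {x - 4 * \<eta> * card T .. x + 4 * \<eta> * card T})"
proof -
  define d where "d = card T"
  have d1: "1 \<le> d" using T by (simp add: d_def Suc_le_eq card_gt_0_iff)
  \<comment> \<open>For values at distance above \<open>\<rho>\<close> the inner product is at most \<open>2 \<eta> / \<rho> = 1 / (2 d)\<close>.\<close>
  define \<rho> where "\<rho> = 4 * \<eta> * d"
  have \<rho>0: "0 < \<rho>" using \<eta> d1 by (simp add: \<rho>_def)
  have "\<exists>u. \<forall>x\<in>Z. u x \<in> span T \<and> norm (u x) = 1 \<and> norm (A (u x) - x *\<^sub>R u x) \<le> \<eta>"
  proof (rule bchoice, rule ballI)
    fix x assume "x \<in> Z"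
    then obtain y where y: "y \<in> span T" "y \<noteq> 0" "norm (A y - x *\<^sub>R y) \<le> \<eta> * norm y" using Z by blast
    define w where "w = (1 / norm y) *\<^sub>R y"
    have "A w - x *\<^sub>R w = (1 / norm y) *\<^sub>R (A y - x *\<^sub>R y)"
      by (simp add: w_def selfadjD(7)[OF A] scaleR_diff_right)
    then have "norm (A w - x *\<^sub>R w) \<le> \<eta>" using y(2,3) by (simp add: divide_le_eq)
    then show "\<exists>w. w \<in> span T \<and> norm w = 1 \<and> norm (A w - x *\<^sub>R w) \<le> \<eta>"
      using y by (intro exI[of _ w]) (auto simp: w_def span_scale)
  qed
  then obtain u where u: "\<And>x. x \<in> Z \<Longrightarrow> u x \<in> span T" "\<And>x. x \<in> Z \<Longrightarrow> norm (u x) = 1" "\<And>x. x \<in> Z \<Longrightarrow> norm (A (u x) - x *\<^sub>R u x) \<le> \<eta>"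
    by blast
  have orth: "\<bar>inner (u x) (u y)\<bar> \<le> 1 / (2 * d)" if xy: "x \<in> Z" "y \<in> Z" "\<rho> < \<bar>x - y\<bar>" for x y
  proof -
    have "(x - y) * inner (u x) (u y) = inner (u x) (A (u y) - y *\<^sub>R u y) - inner (A (u x) - x *\<^sub>R u x) (u y)"
      by (simp add: inner_diff_left inner_diff_right selfadjD(4)[OF A] algebra_simps)
    also have "\<bar>\<dots>\<bar> \<le> \<bar>inner (u x) (A (u y) - y *\<^sub>R u y)\<bar> + \<bar>inner (A (u x) - x *\<^sub>R u x) (u y)\<bar>" by simp
    also have "\<dots> \<le> \<eta> + \<eta>"
      using Cauchy_Schwarz_ineq2[of "u x" "A (u y) - y *\<^sub>R u y"] Cauchy_Schwarz_ineq2[of "A (u x) - x *\<^sub>R u x" "u y"] u(2,3)[OF xy(1)] u(2,3)[OF xy(2)]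
      by simp
    finally have "\<bar>x - y\<bar> * \<bar>inner (u x) (u y)\<bar> \<le> 2 * \<eta>" by (simp add: abs_mult)
    moreover have "\<rho> * \<bar>inner (u x) (u y)\<bar> \<le> \<bar>x - y\<bar> * \<bar>inner (u x) (u y)\<bar>" using xy(3) by (intro mult_right_mono) auto
    ultimately have "\<rho> * \<bar>inner (u x) (u y)\<bar> \<le> 2 * \<eta>" by linarith
    then show ?thesis using \<eta> d1 by (simp add: \<rho>_def field_simps)
  qed
  define sep where "sep F \<longleftrightarrow> finite F \<and> F \<subseteq> Z \<and> (\<forall>x\<in>F. \<forall>y\<in>F. x \<noteq> y \<longrightarrow> \<rho> < \<bar>x - y\<bar>)" for F
  have card_sep: "card F \<le> d" if F: "sep F" for F
  proof (rule ccontr)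
    assume "\<not> card F \<le> d"
    then obtain G where G: "G \<subseteq> F" "card G = d + 1" by (metis obtain_subset_with_card_n not_less_eq_eq Suc_eq_plus1)
    have finG: "finite G" using G by (metis card_eq_0_iff add_is_0 one_neq_zero)
    have inj: "inj_on u G"
    proof (rule inj_onI, rule ccontr)
      fix x y assume xy: "x \<in> G" "y \<in> G" "u x = u y" "x \<noteq> y"
      then have "\<bar>inner (u x) (u y)\<bar> \<le> 1 / (2 * d)" using G F by (intro orth) (auto simp: sep_def)
      moreover have "inner (u x) (u y) = 1" using xy u(2)[of x] G F by (auto simp: sep_def power2_norm_eq_inner[symmetric])
      ultimately show False using d1 by (simp add: le_divide_eq)
    qed
    have "independent (u ` G)"
    proof (rule independent_if_scalars_zero)
      fix f b assume s: "(\<Sum>b\<in>u ` G. f b *\<^sub>R b) = 0" and "b \<in> u ` G"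
      \<comment> \<open>In a linear relation, the largest coefficient is at most half of itself, because \<open>d\<close>
        other terms contribute at most \<open>1 / (2 d)\<close> of it each.\<close>
      define m where "m = Max ((\<lambda>b. \<bar>f b\<bar>) ` u ` G)"
      have mle: "\<bar>f b\<bar> \<le> m" if "b \<in> u ` G" for b using that finG by (auto simp: m_def)
      have "m \<in> (\<lambda>b. \<bar>f b\<bar>) ` u ` G" unfolding m_def using finG \<open>b \<in> u ` G\<close> by (intro Max_in) auto
      then obtain x where x: "x \<in> G" "m = \<bar>f (u x)\<bar>" by auto
      have "0 = inner (\<Sum>b\<in>u ` G. f b *\<^sub>R b) (u x)" by (simp add: s)
      also have "\<dots> = (\<Sum>y\<in>G. f (u y) * inner (u y) (u x))"
        by (simp add: sum.reindex[OF inj] inner_sum_left)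
      also have "\<dots> = f (u x) * inner (u x) (u x) + (\<Sum>y\<in>G - {x}. f (u y) * inner (u y) (u x))"
        using finG x by (simp add: sum.remove)
      finally have "f (u x) = - (\<Sum>y\<in>G - {x}. f (u y) * inner (u y) (u x))"
        using u(2)[of x] x G F by (auto simp: sep_def power2_norm_eq_inner[symmetric])
      then have "m = \<bar>\<Sum>y\<in>G - {x}. f (u y) * inner (u y) (u x)\<bar>" using x(2) by simp
      also have "\<dots> \<le> (\<Sum>y\<in>G - {x}. m * (1 / (2 * d)))"
      proof (rule order_trans[OF sum_abs sum_mono])
        fix y assume y: "y \<in> G - {x}"
        have "\<bar>inner (u y) (u x)\<bar> \<le> 1 / (2 * d)" using y x G F by (intro orth) (auto simp: sep_def)
        then show "\<bar>f (u y) * inner (u y) (u x)\<bar> \<le> m * (1 / (2 * d))"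
          unfolding abs_mult using y mle[of "u y"] x(2) by (intro mult_mono) auto
      qed
      also have "\<dots> = m / 2" using G(2) x d1 finG by simp
      finally have "m \<le> 0" by simp
      then show "f b = 0" using mle[OF \<open>b \<in> u ` G\<close>] by simp
    qed (use finG in simp)
    moreover have "u ` G \<subseteq> span T" using u(1) G F by (auto simp: sep_def)
    ultimately have "card (u ` G) \<le> card T" using independent_span_bound[OF T(1)] by blast
    then show False using card_image[OF inj] G(2) by (simp add: d_def)
  qed
  have "sep {}" by (simp add: sep_def)
  then have "\<exists>F. sep F \<and> (\<forall>G. sep G \<longrightarrow> card G \<le> card F)"
    by (rule ex_has_greatest_nat[where f = card and b = "Suc d"]) (auto simp: less_Suc_eq_le intro: card_sep)
  then obtain F where F: "sep F" "\<And>G. sep G \<Longrightarrow> card G \<le> card F" by blast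
  have "Z \<subseteq> (\<Union>x\<in>F. {x - \<rho>..x + \<rho>})"
  proof
    fix y assume y: "y \<in> Z"
    show "y \<in> (\<Union>x\<in>F. {x - \<rho>..x + \<rho>})"
    proof (rule ccontr)
      assume far: "y \<notin> (\<Union>x\<in>F. {x - \<rho>..x + \<rho>})"
      then have nF: "y \<notin> F" using \<rho>0 by force
      have far': "\<rho> < \<bar>x - y\<bar>" if "x \<in> F" for x using far that by (auto simp: not_le abs_if)
      have "sep (insert y F)"
        using F(1) y far' by (auto simp: sep_def abs_minus_commute)
      then have "card (insert y F) \<le> card F" by (rule F(2))
      then show False using nF F(1) by (simp add: sep_def)
    qed
  qed
  then show ?thesis using F(1) card_sep[OF F(1)] by (auto simp: sep_def \<rho>_def d_def intro!: exI[of _ F])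
qed

lemma closed_approx_eigenvalues: "closed {x. approx_eigenvalue A x}"
  unfolding closed_sequential_limits
proof (intro allI impI, elim conjE)
  fix f :: "nat \<Rightarrow> real" and x assume f: "\<forall>n. f n \<in> {x. approx_eigenvalue A x}" "f \<longlonglongrightarrow> x"
  show "x \<in> {x. approx_eigenvalue A x}"
    unfolding mem_Collect_eq approx_eigenvalue_def
  proof (intro allI impI)
    fix e :: real assume e: "0 < e"
    obtain n where n: "dist (f n) x < e / 2"
      using metric_LIMSEQ_D[OF f(2), of "e / 2"] e by auto
    obtain \<psi> where \<psi>: "\<psi> \<noteq> 0" "norm (A \<psi> - f n *\<^sub>R \<psi>) \<le> e / 2 * norm \<psi>"
    proof -
      have "approx_eigenvalue A (f n)" using f(1) by simp
      moreover have "0 < e / 2" using e by simp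
      ultimately show ?thesis using that unfolding approx_eigenvalue_def by blast
    qed
    have "A \<psi> - x *\<^sub>R \<psi> = (A \<psi> - f n *\<^sub>R \<psi>) + (f n - x) *\<^sub>R \<psi>" by (simp add: scaleR_diff_left)
    then have "norm (A \<psi> - x *\<^sub>R \<psi>) \<le> norm (A \<psi> - f n *\<^sub>R \<psi>) + \<bar>f n - x\<bar> * norm \<psi>"
      by (metis norm_scaleR norm_triangle_ineq real_norm_def)
    also have "\<dots> \<le> e / 2 * norm \<psi> + e / 2 * norm \<psi>"
      using \<psi>(2) n by (intro add_mono mult_right_mono) (auto simp: dist_real_def)
    finally have "norm (A \<psi> - x *\<^sub>R \<psi>) \<le> e * norm \<psi>" by simp
    with \<psi>(1) show "\<exists>\<psi>. \<psi> \<noteq> 0 \<and> norm (A \<psi> - x *\<^sub>R \<psi>) \<le> e * norm \<psi>" by blast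
  qed
qed

lemma approx_eigenvalue_bound:
  assumes "approx_eigenvalue A x" "\<And>\<psi>. norm (A \<psi>) \<le> r * norm \<psi>"
  shows "\<bar>x\<bar> \<le> r"
proof (rule ccontr)
  assume "\<not> ?thesis"
  then have "0 < (\<bar>x\<bar> - r) / 2" by simp
  then obtain \<psi> where \<psi>: "\<psi> \<noteq> 0" "norm (A \<psi> - x *\<^sub>R \<psi>) \<le> (\<bar>x\<bar> - r) / 2 * norm \<psi>"
    using assms(1) unfolding approx_eigenvalue_def by blast
  have "\<bar>x\<bar> * norm \<psi> = norm (A \<psi> - (A \<psi> - x *\<^sub>R \<psi>))" by simp
  also have "\<dots> \<le> norm (A \<psi>) + norm (A \<psi> - x *\<^sub>R \<psi>)" by (rule norm_triangle_ineq4)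
  also have "\<dots> \<le> r * norm \<psi> + (\<bar>x\<bar> - r) / 2 * norm \<psi>" using assms(2) \<psi>(2) by (intro add_mono) auto
  finally have "(\<bar>x\<bar> - (r + (\<bar>x\<bar> - r) / 2)) * norm \<psi> \<le> 0" by (simp add: algebra_simps)
  then have "\<bar>x\<bar> - (r + (\<bar>x\<bar> - r) / 2) \<le> 0" using \<psi>(1) by (simp add: mult_le_0_iff)
  then show False using \<open>0 < (\<bar>x\<bar> - r) / 2\<close> by (simp add: field_simps)
qed

text \<open>Each word deals with the energies at which it is hyperbolic. By the cut-off argument they
  have approximate eigenvectors with error \<open>\<eta> = 4 (2/t)^R\<close> in a space of real dimension \<open>2 q\<close>, so
  they are covered by \<open>2 q\<close> intervals of radius \<open>8 \<eta> q\<close>.\<close>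

theorem thin_spectrum:
  assumes per: "periodic q v" and q: "1 \<le> q" and v: "bounded_pot K v" and t: "2 < t"
    and w: "\<And>i. i < m \<Longrightarrow> periodic (l i) (w i)"
      "\<And>i n. i < m \<Longrightarrow> c i - int (R * l i) \<le> n \<Longrightarrow> n < c i + int (R * l i) \<Longrightarrow> v n = w i n"
    and cov: "\<And>E. E \<in> {-(2+K)..2+K} \<Longrightarrow> \<exists>i<m. t \<le> \<bar>discriminant (w i) E (c i) (l i)\<bar>"
  shows "emeasure lborel {x. approx_eigenvalue (jacobi v) x} \<le> ennreal (real m * (128 * (real q)\<^sup>2 * (2 / t) ^ R))"
proof -
  define \<eta> where "\<eta> = 4 * (2 / t) ^ R"
  have \<eta>0: "0 < \<eta>" using t by (simp add: \<eta>_def)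
  define Z where "Z i = {x. approx_eigenvalue (jacobi v) x \<and> t \<le> \<bar>discriminant (w i) x (c i) (l i)\<bar>}" for i
  define d where "d = 8 * \<eta> * real q"
  have "\<exists>F. finite F \<and> card F \<le> 2 * q \<and> Z i \<subseteq> (\<Union>x\<in>F. {x - d .. x + d})" if i: "i < m" for i
  proof -
    define T where "T = delta ` {c i..<c i + int q} \<union> (\<lambda>n. scaleC \<i> (delta n)) ` {c i..<c i + int q}"
    have T: "finite T" "T \<noteq> {}" using q by (auto simp: T_def)
    have cT: "card T \<le> 2 * q"
    proof -
      have "card T \<le> card (delta ` {c i..<c i + int q}) + card ((\<lambda>n. scaleC \<i> (delta n)) ` {c i..<c i + int q})"
        unfolding T_def by (rule card_Un_le)
      also have "\<dots> \<le> card {c i..<c i + int q} + card {c i..<c i + int q}" by (intro add_mono card_image_le) auto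
      finally show ?thesis by simp
    qed
    have "\<exists>u\<in>span T. u \<noteq> 0 \<and> norm (jacobi v u - x *\<^sub>R u) \<le> \<eta> * norm u" if x: "x \<in> Z i" for x
    proof -
      have a: "approx_eigenvalue (jacobi v) x" and dt: "t \<le> \<bar>discriminant (w i) x (c i) (l i)\<bar>"
        using x by (simp_all add: Z_def)
      show ?thesis unfolding T_def \<eta>_def
        by (rule barrier_approx_eigenvector[OF per q v a w(1)[OF i] t dt w(2)[OF i]])
    qed
    from approx_eigenvalues_cover[OF selfadj_jacobi[OF v] T \<eta>0 this]
    obtain F where F: "finite F" "card F \<le> card T" "Z i \<subseteq> (\<Union>x\<in>F. {x - 4 * \<eta> * card T .. x + 4 * \<eta> * card T})" by blast
    have "4 * \<eta> * real (card T) \<le> d"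
      unfolding d_def using mult_left_mono[of "real (card T)" "real (2 * q)" "4 * \<eta>"] cT \<eta>0 by simp
    then have "(\<Union>x\<in>F. {x - 4 * \<eta> * card T .. x + 4 * \<eta> * card T}) \<subseteq> (\<Union>x\<in>F. {x - d .. x + d})"
      by (intro UN_mono) auto
    then show ?thesis using F cT by (intro exI[of _ F]) auto
  qed
  then obtain F where F: "\<And>i. i < m \<Longrightarrow> finite (F i)" "\<And>i. i < m \<Longrightarrow> card (F i) \<le> 2 * q"
    "\<And>i. i < m \<Longrightarrow> Z i \<subseteq> (\<Union>x\<in>F i. {x - d .. x + d})" by metis
  have d0: "0 \<le> d" using \<eta>0 by (simp add: d_def)
  have "{x. approx_eigenvalue (jacobi v) x} \<subseteq> (\<Union>i<m. \<Union>x\<in>F i. {x - d .. x + d})"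
  proof
    fix x assume "x \<in> {x. approx_eigenvalue (jacobi v) x}"
    then have a: "approx_eigenvalue (jacobi v) x" by simp
    have "\<bar>x\<bar> \<le> 2 + K" by (rule approx_eigenvalue_bound[OF a norm_jacobi[OF v]])
    then obtain i where "i < m" "x \<in> Z i" using cov[of x] a by (auto simp: Z_def abs_le_iff)
    then show "x \<in> (\<Union>i<m. \<Union>x\<in>F i. {x - d .. x + d})" using F(3) by blast
  qed
  then have "emeasure lborel {x. approx_eigenvalue (jacobi v) x} \<le> emeasure lborel (\<Union>i<m. \<Union>x\<in>F i. {x - d .. x + d})"
    using F(1) by (intro emeasure_mono) (auto intro!: sets.finite_UN)
  also have "\<dots> \<le> (\<Sum>i<m. emeasure lborel (\<Union>x\<in>F i. {x - d .. x + d}))"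
    using F(1) by (intro emeasure_subadditive_finite) (auto intro!: sets.finite_UN)
  also have "\<dots> \<le> (\<Sum>i<m. ennreal (128 * (real q)\<^sup>2 * (2 / t) ^ R))"
  proof (rule sum_mono)
    fix i assume "i \<in> {..<m}"
    then have i: "i < m" by simp
    have "emeasure lborel (\<Union>x\<in>F i. {x - d .. x + d}) \<le> (\<Sum>x\<in>F i. emeasure lborel {x - d .. x + d})"
      using F(1)[OF i] by (intro emeasure_subadditive_finite) auto
    also have "\<dots> = (\<Sum>x\<in>F i. ennreal (2 * d))" using d0 by (intro sum.cong) auto
    also have "\<dots> = ennreal (real (card (F i)) * (2 * d))" using d0 by (simp add: ennreal_mult ennreal_of_nat_eq_real_of_nat)
    also have "\<dots> \<le> ennreal (real (2 * q) * (2 * d))"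
      using F(2)[OF i] d0 by (intro ennreal_leI mult_right_mono) auto
    also have "real (2 * q) * (2 * d) = 128 * (real q)\<^sup>2 * (2 / t) ^ R"
      by (simp add: d_def \<eta>_def power2_eq_square)
    finally show "emeasure lborel (\<Union>x\<in>F i. {x - d .. x + d}) \<le> ennreal (128 * (real q)\<^sup>2 * (2 / t) ^ R)" .
  qed
  also have "\<dots> = ennreal (real m * (128 * (real q)\<^sup>2 * (2 / t) ^ R))"
    using t by (simp add: ennreal_mult ennreal_of_nat_eq_real_of_nat)
  finally show ?thesis .
qed

section \<open>Spectral covering of an interval\<close>

text \<open>Frequency and phase as real numbers, so that they can be perturbed without reference to the
  topology of the circle.\<close>

abbreviation line_pot :: "real \<Rightarrow> (circle \<Rightarrow>\<^sub>C real) \<Rightarrow> real \<Rightarrow> int \<Rightarrow> real" where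
  "line_pot a f x \<equiv> pot (to_circle a) f (to_circle x)"

lemma line_pot_eq: "line_pot a f x n = f (to_circle (x + of_int n * a))"
  by (simp add: pot_def zmult_to_circle to_circle_add)

text \<open>The phase may depend on the energy: the interval is covered by the union of the spectra up
  to the precision \<open>d\<close>.\<close>

definition covers :: "real \<Rightarrow> real \<Rightarrow> (circle \<Rightarrow>\<^sub>C real) \<Rightarrow> real set \<Rightarrow> bool" where
  "covers d a f I \<longleftrightarrow> (\<forall>E\<in>I. \<exists>x \<psi>. \<psi> \<noteq> 0 \<and> norm (jacobi (line_pot a f x) \<psi> - E *\<^sub>R \<psi>) \<le> d * norm \<psi>)"

definition covers_exactly :: "real \<Rightarrow> (circle \<Rightarrow>\<^sub>C real) \<Rightarrow> real set \<Rightarrow> bool" where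
  "covers_exactly a f I \<longleftrightarrow> (\<forall>E\<in>I. \<exists>x. approx_eigenvalue (jacobi (line_pot a f x)) E)"

lemma covers_exactly_imp_covers: "covers_exactly a f I \<Longrightarrow> 0 < d \<Longrightarrow> covers d a f I"
  unfolding covers_exactly_def covers_def approx_eigenvalue_def by blast

lemma fin_vec_approx:
  assumes "0 < e"
  shows "\<exists>F. finite F \<and> norm (\<psi> - fin_vec F (ell2_coord \<psi>)) \<le> e"
proof -
  have "((\<lambda>n. (cmod (ell2_coord \<psi> n))\<^sup>2) has_sum (norm \<psi>)\<^sup>2) UNIV"
    unfolding norm_ell2_sq using summable_coord by (rule has_sum_infsum)
  then have "((\<lambda>F. \<Sum>n\<in>F. (cmod (ell2_coord \<psi> n))\<^sup>2) \<longlongrightarrow> (norm \<psi>)\<^sup>2) (finite_subsets_at_top UNIV)"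
    by (simp add: has_sum_def)
  then have "\<forall>\<^sub>F F in finite_subsets_at_top UNIV. (norm \<psi>)\<^sup>2 - e\<^sup>2 < (\<Sum>n\<in>F. (cmod (ell2_coord \<psi> n))\<^sup>2)"
    by (rule order_tendstoD) (use assms in simp)
  then obtain F where F: "finite F" "(norm \<psi>)\<^sup>2 - e\<^sup>2 < (\<Sum>n\<in>F. (cmod (ell2_coord \<psi> n))\<^sup>2)"
    by (auto simp: eventually_finite_subsets_at_top)
  have "norm (\<psi> - fin_vec F (ell2_coord \<psi>)) \<le> e"
  proof (subst norm_le_iff_finite)
    show "\<forall>G. finite G \<longrightarrow> (\<Sum>n\<in>G. (cmod (ell2_coord (\<psi> - fin_vec F (ell2_coord \<psi>)) n))\<^sup>2) \<le> e\<^sup>2"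
    proof (intro allI impI)
      fix G :: "int set" assume G: "finite G"
      have "(\<Sum>n\<in>G. (cmod (ell2_coord (\<psi> - fin_vec F (ell2_coord \<psi>)) n))\<^sup>2) = (\<Sum>n\<in>G - F. (cmod (ell2_coord \<psi> n))\<^sup>2)"
        using G F(1) by (intro sum.mono_neutral_cong_right) (auto simp: coord_fin_vec)
      also have "\<dots> = (\<Sum>n\<in>(G - F) \<union> F. (cmod (ell2_coord \<psi> n))\<^sup>2) - (\<Sum>n\<in>F. (cmod (ell2_coord \<psi> n))\<^sup>2)"
        using G F(1) by (subst sum.union_disjoint) auto
      also have "\<dots> \<le> (norm \<psi>)\<^sup>2 - (\<Sum>n\<in>F. (cmod (ell2_coord \<psi> n))\<^sup>2)"
        using G F(1) by (intro diff_right_mono sum_coord_le_norm) auto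
      finally show "(\<Sum>n\<in>G. (cmod (ell2_coord (\<psi> - fin_vec F (ell2_coord \<psi>)) n))\<^sup>2) \<le> e\<^sup>2" using F(2) by linarith
    qed
  qed (use assms in simp)
  then show ?thesis using F(1) by blast
qed

text \<open>Truncation changes vector and residual by as little as desired.\<close>

lemma finite_support_approx:
  assumes v: "bounded_pot K v" and \<psi>: "\<psi> \<noteq> 0" "norm (jacobi v \<psi> - E *\<^sub>R \<psi>) \<le> d * norm \<psi>" and \<eta>: "0 < \<eta>"
  shows "\<exists>F u. finite F \<and> (\<forall>n. n \<notin> F \<longrightarrow> ell2_coord u n = 0) \<and> u \<noteq> 0 \<and> norm (jacobi v u - E *\<^sub>R u) \<le> (d + \<eta>) * norm u"
proof -
  have d0: "0 \<le> d" using \<psi> by (metis norm_ge_zero order_trans zero_le_mult_iff zero_less_norm_iff not_le)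
  have K0: "0 \<le> K" by (rule bounded_pot_nonneg[OF v])
  define c where "c = (2 + K) + \<bar>E\<bar> + (d + \<eta>) + 1"
  have c0: "0 < c" using K0 d0 \<eta> by (simp add: c_def)
  define e where "e = min (norm \<psi> / 2) (\<eta> * norm \<psi> / c)"
  have e0: "0 < e" using \<psi>(1) \<eta> c0 by (simp add: e_def)
  obtain F where F: "finite F" "norm (\<psi> - fin_vec F (ell2_coord \<psi>)) \<le> e" using fin_vec_approx[OF e0] by blast
  define u where "u = fin_vec F (ell2_coord \<psi>)"
  have ne: "norm (\<psi> - u) \<le> e" using F by (simp add: u_def)
  have lo: "norm u \<ge> norm \<psi> - e" using norm_triangle_ineq2[of \<psi> u] ne by linarith
  have "norm \<psi> - e \<ge> norm \<psi> / 2" by (simp add: e_def min_def)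
  moreover have "0 < norm \<psi>" using \<psi>(1) by simp
  ultimately have "0 < norm u" using lo by linarith
  then have u0: "u \<noteq> 0" by auto
  note sj = selfadj_jacobi[OF v]
  have "jacobi v u - E *\<^sub>R u = (jacobi v \<psi> - E *\<^sub>R \<psi>) - (jacobi v (\<psi> - u) - E *\<^sub>R (\<psi> - u))"
    by (simp add: selfadjD(6)[OF sj] algebra_simps)
  then have "norm (jacobi v u - E *\<^sub>R u) \<le> norm (jacobi v \<psi> - E *\<^sub>R \<psi>) + norm (jacobi v (\<psi> - u) - E *\<^sub>R (\<psi> - u))"
    by (metis norm_triangle_ineq4)
  also have "norm (jacobi v (\<psi> - u) - E *\<^sub>R (\<psi> - u)) \<le> (2 + K) * norm (\<psi> - u) + \<bar>E\<bar> * norm (\<psi> - u)"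
    using norm_triangle_ineq4[of "jacobi v (\<psi> - u)" "E *\<^sub>R (\<psi> - u)"] norm_jacobi[OF v, of "\<psi> - u"] by simp
  also have "\<dots> \<le> ((2 + K) + \<bar>E\<bar>) * e" using ne K0 by (subst distrib_right[symmetric], intro mult_left_mono) auto
  finally have 1: "norm (jacobi v u - E *\<^sub>R u) \<le> d * norm \<psi> + ((2 + K) + \<bar>E\<bar>) * e" using \<psi>(2) by linarith
  have "c * e \<le> \<eta> * norm \<psi>" using c0 by (simp add: e_def min_def field_simps)
  then have "((2 + K) + \<bar>E\<bar>) * e + (d + \<eta>) * e \<le> \<eta> * norm \<psi>"
    using e0 by (simp add: c_def algebra_simps)
  then have "d * norm \<psi> + ((2 + K) + \<bar>E\<bar>) * e \<le> (d + \<eta>) * (norm \<psi> - e)" by (simp add: algebra_simps)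
  also have "\<dots> \<le> (d + \<eta>) * norm u" using lo d0 \<eta> by (intro mult_left_mono) auto
  finally have "norm (jacobi v u - E *\<^sub>R u) \<le> (d + \<eta>) * norm u" using 1 by linarith
  moreover have "\<forall>n. n \<notin> F \<longrightarrow> ell2_coord u n = 0" by (simp add: u_def coord_fin_vec[OF F(1)])
  ultimately show ?thesis using F(1) u0 by blast
qed

lemma norm_jacobi_diff:
  assumes v: "bounded_pot K v" "bounded_pot K' v'" and c: "0 \<le> c" "\<And>n. ell2_coord \<psi> n \<noteq> 0 \<Longrightarrow> \<bar>v' n - v n\<bar> \<le> c"
  shows "norm (jacobi v' \<psi> - jacobi v \<psi>) \<le> c * norm \<psi>"
proof (rule norm_le_pointwise[OF _ c(1)])
  fix n
  have "ell2_coord (jacobi v' \<psi> - jacobi v \<psi>) n = of_real (v' n - v n) * ell2_coord \<psi> n"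
    by (simp add: coord_jacobi[OF v(1)] coord_jacobi[OF v(2)] algebra_simps)
  then have "cmod (ell2_coord (jacobi v' \<psi> - jacobi v \<psi>) n) = \<bar>v' n - v n\<bar> * cmod (ell2_coord \<psi> n)"
    by (simp only: norm_mult norm_of_real)
  also have "\<dots> \<le> c * cmod (ell2_coord \<psi> n)"
    using c(2)[of n] by (cases "ell2_coord \<psi> n = 0") (auto intro: mult_right_mono)
  finally show "cmod (ell2_coord (jacobi v' \<psi> - jacobi v \<psi>) n) \<le> c * cmod (ell2_coord \<psi> n)" .
qed

lemma continuous_on_line: "continuous_on UNIV (\<lambda>x. apply_bcontfun f (to_circle x))"
  by (rule continuous_on_compose2[OF continuous_on_bcontfun continuous_to_circle]) auto

lemma finite_net:
  assumes "0 < (e::real)"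
  shows "\<exists>N. finite N \<and> N \<subseteq> {b..c} \<and> (\<forall>x\<in>{b..c}. \<exists>y\<in>N. \<bar>x - y\<bar> < e)"
proof -
  have "{b..c} \<subseteq> (\<Union>y\<in>{b..c}. ball y e)" using assms by auto
  then obtain N where "N \<subseteq> {b..c}" "finite N" "{b..c} \<subseteq> (\<Union>y\<in>N. ball y e)"
    using compactE_image[OF compact_Icc, of "{b..c}" "\<lambda>y. ball y e" b c] by (metis open_ball)
  then show ?thesis by (intro exI[of _ N]) (fastforce simp: dist_real_def abs_minus_commute)
qed

text \<open>Finitely many finitely supported test vectors, for a net of energies, witness the covering
  up to a small error, and they see finitely many values of the potential. A third of \<open>\<eta>\<close> each is
  spent on truncating the vectors, on moving the frequency and on the net.\<close>

lemma covers_persists: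
  assumes cov: "covers d a f {b..c}" and \<eta>: "0 < \<eta>"
  shows "\<exists>\<rho>>0. \<forall>a' f'. \<bar>a' - a\<bar> < \<rho> \<longrightarrow> covers (d + \<eta> + dist f' f) a' f' {b..c}"
proof -
  obtain N where N: "finite N" "N \<subseteq> {b..c}" "\<And>E. E \<in> {b..c} \<Longrightarrow> \<exists>y\<in>N. \<bar>E - y\<bar> < \<eta> / 3"
    using finite_net[of "\<eta> / 3" b c] \<eta> by auto
  have "\<exists>\<rho>>0. \<forall>a' f'. \<bar>a' - a\<bar> < \<rho> \<longrightarrow> (\<exists>x u. u \<noteq> 0 \<and> norm (jacobi (line_pot a' f' x) u - y *\<^sub>R u) \<le> (d + 2 * \<eta> / 3 + dist f' f) * norm u)"
    if y: "y \<in> N" for y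
  proof -
    obtain x \<psi> where \<psi>: "\<psi> \<noteq> 0" "norm (jacobi (line_pot a f x) \<psi> - y *\<^sub>R \<psi>) \<le> d * norm \<psi>"
      using cov y N(2) unfolding covers_def by blast
    obtain F u where F: "finite F" "\<And>n. n \<notin> F \<Longrightarrow> ell2_coord u n = 0" "u \<noteq> 0" 
      "norm (jacobi (line_pot a f x) u - y *\<^sub>R u) \<le> (d + \<eta> / 3) * norm u"
      using finite_support_approx[OF bounded_pot_pot \<psi>, of "\<eta> / 3"] \<eta> by auto
    have "\<forall>n\<in>F. \<forall>\<^sub>F a' in nhds a. \<bar>f (to_circle (x + of_int n * a')) - f (to_circle (x + of_int n * a))\<bar> < \<eta> / 3"
    proof
      fix n
      define h where "h a' = f (to_circle (x + of_int n * a'))" for a'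
      have "continuous_on UNIV h" unfolding h_def
        by (rule continuous_on_compose2[OF continuous_on_line]) (auto intro!: continuous_intros)
      then have "isCont h a" by (simp add: continuous_on_eq_continuous_at)
      then have "(h \<longlongrightarrow> h a) (nhds a)" unfolding isCont_def tendsto_at_iff_tendsto_nhds .
      then have "((\<lambda>a'. f (to_circle (x + of_int n * a'))) \<longlongrightarrow> f (to_circle (x + of_int n * a))) (nhds a)"
        unfolding h_def .
      then have "\<forall>\<^sub>F a' in nhds a. dist (f (to_circle (x + of_int n * a'))) (f (to_circle (x + of_int n * a))) < \<eta> / 3"
        using \<eta> by (intro tendstoD) auto
      then show "\<forall>\<^sub>F a' in nhds a. \<bar>f (to_circle (x + of_int n * a')) - f (to_circle (x + of_int n * a))\<bar> < \<eta> / 3"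
        by (simp add: dist_real_def)
    qed
    then have "\<forall>\<^sub>F a' in nhds a. \<forall>n\<in>F. \<bar>f (to_circle (x + of_int n * a')) - f (to_circle (x + of_int n * a))\<bar> < \<eta> / 3"
      using F(1) by (simp add: eventually_ball_finite_distrib)
    then obtain \<rho> where \<rho>: "0 < \<rho>" "\<And>a' n. dist a' a < \<rho> \<Longrightarrow> n \<in> F \<Longrightarrow> \<bar>f (to_circle (x + of_int n * a')) - f (to_circle (x + of_int n * a))\<bar> < \<eta> / 3"
      unfolding eventually_nhds_metric by blast
    have "norm (jacobi (line_pot a' f' x) u - y *\<^sub>R u) \<le> (d + 2 * \<eta> / 3 + dist f' f) * norm u"
      if a': "\<bar>a' - a\<bar> < \<rho>" for a' f'
    proof -
      have "norm (jacobi (line_pot a' f' x) u - jacobi (line_pot a f x) u) \<le> (\<eta> / 3 + dist f' f) * norm u"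
      proof (rule norm_jacobi_diff[OF bounded_pot_pot bounded_pot_pot])
        fix n assume "ell2_coord u n \<noteq> 0"
        then have "n \<in> F" using F(2) by blast
        then have 1: "\<bar>f (to_circle (x + of_int n * a')) - f (to_circle (x + of_int n * a))\<bar> < \<eta> / 3"
          using \<rho>(2) a' by (simp add: dist_real_def)
        have 2: "\<bar>f' (to_circle (x + of_int n * a')) - f (to_circle (x + of_int n * a'))\<bar> \<le> dist f' f"
          using dist_bounded[of f' "to_circle (x + of_int n * a')" f] by (simp only: dist_real_def)
        show "\<bar>line_pot a' f' x n - line_pot a f x n\<bar> \<le> \<eta> / 3 + dist f' f"
          unfolding line_pot_eq using 1 2 by linarith
      qed (use \<eta> in simp)
      then show ?thesis
        using norm_triangle_ineq[of "jacobi (line_pot a' f' x) u - jacobi (line_pot a f x) u" "jacobi (line_pot a f x) u - y *\<^sub>R u"] F(4)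
        by (simp add: algebra_simps)
    qed
    then show ?thesis using \<rho>(1) F(3) by blast
  qed
  then obtain \<rho> where \<rho>: "\<And>y. y \<in> N \<Longrightarrow> 0 < \<rho> y" "\<And>y a' f'. y \<in> N \<Longrightarrow> \<bar>a' - a\<bar> < \<rho> y \<Longrightarrow>
    (\<exists>x u. u \<noteq> 0 \<and> norm (jacobi (line_pot a' f' x) u - y *\<^sub>R u) \<le> (d + 2 * \<eta> / 3 + dist f' f) * norm u)" by metis
  define r where "r = Min (insert 1 (\<rho> ` N))"
  have r: "0 < r" "\<And>y. y \<in> N \<Longrightarrow> r \<le> \<rho> y" using N(1) \<rho>(1) by (auto simp: r_def)
  have "covers (d + \<eta> + dist f' f) a' f' {b..c}" if a': "\<bar>a' - a\<bar> < r" for a' f'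
    unfolding covers_def
  proof
    fix E assume "E \<in> {b..c}"
    then obtain y where y: "y \<in> N" "\<bar>E - y\<bar> < \<eta> / 3" using N(3) by blast
    obtain x u where u: "u \<noteq> 0" "norm (jacobi (line_pot a' f' x) u - y *\<^sub>R u) \<le> (d + 2 * \<eta> / 3 + dist f' f) * norm u"
      using \<rho>(2)[OF y(1), of a' f'] r(2)[OF y(1)] a' by force
    have "jacobi (line_pot a' f' x) u - E *\<^sub>R u = (jacobi (line_pot a' f' x) u - y *\<^sub>R u) + (y - E) *\<^sub>R u"
      by (simp add: algebra_simps)
    then have "norm (jacobi (line_pot a' f' x) u - E *\<^sub>R u) \<le> norm (jacobi (line_pot a' f' x) u - y *\<^sub>R u) + \<bar>y - E\<bar> * norm u"
      by (metis norm_scaleR norm_triangle_ineq)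
    also have "\<dots> \<le> (d + 2 * \<eta> / 3 + dist f' f) * norm u + \<eta> / 3 * norm u"
    proof (intro add_mono mult_right_mono u(2))
      show "\<bar>y - E\<bar> \<le> \<eta> / 3" using y(2) by linarith
    qed simp
    finally show "\<exists>x \<psi>. \<psi> \<noteq> 0 \<and> norm (jacobi (line_pot a' f' x) \<psi> - E *\<^sub>R \<psi>) \<le> (d + \<eta> + dist f' f) * norm \<psi>"
      using u(1) by (intro exI[of _ x] exI[of _ u]) (simp add: algebra_simps)
  qed
  then show ?thesis using r(1) by blast
qed

text \<open>One approximate eigenvector serves all energies near its own.\<close>

lemma covers_some_interval: "0 < d \<Longrightarrow> \<exists>b c. b < c \<and> covers d a f {b..c}"
proof -
  assume d: "0 < d"
  define A where "A = jacobi (line_pot a f 0)"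
  have sA: "selfadj A" unfolding A_def by (rule selfadj_jacobi[OF bounded_pot_pot])
  have "\<exists>E. approx_eigenvalue A E"
  proof (rule ccontr)
    assume "\<nexists>E. approx_eigenvalue A E"
    then have "measure (spec_measure A (delta 0)) UNIV = 0" by (intro spec_measure_null[OF sA]) auto
    then show False using spec_measure(3)[OF sA, of "delta 0"] by simp
  qed
  then obtain E where E: "approx_eigenvalue A E" by blast
  then obtain \<psi> where \<psi>: "\<psi> \<noteq> 0" "norm (A \<psi> - E *\<^sub>R \<psi>) \<le> d / 2 * norm \<psi>"
    using d unfolding approx_eigenvalue_def by (meson half_gt_zero)
  have "covers d a f {E - d / 2..E + d / 2}"
    unfolding covers_def
  proof
    fix x assume x: "x \<in> {E - d / 2..E + d / 2}"
    have "A \<psi> - x *\<^sub>R \<psi> = (A \<psi> - E *\<^sub>R \<psi>) + (E - x) *\<^sub>R \<psi>" by (simp add: algebra_simps)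
    then have "norm (A \<psi> - x *\<^sub>R \<psi>) \<le> norm (A \<psi> - E *\<^sub>R \<psi>) + \<bar>E - x\<bar> * norm \<psi>"
      by (metis norm_scaleR norm_triangle_ineq)
    also have "\<dots> \<le> d / 2 * norm \<psi> + d / 2 * norm \<psi>"
    proof (intro add_mono mult_right_mono)
      show "\<bar>E - x\<bar> \<le> d / 2" using x unfolding atLeastAtMost_iff by linarith
    qed (use \<psi>(2) in auto)
    finally show "\<exists>y \<psi>. \<psi> \<noteq> 0 \<and> norm (jacobi (line_pot a f y) \<psi> - x *\<^sub>R \<psi>) \<le> d * norm \<psi>"
      using \<psi>(1) unfolding A_def by (intro exI[of _ 0] exI[of _ \<psi>]) (auto simp: algebra_simps)
  qed
  then show ?thesis using d by (intro exI[of _ "E - d / 2"] exI[of _ "E + d / 2"]) auto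
qed


section \<open>Step functions on the circle with transition layers\<close>

lemma circle_lift:
  fixes F :: "real \<Rightarrow> real"
  assumes c: "continuous_on UNIV F" and p: "\<And>x k. F (x + of_int k) = F x"
  shows "\<exists>f :: circle \<Rightarrow>\<^sub>C real. \<forall>x. f (to_circle x) = F x"
proof -
  define G where "G \<omega> = F (rep_circle \<omega>)" for \<omega>
  have GF: "G (to_circle x) = F x" for x
  proof -
    have "to_circle (rep_circle (to_circle x)) = to_circle x" using Quotient_abs_rep[OF Quotient_circle] by simp
    then have "rep_circle (to_circle x) - x \<in> \<int>" by (simp add: to_circle_eq_iff)
    then obtain k where "rep_circle (to_circle x) - x = of_int k" by (auto elim: Ints_cases)
    then have "rep_circle (to_circle x) = x + of_int k" by simp
    then show ?thesis using p by (simp add: G_def)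
  qed
  have "continuous_on UNIV G"
  proof -
    have "open (G -` U)" if "open U" for U
    proof -
      have "to_circle -` (G -` U) = F -` U" by (auto simp: GF)
      moreover have "open (F -` U)" using c that by (simp add: continuous_on_open_vimage)
      ultimately show ?thesis by (simp add: open_circle_def)
    qed
    then show ?thesis by (simp add: continuous_on_open_vimage)
  qed
  then have "G \<in> bcontfun" by (simp add: bcontfun_circle)
  then have "apply_bcontfun (Bcontfun G) = G" by (rule Bcontfun_inverse)
  then show ?thesis using GF by (intro exI[of _ "Bcontfun G"]) simp
qed

definition ramp :: "real \<Rightarrow> real \<Rightarrow> real" where
  "ramp k s = max 0 ((s - (1 - k)) / k)"

definition bump :: "real \<Rightarrow> real \<Rightarrow> real" where
  "bump k s = (if s \<le> k then sin (2 * pi * s / k) else 0)"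

text \<open>On the unit cell with index \<open>i\<close> the function equals \<open>c i\<close>, except for a layer at the left
  end on which a full sine wave of amplitude \<open>A\<close> is added and a layer at the right end on which
  the value moves linearly to that of the next cell.\<close>

definition cell_fun :: "real \<Rightarrow> real \<Rightarrow> (int \<Rightarrow> real) \<Rightarrow> real \<Rightarrow> real" where
  "cell_fun k A c y = c \<lfloor>y\<rfloor> + (c (\<lfloor>y\<rfloor> + 1) - c \<lfloor>y\<rfloor>) * ramp k (frac y) + A * bump k (frac y)"

lemma ramp_01: "0 < k \<Longrightarrow> 0 \<le> s \<Longrightarrow> s \<le> 1 \<Longrightarrow> 0 \<le> ramp k s \<and> ramp k s \<le> 1"
  by (auto simp: ramp_def divide_le_eq)

lemma ramp_0: "0 < k \<Longrightarrow> s \<le> 1 - k \<Longrightarrow> ramp k s = 0"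
  by (auto simp: ramp_def max_def divide_le_eq zero_le_divide_iff)

lemma abs_bump: "\<bar>bump k s\<bar> \<le> 1"
  by (simp add: bump_def)

lemma continuous_bump:
  assumes "0 < k" shows "continuous_on UNIV (bump k)"
proof -
  have "continuous_on ({..k} \<union> {k..}) (\<lambda>s. if s \<le> k then sin (2 * pi * s / k) else 0)"
    using assms by (intro continuous_on_If) (auto intro!: continuous_intros)
  moreover have "{..k} \<union> {k..} = UNIV" by auto
  ultimately show ?thesis unfolding bump_def by simp
qed

lemma continuous_cell_fun:
  assumes k: "0 < k" "k < 1"
  shows "continuous_on UNIV (cell_fun k A c)"
proof -
  have piece: "continuous_on {of_int i..of_int i + 1} (cell_fun k A c)" for i :: int
  proof -
    have "continuous_on {of_int i..of_int i + 1} (\<lambda>y. c i + (c (i + 1) - c i) * ramp k (y - of_int i) + A * bump k (y - of_int i))"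
      unfolding ramp_def using k
      by (auto intro!: continuous_intros continuous_on_compose2[OF continuous_bump[OF k(1)]])
    moreover have "c i + (c (i + 1) - c i) * ramp k (y - of_int i) + A * bump k (y - of_int i) = cell_fun k A c y"
      if y: "y \<in> {of_int i..of_int i + 1}" for y
    proof (cases "y = of_int i + 1")
      case True
      have "ramp k 1 = 1" "bump k 1 = 0" "ramp k 0 = 0" "bump k 0 = 0" using k by (auto simp: ramp_def bump_def max_def zero_le_divide_iff)
      moreover have "y = of_int (i + 1)" using True by simp
      then have "\<lfloor>y\<rfloor> = i + 1" "frac y = 0" by (auto simp: frac_def)
      ultimately show ?thesis using True by (simp add: cell_fun_def)
    next
      case False
      then have "\<lfloor>y\<rfloor> = i" using y by (intro floor_unique) auto
      then show ?thesis by (simp add: cell_fun_def frac_def)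
    qed
    ultimately show ?thesis by (rule continuous_on_eq)
  qed
  have big: "continuous_on (\<Union>i\<in>{-m..m}. {of_int i..of_int i + 1}) (cell_fun k A c)" for m :: int
    by (rule continuous_on_closed_Union) (use piece in auto)
  have "isCont (cell_fun k A c) y" for y
  proof -
    define m where "m = \<lceil>\<bar>y\<bar>\<rceil> + 1"
    have m: "\<bar>y\<bar> + 1 \<le> of_int m" unfolding m_def by (simp add: le_of_int_ceiling)
    have "{-of_int m<..<of_int m} \<subseteq> (\<Union>i\<in>{-m..m}. {of_int i..of_int i + 1 :: real})"
    proof
      fix z :: real assume z: "z \<in> {-of_int m<..<of_int m}"
      have "\<lfloor>z\<rfloor> \<in> {-m..m}" using z by (auto simp: le_floor_iff floor_le_iff)
      moreover have "z \<in> {of_int \<lfloor>z\<rfloor>..of_int \<lfloor>z\<rfloor> + 1}" by (simp add: less_imp_le)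
      ultimately show "z \<in> (\<Union>i\<in>{-m..m}. {of_int i..of_int i + 1 :: real})" by blast
    qed
    then have "continuous_on {-of_int m<..<of_int m} (cell_fun k A c)" using big continuous_on_subset by blast
    moreover have "y \<in> {-of_int m<..<of_int m}" using m by (auto simp: abs_le_iff)
    ultimately show ?thesis by (simp add: continuous_on_eq_continuous_at)
  qed
  then show ?thesis by (simp add: continuous_at_imp_continuous_on)
qed

lemma cell_fun_shift:
  assumes "\<And>j. c' j = c (j + i)"
  shows "cell_fun k A c (y + of_int i) = cell_fun k A c' y"
  by (simp add: cell_fun_def assms algebra_simps frac_def)

lemma cell_fun_close:
  assumes k: "0 < k" and c: "\<bar>c \<lfloor>y\<rfloor> - z\<bar> \<le> d" "\<bar>c (\<lfloor>y\<rfloor> + 1) - z\<bar> \<le> d" and A: "0 \<le> A"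
  shows "\<bar>cell_fun k A c y - z\<bar> \<le> d + A"
proof -
  define l where "l = ramp k (frac y)"
  have l: "0 \<le> l" "l \<le> 1" using ramp_01[OF k, of "frac y"] frac_ge_0[of y] frac_lt_1[of y] by (auto simp: l_def less_imp_le)
  have "cell_fun k A c y - z = (1 - l) * (c \<lfloor>y\<rfloor> - z) + l * (c (\<lfloor>y\<rfloor> + 1) - z) + A * bump k (frac y)"
    by (simp add: cell_fun_def l_def algebra_simps)
  also have "\<bar>\<dots>\<bar> \<le> (1 - l) * d + l * d + A * 1"
  proof (intro order_trans[OF abs_triangle_ineq] add_mono)
    show "\<bar>(1 - l) * (c \<lfloor>y\<rfloor> - z)\<bar> \<le> (1 - l) * d" "\<bar>l * (c (\<lfloor>y\<rfloor> + 1) - z)\<bar> \<le> l * d"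
      using l c by (auto simp: abs_mult intro!: mult_left_mono)
    show "\<bar>A * bump k (frac y)\<bar> \<le> A * 1"
      using mult_left_mono[OF abs_bump A, of k "frac y"] A by (simp add: abs_mult)
  qed
  finally show ?thesis by (simp add: algebra_simps)
qed

lemma sin_surj:
  assumes "\<bar>x\<bar> \<le> 1" shows "\<exists>s\<in>{0..1}. sin (2 * pi * s) = x"
proof (cases "0 \<le> x")
  case True
  define s where "s = arcsin x / (2 * pi)"
  have "0 \<le> arcsin x" "arcsin x \<le> pi / 2" using arcsin_bounded[of x] arcsin_le_arcsin[of 0 x] assms True by auto
  then have "s \<in> {0..1}" by (simp add: s_def divide_le_eq)
  moreover have "sin (2 * pi * s) = x" using assms by (simp add: s_def abs_le_iff)
  ultimately show ?thesis by blast
next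
  case False
  define s where "s = (arcsin x + 2 * pi) / (2 * pi)"
  have "- (pi / 2) \<le> arcsin x" "arcsin x \<le> 0" using arcsin_bounded[of x] arcsin_le_arcsin[of x 0] assms False by auto
  then have "s \<in> {0..1}" using pi_gt_zero by (simp add: s_def divide_le_eq)
  moreover have "sin (2 * pi * s) = x" using assms by (simp add: s_def abs_le_iff)
  ultimately show ?thesis by blast
qed

lemma bump_surj:
  assumes "0 < k" "\<bar>x\<bar> \<le> 1" shows "\<exists>s\<in>{0..k}. bump k s = x"
proof -
  obtain s where "s \<in> {0..1}" "sin (2 * pi * s) = x" using sin_surj[OF assms(2)] by blast
  then show ?thesis using assms(1) by (intro bexI[of _ "k * s"]) (auto simp: bump_def mult_left_le mult.assoc)
qed

section \<open>Rational frequencies with thin density of states\<close>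

lemma uniform_modulus:
  fixes f :: "circle \<Rightarrow>\<^sub>C real" and d :: real
  assumes "0 < d"
  shows "\<exists>\<kappa>>0. \<kappa> \<le> 1 \<and> (\<forall>x y. \<bar>x - y\<bar> \<le> \<kappa> \<longrightarrow> \<bar>apply_bcontfun f (to_circle x) - apply_bcontfun f (to_circle y)\<bar> \<le> d)"
proof -
  have "uniformly_continuous_on {-1..2::real} (\<lambda>x. apply_bcontfun f (to_circle x))"
    by (intro compact_uniformly_continuous continuous_on_subset[OF continuous_on_line]) auto
  then obtain e where e: "0 < e" "\<And>x y. x \<in> {-1..2} \<Longrightarrow> y \<in> {-1..2} \<Longrightarrow> dist x y < e \<Longrightarrow>
      dist (apply_bcontfun f (to_circle x)) (apply_bcontfun f (to_circle y)) < d"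
    unfolding uniformly_continuous_on_def using assms by meson
  define \<kappa> where "\<kappa> = min (e / 2) 1"
  have "\<bar>apply_bcontfun f (to_circle x) - apply_bcontfun f (to_circle y)\<bar> \<le> d" if xy: "\<bar>x - y\<bar> \<le> \<kappa>" for x y
  proof -
    define x' where "x' = x - of_int \<lfloor>x\<rfloor>"
    define y' where "y' = y - of_int \<lfloor>x\<rfloor>"
    have eq: "to_circle x = to_circle x'" "to_circle y = to_circle y'" by (simp_all add: to_circle_eq_iff x'_def y'_def)
    have x01: "0 \<le> x'" "x' < 1" unfolding x'_def by linarith+
    have xy': "\<bar>x' - y'\<bar> \<le> \<kappa>" using xy by (simp add: x'_def y'_def)
    have "\<kappa> \<le> 1" "\<kappa> < e" using e(1) by (auto simp: \<kappa>_def)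
    then have "x' \<in> {-1..2}" "y' \<in> {-1..2}" "dist x' y' < e" using x01 xy' by (auto simp: dist_real_def)
    from e(2)[OF this] show ?thesis by (simp add: eq dist_real_def)
  qed
  then show ?thesis using e(1) by (intro exI[of _ \<kappa>]) (auto simp: \<kappa>_def)
qed

text \<open>The barriers have length proportional to \<open>n\<close>, and the exponential decay along them beats the
  square.\<close>

lemma barrier_smallness:
  assumes t: "2 < t" and \<beta>: "0 < \<beta>" and e: "0 < e"
  shows "\<forall>\<^sub>F n in sequentially. real m * (128 * (real n)\<^sup>2 * (2 / t) ^ nat \<lfloor>\<beta> * real n\<rfloor>) < e"
proof -
  define c where "c = \<beta> * ln (t / 2)"
  have lt: "0 < ln (t / 2)" using t by simp
  have c0: "0 < c" using \<beta> lt by (simp add: c_def)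
  have le: "(2 / t) ^ nat \<lfloor>\<beta> * real n\<rfloor> \<le> (t / 2) * exp (- c * real n)" for n
  proof -
    define R where "R = nat \<lfloor>\<beta> * real n\<rfloor>"
    have "0 \<le> \<beta> * real n" using \<beta> by simp
    then have R: "\<beta> * real n - 1 \<le> real R" unfolding R_def by simp
    have "2 / t = exp (- ln (t / 2))" using t by (simp add: exp_minus inverse_eq_divide)
    then have "(2 / t) ^ R = exp (- (real R * ln (t / 2)))" by (simp add: exp_of_nat_mult[symmetric])
    also have "\<dots> \<le> exp (- ((\<beta> * real n - 1) * ln (t / 2)))" using R lt by simp
    also have "- ((\<beta> * real n - 1) * ln (t / 2)) = ln (t / 2) + (- c * real n)" by (simp add: c_def algebra_simps)
    also have "exp (ln (t / 2) + (- c * real n)) = (t / 2) * exp (- c * real n)" unfolding exp_add using t by simp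
    finally show ?thesis by (simp add: R_def)
  qed
  have "(\<lambda>n. real m * (128 * (real n)\<^sup>2 * ((t / 2) * exp (- c * real n)))) \<longlonglongrightarrow> 0"
    using c0 t by real_asymp
  then have "\<forall>\<^sub>F n in sequentially. real m * (128 * (real n)\<^sup>2 * ((t / 2) * exp (- c * real n))) < e"
    using e by (rule order_tendstoD(2))
  then show ?thesis
  proof eventually_elim
    case (elim n)
    have "real m * (128 * (real n)\<^sup>2 * (2 / t) ^ nat \<lfloor>\<beta> * real n\<rfloor>) \<le> real m * (128 * (real n)\<^sup>2 * ((t / 2) * exp (- c * real n)))"
      by (intro mult_left_mono le) auto
    then show ?case using elim by linarith
  qed
qed

text \<open>For \<open>j\<close> up to \<open>\<kappa> Q\<close>, the values of \<open>f\<close> along an orbit of the rotation by \<open>p/q + 1/Q\<close> are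
  within \<open>d\<close> of the \<open>q\<close>-periodic sequence for the rotation by \<open>p/q\<close>. This stretch of the period is
  filled with barrier words, whose numbers of repetitions grow linearly in \<open>Q\<close>; the rest of the
  period is left as it is.\<close>

lemma thin_sampling:
  fixes p :: int and q :: nat
  assumes q: "1 \<le> q" and d: "0 < d" and e: "0 < e"
  shows "\<forall>\<^sub>F M in sequentially. \<exists>g. periodic (q * q * M) g \<and>
    (\<forall>j. \<bar>g j - apply_bcontfun f (to_circle (of_int j * (of_int p / of_nat q + 1 / of_nat (q * q * M))))\<bar> \<le> 2 * d) \<and>
    emeasure lborel {x. approx_eigenvalue (jacobi g) x} < ennreal e"
proof -
  obtain \<kappa> where \<kappa>: "0 < \<kappa>" "\<kappa> \<le> 1" "\<And>x y. \<bar>x - y\<bar> \<le> \<kappa> \<Longrightarrow> \<bar>f (to_circle x) - f (to_circle y)\<bar> \<le> d"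
    using uniform_modulus[OF d, of f] by blast
  define W where "W j = f (to_circle (of_int j * (of_int p / of_nat q)))" for j :: int
  have "periodic q W"
    unfolding periodic_def W_def
  proof
    fix n
    have "real_of_int (n + int q) * (of_int p / of_nat q) - of_int n * (of_int p / of_nat q) = of_int p"
      using q by (simp add: field_simps)
    then have "to_circle (real_of_int (n + int q) * (of_int p / of_nat q)) = to_circle (of_int n * (of_int p / of_nat q))"
      unfolding to_circle_eq_iff by simp
    then show "f (to_circle (real_of_int (n + int q) * (of_int p / of_nat q))) = f (to_circle (of_int n * (of_int p / of_nat q)))" by simp
  qed
  define K where "K = norm f + 2 * d"
  obtain m :: nat and l w t where t: "2 < t" and lw: "\<And>i. i < m \<Longrightarrow> 1 \<le> l i" "\<And>i. i < m \<Longrightarrow> periodic (l i) (w i)"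
      "\<And>i j. i < m \<Longrightarrow> \<bar>w i j - W j\<bar> \<le> d"
    and cov: "\<And>E. E \<in> {-(2+K)..2+K} \<Longrightarrow> \<exists>i<m. t \<le> \<bar>discriminant (w i) E 0 (l i)\<bar>"
    using barrier_family[OF \<open>periodic q W\<close> q d, of "2 + K"] by blast
  have "0 \<le> K" using d by (simp add: K_def)
  then have m0: "0 < m" using cov[of 0] by fastforce
  define L where "L = (\<Sum>i<m. l i)"
  have lL: "l i \<le> L" if "i < m" for i unfolding L_def using that by (intro member_le_sum) auto
  have L0: "0 < L" using lL[OF m0] lw(1)[OF m0] by simp
  \<comment> \<open>With at most \<open>\<beta> Q\<close> repetitions \<open>R\<close> on either side of a center, \<open>m\<close> blocks of length \<open>2 L R\<close>
    fill at most \<open>\<kappa> Q\<close> sites.\<close>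
  define \<beta> where "\<beta> = \<kappa> / (2 * real m * real L)"
  have \<beta>0: "0 < \<beta>" using \<kappa>(1) m0 L0 by (simp add: \<beta>_def)
  obtain n0 where n0: "\<And>n. n \<ge> n0 \<Longrightarrow> real m * (128 * (real n)\<^sup>2 * (2 / t) ^ nat \<lfloor>\<beta> * real n\<rfloor>) < e"
    using barrier_smallness[OF t \<beta>0 e] by (auto simp: eventually_sequentially)
  have "\<exists>g. periodic (q * q * M) g \<and>
    (\<forall>j. \<bar>g j - f (to_circle (of_int j * (of_int p / of_nat q + 1 / of_nat (q * q * M))))\<bar> \<le> 2 * d) \<and>
    emeasure lborel {x. approx_eigenvalue (jacobi g) x} < ennreal e" if M: "M \<ge> max 1 n0" for M
  proof -
    define Q where "Q = q * q * M"
    have Q0: "0 < Q" using q M by (simp add: Q_def)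
    have "M \<le> Q" using q by (simp add: Q_def)
    then have Qn0: "n0 \<le> Q" using M by linarith
    define a where "a = of_int p / of_nat q + 1 / real Q"
    define R where "R = nat \<lfloor>\<beta> * real Q\<rfloor>"
    define P where "P = 2 * L * R"
    have "real R \<le> \<beta> * real Q" unfolding R_def using \<beta>0 by (simp add: of_nat_nat)
    then have "real (m * P) \<le> real (2 * m * L) * (\<beta> * real Q)"
      using mult_left_mono[of "real R" "\<beta> * real Q" "real (2 * m * L)"] by (simp add: P_def mult_ac)
    also have "\<dots> = \<kappa> * real Q" using m0 L0 by (simp add: \<beta>_def)
    finally have mP: "real (m * P) \<le> \<kappa> * real Q" .
    also have "\<dots> \<le> real Q" using mult_right_mono[OF \<kappa>(2), of "real Q"] by simp
    finally have mPQ: "m * P \<le> Q" by (simp only: of_nat_le_iff)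
    define h where "h r = (if r < int (m * P) then w (nat (r div int P)) r else f (to_circle (of_int r * a)))" for r
    define g where "g j = h (j mod int Q)" for j
    have per: "periodic Q g" by (simp add: periodic_def g_def)
    have Qa: "real Q * a = of_int (p * int (q * M) + 1)" using q Q0 by (simp add: a_def Q_def field_simps)
    have close: "\<bar>g j - f (to_circle (of_int j * a))\<bar> \<le> 2 * d" for j
    proof -
      define r where "r = j mod int Q"
      have r: "0 \<le> r" "r < int Q" using Q0 by (auto simp: r_def)
      have "j = r + int Q * (j div int Q)" by (simp add: r_def)
      then have "of_int j * a - of_int r * a = of_int (j div int Q) * (real Q * a)"
        by (metis (no_types, opaque_lifting) add_diff_cancel_left' left_diff_distrib mult.assoc mult.commute of_int_add of_int_mult of_int_of_nat_eq)
      also have "\<dots> = of_int ((j div int Q) * (p * int (q * M) + 1))" by (simp only: Qa of_int_mult)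
      finally have jr: "to_circle (of_int j * a) = to_circle (of_int r * a)" unfolding to_circle_eq_iff by (metis Ints_of_int)
      show ?thesis
      proof (cases "r < int (m * P)")
        case True
        have P0: "0 < P" using True r by (cases "P = 0") auto
        have i: "nat (r div int P) < m"
        proof -
          have "r div int P < int m"
          proof (rule ccontr)
            assume "\<not> ?thesis"
            then have "int m * int P \<le> r div int P * int P" by (intro mult_right_mono) auto
            also have "\<dots> \<le> r" using P0 div_mult_mod_eq[of r "int P"] pos_mod_sign[of "int P" r] by linarith
            finally show False using True by simp
          qed
          moreover have "0 \<le> r div int P" using r P0 by (simp add: pos_imp_zdiv_nonneg_iff)
          ultimately show ?thesis by linarith
        qed
        have "of_int r * a - of_int r * (of_int p / of_nat q) = of_int r / real Q" by (simp add: a_def distrib_left)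
        moreover have "\<bar>of_int r / real Q\<bar> \<le> \<kappa>"
        proof -
          have "real_of_int r \<le> real (m * P)" using True by linarith
          then have "real_of_int r \<le> \<kappa> * real Q" using mP by linarith
          then show ?thesis using r Q0 by (simp add: divide_le_eq)
        qed
        ultimately have "\<bar>f (to_circle (of_int r * a)) - W r\<bar> \<le> d"
          unfolding W_def by (intro \<kappa>(3)) simp
        moreover have "\<bar>w (nat (r div int P)) r - W r\<bar> \<le> d" by (rule lw(3)[OF i])
        moreover have "g j = w (nat (r div int P)) r" using True by (simp add: g_def h_def r_def)
        ultimately show ?thesis unfolding jr by linarith
      next
        case False
        then have "g j = f (to_circle (of_int r * a))" by (simp add: g_def h_def r_def)
        then show ?thesis using d by (simp add: jr)
      qed
    qed
    have bg: "bounded_pot K g"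
      unfolding bounded_pot_def
    proof
      fix j
      have "\<bar>f (to_circle (of_int j * a))\<bar> \<le> norm f" using norm_bounded[of f "to_circle (of_int j * a)"] by simp
      then show "\<bar>g j\<bar> \<le> K" using close[of j] unfolding K_def by linarith
    qed
    \<comment> \<open>The centers of the blocks.\<close>
    define c where "c i = (2 * int i + 1) * int (L * R)" for i
    have "emeasure lborel {x. approx_eigenvalue (jacobi g) x} \<le> ennreal (real m * (128 * (real Q)\<^sup>2 * (2 / t) ^ R))"
    proof (rule thin_spectrum[OF per _ bg t, where c = c])
      show "1 \<le> Q" using Q0 by simp
      show "periodic (l i) (w i)" if "i < m" for i by (rule lw(2)[OF that])
      show "\<exists>i<m. t \<le> \<bar>discriminant (w i) E (c i) (l i)\<bar>" if E: "E \<in> {-(2+K)..2+K}" for E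
      proof -
        obtain i where i: "i < m" "t \<le> \<bar>discriminant (w i) E 0 (l i)\<bar>" using cov[OF E] by blast
        then show ?thesis using discriminant_base[OF lw(2)[OF i(1)], of E "c i"] by auto
      qed
      fix i n assume i: "i < m" and n: "c i - int (R * l i) \<le> n" "n < c i + int (R * l i)"
      have "R * l i \<le> L * R" using lL[OF i] by simp
      then have RL: "int (R * l i) \<le> int (L * R)" by linarith
      have cP: "c i = int i * int P + int (L * R)" by (simp add: c_def P_def algebra_simps)
      have n1: "int i * int P \<le> n" using n(1) RL cP by linarith
      have n2: "n < int i * int P + int P"
        using n(2) RL cP by (simp add: P_def)
      have P0: "0 < int P" using n1 n2 by linarith
      have di: "n div int P = int i"
        by (rule int_div_pos_eq[of _ _ _ "n - int i * int P"]) (use n1 n2 in \<open>auto simp: mult.commute\<close>)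
      have "int i * int P + int P \<le> int (m * P)"
      proof -
        have "(int i + 1) * int P \<le> int m * int P" using i P0 by (intro mult_right_mono) auto
        then show ?thesis by (simp add: algebra_simps)
      qed
      then have nm: "n < int (m * P)" using n2 by linarith
      have "0 \<le> int i * int P" by simp
      then have "0 \<le> n" using n1 by linarith
      moreover have "n < int Q" using nm mPQ by linarith
      ultimately have "n mod int Q = n" by simp
      then show "g n = w i n" using nm di by (simp add: g_def h_def)
    qed
    also have "\<dots> < ennreal e" using n0[OF Qn0] t by (intro ennreal_lessI) (auto simp: R_def e)
    finally show ?thesis using per close unfolding Q_def[symmetric] a_def by blast
  qed
  then show ?thesis unfolding eventually_sequentially by blast
qed

text \<open>The excluded arcs have radius \<open>k/Q\<close> and centers \<open>i/Q\<close>. At most \<open>Q + 1\<close> of them meet a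
  fundamental domain, and \<open>Q + 1 \<le> 2 Q\<close>.\<close>

lemma bad_phases:
  assumes k: "0 < k" and Q: "1 \<le> (Q::nat)"
  shows "\<exists>B \<in> sets borel. measure haar_circle B \<le> 4 * k \<and> (\<forall>x. to_circle x \<notin> B \<longrightarrow> k \<le> frac (real Q * x) \<and> frac (real Q * x) \<le> 1 - k)"
proof -
  define J where "J i = {(of_int i - k) / real Q <..< (of_int i + k) / real Q}" for i :: int
  define V where "V = (\<Union>i. J i)"
  define B where "B = to_circle ` V"
  have Q0: "0 < real Q" using Q by simp
  have Jiff: "x \<in> J i \<longleftrightarrow> \<bar>real Q * x - of_int i\<bar> < k" for x i
    using Q0 by (auto simp: J_def pos_divide_less_eq pos_less_divide_eq abs_less_iff algebra_simps)
  have pre: "to_circle -` B = V"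
  proof (intro equalityI subsetI)
    fix x assume "x \<in> to_circle -` B"
    then obtain y i where y: "y \<in> J i" "to_circle x = to_circle y" by (auto simp: B_def V_def)
    then obtain n where n: "x - y = of_int n" by (auto simp: to_circle_eq_iff elim: Ints_cases)
    have x: "x = y + of_int n" using n by simp
    have "real Q * x - of_int (i + int Q * n) = real Q * y - of_int i" by (simp add: x algebra_simps)
    then have "x \<in> J (i + int Q * n)" using y(1) unfolding Jiff by simp
    then show "x \<in> V" by (auto simp: V_def)
  qed (auto simp: B_def)
  have "open B" unfolding open_circle_def pre V_def J_def by auto
  then have B: "B \<in> sets borel" by simp
  have "measure haar_circle B = measure lborel (V \<inter> {0..<1})" by (simp add: measure_haar[OF B] pre)
  also have "\<dots> \<le> measure lborel (\<Union>i\<in>{0..int Q}. J i)" if "k < 1"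
  proof (rule measure_mono_fmeasurable)
    show "V \<inter> {0..<1} \<subseteq> (\<Union>i\<in>{0..int Q}. J i)"
    proof
      fix x assume "x \<in> V \<inter> {0..<1}"
      then obtain i where i: "x \<in> J i" and x: "0 \<le> x" "x < 1" by (auto simp: V_def)
      have "0 \<le> real Q * x" "real Q * x < real Q" using x Q0 by auto
      then have "-1 < real_of_int i" "real_of_int i < real Q + 1" using i that unfolding Jiff by linarith+
      then have "i \<in> {0..int Q}" by auto
      then show "x \<in> (\<Union>i\<in>{0..int Q}. J i)" using i by blast
    qed
    show "V \<inter> {0..<1} \<in> sets lborel" unfolding V_def J_def by auto
    show "(\<Union>i\<in>{0..int Q}. J i) \<in> fmeasurable lborel" 
    proof (rule fmeasurable.finite_UN)
      have "emeasure lborel {u<..<v} < \<infinity>" for u v :: real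
        by (cases "u \<le> v") (auto simp: less_top[symmetric])
      then show "J i \<in> fmeasurable lborel" for i unfolding J_def by (intro fmeasurableI) auto
    qed simp
  qed
  finally have 1: "measure haar_circle B \<le> measure lborel (\<Union>i\<in>{0..int Q}. J i)" if "k < 1" using that .
  have "measure lborel (\<Union>i\<in>{0..int Q}. J i) \<le> (\<Sum>i\<in>{0..int Q}. measure lborel (J i))"
    by (rule measure_UNION_le) (auto simp: J_def)
  also have "\<dots> = (\<Sum>i\<in>{0..int Q}. 2 * k / real Q)"
    using k Q0 by (intro sum.cong) (auto simp: J_def diff_divide_distrib[symmetric] divide_right_mono)
  also have "\<dots> = (real Q + 1) * (2 * k / real Q)" by simp
  also have "\<dots> \<le> 4 * k"
    using k Q by (simp add: field_simps)
  finally have 2: "measure lborel (\<Union>i\<in>{0..int Q}. J i) \<le> 4 * k" .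
  have "measure haar_circle B \<le> 4 * k"
  proof (cases "k < 1")
    case True then show ?thesis using 1 2 by linarith
  next
    case False
    then show ?thesis using prob_space.prob_le_1[OF prob_space_haar, of B] by linarith
  qed
  moreover have "k \<le> frac (real Q * x) \<and> frac (real Q * x) \<le> 1 - k" if "to_circle x \<notin> B" for x
  proof -
    have "x \<notin> V" using that pre by blast
    then have n: "\<not> \<bar>real Q * x - of_int i\<bar> < k" for i unfolding V_def using Jiff by blast
    have "frac (real Q * x) = real Q * x - of_int \<lfloor>real Q * x\<rfloor>" by (simp add: frac_def)
    moreover have "0 \<le> frac (real Q * x)" "frac (real Q * x) < 1" by (simp_all add: frac_lt_1)
    ultimately show ?thesis using n[of "\<lfloor>real Q * x\<rfloor>"] n[of "\<lfloor>real Q * x\<rfloor> + 1"] unfolding of_int_add of_int_1 by linarith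
  qed
  ultimately show ?thesis using B by blast
qed

text \<open>The new function takes on the arc from \<open>i/Q\<close> to \<open>(i + 1)/Q\<close> the value of the thin sampled
  sequence at the time when the orbit of \<open>0\<close> under the new rotation is at \<open>i/Q\<close>. For phases in the
  flat parts the potential is a translate of this sequence, so the mass of the density of states
  measure is on its thin spectrum up to the measure of the layers. On the oscillating layers
  constants are added to the potential; as the spectrum of the sequence comes within \<open>11 d\<close> of
  each energy of the interval, a wave of amplitude \<open>11 d\<close> moves some spectral value onto that
  energy.\<close>

lemma rational_step:
  fixes p :: int and q :: nat and f :: "circle \<Rightarrow>\<^sub>C real"
  assumes q: "1 \<le> q" and d: "0 < d" and cov: "covers d (of_int p / of_nat q) f {b..c}" and e: "0 < e"
  shows "\<exists>(p'::int) (q'::nat) f' U. N0 < q' \<and> coprime p' (int q') \<and> \<bar>of_int p' / of_nat q' - of_int p / of_nat q\<bar> < e \<and>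
    dist f' f \<le> 14 * d \<and> covers_exactly (of_int p' / of_nat q') f' {b..c} \<and> compact U \<and>
    emeasure lborel U < ennreal e \<and> 1 - e \<le> measure (dos_measure (to_circle (of_int p' / of_nat q')) f') U"
proof -
  obtain \<kappa> where \<kappa>: "0 < \<kappa>" "\<kappa> \<le> 1" "\<And>x y. \<bar>x - y\<bar> \<le> \<kappa> \<Longrightarrow> \<bar>f (to_circle x) - f (to_circle y)\<bar> \<le> d"
    using uniform_modulus[OF d, of f] by blast
  obtain \<rho> where \<rho>: "0 < \<rho>" "\<And>a' f'. \<bar>a' - of_int p / of_nat q\<bar> < \<rho> \<Longrightarrow> covers (d + d + dist f' f) a' f' {b..c}"
    using covers_persists[OF cov d] by blast
  have "\<forall>\<^sub>F M in sequentially. \<exists>g. periodic (q * q * M) g \<and>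
    (\<forall>j. \<bar>g j - apply_bcontfun f (to_circle (of_int j * (of_int p / of_nat q + 1 / of_nat (q * q * M))))\<bar> \<le> 2 * d) \<and>
    emeasure lborel {x. approx_eigenvalue (jacobi g) x} < ennreal e"
    by (rule thin_sampling[OF q d e])
  moreover have "\<forall>\<^sub>F M in sequentially. N0 < M" by (rule eventually_gt_at_top)
  moreover have "\<forall>\<^sub>F M in sequentially. 1 / real M < min (min \<rho> \<kappa>) e"
  proof -
    have "(\<lambda>M. 1 / real M) \<longlonglongrightarrow> 0" by real_asymp
    then show ?thesis using \<rho>(1) \<kappa>(1) e by (intro order_tendstoD(2)) auto
  qed
  ultimately have "\<forall>\<^sub>F M in sequentially. N0 < M \<and> 1 / real M < min (min \<rho> \<kappa>) e \<and> (\<exists>g. periodic (q * q * M) g \<and>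
    (\<forall>j. \<bar>g j - apply_bcontfun f (to_circle (of_int j * (of_int p / of_nat q + 1 / of_nat (q * q * M))))\<bar> \<le> 2 * d) \<and>
    emeasure lborel {x. approx_eigenvalue (jacobi g) x} < ennreal e)"
    by eventually_elim blast
  then obtain M g where M: "N0 < M" "1 / real M < min (min \<rho> \<kappa>) e" and per0: "periodic (q * q * M) g" and
    g0: "\<And>j. \<bar>g j - apply_bcontfun f (to_circle (of_int j * (of_int p / of_nat q + 1 / of_nat (q * q * M))))\<bar> \<le> 2 * d"
    and thin: "emeasure lborel {x. approx_eigenvalue (jacobi g) x} < ennreal e"
    unfolding eventually_sequentially by blast
  define Q where "Q = q * q * M"
  have M0: "0 < M" using M(1) by simp
  have Q0: "0 < real Q" "1 \<le> Q" using q M0 by (auto simp: Q_def Suc_le_eq)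
  have MQ: "M \<le> Q" using q by (simp add: Q_def)
  have per: "periodic Q g" using per0 by (simp add: Q_def)
  define p' where "p' = p * int (q * M) + 1"
  \<comment> \<open>The inverse of \<open>p'\<close> modulo \<open>Q\<close>, since \<open>p' pb = 1 - (p q M)\<^sup>2\<close> and \<open>Q\<close> divides \<open>(q M)\<^sup>2\<close>. The
    orbit of \<open>0\<close> reaches \<open>i/Q\<close> after \<open>i pb\<close> steps.\<close>
  define pb where "pb = 1 - p * int (q * M)"
  define a' where "a' = of_int p' / real Q"
  have a'_eq: "a' = of_int p / of_nat q + 1 / real Q" using q M0 by (simp add: a'_def p'_def Q_def field_simps)
  have gf: "\<bar>g j - f (to_circle (of_int j * a'))\<bar> \<le> 2 * d" for j using g0[of j] by (simp add: a'_eq Q_def)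
  have inv: "p' * pb = 1 - int Q * (p * p * int M)" by (simp add: p'_def pb_def Q_def algebra_simps)
  have cop: "coprime p' (int Q)"
  proof (rule coprimeI)
    fix x assume x: "x dvd p'" "x dvd int Q"
    have "x dvd p' * pb + int Q * (p * p * int M)" using x by (intro dvd_add dvd_mult2)
    then show "is_unit x" by (simp add: inv)
  qed
  have inQ: "1 / real Q \<le> 1 / real M" using MQ M0 by (simp add: frac_le)
  have small: "1 / real Q < \<rho>" "1 / real Q \<le> \<kappa>" "1 / real Q < e" using inQ M(2) by auto
  \<comment> \<open>The relative width of the layers; the phases in the layers have measure at most \<open>4 k\<close>.\<close>
  define k where "k = min (1/4) (e / 4)"
  have k: "0 < k" "k \<le> 1/4" "4 * k \<le> e" using e by (auto simp: k_def)
  define cc where "cc i = g (i * pb)" for i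
  have gper: "g (j + int Q * n) = g j" for j n by (rule periodic_mult[OF per])
  have cc_close: "\<bar>cc i - f (to_circle (of_int i / real Q))\<bar> \<le> 2 * d" for i
  proof -
    have "of_int (i * pb) * a' - of_int i / real Q = of_int (i * (pb * p')) / real Q - of_int i / real Q"
      by (simp add: a'_def mult_ac)
    also have "pb * p' = 1 - int Q * (p * p * int M)" using inv by (simp add: mult.commute)
    also have "of_int (i * (1 - int Q * (p * p * int M))) / real Q - of_int i / real Q = of_int (- (i * p * p * int M))"
      using Q0 by (simp add: field_simps)
    finally have "to_circle (of_int (i * pb) * a') = to_circle (of_int i / real Q)"
      unfolding to_circle_eq_iff by (metis Ints_of_int)
    then show ?thesis using gf[of "i * pb"] by (simp add: cc_def)
  qed
  have cell: "\<bar>cc i - f (to_circle x)\<bar> \<le> 3 * d" if "\<bar>of_int i / real Q - x\<bar> \<le> 1 / real Q" for i x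
    using cc_close[of i] \<kappa>(3)[of "of_int i / real Q" x] that small(2) by linarith
  have cell_near: "\<bar>of_int \<lfloor>real Q * x\<rfloor> / real Q - x\<bar> \<le> 1 / real Q" "\<bar>of_int (\<lfloor>real Q * x\<rfloor> + 1) / real Q - x\<bar> \<le> 1 / real Q" for x
  proof -
    have eq: "of_int i / real Q - x = (of_int i - real Q * x) / real Q" for i using Q0 by (simp add: field_simps)
    have "\<bar>of_int \<lfloor>real Q * x\<rfloor> - real Q * x\<bar> \<le> 1" "\<bar>of_int (\<lfloor>real Q * x\<rfloor> + 1) - real Q * x\<bar> \<le> 1" by linarith+
    then show "\<bar>of_int \<lfloor>real Q * x\<rfloor> / real Q - x\<bar> \<le> 1 / real Q" "\<bar>of_int (\<lfloor>real Q * x\<rfloor> + 1) / real Q - x\<bar> \<le> 1 / real Q"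
      unfolding eq using Q0 by (simp_all only: abs_divide abs_of_pos divide_right_mono less_imp_le)
  qed
  have "\<exists>F :: circle \<Rightarrow>\<^sub>C real. \<forall>x. F (to_circle x) = cell_fun k A cc (real Q * x)" for A
  proof (rule circle_lift)
    show "continuous_on UNIV (\<lambda>x. cell_fun k A cc (real Q * x))"
      by (rule continuous_on_compose2[OF continuous_cell_fun]) (use k in \<open>auto intro!: continuous_intros\<close>)
    fix x and n :: int
    have "real Q * (x + of_int n) = real Q * x + of_int (int Q * n)" by (simp add: algebra_simps)
    moreover have "cc j = cc (j + int Q * n)" for j
      using gper[of "j * pb" "n * pb"] by (simp add: cc_def algebra_simps)
    ultimately show "cell_fun k A cc (real Q * (x + of_int n)) = cell_fun k A cc (real Q * x)"
      using cell_fun_shift[of cc cc] by metis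
  qed
  then obtain F :: "real \<Rightarrow> circle \<Rightarrow>\<^sub>C real" where F: "\<And>A x. F A (to_circle x) = cell_fun k A cc (real Q * x)" by metis
  have distF: "dist (F A) f \<le> 3 * d + A" if "0 \<le> A" for A
  proof (rule dist_bound)
    fix \<omega>
    obtain x where x: "\<omega> = to_circle x" using to_circle_surj by blast
    show "dist (F A \<omega>) (f \<omega>) \<le> 3 * d + A"
      unfolding x F dist_real_def by (rule cell_fun_close[OF k(1) cell[OF cell_near(1)] cell[OF cell_near(2)] that])
  qed
  have gc: "g (h * pb + n) = cc (h + n * p')" for h n
  proof -
    have eq: "(h + n * p') * pb = (h * pb + n) + int Q * (- n * (p * p * int M))"
      using inv by (simp add: distrib_right mult.assoc) (simp add: algebra_simps)
    show ?thesis unfolding cc_def eq gper ..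
  qed
  \<comment> \<open>The times at which the orbit of \<open>0\<close> is at the two ends of the cell of \<open>x\<close>.\<close>
  define j0 where "j0 x = \<lfloor>real Q * x\<rfloor> * pb" for x
  define j1 where "j1 x = (\<lfloor>real Q * x\<rfloor> + 1) * pb" for x
  have Qa: "real Q * a' = of_int p'" using Q0 by (simp add: a'_def)
  have potF: "line_pot a' (F A) x n = g (j0 x + n) + (g (j1 x + n) - g (j0 x + n)) * ramp k (frac (real Q * x)) + A * bump k (frac (real Q * x))" for A x n
  proof -
    have "real Q * (x + of_int n * a') = real Q * x + of_int (n * p')"
      using Qa by (simp add: distrib_left)
    moreover have "cell_fun k A cc (real Q * x + of_int (n * p')) = cell_fun k A (\<lambda>i. g (i * pb + n)) (real Q * x)"
      by (rule cell_fun_shift) (rule gc)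
    ultimately show ?thesis unfolding line_pot_eq F by (simp add: cell_fun_def j0_def j1_def)
  qed
  have step5: "\<bar>g (j1 x + n) - g (j0 x + n)\<bar> \<le> 5 * d" for x n
  proof -
    define i where "i = \<lfloor>real Q * x\<rfloor> + n * p'"
    have e0: "g (j0 x + n) = cc i" "g (j1 x + n) = cc (i + 1)"
    proof -
      show "g (j0 x + n) = cc i" unfolding j0_def i_def by (rule gc)
      have "g (j1 x + n) = cc (\<lfloor>real Q * x\<rfloor> + 1 + n * p')" unfolding j1_def by (rule gc)
      also have "\<dots> = cc (i + 1)" by (rule arg_cong[where f = cc]) (simp add: i_def)
      finally show "g (j1 x + n) = cc (i + 1)" .
    qed
    have "\<bar>of_int (i + 1) / real Q - of_int i / real Q\<bar> \<le> \<kappa>" using small(2) Q0 by (simp add: diff_divide_distrib[symmetric])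
    from \<kappa>(3)[OF this] cc_close[of i] cc_close[of "i + 1"] show ?thesis unfolding e0 by linarith
  qed
  have bg: "bounded_pot (norm f + 2 * d) g"
    unfolding bounded_pot_def
  proof
    fix j
    have "\<bar>f (to_circle (of_int j * a'))\<bar> \<le> norm f" using norm_bounded[of f "to_circle (of_int j * a')"] by simp
    then show "\<bar>g j\<bar> \<le> norm f + 2 * d" using gf[of j] by linarith
  qed
  have bgs: "bounded_pot (norm f + 2 * d) (\<lambda>n. g (j + n))" for j using bg by (simp add: bounded_pot_def)
  \<comment> \<open>Without waves the new function covers with error \<open>2 d + 3 d\<close>, and replacing the potential by
    its flat part costs another \<open>5 d\<close>; the amplitude exceeds the sum.\<close>
  define A where "A = 11 * d"
  have close_a: "\<bar>a' - of_int p / of_nat q\<bar> < \<rho>" using small(1) Q0 by (simp add: a'_eq)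
  have cov_f': "covers_exactly a' (F A) {b..c}"
    unfolding covers_exactly_def
  proof
    fix E assume E: "E \<in> {b..c}"
    have "covers (d + d + dist (F 0) f) a' (F 0) {b..c}" by (rule \<rho>(2)[OF close_a])
    then obtain x \<psi> where \<psi>: "\<psi> \<noteq> 0" "norm (jacobi (line_pot a' (F 0) x) \<psi> - E *\<^sub>R \<psi>) \<le> (d + d + dist (F 0) f) * norm \<psi>"
      using E unfolding covers_def by blast
    have "(d + d + dist (F 0) f) * norm \<psi> \<le> 5 * d * norm \<psi>" using distF[of 0] by (intro mult_right_mono) auto
    then have 1: "norm (jacobi (line_pot a' (F 0) x) \<psi> - E *\<^sub>R \<psi>) \<le> 5 * d * norm \<psi>" using \<psi>(2) by linarith
    define v where "v n = g (j0 x + n)" for n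
    have bv: "bounded_pot (norm f + 2 * d) v" unfolding v_def by (rule bgs)
    have "norm (jacobi v \<psi> - jacobi (line_pot a' (F 0) x) \<psi>) \<le> (5 * d) * norm \<psi>"
    proof (rule norm_jacobi_diff[OF bounded_pot_pot bv])
      fix n
      define s where "s = ramp k (frac (real Q * x))"
      have s: "0 \<le> s" "s \<le> 1" using ramp_01[OF k(1), of "frac (real Q * x)"] by (auto simp: s_def frac_lt_1 less_imp_le)
      have "v n - line_pot a' (F 0) x n = - ((g (j1 x + n) - g (j0 x + n)) * s)" by (simp add: potF v_def s_def)
      then have "\<bar>v n - line_pot a' (F 0) x n\<bar> = \<bar>g (j1 x + n) - g (j0 x + n)\<bar> * s" using s by (simp add: abs_mult)
      also have "\<dots> \<le> (5 * d) * 1" using step5 s d by (intro mult_mono) auto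
      finally show "\<bar>v n - line_pot a' (F 0) x n\<bar> \<le> 5 * d" by simp
    qed (use d in simp)
    then have "norm (jacobi v \<psi> - E *\<^sub>R \<psi>) \<le> 5 * d * norm \<psi> + 5 * d * norm \<psi>"
      using norm_triangle_ineq[of "jacobi v \<psi> - jacobi (line_pot a' (F 0) x) \<psi>" "jacobi (line_pot a' (F 0) x) \<psi> - E *\<^sub>R \<psi>"] 1
      by simp
    also have "\<dots> = 10 * d * norm \<psi>" by simp
    also have "\<dots> < A * norm \<psi>" using \<psi>(1) d by (simp add: A_def)
    finally have 2: "norm (jacobi v \<psi> - E *\<^sub>R \<psi>) < A * norm \<psi>" .
    have A0: "0 \<le> A" using d by (simp add: A_def)
    obtain E' where E': "\<bar>E' - E\<bar> \<le> A" "approx_eigenvalue (jacobi v) E'"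
      using approx_eigenvalue_exists[OF selfadj_jacobi[OF bv] A0 \<psi>(1) 2] by blast
    have "\<bar>(E - E') / A\<bar> \<le> 1" using E'(1) d by (simp add: A_def abs_minus_commute divide_le_eq)
    then obtain s where s: "s \<in> {0..k}" "bump k s = (E - E') / A" using bump_surj[OF k(1)] by blast
    \<comment> \<open>The point of the same cell at which the wave has the value \<open>E - E'\<close>.\<close>
    define y where "y = (of_int \<lfloor>real Q * x\<rfloor> + s) / real Q"
    have Qy: "real Q * y = of_int \<lfloor>real Q * x\<rfloor> + s" using Q0 by (simp add: y_def)
    have fl: "\<lfloor>real Q * y\<rfloor> = \<lfloor>real Q * x\<rfloor>" using s(1) k(2) by (intro floor_unique) (auto simp: Qy)
    then have fr: "frac (real Q * y) = s" by (simp add: frac_def Qy)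
    have "line_pot a' (F A) y n = v n + (E - E')" for n
      unfolding potF fr using s k d by (simp add: ramp_0 v_def j0_def fl A_def)
    then have "line_pot a' (F A) y = (\<lambda>n. v n + (E - E'))" by blast
    moreover have "approx_eigenvalue (jacobi (\<lambda>n. v n + (E - E'))) (E' + (E - E'))"
      by (rule approx_eigenvalue_add_const[OF bv E'(2)])
    ultimately show "\<exists>x. approx_eigenvalue (jacobi (line_pot a' (F A) x)) E" by (intro exI[of _ y]) simp
  qed
  define U where "U = {x. approx_eigenvalue (jacobi g) x}"
  have cU: "compact U"
  proof -
    have "\<bar>x\<bar> \<le> 2 + (norm f + 2 * d)" if "x \<in> U" for x
      using approx_eigenvalue_bound[OF _ norm_jacobi[OF bg]] that by (simp add: U_def)
    then have "bounded U" by (auto simp: bounded_iff)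
    then show ?thesis unfolding compact_eq_bounded_closed U_def by (simp add: closed_approx_eigenvalues)
  qed
  have bU: "U \<in> sets borel" using cU by (simp add: compact_imp_closed)
  obtain B where B: "B \<in> sets borel" "measure haar_circle B \<le> 4 * k"
    "\<And>x. to_circle x \<notin> B \<Longrightarrow> k \<le> frac (real Q * x) \<and> frac (real Q * x) \<le> 1 - k"
    using bad_phases[OF k(1) Q0(2)] by blast
  have full: "measure (phase_measure (to_circle a') (F A) \<omega>) U = 1" if \<omega>: "\<omega> \<in> - B" for \<omega>
  proof -
    obtain x where x: "\<omega> = to_circle x" using to_circle_surj by blast
    have fr: "k \<le> frac (real Q * x)" "frac (real Q * x) \<le> 1 - k" using B(3)[of x] \<omega> x by auto
    have bump0: "bump k (frac (real Q * x)) = 0"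
    proof (cases "frac (real Q * x) = k")
      case True then show ?thesis using k(1) by (simp add: bump_def)
    next
      case False then show ?thesis using fr by (simp add: bump_def)
    qed
    have pot: "line_pot a' (F A) x = (\<lambda>n. g (n + j0 x))"
      by (rule ext) (simp add: potF ramp_0[OF k(1) fr(2)] bump0 add.commute)
    have b2: "bounded_pot (norm f + 2 * d) (\<lambda>n. g (n + j0 x))" using bg by (simp add: bounded_pot_def)
    have no: "\<not> approx_eigenvalue (jacobi (\<lambda>n. g (n + j0 x))) E" if "E \<in> - U" for E
      using approx_eigenvalue_shift[OF b2, of E "- j0 x"] that by (auto simp: U_def)
    have "measure (phase_measure (to_circle a') (F A) \<omega>) (- U) = 0"
      unfolding phase_measure_def schroedinger_jacobi x pot
      by (rule spec_measure_null[OF selfadj_jacobi[OF b2] _ no]) (use bU in auto)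
    moreover have "measure (phase_measure (to_circle a') (F A) \<omega>) (UNIV - U) = 1 - measure (phase_measure (to_circle a') (F A) \<omega>) U"
    proof -
      interpret prob_space "phase_measure (to_circle a') (F A) \<omega>" by (rule phase_measure)
      show ?thesis using prob_compl[of U] bU phase_measure(2) sets_eq_imp_space_eq[OF phase_measure(2)] by simp
    qed
    ultimately show ?thesis by (simp add: Compl_eq_Diff_UNIV)
  qed
  have "1 - e \<le> measure haar_circle (- B)"
  proof -
    interpret prob_space haar_circle by (rule prob_space_haar)
    have "measure haar_circle (- B) = 1 - measure haar_circle B"
      using prob_compl[of B] B(1) by (simp add: Compl_eq_Diff_UNIV)
    then show ?thesis using B(2) k(3) by linarith
  qed
  also have "\<dots> \<le> measure (dos_measure (to_circle a') (F A)) U"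
    by (rule dos_measure_ge[OF bU _ full]) (use B(1) in auto)
  finally have "1 - e \<le> measure (dos_measure (to_circle a') (F A)) U" .
  moreover have "N0 < Q" using M(1) MQ by linarith
  moreover have "\<bar>a' - of_int p / of_nat q\<bar> < e" using small(3) Q0 by (simp add: a'_eq)
  moreover have "dist (F A) f \<le> 14 * d" using distF[of A] d by (simp add: A_def)
  ultimately show ?thesis
    using cop cov_f' cU thin unfolding U_def[symmetric] a'_def by blast
qed

section \<open>The limit of the construction\<close>

text \<open>A continuous function between the indicators of \<open>U\<close> and of a slightly larger open set has an
  integral that depends continuously on the pair.\<close>

lemma dos_neighbourhood:
  assumes U: "compact U" "emeasure lborel U < ennreal e" and e: "0 < e"
    and dos: "1 - e \<le> measure (dos_measure (to_circle a) f) U"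
  shows "\<exists>V r. open V \<and> emeasure lborel V < ennreal (2 * e) \<and> 0 < r \<and>
    (\<forall>a' f'. \<bar>a' - a\<bar> < r \<longrightarrow> dist f' f < r \<longrightarrow> 1 - 2 * e \<le> measure (dos_measure (to_circle a') f') V)"
proof -
  have bU: "U \<in> sets borel" using U(1) by (simp add: compact_imp_closed)
  obtain V where V: "open V" "U \<subseteq> V" "emeasure lborel (V - U) < e"
    using outer_regular_lborel[OF bU e] by blast
  have bV: "V \<in> sets borel" using V(1) by simp
  have eV: "emeasure lborel V < ennreal (2 * e)"
  proof -
    have "emeasure lborel V = emeasure lborel (U \<union> (V - U))" using V(2) by (simp add: Un_absorb1)
    also have "\<dots> = emeasure lborel U + emeasure lborel (V - U)"
      using bU bV by (intro plus_emeasure[symmetric]) auto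
    also have "\<dots> < ennreal e + ennreal e" using U(2) V(3) by (rule add_strict_mono)
    also have "\<dots> = ennreal (2 * e)" using e by (simp add: ennreal_plus[symmetric] del: ennreal_plus)
    finally show ?thesis .
  qed
  have "closed U" "closed (- V)" "U \<inter> - V = {}" using U(1) V by (auto simp: compact_imp_closed)
  from Urysohn[OF this, of "1::real" "0::real"]
  obtain b :: "real \<Rightarrow> real" where b: "continuous_on UNIV b" "\<And>x. b x \<in> closed_segment 1 0"
    "\<And>x. x \<in> U \<Longrightarrow> b x = 1" "\<And>x. x \<in> - V \<Longrightarrow> b x = 0" by blast
  have b01: "0 \<le> b x" "b x \<le> 1" for x using b(2)[of x] by (auto simp: closed_segment_eq_real_ivl)
  have bm[measurable]: "b \<in> borel_measurable borel" using b(1) by (rule borel_measurable_continuous_onI)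
  define B where "B a' f' = (\<integral>x. b x \<partial>dos_measure (to_circle a') f')" for a' f'
  have int: "integrable (dos_measure (to_circle a') f') b" for a' f'
  proof -
    interpret prob_space "dos_measure (to_circle a') f'" by (rule dos_measure)
    note [measurable_cong] = dos_measure(2)
    show ?thesis by (rule integrable_const_bound[where B = 1]) (use b01 in auto)
  qed
  have sp: "space (dos_measure \<alpha> f') = UNIV" for \<alpha> f' using sets_eq_imp_space_eq[OF dos_measure(2)] by simp
  have ind: "integrable (dos_measure (to_circle a') f') (indicat_real S)" "(\<integral>x. indicator S x \<partial>dos_measure (to_circle a') f') = measure (dos_measure (to_circle a') f') S"
    if "S \<in> sets borel" for a' f' S
  proof -
    interpret prob_space "dos_measure (to_circle a') f'" by (rule dos_measure)
    show "integrable (dos_measure (to_circle a') f') (indicat_real S)"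
      using that by (intro integrable_real_indicator) (auto simp: dos_measure(2) less_top[symmetric])
    show "(\<integral>x. indicator S x \<partial>dos_measure (to_circle a') f') = measure (dos_measure (to_circle a') f') S"
      using that by (simp add: dos_measure(2) sp)
  qed
  have lower: "measure (dos_measure (to_circle a') f') U \<le> B a' f'" for a' f'
    unfolding ind(2)[OF bU, symmetric] B_def
    by (rule integral_mono[OF ind(1)[OF bU] int]) (use b01 b(3) in \<open>auto simp: indicator_def\<close>)
  have upper: "B a' f' \<le> measure (dos_measure (to_circle a') f') V" for a' f'
    unfolding ind(2)[OF bV, symmetric] B_def
    by (rule integral_mono[OF int ind(1)[OF bV]]) (use b01 b(4) in \<open>auto simp: indicator_def\<close>)
  have "\<exists>r>0. \<forall>a' f'. \<bar>a' - a\<bar> < r \<longrightarrow> dist f' f < r \<longrightarrow> 1 - 2 * e \<le> B a' f'"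
  proof (rule ccontr)
    assume "\<not> ?thesis"
    then have "\<exists>a' f'. \<bar>a' - a\<bar> < r \<and> dist f' f < r \<and> B a' f' < 1 - 2 * e" if "0 < r" for r
      using that by (meson not_less)
    then have "\<forall>n::nat. \<exists>a' f'. \<bar>a' - a\<bar> < 1 / (real n + 1) \<and> dist f' f < 1 / (real n + 1) \<and> B a' f' < 1 - 2 * e" by simp
    then obtain a' f' where s: "\<And>n::nat. \<bar>a' n - a\<bar> < 1 / (real n + 1)" "\<And>n. dist (f' n) f < 1 / (real n + 1)"
      "\<And>n. B (a' n) (f' n) < 1 - 2 * e" by metis
    have z: "(\<lambda>n. 1 / (real n + 1)) \<longlonglongrightarrow> 0" by real_asymp
    have "(\<lambda>n. a' n - a) \<longlonglongrightarrow> 0"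
      by (rule Lim_null_comparison[OF _ z]) (use s(1) in \<open>auto intro!: always_eventually less_imp_le\<close>)
    then have la: "a' \<longlonglongrightarrow> a" by (simp add: LIM_zero_iff)
    have "(\<lambda>n. dist (f' n) f) \<longlonglongrightarrow> 0"
      by (rule Lim_null_comparison[OF _ z]) (use s(2) in \<open>auto intro!: always_eventually less_imp_le\<close>)
    then have lf: "f' \<longlonglongrightarrow> f" by (rule tendsto_dist_iff[THEN iffD2])
    have "(\<lambda>n. B (a' n) (f' n)) \<longlonglongrightarrow> B a f"
      unfolding B_def by (rule dos_weakly_continuous[OF la lf b(1), of 1]) (use b01 in auto)
    then have "B a f \<le> 1 - 2 * e" by (rule LIMSEQ_le_const2) (use s(3) in \<open>auto intro: less_imp_le\<close>)
    then show False using lower[of a f] dos e by linarith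
  qed
  then show ?thesis using V(1) eV upper by (meson order_trans)
qed

lemma rational_gap:
  fixes p x :: int and q y :: nat
  assumes c: "coprime p (int q)" and y: "1 \<le> y" "y < q"
  shows "1 / (real q * real y) \<le> \<bar>of_int p / real q - of_int x / real y\<bar>"
proof -
  have "p * int y \<noteq> x * int q"
  proof
    assume "p * int y = x * int q"
    then have "int q dvd p * int y" by simp
    then have "int q dvd int y" using c by (simp add: coprime_commute coprime_dvd_mult_right_iff)
    then show False using y zdvd_not_zless[of "int y" "int q"] by simp
  qed
  then have "1 \<le> \<bar>p * int y - x * int q\<bar>" by simp
  then have "1 \<le> \<bar>real_of_int (p * int y - x * int q)\<bar>" by linarith
  moreover have "of_int p / real q - of_int x / real y = of_int (p * int y - x * int q) / (real q * real y)"
    using y by (simp add: field_simps)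
  ultimately show ?thesis using y by (simp add: abs_divide divide_right_mono)
qed

text \<open>What the \<open>n\<close>-th stage achieves is required on the whole closed ball, so that it is inherited
  by the limit.\<close>

definition good_ball :: "nat \<Rightarrow> real set \<Rightarrow> real \<Rightarrow> (circle \<Rightarrow>\<^sub>C real) \<Rightarrow> real \<Rightarrow> bool" where
  "good_ball n I a f r \<longleftrightarrow> (\<exists>V. open V \<and> emeasure lborel V < ennreal ((1/2)^n) \<and>
     (\<forall>a' f'. \<bar>a' - a\<bar> \<le> r \<longrightarrow> dist f' f \<le> r \<longrightarrow>
        1 - (1/2)^n \<le> measure (dos_measure (to_circle a') f') V \<and> covers (1 / (real n + 1)) a' f' I \<and>
        (\<forall>(x::int) (y::nat). 1 \<le> y \<longrightarrow> y \<le> n \<longrightarrow> a' \<noteq> of_int x / real y)))"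

text \<open>The step moves \<open>f\<close> by at most fourteen times the covering error. Tying that error to the
  radius as \<open>r / 30\<close> keeps the new ball inside the old one; the new covering is exact, so that any
  new radius is allowed.\<close>

lemma good_ball_step:
  fixes p :: int and q :: nat and f :: "circle \<Rightarrow>\<^sub>C real"
  assumes q: "1 \<le> q" and r: "0 < r" and cov: "covers (r / 30) (of_int p / of_nat q) f {b..c}"
  shows "\<exists>(p'::int) (q'::nat) f' r'. 1 \<le> q' \<and> 0 < r' \<and> r' \<le> r / 2 \<and> covers (r' / 30) (of_int p' / of_nat q') f' {b..c} \<and>
    \<bar>of_int p' / of_nat q' - of_int p / of_nat q\<bar> + r' \<le> r \<and> dist f' f + r' \<le> r \<and>
    good_ball n {b..c} (of_int p' / of_nat q') f' r'"
proof -
  define e where "e = min (r / 2) ((1/2)^n / 2)"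
  have e: "0 < e" "e \<le> r / 2" "2 * e \<le> (1/2)^n" using r by (auto simp: e_def)
  obtain p' :: int and q' :: nat and f' U where S: "n < q'" "coprime p' (int q')"
    "\<bar>of_int p' / of_nat q' - of_int p / of_nat q\<bar> < e" "dist f' f \<le> 14 * (r / 30)"
    "covers_exactly (of_int p' / of_nat q') f' {b..c}" "compact U" "emeasure lborel U < ennreal e"
    "1 - e \<le> measure (dos_measure (to_circle (of_int p' / of_nat q')) f') U"
    using rational_step[OF q _ cov e(1), of n] r by auto
  define a where "a = of_int p' / real q'"
  obtain V s where V: "open V" "emeasure lborel V < ennreal (2 * e)" "0 < s"
    "\<And>a' f''. \<bar>a' - a\<bar> < s \<Longrightarrow> dist f'' f' < s \<Longrightarrow> 1 - 2 * e \<le> measure (dos_measure (to_circle a') f'') V"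
    using dos_neighbourhood[OF S(6,7) e(1) S(8)] unfolding a_def by blast
  define d where "d = 1 / (3 * (real n + 1))"
  have d: "0 < d" by (simp add: d_def)
  obtain \<rho> where \<rho>: "0 < \<rho>" "\<And>a' f''. \<bar>a' - a\<bar> < \<rho> \<Longrightarrow> covers (d + d + dist f'' f') a' f'' {b..c}"
    using covers_persists[OF covers_exactly_imp_covers[OF S(5) d] d] unfolding a_def by blast
  define r' where "r' = min (min (r / 30) (s / 2)) (min (min (\<rho> / 2) d) (1 / (2 * (real q' * (real n + 1)))))"
  have q'0: "0 < real q'" using S(1) by simp
  have r': "0 < r'" "r' \<le> r / 30" "r' \<le> s / 2" "r' \<le> \<rho> / 2" "r' \<le> d" "r' \<le> 1 / (2 * (real q' * (real n + 1)))"
    using r V(3) \<rho>(1) d q'0 by (auto simp: r'_def)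
  have ball: "1 - (1/2)^n \<le> measure (dos_measure (to_circle a') f'') V \<and> covers (1 / (real n + 1)) a' f'' {b..c} \<and>
        (\<forall>(x::int) (y::nat). 1 \<le> y \<longrightarrow> y \<le> n \<longrightarrow> a' \<noteq> of_int x / real y)"
    if a': "\<bar>a' - a\<bar> \<le> r'" and f'': "dist f'' f' \<le> r'" for a' f''
  proof (intro conjI allI impI notI)
    have "1 - 2 * e \<le> measure (dos_measure (to_circle a') f'') V"
      using a' f'' r'(1,3) V(3) by (intro V(4)) linarith+
    then show "1 - (1/2)^n \<le> measure (dos_measure (to_circle a') f'') V" using e(3) by linarith
    have cv: "covers (d + d + dist f'' f') a' f'' {b..c}" using a' r'(1,4) \<rho>(1) by (intro \<rho>(2)) linarith
    have "d + d + dist f'' f' \<le> 1 / (real n + 1)"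
    proof -
      have "3 * (1 / (3 * y)) = 1 / y" for y :: real by simp
      then have "3 * d = 1 / (real n + 1)" unfolding d_def .
      then show ?thesis using f'' r'(5) by linarith
    qed
    then have "(d + d + dist f'' f') * norm \<psi> \<le> 1 / (real n + 1) * norm \<psi>" for \<psi> :: ell2 by (intro mult_right_mono) auto
    then show "covers (1 / (real n + 1)) a' f'' {b..c}"
      using cv unfolding covers_def by (meson order_trans)
    fix x :: int and y :: nat assume y: "1 \<le> y" "y \<le> n" and eq: "a' = of_int x / real y"
    have "1 / (real q' * real y) \<le> \<bar>a - a'\<bar>"
      unfolding eq a_def by (rule rational_gap[OF S(2) y(1)]) (use y S(1) in linarith)
    moreover have "1 / (real q' * (real n + 1)) \<le> 1 / (real q' * real y)"
      using y q'0 by (intro divide_left_mono mult_left_mono) auto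
    moreover have "r' < 1 / (real q' * (real n + 1))"
    proof -
      have half: "1 / (2 * y) < 1 / y" if "0 < y" for y :: real using that by (simp add: field_simps)
      show ?thesis by (rule le_less_trans[OF r'(6) half]) (use q'0 in simp)
    qed
    ultimately show False using a' by (simp add: abs_minus_commute)
  qed
  have "good_ball n {b..c} a f' r'"
    unfolding good_ball_def
  proof (intro exI[of _ V] conjI)
    show "emeasure lborel V < ennreal ((1/2)^n)"
      using V(2) e(3) by (meson ennreal_leI less_le_trans)
  qed (use V(1) ball in blast)+
  moreover have "covers (r' / 30) a f' {b..c}"
    using covers_exactly_imp_covers[OF S(5), of "r' / 30"] r'(1) by (simp add: a_def)
  moreover have "\<bar>a - of_int p / of_nat q\<bar> + r' \<le> r" using S(3) e(2) r'(2) r by (simp add: a_def)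
  moreover have "dist f' f + r' \<le> r" using S(4) r'(2) r by linarith
  moreover have "r' \<le> r / 2" using r'(2) r by linarith
  moreover have "1 \<le> q'" using S(1) by simp
  ultimately show ?thesis using r'(1) unfolding a_def by blast
qed

lemma Cauchy_circle_functions:
  fixes f :: "nat \<Rightarrow> circle \<Rightarrow>\<^sub>C real"
  assumes "Cauchy f"
  shows "convergent f"
proof -
  have "\<exists>l. \<forall>e>0. \<exists>N. \<forall>n x. N \<le> n \<and> True \<longrightarrow> dist (f n x) (l x) < e"
  proof (rule uniformly_convergent_eq_cauchy[THEN iffD2], intro allI impI)
    fix e :: real assume "0 < e"
    then obtain N where "\<And>m n. N \<le> m \<Longrightarrow> N \<le> n \<Longrightarrow> dist (f m) (f n) < e" using metric_CauchyD[OF assms] by blast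
    then show "\<exists>N. \<forall>m n x. N \<le> m \<and> N \<le> n \<and> True \<longrightarrow> dist (f m x) (f n x) < e"
      using dist_fun_lt_imp_dist_val_lt by blast
  qed
  then obtain g where "uniform_limit UNIV (\<lambda>n. apply_bcontfun (f n)) g sequentially"
    unfolding uniform_limit_sequentially_iff by blast
  from uniform_limit_bcontfunE[OF this sequentially_bot] show ?thesis by (metis convergentI)
qed

lemma nested_balls:
  fixes x :: "nat \<Rightarrow> 'a :: metric_space" and r :: "nat \<Rightarrow> real"
  assumes complete: "Cauchy x \<Longrightarrow> convergent x" and step: "\<And>n. dist (x (Suc n)) (x n) + r (Suc n) \<le> r n" and half: "\<And>n. r (Suc n) \<le> r n / 2" and r0: "\<And>n. 0 < r n"
  shows "\<exists>l. \<forall>n. dist l (x n) \<le> r n"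
proof -
  have near: "dist (x (n + k)) (x n) + r (n + k) \<le> r n" for n k
  proof (induction k)
    case (Suc k)
    have "dist (x (n + Suc k)) (x n) \<le> dist (x (Suc (n + k))) (x (n + k)) + dist (x (n + k)) (x n)"
      using dist_triangle[of "x (Suc (n + k))" "x n" "x (n + k)"] by simp
    then show ?case using step[of "n + k"] Suc by simp
  qed simp
  have pow: "r n \<le> r 0 * (1/2)^n" for n
  proof (induction n)
    case (Suc n) then show ?case using half[of n] by simp
  qed simp
  have "(\<lambda>n. r 0 * (1/2)^n) \<longlonglongrightarrow> 0" by real_asymp
  have "Cauchy x"
  proof (rule metric_CauchyI)
    fix e :: real assume "0 < e"
    then have "\<forall>\<^sub>F n in sequentially. r 0 * (1/2)^n < e / 2"
      using \<open>(\<lambda>n. r 0 * (1/2)^n) \<longlonglongrightarrow> 0\<close> by (intro order_tendstoD(2)) auto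
    then obtain N where "r 0 * (1/2)^N < e / 2" by (auto simp: eventually_sequentially)
    then have N: "r N < e / 2" using pow[of N] by linarith
    have xN: "dist (x m) (x N) < e / 2" if "m \<ge> N" for m
      using near[of N "m - N"] that N r0[of m] by simp
    have "dist (x m) (x n) < e" if "m \<ge> N" "n \<ge> N" for m n
      using dist_triangle2[of "x m" "x n" "x N"] xN[OF that(1)] xN[OF that(2)] by linarith
    then show "\<exists>M. \<forall>m\<ge>M. \<forall>n\<ge>M. dist (x m) (x n) < e" by blast
  qed
  then obtain l where l: "x \<longlonglongrightarrow> l" using complete convergent_def by blast
  have "dist l (x n) \<le> r n" for n
  proof (rule LIMSEQ_le_const2)
    show "(\<lambda>m. dist (x m) (x n)) \<longlonglongrightarrow> dist l (x n)" by (intro tendsto_intros l)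
    have "dist (x m) (x n) \<le> r n" if "m \<ge> n" for m
      using near[of n "m - n"] that r0[of m] by simp
    then show "\<exists>N. \<forall>m\<ge>N. dist (x m) (x n) \<le> r n" by blast
  qed
  then show ?thesis by blast
qed

text \<open>The orbit of the phase \<open>0\<close> comes close to every phase, so some translate of the potential
  for this phase is uniformly close to the potential for the phase of the approximate eigenvector.\<close>

lemma irrational_covers_spectrum:
  assumes irr: "a \<notin> \<rat>" and cov: "\<And>n::nat. covers (1 / (real n + 1)) a f I" and E: "E \<in> I"
  shows "approx_eigenvalue (jacobi (line_pot a f 0)) E"
  unfolding approx_eigenvalue_def
proof (intro allI impI)
  fix e :: real assume e: "0 < e"
  obtain n :: nat where "1 / (e / 2) < real n" using reals_Archimedean2 by blast
  then have n: "1 / (real n + 1) \<le> e / 2" using e by (simp add: field_simps)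
  obtain x \<psi> where \<psi>: "\<psi> \<noteq> 0" "norm (jacobi (line_pot a f x) \<psi> - E *\<^sub>R \<psi>) \<le> 1 / (real n + 1) * norm \<psi>"
    using cov[of n] E unfolding covers_def by blast
  obtain \<kappa> where \<kappa>: "0 < \<kappa>" "\<And>x y. \<bar>x - y\<bar> \<le> \<kappa> \<Longrightarrow> \<bar>f (to_circle x) - f (to_circle y)\<bar> \<le> e / 2"
    using uniform_modulus[of "e / 2" f] e by auto
  obtain k :: nat where k: "\<bar>frac (real k * a) - frac x\<bar> < \<kappa>"
    using Kronecker_approx_1_explicit[OF irr, of "frac x" \<kappa>] \<kappa>(1) frac_ge_0[of x] frac_lt_1[of x] by (auto simp: less_imp_le)
  define v where "v n = line_pot a f 0 (n + int k)" for n
  have bv: "bounded_pot (norm f) v" using bounded_pot_pot[of f "to_circle a" "to_circle 0"] by (simp add: bounded_pot_def v_def)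
  have vx: "\<bar>v n - line_pot a f x n\<bar> \<le> e / 2" for n
  proof -
    have 1: "to_circle (0 + of_int (n + int k) * a) = to_circle (frac (real k * a) + of_int n * a)"
      unfolding to_circle_eq_iff by (simp add: frac_def algebra_simps)
    have 2: "to_circle (x + of_int n * a) = to_circle (frac x + of_int n * a)"
      unfolding to_circle_eq_iff by (simp add: frac_def)
    show ?thesis unfolding v_def line_pot_eq 1 2 by (rule \<kappa>(2)) (use k in simp)
  qed
  have diff: "norm (jacobi v \<psi> - jacobi (line_pot a f x) \<psi>) \<le> e / 2 * norm \<psi>"
    by (rule norm_jacobi_diff[OF bounded_pot_pot bv]) (use e vx in auto)
  have err: "1 / (real n + 1) * norm \<psi> \<le> e / 2 * norm \<psi>" using n by (intro mult_right_mono) auto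
  have v: "norm (jacobi v \<psi> - E *\<^sub>R \<psi>) \<le> e * norm \<psi>"
  proof -
    have "jacobi v \<psi> - E *\<^sub>R \<psi> = (jacobi v \<psi> - jacobi (line_pot a f x) \<psi>) + (jacobi (line_pot a f x) \<psi> - E *\<^sub>R \<psi>)" by simp
    then have "norm (jacobi v \<psi> - E *\<^sub>R \<psi>) \<le> norm (jacobi v \<psi> - jacobi (line_pot a f x) \<psi>) + norm (jacobi (line_pot a f x) \<psi> - E *\<^sub>R \<psi>)"
      by (metis norm_triangle_ineq)
    also have "\<dots> \<le> e / 2 * norm \<psi> + e / 2 * norm \<psi>"
      using diff \<psi>(2) err by (intro add_mono) linarith+
    finally show ?thesis by simp
  qed
  define \<phi> where "\<phi> = shift_op (- int k) \<psi>"
  have "v = (\<lambda>n. line_pot a f 0 (n + int k))" by (rule ext) (rule v_def)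
  then have "jacobi v \<psi> = shift_op (int k) (jacobi (line_pot a f 0) \<phi>)"
    using jacobi_shift[OF bounded_pot_pot, of "to_circle a" f "to_circle 0" "int k" \<phi>] by (simp add: \<phi>_def)
  then have "jacobi v \<psi> - E *\<^sub>R \<psi> = shift_op (int k) (jacobi (line_pot a f 0) \<phi> - E *\<^sub>R \<phi>)"
    by (simp add: shift_linear \<phi>_def)
  then have "norm (jacobi (line_pot a f 0) \<phi> - E *\<^sub>R \<phi>) \<le> e * norm \<phi>" using v by (simp add: \<phi>_def)
  moreover have "\<phi> \<noteq> 0" using \<psi>(1) by (simp add: \<phi>_def)
  ultimately show "\<exists>\<psi>. \<psi> \<noteq> 0 \<and> norm (jacobi (line_pot a f 0) \<psi> - E *\<^sub>R \<psi>) \<le> e * norm \<psi>" by blast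
qed

text \<open>By Borel and Cantelli the upper limit of the sets is null; it carries \<open>M\<close>, since what all
  sets from some stage on miss has mass at most \<open>(1/2)^m\<close> for all later \<open>m\<close>.\<close>

lemma lebesgue_singularI:
  assumes P: "prob_space M" and sM: "sets M = sets borel"
    and V: "\<And>n::nat. V n \<in> sets borel" "\<And>n. emeasure lborel (V n) < ennreal ((1/2)^n)" "\<And>n. 1 - (1/2)^n \<le> measure M (V n)"
  shows "lebesgue_singular M"
proof -
  interpret prob_space M by fact
  have spM: "space M = UNIV" using sets_eq_imp_space_eq[OF sM] by simp
  have fin: "emeasure lborel (V n) < \<infinity>" for n
    using less_trans[OF V(2)[of n] ennreal_less_top] by simp
  have mV: "measure lborel (V n) \<le> (1/2)^n" for n
    using V(2)[of n] by (simp add: measure_def enn2real_leI less_imp_le)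
  have "limsup V \<in> null_sets lborel"
  proof (rule borel_cantelli_limsup1)
    show "summable (\<lambda>n. measure lborel (V n))"
      by (rule summable_comparison_test'[of "\<lambda>n. (1/2)^n" 0]) (use mV in \<open>auto intro: summable_geometric\<close>)
  qed (use V(1) fin in auto)
  moreover have "- limsup V \<in> null_sets M"
  proof -
    have eq: "- limsup V = (\<Union>n. \<Inter>m\<in>{n..}. - V m)" by (auto simp: limsup_INF_SUP)
    have "(\<Inter>m\<in>{n..}. - V m) \<in> null_sets M" for n
    proof -
      have bI: "(\<Inter>m\<in>{n..}. - V m) \<in> sets M" using V(1) by (auto simp: sM)
      have "measure M (\<Inter>m\<in>{n..}. - V m) \<le> (1/2)^m" if "m \<ge> n" for m
      proof -
        have "measure M (\<Inter>m\<in>{n..}. - V m) \<le> measure M (space M - V m)"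
          using that V(1) by (intro finite_measure_mono) (auto simp: sM spM)
        also have "\<dots> = 1 - measure M (V m)" using V(1) by (intro prob_compl) (simp add: sM)
        finally show ?thesis using V(3)[of m] by linarith
      qed
      moreover have "(\<lambda>m. (1/2::real)^m) \<longlonglongrightarrow> 0" by real_asymp
      ultimately have "measure M (\<Inter>m\<in>{n..}. - V m) \<le> 0"
        by (intro LIMSEQ_le_const[where X = "\<lambda>m. (1/2)^m"]) auto
      then have "measure M (\<Inter>m\<in>{n..}. - V m) = 0" by (intro antisym) auto
      then show ?thesis using bI by (simp add: null_sets_def emeasure_eq_measure)
    qed
    then show ?thesis unfolding eq by (intro null_sets_UN)
  qed
  ultimately show ?thesis unfolding lebesgue_singular_def by blast
qed

text \<open>The balls of the successive stages are nested, and the point common to all of them has the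
  properties of every stage.\<close>

lemma good_pair_near:
  fixes f0 :: "circle \<Rightarrow>\<^sub>C real"
  assumes r: "0 < r"
  shows "\<exists>a f. \<bar>a - x0\<bar> < r \<and> dist f f0 < r \<and> lebesgue_singular (dos_measure (to_circle a) f) \<and>
       (\<exists>b c. b < c \<and> complex_of_real ` {b..c} \<subseteq> total_spectrum (to_circle a) f) \<and> irrational_circle (to_circle a)"
proof -
  define r0 where "r0 = r / 3"
  have r0: "0 < r0" using r by (simp add: r0_def)
  obtain q0 :: nat where "1 / r0 < real q0" using reals_Archimedean2 by blast
  then have q0: "1 < real q0 * r0" using r0 by (simp add: field_simps)
  then have q01: "1 \<le> q0" using r0 by (cases q0) auto
  define p0 where "p0 = \<lfloor>x0 * real q0\<rfloor>"
  have "\<bar>of_int p0 / real q0 - x0\<bar> \<le> 1 / real q0"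
  proof -
    have "of_int p0 / real q0 - x0 = (of_int p0 - x0 * real q0) / real q0" using q01 by (simp add: field_simps)
    moreover have "\<bar>of_int p0 - x0 * real q0\<bar> \<le> 1" unfolding p0_def by linarith
    ultimately show ?thesis using q01 by (simp add: abs_divide divide_right_mono)
  qed
  also have "1 / real q0 < r0" using q0 q01 by (simp add: field_simps)
  finally have close0: "\<bar>of_int p0 / real q0 - x0\<bar> < r0" .
  obtain b c where bc: "b < c" "covers (r0 / 30) (of_int p0 / real q0) f0 {b..c}"
    using covers_some_interval[of "r0 / 30" "of_int p0 / real q0" f0] r0 by auto
  define Inv where "Inv s = (case s of (p::int, q::nat, f, r) \<Rightarrow> 1 \<le> q \<and> 0 < r \<and> covers (r / 30) (of_int p / real q) f {b..c})" for s
  define Stp where "Stp n s s' = (case (s, s') of ((p::int, q::nat, f, r), (p'::int, q'::nat, f', r')) \<Rightarrow>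
      r' \<le> r / 2 \<and> \<bar>of_int p' / real q' - of_int p / real q\<bar> + r' \<le> r \<and> dist f' f + r' \<le> r \<and>
      good_ball n {b..c} (of_int p' / real q') f' r')" for n s s'
  have "\<exists>S. \<forall>n::nat. (Inv (S n) \<and> (n = 0 \<longrightarrow> S n = (p0, q0, f0, r0))) \<and> Stp n (S n) (S (Suc n))"
  proof (rule dependent_nat_choice)
    show "\<exists>s. Inv s \<and> (0 = (0::nat) \<longrightarrow> s = (p0, q0, f0, r0))" using bc q01 r0 by (simp add: Inv_def)
    fix s and n :: nat assume s: "Inv s \<and> (n = 0 \<longrightarrow> s = (p0, q0, f0, r0))"
    obtain p q f r where s_eq: "s = (p, q, f, r)" by (cases s) auto
    have "1 \<le> q" "0 < r" "covers (r / 30) (of_int p / real q) f {b..c}" using s by (auto simp: s_eq Inv_def)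
    from good_ball_step[OF this, of n] obtain p' :: int and q' :: nat and f' r' where
      "1 \<le> q'" "0 < r'" "r' \<le> r / 2" "covers (r' / 30) (of_int p' / real q') f' {b..c}"
      "\<bar>of_int p' / real q' - of_int p / real q\<bar> + r' \<le> r" "dist f' f + r' \<le> r" "good_ball n {b..c} (of_int p' / real q') f' r'"
      by blast
    then show "\<exists>s'. (Inv s' \<and> (Suc n = 0 \<longrightarrow> s' = (p0, q0, f0, r0))) \<and> Stp n s s'"
      by (intro exI[of _ "(p', q', f', r')"]) (simp add: Inv_def Stp_def s_eq)
  qed
  then obtain S where S: "\<And>n::nat. Inv (S n)" "S 0 = (p0, q0, f0, r0)" "\<And>n. Stp n (S n) (S (Suc n))" by blast
  define \<alpha> where "\<alpha> n = (case S n of (p, q, f, r) \<Rightarrow> of_int p / real q)" for n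
  define \<phi> where "\<phi> n = (case S n of (p, q, f, r) \<Rightarrow> f)" for n
  define \<rho> where "\<rho> n = (case S n of (p, q, f, r) \<Rightarrow> r)" for n
  have \<rho>0: "0 < \<rho> n" for n using S(1)[of n] by (auto simp: \<rho>_def Inv_def split: prod.splits)
  have step: "\<rho> (Suc n) \<le> \<rho> n / 2" "\<bar>\<alpha> (Suc n) - \<alpha> n\<bar> + \<rho> (Suc n) \<le> \<rho> n" "dist (\<phi> (Suc n)) (\<phi> n) + \<rho> (Suc n) \<le> \<rho> n"
    "good_ball n {b..c} (\<alpha> (Suc n)) (\<phi> (Suc n)) (\<rho> (Suc n))" for n
    using S(3)[of n] by (auto simp: \<rho>_def \<alpha>_def \<phi>_def Stp_def split: prod.splits)
  obtain a where a: "\<And>n. dist a (\<alpha> n) \<le> \<rho> n"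
    using nested_balls[of \<alpha> \<rho>] step(1,2) \<rho>0 by (auto simp: dist_real_def real_Cauchy_convergent)
  obtain f where f: "\<And>n. dist f (\<phi> n) \<le> \<rho> n"
    using nested_balls[of \<phi> \<rho>, OF Cauchy_circle_functions] step(1,3) \<rho>0 by auto
  have "\<exists>V. open V \<and> emeasure lborel V < ennreal ((1/2)^n) \<and> 1 - (1/2)^n \<le> measure (dos_measure (to_circle a) f) V \<and>
     covers (1 / (real n + 1)) a f {b..c} \<and> (\<forall>(x::int) (y::nat). 1 \<le> y \<longrightarrow> y \<le> n \<longrightarrow> a \<noteq> of_int x / real y)" for n
  proof -
    have "\<bar>a - \<alpha> (Suc n)\<bar> \<le> \<rho> (Suc n)" using a[of "Suc n"] by (simp only: dist_real_def)
    with f[of "Suc n"] step(4)[of n] show ?thesis unfolding good_ball_def by blast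
  qed
  then obtain V where V: "\<And>n. open (V n)" "\<And>n. emeasure lborel (V n) < ennreal ((1/2)^n)"
    "\<And>n. 1 - (1/2)^n \<le> measure (dos_measure (to_circle a) f) (V n)" and cov: "\<And>n. covers (1 / (real n + 1)) a f {b..c}"
    and irr: "\<And>n (x::int) (y::nat). 1 \<le> y \<Longrightarrow> y \<le> n \<Longrightarrow> a \<noteq> of_int x / real y" by metis
  have irrational: "a \<notin> \<rat>"
  proof
    assume "a \<in> \<rat>"
    then obtain x y where xy: "y > 0" "a = of_int x / of_int y" by (meson Rats_cases')
    then have "a = of_int x / real (nat y)" by simp
    moreover have "1 \<le> nat y" using xy(1) by linarith
    ultimately show False using irr[of "nat y" "nat y" x] by blast
  qed
  have "irrational_circle (to_circle a)"
    unfolding irrational_circle_def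
  proof (intro allI impI notI)
    fix x assume "to_circle x = to_circle a" and x: "x \<in> \<rat>"
    then have "x - a \<in> \<int>" by (simp add: to_circle_eq_iff)
    then have "x - a \<in> \<rat>" using Ints_subset_Rats by blast
    from Rats_diff[OF x this] show False using irrational by simp
  qed
  moreover have "lebesgue_singular (dos_measure (to_circle a) f)"
    by (rule lebesgue_singularI[OF dos_measure, of V]) (use V in auto)
  moreover have "complex_of_real ` {b..c} \<subseteq> total_spectrum (to_circle a) f"
  proof
    fix z assume "z \<in> complex_of_real ` {b..c}"
    then obtain E where E: "E \<in> {b..c}" "z = complex_of_real E" by auto
    from approx_eigenvalue_in_spectrum[OF irrational_covers_spectrum[OF irrational cov E(1)]]
    have "z \<in> spectrum (schroedinger (to_circle a) f (to_circle 0))" by (simp add: schroedinger_jacobi E(2))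
    then show "z \<in> total_spectrum (to_circle a) f" by (auto simp: total_spectrum_def)
  qed
  moreover have "\<bar>a - x0\<bar> < r"
  proof -
    have "\<bar>a - of_int p0 / real q0\<bar> \<le> r0" using a[of 0] by (simp add: \<alpha>_def \<rho>_def S(2) dist_real_def)
    then show ?thesis using close0 r unfolding r0_def by linarith
  qed
  moreover have "dist f f0 < r" using f[of 0] r by (simp add: \<phi>_def \<rho>_def S(2) r0_def)
  ultimately show ?thesis using bc(1) by blast
qed

theorem theorem5:
  shows "\<exists>\<D> :: (circle \<times> (circle \<Rightarrow>\<^sub>C real)) set. closure \<D> = UNIV \<and>
    (\<forall>(\<alpha>, f) \<in> \<D>.
       lebesgue_singular (dos_measure \<alpha> f) \<and>
       (\<exists>a b. a < b \<and> complex_of_real ` {a..b} \<subseteq> total_spectrum \<alpha> f) \<and>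
       irrational_circle \<alpha>)"
proof -
  define D :: "(circle \<times> (circle \<Rightarrow>\<^sub>C real)) set" where
    "D = {(\<alpha>, f). lebesgue_singular (dos_measure \<alpha> f) \<and>
       (\<exists>a b. a < b \<and> complex_of_real ` {a..b} \<subseteq> total_spectrum \<alpha> f) \<and> irrational_circle \<alpha>}"
  have "x \<in> closure D" for x
    unfolding closure_iff_nhds_not_empty
  proof (intro allI impI)
    fix T O' :: "(circle \<times> (circle \<Rightarrow>\<^sub>C real)) set" assume O: "O' \<subseteq> T" "open O'" "x \<in> O'"
    obtain A B where AB: "open A" "open B" "x \<in> A \<times> B" "A \<times> B \<subseteq> O'"
      using open_prod_elim[OF O(2,3)] by metis
    obtain x0 where x0: "fst x = to_circle x0" using to_circle_surj by blast
    have "open (to_circle -` A)" using AB(1) by (simp add: open_circle_def)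
    moreover have "x0 \<in> to_circle -` A" using AB(3) x0 by auto
    ultimately have "\<exists>e>0. \<forall>y. dist y x0 < e \<longrightarrow> y \<in> to_circle -` A" unfolding open_dist by blast
    then obtain r1 where r1: "0 < r1" "\<And>y. dist y x0 < r1 \<Longrightarrow> to_circle y \<in> A" by auto
    have "snd x \<in> B" using AB(3) by auto
    then have "\<exists>e>0. \<forall>g. dist g (snd x) < e \<longrightarrow> g \<in> B" using AB(2) unfolding open_dist by blast
    then obtain r2 where r2: "0 < r2" "\<And>g. dist g (snd x) < r2 \<Longrightarrow> g \<in> B" by blast
    obtain a f where af: "\<bar>a - x0\<bar> < min r1 r2" "dist f (snd x) < min r1 r2" "(to_circle a, f) \<in> D"
      using good_pair_near[of "min r1 r2" x0 "snd x"] r1(1) r2(1) unfolding D_def by auto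
    then have "(to_circle a, f) \<in> A \<times> B" using r1(2) r2(2) by (auto simp: dist_real_def)
    then show "D \<inter> T \<noteq> {}" using af(3) AB(4) O(1) by blast
  qed
  then have "closure D = UNIV" by blast
  then show ?thesis by (intro exI[of _ D]) (auto simp: D_def)
qed

end
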